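(* Let $0\le\rho_1<\rho<\rho_2$ and $\underline{\eta}\in\mathbb{S}$, let $\mathsf{A}=\{\mathbf{x}\in\mathbb{R}^{p+q+1}:\rho_1<|\mathbf{x}|<\rho_2\}$ and $S=\{\mathbf{x}\in\mathbb{R}^{p+q+1}:|\mathbf{x}|=\rho\}$. If $f:\mathsf{A}\to\mathbb{R}_{p+q}$ is a generalized partial-slice monogenic function, then for $\mathbf{x}\in\mathsf{A}$ $$f(\mathbf{x})=\sum_{k=0}^{+\infty}\sum_{|\mathrm{k}|=k}\mathcal{P}_{\mathrm{k}}(\mathbf{x})\,a_{\mathrm{k}}+\sum_{k=0}^{+\infty}\sum_{|\mathrm{k}|=k}\mathcal{Q}_{\mathrm{k}}(\mathbf{x})\,b_{\mathrm{k}},$$ where both series (over $k$) converge uniformly on each compact subset of $\mathsf{A}$ and $$a_{\mathrm{k}}=\int_{S_{\underline{\eta}}}\mathcal{Q}_{\underline{\eta},\mathrm{k}}(\mathbf{y})\,n(\mathbf{y})\,f(\mathbf{y})\,dS(\mathbf{y}),\qquad b_{\mathrm{k}}=\int_{S_{\underline{\eta}}}\mathcal{P}^{R}_{\underline{\eta},\mathrm{k}}(\mathbf{y})\,n(\mathbf{y})\,f(\mathbf{y})\,dS(\mathbf{y}).$$ Here $S_{\underline{\eta}}=S\cap(\mathbb{R}^{p+1}\oplus\underline{\eta}\mathbb{R})$ is the sphere of radius $\rho$ in $\mathbb{R}^{p+2}$, $n(\mathbf{y})=\sum_{i=0}^pn_i(\mathbf{y})e_i+n_{p+1}(\mathbf{y})\underline{\eta}$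 is its unit exterior normal at $\mathbf{y}$, and $dS$ is the classical Lebesgue surface element in $\mathbb{R}^{p+2}$.
   Context: Fix integers $p\ge 0$, $q\ge 1$. $\mathbb{R}_{p+q}$ is the real Clifford algebra generated by $e_1,\dots,e_{p+q}$ with $e_ie_j+e_je_i=-2\delta_{ij}$; put $e_0=1$. A point $\mathbf{x}=(x_0,\dots,x_{p+q})\in\mathbb{R}^{p+q+1}$ is identified with the paravector $\mathbf{x}=\mathbf{x}_p+\underline{\mathbf{x}}_q$, where $\mathbf{x}_p=\sum_{i=0}^p x_ie_i\in\mathbb{R}^{p+1}$ and $\underline{\mathbf{x}}_q=\sum_{i=p+1}^{p+q}x_ie_i\in\mathbb{R}^q$; its conjugate is $\overline{\mathbf{x}}=x_0-\sum_{i\ge1}x_ie_i$. Let $\mathbb{S}=\{\sum_{i=p+1}^{p+q}x_ie_i:\sum_{i=p+1}^{p+q} x_i^2=1\}$, so that $\underline{\omega}^2=-1$ for $\underline{\omega}\in\mathbb{S}$. Every $\mathbf{x}$ can be written $\mathbf{x}=\mathbf{x}_p+r\underline{\omega}$ with $r=|\underline{\mathbf{x}}_q|\ge0$, $\underline{\omega}\in\mathbb{S}$ ($\underline{\omega}$ is unique if $r>0$, arbitrary if $r=0$). For an open set $\Omega\subseteq\mathbb{R}^{p+q+1}$ and $\underline{\omega}\in\mathbb{S}$, put $\Omega_{\underline{\omega}}=\Omega\cap(\mathbb{R}^{p+1}\oplus\underline{\omega}\mathbb{R})$, viewed as an open subset of $\mathbb{R}^{p+2}$ via $(\mathbf{x}_p,r)\leftrightarrow\mathbf{x}_p+r\underline{\omega}$.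 Generalized partial-slice monogenic: a function $f:\Omega\to\mathbb{R}_{p+q}$ on a domain $\Omega$ is (left) generalized partial-slice monogenic (of type $(p,q)$) if for every $\underline{\omega}\in\mathbb{S}$ the restriction $f_{\underline{\omega}}$ of $f$ to $\Omega_{\underline{\omega}}$ has continuous partial derivatives and $(D_{\mathbf{x}_p}+\underline{\omega}\partial_r)f_{\underline{\omega}}(\mathbf{x}_p+r\underline{\omega})=0$ on $\Omega_{\underline{\omega}}$, where $D_{\mathbf{x}_p}=\sum_{i=0}^p e_i\partial_{x_i}$. Multi-indices: $\mathrm{k}=(k_0,\dots,k_p)\in\mathbb{N}^{p+1}$ with $\mathbb{N}\ni0$, $|\mathrm{k}|=k_0+\cdots+k_p$, and $\partial_{\mathrm{k}}=\dfrac{\partial^{|\mathrm{k}|}}{\partial x_0^{k_0}\cdots\partial x_p^{k_p}}$ (derivatives only in $x_0,\dots,x_p$). Fueter polynomials: for $\underline{\eta}\in\mathbb{S}$ and $(\mathbf{x}_p,r)\in\mathbb{R}^{p+2}$ let $z_\ell=x_\ell+r\,\underline{\eta}\,e_\ell$ and $z_\ell^R=x_\ell+r\,e_\ell\,\underline{\eta}$, $\ell=0,\dots,p$. For $|\mathrm{k}|=k\ge1$, $\mathcal{P}_{\underline{\eta},\mathrm{k}}(\mathbf{x}_p,r)=\frac{1}{k!}\sum z_{j_1}\cdots z_{j_k}$, where the sum runs over all distinct sequences $(j_1,\dots,j_k)$ in $\{0,\dots,p\}$ in which each $\ell$ occurs exactly $k_\ell$ times; $\mathcal{P}_{\underline{\eta},0}=1$.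 $\mathcal{P}^R_{\underline{\eta},\mathrm{k}}$ is defined in the same way with $z_\ell^R$ in place of $z_\ell$. The function $\mathcal{P}_{\mathrm{k}}:\mathbb{R}^{p+q+1}\to\mathbb{R}_{p+q}$ is $\mathcal{P}_{\mathrm{k}}(\mathbf{x}_p+r\underline{\omega})=\mathcal{P}_{\underline{\omega},\mathrm{k}}(\mathbf{x}_p,r)$. Functions $\mathcal{Q}$: let $E(\mathbf{x})=\frac{1}{\sigma_{p+1}}\frac{\overline{\mathbf{x}}}{|\mathbf{x}|^{p+2}}$ for $\mathbf{x}\in\mathbb{R}^{p+q+1}\setminus\{0\}$, with $\sigma_{p+1}=2\,\Gamma(\tfrac12)^{p+2}/\Gamma(\tfrac{p+2}{2})$ (the surface area of the unit sphere in $\mathbb{R}^{p+2}$). Put $\mathcal{Q}_{\mathrm{k}}(\mathbf{x})=(-1)^{|\mathrm{k}|}\partial_{\mathrm{k}}E(\mathbf{x})$ and $\mathcal{Q}_{\underline{\eta},\mathrm{k}}(\mathbf{x}_p,r)=(-1)^{|\mathrm{k}|}\partial_{\mathrm{k}}E(\mathbf{x}_p+r\underline{\eta})$. In the integrals, $\mathbf{y}=\mathbf{y}_p+\widetilde r\,\underline{\eta}$ ($\widetilde r\in\mathbb{R}$) is identified with $(\mathbf{y}_p,\widetilde r)\in\mathbb{R}^{p+2}$ when evaluating $\mathcal{Q}_{\underline{\eta},\mathrm{k}}$ and $\mathcal{P}^R_{\underline{\eta},\mathrm{k}}$. *)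

theory Defs
  imports "HOL-Analysis.Analysis"
begin

section \<open>Real Clifford algebras\<close>

text \<open>
  Over a finite linearly ordered type \<open>'g\<close> of generators, an element is its family of
  coefficients with respect to the basis \<open>e\<^sub>A\<close> (\<open>A \<subseteq> 'g\<close>), where \<open>e\<^sub>A\<close> is the product of the
  \<open>e\<^sub>g\<close>, \<open>g \<in> A\<close>, in increasing order. Topology and norm are Euclidean in these coefficients;
  the norm is not submultiplicative in general.
\<close>

typedef (overloaded) 'g clifford = "UNIV :: (real ^ ('g::finite) set) set"
  morphisms coeffs Clifford
  by simp

setup_lifting type_definition_clifford

text \<open>
  \<open>e\<^sub>A e\<^sub>B = blade_sign A B e\<^bsub>sym_diff A B\<^esub>\<close>: each pair \<open>a \<in> A\<close>, \<open>b \<in> B\<close> with \<open>b < a\<close> costs a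
  transposition, each common element costs a factor \<open>e\<^sub>a\<^sup>2 = -1\<close>.
\<close>

definition blade_sign :: "('g::{finite,linorder}) set \<Rightarrow> 'g set \<Rightarrow> real" where
  "blade_sign A B = (\<Prod>a\<in>A. \<Prod>b\<in>B. if b \<le> a then - 1 else 1)"

lemma sym_diff_cancel [simp]: "sym_diff A (sym_diff A B) = B"
  by blast

lemma prod_sym_diff:
  fixes f :: "'g::finite \<Rightarrow> real"
  assumes "\<And>x. f x * f x = 1"
  shows "(\<Prod>x\<in>sym_diff A B. f x) = (\<Prod>x\<in>A. f x) * (\<Prod>x\<in>B. f x)"
proof -
  have A: "(\<Prod>x\<in>A. f x) = (\<Prod>x\<in>A - B. f x) * (\<Prod>x\<in>A \<inter> B. f x)"
    by (subst prod.union_disjoint [symmetric]) (auto intro!: prod.cong)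
  have B: "(\<Prod>x\<in>B. f x) = (\<Prod>x\<in>B - A. f x) * (\<Prod>x\<in>A \<inter> B. f x)"
    by (subst prod.union_disjoint [symmetric]) (auto intro!: prod.cong)
  have "(\<Prod>x\<in>A \<inter> B. f x) * (\<Prod>x\<in>A \<inter> B. f x) = 1"
    by (simp add: prod.distrib [symmetric] assms)
  moreover have "(\<Prod>x\<in>sym_diff A B. f x) = (\<Prod>x\<in>A - B. f x) * (\<Prod>x\<in>B - A. f x)"
    by (rule prod.union_disjoint) auto
  ultimately show ?thesis
    unfolding A B by (simp add: algebra_simps)
qed

lemma blade_sign_square [simp]: "(\<Prod>b\<in>B. if b \<le> a then - 1 else 1 :: real) *
    (\<Prod>b\<in>B. if b \<le> a then - 1 else 1) = 1"
  unfolding prod.distrib [symmetric] by (rule prod.neutral) simp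

lemma blade_sign_sym_diff_left:
  "blade_sign (sym_diff A B) C = blade_sign A C * blade_sign B C"
  unfolding blade_sign_def by (rule prod_sym_diff) simp

lemma blade_sign_sym_diff_right:
  "blade_sign A (sym_diff B C) = blade_sign A B * blade_sign A C"
  unfolding blade_sign_def prod.distrib [symmetric]
  by (rule prod.cong [OF refl], rule prod_sym_diff) simp

lemma blade_sign_empty [simp]: "blade_sign {} B = 1" "blade_sign A {} = 1"
  by (simp_all add: blade_sign_def)

lemma sum_sym_diff_shift:
  fixes f :: "('g::finite) set \<Rightarrow> 'b::comm_monoid_add"
  shows "(\<Sum>B\<in>UNIV. f B) = (\<Sum>B\<in>UNIV. f (sym_diff A B))"
  by (rule sum.reindex_bij_witness [of _ "sym_diff A" "sym_diff A"]) auto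

instantiation clifford :: (finite) euclidean_space
begin

lift_definition zero_clifford :: "'a clifford" is 0 .
lift_definition plus_clifford :: "'a clifford \<Rightarrow> 'a clifford \<Rightarrow> 'a clifford" is "(+)" .
lift_definition minus_clifford :: "'a clifford \<Rightarrow> 'a clifford \<Rightarrow> 'a clifford" is "(-)" .
lift_definition uminus_clifford :: "'a clifford \<Rightarrow> 'a clifford" is uminus .
lift_definition scaleR_clifford :: "real \<Rightarrow> 'a clifford \<Rightarrow> 'a clifford" is scaleR .
lift_definition norm_clifford :: "'a clifford \<Rightarrow> real" is norm .
lift_definition dist_clifford :: "'a clifford \<Rightarrow> 'a clifford \<Rightarrow> real" is dist .
lift_definition inner_clifford :: "'a clifford \<Rightarrow> 'a clifford \<Rightarrow> real" is inner .
lift_definition sgn_clifford :: "'a clifford \<Rightarrow> 'a clifford" is sgn .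
lift_definition Basis_clifford :: "'a clifford set" is Basis .

definition uniformity_clifford :: "('a clifford \<times> 'a clifford) filter" where
  "uniformity_clifford = (INF e\<in>{0<..}. principal {(x, y). dist x y < e})"

definition open_clifford :: "'a clifford set \<Rightarrow> bool" where
  "open_clifford U \<longleftrightarrow> (\<forall>x\<in>U. \<forall>\<^sub>F (x', y) in uniformity. x' = x \<longrightarrow> y \<in> U)"

instance
proof
  fix x y z :: "'a clifford" and r s :: real and U :: "'a clifford set"
  show "x + y + z = x + (y + z)" "x + y = y + x" "0 + x = x" "- x + x = 0" "x - y = x + - y"
    by (transfer; simp add: algebra_simps)+
  show "r *\<^sub>R (x + y) = r *\<^sub>R x + r *\<^sub>R y" "(r + s) *\<^sub>R x = r *\<^sub>R x + s *\<^sub>R x"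
    "r *\<^sub>R s *\<^sub>R x = (r * s) *\<^sub>R x" "1 *\<^sub>R x = x"
    by (transfer; simp add: algebra_simps)+
  show "dist x y = norm (x - y)" by transfer (rule dist_norm)
  show "sgn x = inverse (norm x) *\<^sub>R x" by transfer (rule sgn_div_norm)
  show "uniformity = (INF e\<in>{0<..}. principal {(x, y::'a clifford). dist x y < e})"
    by (rule uniformity_clifford_def)
  show "open U = (\<forall>x\<in>U. \<forall>\<^sub>F (x', y) in uniformity. x' = x \<longrightarrow> y \<in> U)"
    by (rule open_clifford_def)
  show "x \<bullet> y = y \<bullet> x" by transfer (rule inner_commute)
  show "(x + y) \<bullet> z = x \<bullet> z + y \<bullet> z" by transfer (rule inner_add_left)
  show "(r *\<^sub>R x) \<bullet> y = r * (x \<bullet> y)" by transfer (rule inner_scaleR_left)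
  show "0 \<le> x \<bullet> x" by transfer (rule inner_ge_zero)
  show "(x \<bullet> x = 0) = (x = 0)" by transfer (rule inner_eq_zero_iff)
  show "norm x = sqrt (x \<bullet> x)" by transfer (rule norm_eq_sqrt_inner)
  show "(Basis :: 'a clifford set) \<noteq> {}" by transfer (rule nonempty_Basis)
  show "finite (Basis :: 'a clifford set)" by transfer (rule finite_Basis)
  show "(\<forall>u\<in>Basis. x \<bullet> u = 0) = (x = 0)" by transfer (rule euclidean_all_zero_iff)
next
  fix u v :: "'a clifford"
  assume "u \<in> Basis" "v \<in> Basis"
  then show "u \<bullet> v = (if u = v then 1 else 0)" by transfer (rule inner_Basis)
qed

end

instantiation clifford :: ("{finite,linorder}") real_algebra_1
begin

lift_definition one_clifford :: "'a clifford" is "\<chi> A. if A = {} then 1 else 0" .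

lift_definition times_clifford :: "'a clifford \<Rightarrow> 'a clifford \<Rightarrow> 'a clifford" is
  "\<lambda>x y. \<chi> C. \<Sum>A\<in>UNIV. blade_sign A (sym_diff A C) * x $ A * y $ sym_diff A C" .

instance
proof
  fix x y z :: "'a clifford" and r :: real
  show "x * y * z = x * (y * z)"
  proof transfer
    fix x y z :: "real ^ 'a set"
    have "(\<Sum>E\<in>UNIV. blade_sign E (sym_diff E D) *
              (\<Sum>A\<in>UNIV. blade_sign A (sym_diff A E) * x $ A * y $ sym_diff A E) * z $ sym_diff E D)
        = (\<Sum>A\<in>UNIV. blade_sign A (sym_diff A D) * x $ A *
              (\<Sum>B\<in>UNIV. blade_sign B (sym_diff B (sym_diff A D)) * y $ B * z $ sym_diff B (sym_diff A D)))"
      (is "?L = ?R") for D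
    proof -
      have "?L = (\<Sum>A\<in>UNIV. \<Sum>E\<in>UNIV. blade_sign E (sym_diff E D) * blade_sign A (sym_diff A E)
                * x $ A * y $ sym_diff A E * z $ sym_diff E D)"
        by (subst sum.swap) (simp add: sum_distrib_left sum_distrib_right mult_ac)
      also have "\<dots> = (\<Sum>A\<in>UNIV. \<Sum>B\<in>UNIV. blade_sign (sym_diff A B) (sym_diff (sym_diff A B) D)
                * blade_sign A B * x $ A * y $ B * z $ sym_diff (sym_diff A B) D)"
      proof (rule sum.cong [OF refl])
        fix A :: "'a set"
        show "(\<Sum>E\<in>UNIV. blade_sign E (sym_diff E D) * blade_sign A (sym_diff A E)
                * x $ A * y $ sym_diff A E * z $ sym_diff E D)
            = (\<Sum>B\<in>UNIV. blade_sign (sym_diff A B) (sym_diff (sym_diff A B) D)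
                * blade_sign A B * x $ A * y $ B * z $ sym_diff (sym_diff A B) D)"
          by (subst sum_sym_diff_shift [of _ A]) (simp only: sym_diff_cancel)
      qed
      also have "\<dots> = (\<Sum>A\<in>UNIV. \<Sum>B\<in>UNIV. blade_sign A (sym_diff A D)
                * blade_sign B (sym_diff B (sym_diff A D)) * x $ A * y $ B
                * z $ sym_diff B (sym_diff A D))"
      proof (intro sum.cong refl)
        fix A B :: "'a set"
        have eq: "sym_diff (sym_diff A B) D = sym_diff B (sym_diff A D)" by blast
        have "blade_sign A B * blade_sign A B = 1"
          unfolding blade_sign_def prod.distrib [symmetric] by (intro prod.neutral ballI) simp
        then have "blade_sign (sym_diff A B) (sym_diff (sym_diff A B) D) * blade_sign A B
            = blade_sign A (sym_diff A D) * blade_sign B (sym_diff B (sym_diff A D))"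
          unfolding eq blade_sign_sym_diff_left
          unfolding blade_sign_sym_diff_right by (simp add: mult_ac)
        then show "blade_sign (sym_diff A B) (sym_diff (sym_diff A B) D)
                * blade_sign A B * x $ A * y $ B * z $ sym_diff (sym_diff A B) D
            = blade_sign A (sym_diff A D) * blade_sign B (sym_diff B (sym_diff A D)) * x $ A * y $ B
                * z $ sym_diff B (sym_diff A D)"
          unfolding eq by simp
      qed
      also have "\<dots> = ?R"
        by (simp add: sum_distrib_left mult_ac)
      finally show ?thesis .
    qed
    then show "(\<chi> C. \<Sum>A\<in>UNIV. blade_sign A (sym_diff A C) *
          (\<chi> C. \<Sum>A\<in>UNIV. blade_sign A (sym_diff A C) * x $ A * y $ sym_diff A C) $ A
          * z $ sym_diff A C)
      = (\<chi> C. \<Sum>A\<in>UNIV. blade_sign A (sym_diff A C) * x $ A *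
          (\<chi> C. \<Sum>A\<in>UNIV. blade_sign A (sym_diff A C) * y $ A * z $ sym_diff A C) $ sym_diff A C)"
      by (simp only: vec_lambda_beta vec_eq_iff) simp
  qed
  show "1 * x = x"
    by transfer (simp add: vec_eq_iff if_distrib [of "\<lambda>t. t * _"] if_distrib [of "\<lambda>t. _ * t"]
        sum.delta cong: if_cong)
  show "x * 1 = x"
  proof transfer
    fix x :: "real ^ 'a set"
    have "sym_diff A C = {} \<longleftrightarrow> A = C" for A C :: "'a set" by blast
    then show "(\<chi> C. \<Sum>A\<in>UNIV. blade_sign A (sym_diff A C) * x $ A *
        (\<chi> A. if A = {} then 1 else 0) $ sym_diff A C) = x"
      by (simp add: vec_eq_iff if_distrib [of "\<lambda>t. _ * t"] cong: if_cong)
  qed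
  show "(x + y) * z = x * z + y * z" "x * (y + z) = x * y + x * z"
    by (transfer; simp add: vec_eq_iff algebra_simps sum.distrib)+
  show "r *\<^sub>R x * y = r *\<^sub>R (x * y)" "x * r *\<^sub>R y = r *\<^sub>R (x * y)"
    by (transfer; simp add: vec_eq_iff sum_distrib_left mult_ac)+
  show "(0 :: 'a clifford) \<noteq> 1"
    by transfer (auto simp: vec_eq_iff)
qed

end

lift_definition generator :: "'g::finite \<Rightarrow> 'g clifford" is "\<lambda>g. axis {g} 1" .

lemma generator_anticommute:
  fixes g h :: "'g::{finite,linorder}"
  shows "generator g * generator h + generator h * generator g = (if g = h then - 2 else 0)"
proof -
  have *: "generator g * generator h = Clifford (\<chi> C. if C = sym_diff {g} {h} then blade_sign {g} {h} else 0)"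
    for g h :: 'g
  proof transfer
    fix g h :: 'g
    have eq: "(sym_diff {g} C = {h}) = (C = sym_diff {g} {h})" for C by blast
    have "(\<Sum>A\<in>UNIV. blade_sign A (sym_diff A C) * axis {g} 1 $ A * axis {h} 1 $ sym_diff A C)
        = (\<Sum>A\<in>UNIV. if A = {g} then blade_sign {g} (sym_diff {g} C) * axis {h} 1 $ sym_diff {g} C else 0)"
      for C
      by (rule sum.cong [OF refl]) (simp add: axis_def)
    then have 1: "(\<Sum>A\<in>UNIV. blade_sign A (sym_diff A C) * axis {g} 1 $ A * axis {h} 1 $ sym_diff A C)
        = blade_sign {g} (sym_diff {g} C) * axis {h} 1 $ sym_diff {g} C" for C
      by (simp only: sum.delta finite UNIV_I if_True)
    have 2: "blade_sign {g} (sym_diff {g} C) * axis {h} 1 $ sym_diff {g} C = (if C = sym_diff {g} {h} then blade_sign {g} {h} else 0)" for C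
    proof (cases "C = sym_diff {g} {h}")
      case True
      then have "sym_diff {g} C = {h}" by (simp only: eq)
      with True show ?thesis by (simp only: axis_def) simp
    next
      case False
      then have "sym_diff {g} C \<noteq> {h}" unfolding eq .
      with False show ?thesis by (simp only: axis_def vec_lambda_beta) simp
    qed
    show "(\<chi> C. \<Sum>A\<in>UNIV. blade_sign A (sym_diff A C) * axis {g} 1 $ A * axis {h} 1 $ sym_diff A C)
      = (\<chi> C. if C = sym_diff {g} {h} then blade_sign {g} {h} else 0)"
      by (simp only: 1 2)
  qed
  have two: "(- 2 :: 'g clifford) = - 1 - 1" by simp
  show ?thesis
  proof (cases "g = h")
    case True
    then show ?thesis
      unfolding * two by transfer (simp add: vec_eq_iff blade_sign_def)
  next
    case False
    then have sgn: "blade_sign {h} {g} = - blade_sign {g} {h}"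
      by (auto simp: blade_sign_def)
    have D: "sym_diff {g} {h} = {g, h}" "sym_diff {h} {g} = {g, h}"
      using False by auto
    have "generator g * generator h + generator h * generator g = Clifford 0"
      unfolding * D sgn plus_clifford.abs_eq
      by (rule arg_cong [of _ _ Clifford]) (simp add: vec_eq_iff)
    with False show ?thesis
      by (simp add: zero_clifford_def)
  qed
qed


section \<open>Paravectors of type \<open>(p, q)\<close>\<close>

text \<open>
  Throughout, \<open>'i\<close> is the index set \<open>{0, \<dots>, p}\<close> and \<open>'j\<close> the index set \<open>{p + 1, \<dots>, p + q}\<close>;
  so \<open>CARD('i) = p + 1\<close>, \<open>CARD('j) = q\<close>, and, types being nonempty, every pair \<open>p \<ge> 0\<close>,
  \<open>q \<ge> 1\<close> occurs. The index \<open>0\<close> is the least element of \<open>'i\<close>; the other \<open>p + q\<close> indices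
  are the generators.
\<close>

definition idx0 :: "'i::{finite,linorder}" where
  "idx0 = Min UNIV"

typedef (overloaded) ('i, 'j) gen = "{k :: 'i::{finite,linorder} + 'j::{finite,linorder}. k \<noteq> Inl idx0}"
  by blast

instance gen :: ("{finite,linorder}", "{finite,linorder}") finite
proof
  have "(UNIV :: ('a, 'b) gen set) = Abs_gen ` {k. k \<noteq> Inl idx0}"
    by (rule type_definition.univ [OF type_definition_gen])
  then show "finite (UNIV :: ('a, 'b) gen set)"
    by (metis finite finite_imageI)
qed

instantiation gen :: ("{finite,linorder}", "{finite,linorder}") linorder
begin

definition less_eq_gen :: "('a, 'b) gen \<Rightarrow> ('a, 'b) gen \<Rightarrow> bool" where
  "less_eq_gen g h \<longleftrightarrow> (case (Rep_gen g, Rep_gen h) of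
      (Inl i, Inl i') \<Rightarrow> i \<le> i' | (Inl _, Inr _) \<Rightarrow> True
    | (Inr _, Inl _) \<Rightarrow> False | (Inr j, Inr j') \<Rightarrow> j \<le> j')"

definition less_gen :: "('a, 'b) gen \<Rightarrow> ('a, 'b) gen \<Rightarrow> bool" where
  "less_gen g h \<longleftrightarrow> g \<le> h \<and> \<not> h \<le> g"

instance
  by standard
    (auto simp: less_eq_gen_def less_gen_def Rep_gen_inject [symmetric] split: sum.splits)

end

lemma card_gen: "CARD(('i::{finite,linorder}, 'j::{finite,linorder}) gen) + 1 = CARD('i) + CARD('j)"
proof -
  have "{k :: 'i + 'j. k \<noteq> Inl idx0} = UNIV - {Inl idx0}" by blast
  then have "CARD(('i, 'j) gen) = CARD('i + 'j) - 1"
    by (simp add: type_definition.card [OF type_definition_gen] card_Diff_singleton)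
  moreover have "CARD('i + 'j) > 0" by (rule zero_less_card_finite)
  ultimately show ?thesis
    by (simp add: card_UNIV_sum)
qed

type_synonym ('i, 'j) cl = "('i, 'j) gen clifford"

definition e_vec :: "'i::{finite,linorder} \<Rightarrow> ('i, 'j::{finite,linorder}) cl" where
  "e_vec i = (if i = idx0 then 1 else generator (Abs_gen (Inl i)))"

definition e_im :: "'j::{finite,linorder} \<Rightarrow> ('i::{finite,linorder}, 'j) cl" where
  "e_im j = generator (Abs_gen (Inr j))"

text \<open>
  \<open>('i, 'j) point\<close> is \<open>\<real>\<^bsup>p+q+1\<^esup>\<close> and \<open>'i slice\<close> is \<open>\<real>\<^bsup>p+2\<^esup>\<close>; the product norms are the
  Euclidean ones. The sphere \<open>\<S>\<close> is \<^term>\<open>sphere 0 1 :: (real ^ 'j) set\<close>.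
\<close>

type_synonym ('i, 'j) point = "(real, 'i) vec \<times> (real, 'j) vec"
type_synonym 'i slice = "(real, 'i) vec \<times> real"

definition im_vec :: "real ^ 'j::{finite,linorder} \<Rightarrow> ('i::{finite,linorder}, 'j) cl" where
  "im_vec v = (\<Sum>j\<in>UNIV. (v $ j) *\<^sub>R e_im j)"

definition paravector ::
  "('i::{finite,linorder}, 'j::{finite,linorder}) point \<Rightarrow> ('i, 'j) cl" where
  "paravector x = (\<Sum>i\<in>UNIV. (fst x $ i) *\<^sub>R e_vec i) + im_vec (snd x)"

definition conj_paravector ::
  "('i::{finite,linorder}, 'j::{finite,linorder}) point \<Rightarrow> ('i, 'j) cl" where
  "conj_paravector x =
     (fst x $ idx0) *\<^sub>R 1 - (\<Sum>i\<in>UNIV - {idx0}. (fst x $ i) *\<^sub>R e_vec i) - im_vec (snd x)"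

definition slice_point ::
  "(real, 'j::{finite,linorder}) vec \<Rightarrow> 'i::{finite,linorder} slice \<Rightarrow> ('i, 'j) point" where
  "slice_point \<omega> y = (fst y, snd y *\<^sub>R \<omega>)"


section \<open>Generalized partial-slice monogenic functions\<close>

definition directional_deriv ::
  "'v::real_normed_vector \<Rightarrow> ('v \<Rightarrow> 'w::real_normed_vector) \<Rightarrow> 'v \<Rightarrow> 'w" where
  "directional_deriv v g x = vector_derivative (\<lambda>t. g (x + t *\<^sub>R v)) (at 0)"

definition continuous_partials_on ::
  "'v::euclidean_space set \<Rightarrow> ('v \<Rightarrow> 'w::real_normed_vector) \<Rightarrow> bool" where
  "continuous_partials_on U g \<longleftrightarrow>
     (\<forall>v\<in>Basis. (\<forall>x\<in>U. (\<lambda>t. g (x + t *\<^sub>R v)) differentiable at 0) \<and>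
        continuous_on U (directional_deriv v g))"

definition slice_dirac ::
  "(real, 'j::{finite,linorder}) vec \<Rightarrow> ('i::{finite,linorder} slice \<Rightarrow> ('i, 'j) cl)
     \<Rightarrow> 'i slice \<Rightarrow> ('i, 'j) cl" where
  "slice_dirac \<omega> g y =
     (\<Sum>i\<in>UNIV. e_vec i * directional_deriv (axis i 1, 0) g y) + im_vec \<omega> * directional_deriv (0, 1) g y"

text \<open>Values of \<open>f\<close> outside the open set \<open>\<Omega>\<close> play no role.\<close>

definition gen_partial_slice_monogenic ::
  "('i::{finite,linorder}, 'j::{finite,linorder}) point set
     \<Rightarrow> (('i, 'j) point \<Rightarrow> ('i, 'j) cl) \<Rightarrow> bool" where
  "gen_partial_slice_monogenic \<Omega> f \<longleftrightarrow> open \<Omega> \<and> connected \<Omega> \<and>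
     (\<forall>\<omega>\<in>sphere 0 1.
        continuous_partials_on (slice_point \<omega> -` \<Omega>) (f \<circ> slice_point \<omega>) \<and>
        (\<forall>y\<in>slice_point \<omega> -` \<Omega>. slice_dirac \<omega> (f \<circ> slice_point \<omega>) y = 0))"


section \<open>Fueter polynomials and derivatives of the Cauchy kernel\<close>

text \<open>
  \<open>\<partial>\<^sub>\<kappa>\<close> differentiates in \<open>x\<^sub>0, \<dots>, x\<^sub>p\<close> only, with the derivatives in \<open>x\<^sub>p\<close> innermost.
\<close>

definition multi_deriv ::
  "('i::{finite,linorder} \<Rightarrow> nat) \<Rightarrow> (('i, 'j::{finite,linorder}) point \<Rightarrow> 'w::real_normed_vector)
     \<Rightarrow> ('i, 'j) point \<Rightarrow> 'w" where
  "multi_deriv \<kappa> g =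
     foldr (\<lambda>i. directional_deriv (axis i 1, 0) ^^ \<kappa> i) (sorted_list_of_set UNIV) g"

definition fueter_slice ::
  "(real, 'j::{finite,linorder}) vec \<Rightarrow> ('i::{finite,linorder} \<Rightarrow> nat) \<Rightarrow> 'i slice \<Rightarrow> ('i, 'j) cl" where
  "fueter_slice \<eta> \<kappa> y = (1 / fact (sum \<kappa> UNIV)) *\<^sub>R
     (\<Sum>js | \<forall>l. count_list js l = \<kappa> l.
        prod_list (map (\<lambda>l. (fst y $ l) *\<^sub>R 1 + snd y *\<^sub>R (im_vec \<eta> * e_vec l)) js))"

definition fueter_slice_right ::
  "(real, 'j::{finite,linorder}) vec \<Rightarrow> ('i::{finite,linorder} \<Rightarrow> nat) \<Rightarrow> 'i slice \<Rightarrow> ('i, 'j) cl" where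
  "fueter_slice_right \<eta> \<kappa> y = (1 / fact (sum \<kappa> UNIV)) *\<^sub>R
     (\<Sum>js | \<forall>l. count_list js l = \<kappa> l.
        prod_list (map (\<lambda>l. (fst y $ l) *\<^sub>R 1 + snd y *\<^sub>R (e_vec l * im_vec \<eta>)) js))"

text \<open>
  The direction \<open>\<omega>\<close> of \<open>x\<close> is unique unless \<open>snd x = 0\<close>, when the value does not depend on it.
\<close>

definition fueter ::
  "('i::{finite,linorder} \<Rightarrow> nat) \<Rightarrow> ('i, 'j::{finite,linorder}) point \<Rightarrow> ('i, 'j) cl" where
  "fueter \<kappa> x = fueter_slice (SOME \<omega>. \<omega> \<in> sphere 0 1 \<and> snd x = norm (snd x) *\<^sub>R \<omega>) \<kappa>
     (fst x, norm (snd x))"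

lemma fueter_slice_r0: "fueter_slice \<omega> \<kappa> (u, 0) = fueter_slice \<omega>' \<kappa> (u, 0)"
  by (simp add: fueter_slice_def)

lemma fueter_eq:
  fixes \<omega> :: "real ^ 'j::{finite,linorder}"
  assumes "\<omega> \<in> sphere 0 1" "r \<ge> 0"
  shows "fueter \<kappa> (slice_point \<omega> (u, r)) = fueter_slice \<omega> \<kappa> (u, r)"
proof (cases "r = 0")
  case True
  then show ?thesis
    by (simp add: fueter_def slice_point_def) (rule fueter_slice_r0)
next
  case False
  then have "(SOME \<omega>'. \<omega>' \<in> sphere 0 1 \<and> r *\<^sub>R \<omega> = r *\<^sub>R \<omega>') = \<omega>"
    using assms by (intro some_equality) auto
  then show ?thesis
    using assms by (simp add: fueter_def slice_point_def)
qed

text \<open>Here \<open>CARD('i) + 1 = p + 2\<close>.\<close>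

definition sphere_area :: "'i::finite itself \<Rightarrow> real" where
  "sphere_area _ = 2 * Gamma (1 / 2) ^ (CARD('i) + 1) / Gamma (real (CARD('i) + 1) / 2)"

definition cauchy_kernel ::
  "('i::{finite,linorder}, 'j::{finite,linorder}) point \<Rightarrow> ('i, 'j) cl" where
  "cauchy_kernel x =
     (1 / sphere_area TYPE('i)) *\<^sub>R ((1 / norm x ^ (CARD('i) + 1)) *\<^sub>R conj_paravector x)"

definition kernel_deriv ::
  "('i::{finite,linorder} \<Rightarrow> nat) \<Rightarrow> ('i, 'j::{finite,linorder}) point \<Rightarrow> ('i, 'j) cl" where
  "kernel_deriv \<kappa> x = (- 1) ^ sum \<kappa> UNIV *\<^sub>R multi_deriv \<kappa> cauchy_kernel x"

definition kernel_deriv_slice ::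
  "(real, 'j::{finite,linorder}) vec \<Rightarrow> ('i::{finite,linorder} \<Rightarrow> nat) \<Rightarrow> 'i slice \<Rightarrow> ('i, 'j) cl" where
  "kernel_deriv_slice \<eta> \<kappa> y = (- 1) ^ sum \<kappa> UNIV *\<^sub>R multi_deriv \<kappa> cauchy_kernel (slice_point \<eta> y)"


section \<open>The surface element on spheres\<close>

text \<open>
  The cone \<open>{t y | 0 < t \<le> 1, y \<in> B}\<close> over a surface piece \<open>B\<close> of the sphere of radius \<open>\<rho>\<close> about
  the origin of \<open>\<real>\<^sup>n\<close> has volume \<open>\<rho> / n\<close> times the area of \<open>B\<close>
  (lemma \<open>emeasure_sphere_surface\<close>). The measure lives on the whole space, with all its mass
  on the sphere.
\<close>

definition sphere_surface :: "real \<Rightarrow> 'v::euclidean_space measure" where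
  "sphere_surface \<rho> = scale_measure (ennreal (real DIM('v) / \<rho>))
     (distr (restrict_space lborel (cball 0 \<rho> - {0})) borel (\<lambda>x. (\<rho> / norm x) *\<^sub>R x))"

lemma sphere_surface_measurable:
  "(\<lambda>x. (\<rho> / norm x) *\<^sub>R x) \<in> restrict_space lborel (cball 0 \<rho> - {0}) \<rightarrow>\<^sub>M (borel :: 'v::euclidean_space measure)"
  by (intro measurable_restrict_space1) measurable

lemma emeasure_sphere_surface:
  fixes B :: "'v::euclidean_space set"
  assumes "\<rho> > 0" "B \<in> sets borel" "B \<subseteq> sphere 0 \<rho>"
  shows "emeasure (sphere_surface \<rho>) B =
    ennreal (real DIM('v) / \<rho>) * emeasure lborel {t *\<^sub>R y | t y. 0 < t \<and> t \<le> 1 \<and> y \<in> B}"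
proof -
  have "(\<lambda>x. (\<rho> / norm x) *\<^sub>R x) -` B \<inter> (cball 0 \<rho> - {0}) =
      {t *\<^sub>R y | t y. 0 < t \<and> t \<le> 1 \<and> y \<in> B}" (is "?L = ?R")
  proof (intro equalityI subsetI)
    fix x assume "x \<in> ?L"
    then have "x = (norm x / \<rho>) *\<^sub>R ((\<rho> / norm x) *\<^sub>R x)" "0 < norm x / \<rho>" "norm x / \<rho> \<le> 1"
      "(\<rho> / norm x) *\<^sub>R x \<in> B"
      using assms(1) by (auto simp: field_simps)
    then show "x \<in> ?R" by blast
  next
    fix x assume "x \<in> ?R"
    then obtain t y where t: "x = t *\<^sub>R y" "0 < t" "t \<le> 1" "y \<in> B" by blast
    then have "norm y = \<rho>" using assms(3) by auto
    then show "x \<in> ?L"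
      using t assms(1) by (auto simp: mult_left_le_one_le)
  qed
  moreover have "emeasure (sphere_surface \<rho>) B = ennreal (real DIM('v) / \<rho>) *
      emeasure lborel ((\<lambda>x. (\<rho> / norm x) *\<^sub>R x) -` B \<inter> (cball 0 \<rho> - {0}))"
    using assms(2) unfolding sphere_surface_def
    by (simp add: emeasure_distr [OF sphere_surface_measurable] emeasure_restrict_space
        space_restrict_space)
  ultimately show ?thesis by simp
qed

lemma emeasure_sphere_surface_Compl:
  fixes \<rho> :: real
  assumes "\<rho> > 0"
  shows "emeasure (sphere_surface \<rho> :: 'v::euclidean_space measure) (- sphere 0 \<rho>) = 0"
proof -
  have "(\<lambda>x. (\<rho> / norm x) *\<^sub>R x) -` (- sphere 0 \<rho>) \<inter> (cball 0 \<rho> - {0 :: 'v}) = {}"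
    using assms by (auto split: if_splits)
  then show ?thesis
    unfolding sphere_surface_def
    by (simp add: emeasure_distr [OF sphere_surface_measurable] space_restrict_space)
qed

lemma emeasure_sphere_surface_total:
  fixes \<rho> :: real
  assumes "\<rho> > 0"
  shows "emeasure (sphere_surface \<rho> :: ((real ^ 'i::finite) \<times> real) measure) UNIV =
      ennreal (sphere_area TYPE('i) * \<rho> ^ CARD('i))"
proof -
  let ?M = "sphere_surface \<rho> :: ((real ^ 'i) \<times> real) measure"
  define n where "n = CARD('i) + 1"
  have n: "DIM((real ^ 'i) \<times> real) = n" by (simp add: n_def)
  have em: "emeasure ?M B = ennreal (real n / \<rho>) *
      emeasure lborel ((\<lambda>x. (\<rho> / norm x) *\<^sub>R x) -` B \<inter> (cball 0 \<rho> - {0}))" if "B \<in> sets borel" for B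
    using that unfolding sphere_surface_def n
    by (simp add: emeasure_distr [OF sphere_surface_measurable] emeasure_restrict_space
        space_restrict_space)
  have "emeasure lborel (cball 0 \<rho> - {0} :: ((real ^ 'i) \<times> real) set) = emeasure lborel (cball 0 \<rho> :: ((real ^ 'i) \<times> real) set)"
    by (rule emeasure_Diff_null_set) auto
  also have "\<dots> = ennreal (unit_ball_vol n * \<rho> ^ n)"
    using assms by (simp add: emeasure_cball n del: DIM_prod)
  finally have "emeasure ?M UNIV = ennreal (real n / \<rho>) * ennreal (unit_ball_vol n * \<rho> ^ n)"
    by (simp add: em)
  also have "\<dots> = ennreal (real n / \<rho> * (unit_ball_vol n * \<rho> ^ n))"
    using assms by (intro ennreal_mult [symmetric]) auto
  also have "real n / \<rho> * (unit_ball_vol n * \<rho> ^ n) = sphere_area TYPE('i) * \<rho> ^ CARD('i)"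
  proof -
    have G: "Gamma (real n / 2 + 1) = real n / 2 * Gamma (real n / 2)"
      by (rule Gamma_plus1) (auto simp: n_def nonpos_Ints_def)
    have P: "pi powr (real n / 2) = sqrt pi ^ n"
      by (simp add: powr_half_sqrt [symmetric] powr_realpow [symmetric] powr_powr)
    have R: "\<rho> ^ n = \<rho> * \<rho> ^ CARD('i)" by (simp add: n_def)
    have "n > 0" by (simp add: n_def)
    moreover from this have "Gamma (real n / 2) > 0" by (intro Gamma_real_pos) simp
    ultimately show ?thesis
      using assms
      unfolding sphere_area_def unit_ball_vol_def Gamma_one_half_real n_def [symmetric] G P R
      by (simp add: divide_simps)
  qed
  finally show ?thesis .
qed

end

theory Submission
  imports Defs
begin

text \<open>
  On one slice, Stokes' theorem on spherical shells, applied to a kernel \<open>E\<close> regularised at its pole,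
  gives the Cauchy formula. The part of degree \<open>k\<close> in \<open>x\<close> of \<open>E(y - x)\<close> is a directional derivative
  \<open>(-x)\<^sup>k\<close> of \<open>E\<close> at \<open>y\<close>; since \<open>E\<close> is annihilated by the Dirac operator from both sides, its
  \<open>r\<close>-derivative is a combination of those in \<open>x\<^sub>0, \<dots>, x\<^sub>p\<close>, which turns this part into
  \<open>\<Sum> P\<^sub>\<kappa>(x) Q\<^sub>\<kappa>(y) = \<Sum> Q\<^sub>\<kappa>(y) P\<^sup>R\<^sub>\<kappa>(x)\<close> over \<open>|\<kappa>| = k\<close>. The coefficients do not depend on the radius
  of integration, and the expansion converges geometrically by comparison with a Gegenbauer series.

  On the other slices, both \<open>f\<close> and the terms of the series obey the representation formula, which
  recovers them from their values on the slice of \<open>\<eta>\<close>. For \<open>f\<close> this is the identity theorem: a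
  monogenic function that vanishes on \<open>r = 0\<close> is zero.
\<close>

section \<open>Polar coordinates and the divergence theorem on a shell\<close>

text \<open>Only continuous partial derivatives are given, and the pole may lie anywhere off the two
  boundary spheres; excising it would call for Stokes' theorem on regions that are not concentric.
  With a regularised kernel, shells about the origin suffice. There the flux is compared with the
  divergence in the weak sense: a radial cutoff makes a field compactly supported, partial
  derivatives of such a field have integral zero by translation invariance, and polar coordinates
  leave a statement about functions of the radius. On the sphere of radius \<rho> itself neither
  kernel series need converge at a given x. So single homogeneous terms, not sums, are moved between
  spheres; scaling the pole separates them. The representation formula for \<open>f\<close> is not a
  hypothesis. Two slices have in general only r = 0 in common, a set without interior, so equality
  there is out of reach of the identity theorem for open sets; setting the function to zero on one
  side of r = 0 bridges the gap.\<close>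

lemma nn_integral_lborel_scaleR:
  fixes f :: "'v::euclidean_space \<Rightarrow> ennreal"
  assumes [measurable]: "f \<in> borel_measurable borel" and "c > 0"
  shows "(\<integral>\<^sup>+x. f (c *\<^sub>R x) \<partial>lborel) = ennreal (1 / c ^ DIM('v)) * (\<integral>\<^sup>+x. f x \<partial>lborel)"
proof -
  have "(\<integral>\<^sup>+x. f x \<partial>lborel) =
      (\<integral>\<^sup>+x. f x \<partial>(density (distr lborel borel (\<lambda>x. 0 + c *\<^sub>R x)) (\<lambda>_. \<bar>c\<bar> ^ DIM('v))))"
    using assms(2) by (subst lborel_affine [of c 0]) auto
  also have "\<dots> = ennreal (c ^ DIM('v)) * (\<integral>\<^sup>+x. f (c *\<^sub>R x) \<partial>lborel)"
    using assms(2) by (simp add: nn_integral_density nn_integral_distr nn_integral_cmult)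
  finally have "ennreal (1 / c ^ DIM('v)) * (\<integral>\<^sup>+x. f x \<partial>lborel) =
      (ennreal (1 / c ^ DIM('v)) * ennreal (c ^ DIM('v))) * (\<integral>\<^sup>+x. f (c *\<^sub>R x) \<partial>lborel)"
    by (simp add: mult.assoc)
  also have "ennreal (1 / c ^ DIM('v)) * ennreal (c ^ DIM('v)) = 1"
    using assms(2) by (subst ennreal_mult [symmetric]) auto
  finally show ?thesis by simp
qed

lemma nn_integral_sphere_surface:
  fixes f :: "'v::euclidean_space \<Rightarrow> ennreal"
  assumes [measurable]: "f \<in> borel_measurable borel" and "\<rho> > 0"
  shows "(\<integral>\<^sup>+y. f y \<partial>sphere_surface \<rho>) = ennreal (real DIM('v) / \<rho>) *
     (\<integral>\<^sup>+x. f ((\<rho> / norm x) *\<^sub>R x) * indicator (cball 0 \<rho> - {0}) x \<partial>lborel)"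
proof -
  have "(\<integral>\<^sup>+y. f y \<partial>sphere_surface \<rho>) = ennreal (real DIM('v) / \<rho>) *
     (\<integral>\<^sup>+y. f y \<partial>distr (restrict_space lborel (cball 0 \<rho> - {0})) borel (\<lambda>x. (\<rho> / norm x) *\<^sub>R x))"
    unfolding sphere_surface_def by (rule nn_integral_scale_measure) simp
  also have "(\<integral>\<^sup>+y. f y \<partial>distr (restrict_space lborel (cball 0 \<rho> - {0})) borel (\<lambda>x. (\<rho> / norm x) *\<^sub>R x))
      = (\<integral>\<^sup>+x. f ((\<rho> / norm x) *\<^sub>R x) \<partial>restrict_space lborel (cball 0 \<rho> - {0}))"
    by (rule nn_integral_distr [OF sphere_surface_measurable]) simp
  also have "\<dots> = (\<integral>\<^sup>+x. f ((\<rho> / norm x) *\<^sub>R x) * indicator (cball 0 \<rho> - {0}) x \<partial>lborel)"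
    by (subst nn_integral_restrict_space) auto
  finally show ?thesis .
qed

lemma nn_integral_inverse_power_atLeast:
  assumes "r > 0" "n > 0"
  shows "(\<integral>\<^sup>+t. ennreal (1 / t ^ Suc n) * indicator {r..} t \<partial>lborel) = ennreal (1 / (real n * r ^ n))"
proof -
  let ?F = "\<lambda>t::real. - (inverse t ^ n / real n)"
  have "(\<integral>\<^sup>+t. ennreal (1 / t ^ Suc n) * indicator {r..} t \<partial>lborel) = ennreal (0 - ?F r)"
  proof (rule nn_integral_FTC_atLeast)
    show "DERIV ?F t :> 1 / t ^ Suc n" if "r \<le> t" for t
    proof -
      have "t \<noteq> 0" using that assms by simp
      then have "DERIV ?F t :> - ((real n * (- (inverse t ^ Suc (Suc 0)) * inverse t ^ (n - Suc 0))) / real n)"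
        by (intro DERIV_minus DERIV_cdivide DERIV_power DERIV_inverse)
      moreover have "inverse t ^ Suc (Suc 0) * inverse t ^ (n - Suc 0) = 1 / t ^ Suc n"
        using assms(2) by (simp add: power_one_over inverse_eq_divide flip: power_add power_Suc)
      ultimately show ?thesis using assms(2) by (simp del: power_Suc)
    qed
    show "(?F \<longlongrightarrow> 0) at_top"
    proof -
      have "filterlim (\<lambda>t::real. real n * t ^ n) at_top at_top"
        using assms by (intro filterlim_tendsto_pos_mult_at_top [OF tendsto_const] filterlim_pow_at_top filterlim_ident) auto
      then have "((\<lambda>t::real. inverse (real n * t ^ n)) \<longlongrightarrow> 0) at_top"
        by (rule tendsto_inverse_0_at_top)
      from tendsto_minus [OF this] show ?thesis by (simp add: divide_inverse power_inverse mult.commute)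
    qed
  qed (use assms in auto)
  then show ?thesis by (simp add: divide_inverse power_inverse mult.commute)
qed

text \<open>The surface measure is an image of Lebesgue measure on the unit ball, so the right-hand
  side is a double integral over radii \<open>s\<close> and ball points \<open>x\<close>. The
  substitutions s = |x| t and then u = t x, with Tonelli in between, leave f(u) times the integral
  of n |u|^n / t^(n+1) over t \<ge> |u|, which is 1.\<close>

theorem nn_integral_polar:
  fixes f :: "'v::euclidean_space \<Rightarrow> ennreal"
  assumes [measurable]: "f \<in> borel_measurable borel"
  shows "(\<integral>\<^sup>+x. f x \<partial>lborel) =
    (\<integral>\<^sup>+s. ennreal (s ^ (DIM('v) - 1)) * indicator {0<..} s * (\<integral>\<^sup>+y. f (s *\<^sub>R y) \<partial>sphere_surface 1) \<partial>lborel)"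
proof -
  define n where "n = DIM('v)"
  obtain m where m: "n = Suc m" unfolding n_def by (metis DIM_positive gr0_implies_Suc)
  let ?c = "indicator (cball 0 1 - {0}) :: 'v \<Rightarrow> ennreal"
  let ?p = "indicator {0<..} :: real \<Rightarrow> ennreal"
  have [measurable]: "cball 0 1 - {0 :: 'v} \<in> sets borel" by simp
  have "(\<integral>\<^sup>+s. ennreal (s ^ (n - 1)) * ?p s * (\<integral>\<^sup>+y. f (s *\<^sub>R y) \<partial>sphere_surface 1) \<partial>lborel)
    = (\<integral>\<^sup>+s. (\<integral>\<^sup>+x. ennreal n * ennreal (s ^ (n - 1)) * ?p s * (f (s *\<^sub>R (1 / norm x) *\<^sub>R x) * ?c x) \<partial>lborel) \<partial>lborel)"
  proof (rule nn_integral_cong)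
    fix s :: real
    have "(\<integral>\<^sup>+y. f (s *\<^sub>R y) \<partial>sphere_surface 1) =
        ennreal n * (\<integral>\<^sup>+x. f (s *\<^sub>R (1 / norm x) *\<^sub>R x) * ?c x \<partial>lborel)"
      by (subst nn_integral_sphere_surface) (auto simp: n_def)
    then have "ennreal (s ^ (n - 1)) * ?p s * (\<integral>\<^sup>+y. f (s *\<^sub>R y) \<partial>sphere_surface 1) =
        (ennreal n * ennreal (s ^ (n - 1)) * ?p s) * (\<integral>\<^sup>+x. f (s *\<^sub>R (1 / norm x) *\<^sub>R x) * ?c x \<partial>lborel)"
      by (simp add: mult_ac)
    also have "\<dots> = (\<integral>\<^sup>+x. ennreal n * ennreal (s ^ (n - 1)) * ?p s * (f (s *\<^sub>R (1 / norm x) *\<^sub>R x) * ?c x) \<partial>lborel)"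
      by (rule nn_integral_cmult [symmetric]) measurable
    finally show "ennreal (s ^ (n - 1)) * ?p s * (\<integral>\<^sup>+y. f (s *\<^sub>R y) \<partial>sphere_surface 1) = \<dots>" .
  qed
  also have "\<dots> = (\<integral>\<^sup>+x. (\<integral>\<^sup>+s. ennreal n * ennreal (s ^ (n - 1)) * ?p s * (f (s *\<^sub>R (1 / norm x) *\<^sub>R x) * ?c x) \<partial>lborel) \<partial>lborel)"
    by (rule lborel_pair.Fubini') measurable
  also have "\<dots> = (\<integral>\<^sup>+x. (\<integral>\<^sup>+t. ennreal n * ennreal (norm x ^ n * t ^ (n - 1)) * ?p t * (f (t *\<^sub>R x) * ?c x) \<partial>lborel) \<partial>lborel)"
  proof (rule nn_integral_cong)
    fix x :: 'v
    show "(\<integral>\<^sup>+s. ennreal n * ennreal (s ^ (n - 1)) * ?p s * (f (s *\<^sub>R (1 / norm x) *\<^sub>R x) * ?c x) \<partial>lborel)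
      = (\<integral>\<^sup>+t. ennreal n * ennreal (norm x ^ n * t ^ (n - 1)) * ?p t * (f (t *\<^sub>R x) * ?c x) \<partial>lborel)"
    proof (cases "x = 0")
      case False
      have "(\<integral>\<^sup>+s. ennreal n * ennreal (s ^ (n - 1)) * ?p s * (f (s *\<^sub>R (1 / norm x) *\<^sub>R x) * ?c x) \<partial>lborel)
        = ennreal \<bar>norm x\<bar> * (\<integral>\<^sup>+t. ennreal n * ennreal ((0 + norm x * t) ^ (n - 1)) * ?p (0 + norm x * t) * (f ((0 + norm x * t) *\<^sub>R (1 / norm x) *\<^sub>R x) * ?c x) \<partial>lborel)"
        using False by (intro nn_integral_real_affine) auto
      also have "\<dots> = (\<integral>\<^sup>+t. ennreal \<bar>norm x\<bar> * (ennreal n * ennreal ((0 + norm x * t) ^ (n - 1)) * ?p (0 + norm x * t) * (f ((0 + norm x * t) *\<^sub>R (1 / norm x) *\<^sub>R x) * ?c x)) \<partial>lborel)"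
        by (rule nn_integral_cmult [symmetric]) measurable
      also have "\<dots> = (\<integral>\<^sup>+t. ennreal n * ennreal (norm x ^ n * t ^ (n - 1)) * ?p t * (f (t *\<^sub>R x) * ?c x) \<partial>lborel)"
      proof (rule nn_integral_cong)
        fix t :: real
        show "ennreal \<bar>norm x\<bar> * (ennreal n * ennreal ((0 + norm x * t) ^ (n - 1)) * ?p (0 + norm x * t) * (f ((0 + norm x * t) *\<^sub>R (1 / norm x) *\<^sub>R x) * ?c x))
          = ennreal n * ennreal (norm x ^ n * t ^ (n - 1)) * ?p t * (f (t *\<^sub>R x) * ?c x)"
        proof (cases "t > 0")
          case True
          have "ennreal (norm x) * ennreal ((norm x * t) ^ m) = ennreal (norm x ^ n * t ^ m)"
            using True by (subst ennreal_mult [symmetric]) (auto simp: m power_mult_distrib mult_ac)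
          moreover have "?p (norm x * t) = ?p t" using True False by (simp add: indicator_def)
          moreover have "(norm x * t) *\<^sub>R (1 / norm x) *\<^sub>R x = t *\<^sub>R x" using False by simp
          moreover have "ennreal (norm x) * (ennreal n * ennreal ((norm x * t) ^ m) * ?p (norm x * t) * (f ((norm x * t) *\<^sub>R (1 / norm x) *\<^sub>R x) * ?c x))
            = ennreal n * (ennreal (norm x) * ennreal ((norm x * t) ^ m)) * ?p (norm x * t) * (f ((norm x * t) *\<^sub>R (1 / norm x) *\<^sub>R x) * ?c x)"
            by (simp only: mult_ac)
          moreover have "n - 1 = m" by (simp add: m)
          ultimately show ?thesis by (simp only: add_0 abs_norm_cancel)
        next
          case f: False
          then have "?p (norm x * t) = 0" "?p t = 0" using False by (auto simp: indicator_def zero_less_mult_iff)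
          then show ?thesis by (simp only: add_0) simp
        qed
      qed
      finally show ?thesis .
    qed simp
  qed
  also have "\<dots> = (\<integral>\<^sup>+t. (\<integral>\<^sup>+x. ennreal n * ennreal (norm x ^ n * t ^ (n - 1)) * ?p t * (f (t *\<^sub>R x) * ?c x) \<partial>lborel) \<partial>lborel)"
    by (rule lborel_pair.Fubini') measurable
  also have "\<dots> = (\<integral>\<^sup>+t. (\<integral>\<^sup>+u. ennreal n * (ennreal (norm u ^ n / t ^ Suc n) * ?p t * (f u * (if 0 < norm u \<and> norm u \<le> t then 1 else 0))) \<partial>lborel) \<partial>lborel)"
  proof (rule nn_integral_cong)
    fix t :: real
    show "(\<integral>\<^sup>+x. ennreal n * ennreal (norm x ^ n * t ^ (n - 1)) * ?p t * (f (t *\<^sub>R x) * ?c x) \<partial>lborel)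
      = (\<integral>\<^sup>+u. ennreal n * (ennreal (norm u ^ n / t ^ Suc n) * ?p t * (f u * (if 0 < norm u \<and> norm u \<le> t then 1 else 0))) \<partial>lborel)"
    proof (cases "t > 0")
      case True
      let ?g = "\<lambda>u::'v. ennreal n * (ennreal (norm u ^ n / t) * (f u * (if 0 < norm u \<and> norm u \<le> t then 1 else 0)))"
      have "(\<integral>\<^sup>+x. ennreal n * ennreal (norm x ^ n * t ^ (n - 1)) * ?p t * (f (t *\<^sub>R x) * ?c x) \<partial>lborel) = (\<integral>\<^sup>+x. ?g (t *\<^sub>R x) \<partial>lborel)"
        using True by (intro nn_integral_cong)
          (auto simp: indicator_def m power_mult_distrib field_simps)
      also have "\<dots> = ennreal (1 / t ^ n) * (\<integral>\<^sup>+x. ?g x \<partial>lborel)"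
        unfolding n_def by (rule nn_integral_lborel_scaleR [OF _ True]) measurable
      also have "\<dots> = (\<integral>\<^sup>+x. ennreal (1 / t ^ n) * ?g x \<partial>lborel)"
        by (rule nn_integral_cmult [symmetric]) measurable
      also have "\<dots> = (\<integral>\<^sup>+u. ennreal n * (ennreal (norm u ^ n / t ^ Suc n) * ?p t * (f u * (if 0 < norm u \<and> norm u \<le> t then 1 else 0))) \<partial>lborel)"
      proof (rule nn_integral_cong)
        fix u :: 'v
        have "ennreal (1 / t ^ n) * ennreal (norm u ^ n / t) = ennreal (norm u ^ n / t ^ Suc n)"
          using True by (subst ennreal_mult [symmetric]) (auto simp: mult.commute)
        moreover have "?p t = 1" using True by simp
        ultimately show "ennreal (1 / t ^ n) * ?g u = ennreal n * (ennreal (norm u ^ n / t ^ Suc n) * ?p t * (f u * (if 0 < norm u \<and> norm u \<le> t then 1 else 0)))"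
          by (simp add: mult_ac del: power_Suc)
      qed
      finally show ?thesis .
    qed (simp add: indicator_def)
  qed
  also have "\<dots> = (\<integral>\<^sup>+u. (\<integral>\<^sup>+t. ennreal n * (ennreal (norm u ^ n / t ^ Suc n) * ?p t * (f u * (if 0 < norm u \<and> norm u \<le> t then 1 else 0))) \<partial>lborel) \<partial>lborel)"
    by (rule lborel_pair.Fubini') measurable
  also have "\<dots> = (\<integral>\<^sup>+u. f u \<partial>lborel)"
  proof (rule nn_integral_cong_AE)
    have "AE u in lborel. u \<noteq> (0::'v)" by (rule AE_lborel_singleton)
    then show "AE u in lborel. (\<integral>\<^sup>+t. ennreal n * (ennreal (norm u ^ n / t ^ Suc n) * ?p t * (f u * (if 0 < norm u \<and> norm u \<le> t then 1 else 0))) \<partial>lborel) = f u"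
    proof (rule AE_mp, intro AE_I2 impI)
      fix u :: 'v assume u: "u \<noteq> 0"
      have "(\<integral>\<^sup>+t. ennreal n * (ennreal (norm u ^ n / t ^ Suc n) * ?p t * (f u * (if 0 < norm u \<and> norm u \<le> t then 1 else 0))) \<partial>lborel)
        = (\<integral>\<^sup>+t. (f u * (ennreal n * ennreal (norm u ^ n))) * (ennreal (1 / t ^ Suc n) * indicator {norm u..} t) \<partial>lborel)"
      proof (rule nn_integral_cong)
        fix t :: real
        show "ennreal n * (ennreal (norm u ^ n / t ^ Suc n) * ?p t * (f u * (if 0 < norm u \<and> norm u \<le> t then 1 else 0)))
          = (f u * (ennreal n * ennreal (norm u ^ n))) * (ennreal (1 / t ^ Suc n) * indicator {norm u..} t)"
        proof (cases "norm u \<le> t")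
          case True
          then have "t > 0" using u by (meson order_less_le_trans zero_less_norm_iff)
          then have "ennreal (norm u ^ n / t ^ Suc n) = ennreal (norm u ^ n) * ennreal (1 / t ^ Suc n)"
            by (subst ennreal_mult [symmetric]) auto
          then show ?thesis using True u \<open>t > 0\<close> by (simp add: mult_ac del: power_Suc)
        qed simp
      qed
      also have "\<dots> = (f u * (ennreal n * ennreal (norm u ^ n))) * (\<integral>\<^sup>+t. ennreal (1 / t ^ Suc n) * indicator {norm u..} t \<partial>lborel)"
        by (rule nn_integral_cmult) measurable
      also have "(\<integral>\<^sup>+t. ennreal (1 / t ^ Suc n) * indicator {norm u..} t \<partial>lborel) = ennreal (1 / (n * norm u ^ n))"
        using u by (intro nn_integral_inverse_power_atLeast) (auto simp: m)
      also have "f u * (ennreal n * ennreal (norm u ^ n)) * ennreal (1 / (n * norm u ^ n))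
          = f u * (ennreal n * ennreal (norm u ^ n) * ennreal (1 / (n * norm u ^ n)))"
        by (simp add: mult_ac)
      also have "ennreal n * ennreal (norm u ^ n) * ennreal (1 / (n * norm u ^ n)) = 1"
        using u by (subst ennreal_mult [symmetric], simp, simp, subst ennreal_mult [symmetric]) (auto simp: m)
      finally show "(\<integral>\<^sup>+t. ennreal n * (ennreal (norm u ^ n / t ^ Suc n) * ?p t * (f u * (if 0 < norm u \<and> norm u \<le> t then 1 else 0))) \<partial>lborel) = f u"
        by simp
    qed
  qed
  finally show ?thesis unfolding n_def by simp
qed

section \<open>Integrals of partial derivatives\<close>

lemma has_vector_derivative_quotient:
  assumes "(f has_vector_derivative D) (at x)"
  shows "((\<lambda>t. (f (x + t) - f x) /\<^sub>R t) \<longlongrightarrow> D) (at 0)"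
proof -
  have "((\<lambda>h. norm (f (x + h) - f x - h *\<^sub>R D) / norm h) \<longlongrightarrow> 0) (at 0)"
    using assms unfolding has_vector_derivative_def has_derivative_at by (rule conjunct2)
  moreover have "\<forall>\<^sub>F h in at 0. norm (f (x + h) - f x - h *\<^sub>R D) / norm h = norm ((f (x + h) - f x) /\<^sub>R h - D)"
    unfolding eventually_at_filter
  proof (intro always_eventually allI impI)
    fix h :: real assume "h \<noteq> 0"
    then have eq: "(f (x + h) - f x) /\<^sub>R h - D = (f (x + h) - f x - h *\<^sub>R D) /\<^sub>R h"
      by (subst scaleR_diff_right [of _ _ "h *\<^sub>R D"]) simp
    show "norm (f (x + h) - f x - h *\<^sub>R D) / norm h = norm ((f (x + h) - f x) /\<^sub>R h - D)"
      unfolding eq norm_scaleR by (simp add: divide_inverse mult.commute)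
  qed
  ultimately have "((\<lambda>h. norm ((f (x + h) - f x) /\<^sub>R h - D)) \<longlongrightarrow> 0) (at 0)"
    by (rule Lim_transform_eventually)
  then show ?thesis by (rule LIM_zero_cancel [OF tendsto_norm_zero_cancel])
qed

text \<open>Difference quotients of \<open>\<phi>\<close> along \<open>v\<close> have integral zero
  by translation invariance, and they converge to \<open>D\<close> under a common bound, which the
  mean value inequality takes from the supremum of |D|. Differentiability is asked for along
  \<open>v\<close> only, in keeping with functions that merely have partial derivatives.\<close>

lemma integral_partial_derivative_zero:
  fixes \<phi> D :: "'v::euclidean_space \<Rightarrow> 'w::euclidean_space"
  assumes cont: "continuous_on UNIV \<phi>" "continuous_on UNIV D"
    and deriv: "\<And>y. ((\<lambda>t. \<phi> (y + t *\<^sub>R v)) has_vector_derivative D y) (at 0)"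
    and supp: "\<And>y. norm y \<ge> B \<Longrightarrow> \<phi> y = 0" "\<And>y. norm y \<ge> B \<Longrightarrow> D y = 0"
  shows "integral\<^sup>L lborel D = 0"
proof -
  have "compact (D ` cball 0 B)"
    by (intro compact_continuous_image continuous_on_subset [OF cont(2)]) auto
  then obtain M where M: "\<And>y. y \<in> cball 0 B \<Longrightarrow> norm (D y) \<le> M"
    by (meson bounded_iff compact_imp_bounded imageI)
  define M' where "M' = max M 0"
  have M': "norm (D y) \<le> M'" for y
    using M [of y] supp(2) [of y] by (cases "norm y \<le> B") (auto simp: M'_def)
  have M'0: "M' \<ge> 0" by (simp add: M'_def)
  have int: "integrable lborel \<phi>"
  proof -
    have "integrable lborel (\<lambda>x. indicator (cball 0 B) x *\<^sub>R \<phi> x)"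
      by (rule borel_integrable_compact) (auto intro: continuous_on_subset [OF cont(1)])
    also have "(\<lambda>x. indicator (cball 0 B) x *\<^sub>R \<phi> x) = \<phi>"
      using supp(1) by (auto simp: indicator_def fun_eq_iff)
    finally show ?thesis .
  qed
  have shift: "integrable lborel (\<lambda>y. \<phi> (y + a))" "(\<integral>y. \<phi> (y + a) \<partial>lborel) = integral\<^sup>L lborel \<phi>" for a
  proof -
    have m: "(+) a \<in> borel_measurable borel" by simp
    have "integrable (distr lborel borel ((+) a)) \<phi>"
      using int by (simp add: lborel_distr_plus)
    then have "integrable lborel (\<lambda>y. \<phi> (a + y))"
      by (subst (asm) integrable_distr_eq) (use int in auto)
    then show "integrable lborel (\<lambda>y. \<phi> (y + a))" by (simp add: add.commute)
    have "integral\<^sup>L (distr lborel borel ((+) a)) \<phi> = (\<integral>y. \<phi> (a + y) \<partial>lborel)"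
      by (rule integral_distr) (use int in auto)
    then show "(\<integral>y. \<phi> (y + a) \<partial>lborel) = integral\<^sup>L lborel \<phi>"
      by (simp add: lborel_distr_plus add.commute)
  qed
  have mvt: "norm (\<phi> (y + t *\<^sub>R v) - \<phi> y) \<le> M' * t" if "t \<ge> 0" for y t
  proof -
    have "((\<lambda>t. \<phi> (y + t *\<^sub>R v)) has_derivative (\<lambda>h. h *\<^sub>R D (y + s *\<^sub>R v))) (at s within {0..t})" for s
    proof -
      have "((\<lambda>t. \<phi> ((y + s *\<^sub>R v) + t *\<^sub>R v)) has_vector_derivative D (y + s *\<^sub>R v)) (at (s - s))"
        using deriv [of "y + s *\<^sub>R v"] by simp
      moreover have "((\<lambda>t. t - s) has_vector_derivative 1) (at s)"
        by (auto intro!: derivative_eq_intros)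
      ultimately have "((\<lambda>t. \<phi> (y + t *\<^sub>R v)) has_vector_derivative D (y + s *\<^sub>R v)) (at s)"
        using vector_diff_chain_at [of "\<lambda>t. t - s" 1 s "\<lambda>t. \<phi> ((y + s *\<^sub>R v) + t *\<^sub>R v)" "D (y + s *\<^sub>R v)"]
        by (simp add: o_def algebra_simps)
      then show ?thesis
        using has_derivative_at_withinI has_vector_derivative_def by blast
    qed
    then have "norm (\<phi> (y + t *\<^sub>R v) - \<phi> (y + 0 *\<^sub>R v)) \<le> M' * norm (t - 0)"
      using that M' by (intro differentiable_bound [where S = "{0..t}"])
        (auto intro!: onorm_le mult_right_mono simp: mult.commute [of M'] mult_left_mono)
    then show ?thesis using that by simp
  qed
  define q where "q k y = real (Suc k) *\<^sub>R (\<phi> (y + (1 / real (Suc k)) *\<^sub>R v) - \<phi> y)" for k y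
  have "(\<lambda>k. integral\<^sup>L lborel (q k)) \<longlonglongrightarrow> integral\<^sup>L lborel D"
  proof (rule integral_dominated_convergence)
    show "D \<in> borel_measurable lborel" using cont by (simp add: borel_measurable_continuous_onI)
    have [measurable]: "\<phi> \<in> borel_measurable borel" using cont by (simp add: borel_measurable_continuous_onI)
    show "q k \<in> borel_measurable lborel" for k unfolding q_def by measurable
    \<comment> \<open>The steps 1/(k+1) are at most 1, so every quotient vanishes outside the
      support radius enlarged by |v|.\<close>
    show "integrable lborel (\<lambda>y. indicator (cball 0 (\<bar>B\<bar> + norm v)) (y::'v) * M')"
      by (intro integrable_mult_left integrable_real_indicator) (auto simp: emeasure_lborel_cball_finite [unfolded infinity_ennreal_def])
    show "AE y in lborel. (\<lambda>k. q k y) \<longlonglongrightarrow> D y"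
    proof (rule AE_I2)
      fix y
      have "((\<lambda>t. (\<phi> (y + (0 + t) *\<^sub>R v) - \<phi> (y + 0 *\<^sub>R v)) /\<^sub>R t) \<longlongrightarrow> D y) (at 0)"
        using deriv [of y] by (rule has_vector_derivative_quotient)
      moreover have "filterlim (\<lambda>k. 1 / real (Suc k)) (at 0) sequentially"
        unfolding filterlim_at using LIMSEQ_Suc [OF lim_1_over_n] by auto
      ultimately have "((\<lambda>k. (\<phi> (y + (0 + 1 / real (Suc k)) *\<^sub>R v) - \<phi> (y + 0 *\<^sub>R v)) /\<^sub>R (1 / real (Suc k))) \<longlonglongrightarrow> D y)"
        by (rule filterlim_compose)
      then show "(\<lambda>k. q k y) \<longlonglongrightarrow> D y" by (simp add: q_def)
    qed
    show "AE y in lborel. norm (q k y) \<le> indicator (cball 0 (\<bar>B\<bar> + norm v)) y * M'" for k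
    proof (rule AE_I2)
      fix y
      show "norm (q k y) \<le> indicator (cball 0 (\<bar>B\<bar> + norm v)) y * M'"
      proof (cases "y \<in> cball 0 (\<bar>B\<bar> + norm v)")
        case True
        have "norm (q k y) = real (Suc k) * norm (\<phi> (y + (1 / real (Suc k)) *\<^sub>R v) - \<phi> y)"
          by (simp add: q_def)
        also have "\<dots> \<le> real (Suc k) * (M' * (1 / real (Suc k)))"
          by (intro mult_left_mono mvt) auto
        finally show ?thesis using True by simp
      next
        case False
        then have y: "norm y > \<bar>B\<bar> + norm v" by simp
        have "norm ((1 / real (Suc k)) *\<^sub>R v) \<le> norm v"
          by (simp add: divide_le_eq mult_left_le algebra_simps)
        then have "norm (y + (1 / real (Suc k)) *\<^sub>R v) \<ge> B"
          using y norm_triangle_ineq2 [of y "- ((1 / real (Suc k)) *\<^sub>R v)"] by simp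
        moreover have "norm y \<ge> B" using y norm_ge_zero [of v] by linarith
        ultimately have "q k y = 0" using supp(1) by (simp add: q_def)
        then show ?thesis by (simp add: M'0)
      qed
    qed
  qed
  moreover have "integral\<^sup>L lborel (q k) = 0" for k
    unfolding q_def using shift [of "(1 / real (Suc k)) *\<^sub>R v"] int by simp
  ultimately show ?thesis by (simp add: LIMSEQ_const_iff)
qed

section \<open>The surface measure and integrals over spheres\<close>

lemma sets_sphere_surface [simp, measurable_cong]:
  "sets (sphere_surface \<rho> :: 'v::euclidean_space measure) = sets borel"
  by (simp add: sphere_surface_def)

lemma space_sphere_surface [simp]:
  "space (sphere_surface \<rho> :: 'v::euclidean_space measure) = UNIV"
  using sets_eq_imp_space_eq [OF sets_sphere_surface] by simp

lemma emeasure_sphere_surface_nn_integral: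
  fixes A :: "'v::euclidean_space set"
  assumes [measurable]: "A \<in> sets borel"
  shows "emeasure (sphere_surface \<rho>) A = (\<integral>\<^sup>+y. indicator A y \<partial>sphere_surface \<rho>)"
  by simp

lemma finite_measure_sphere_surface:
  assumes "\<rho> > 0"
  shows "finite_measure (sphere_surface \<rho> :: 'v::euclidean_space measure)"
proof
  have "emeasure (sphere_surface \<rho> :: 'v measure) UNIV = ennreal (real DIM('v) / \<rho>) *
      (\<integral>\<^sup>+x. indicator UNIV ((\<rho> / norm x) *\<^sub>R x) * indicator (cball 0 \<rho> - {0}) x \<partial>(lborel :: 'v measure))"
    by (subst emeasure_sphere_surface_nn_integral, simp, subst nn_integral_sphere_surface) (use assms in auto)
  also have "\<dots> = ennreal (real DIM('v) / \<rho>) * emeasure lborel (cball 0 \<rho> - {0 :: 'v})"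
    by simp
  also have "\<dots> < \<infinity>"
  proof -
    have "emeasure lborel (cball 0 \<rho> - {0 :: 'v}) \<le> emeasure lborel (cball 0 \<rho> :: 'v set)"
      by (intro emeasure_mono) auto
    also have "\<dots> < \<infinity>" by (rule emeasure_lborel_cball_finite)
    finally show ?thesis by (simp add: ennreal_mult_less_top)
  qed
  finally show "emeasure (sphere_surface \<rho> :: 'v measure) (space (sphere_surface \<rho>)) \<noteq> \<infinity>" by simp
qed

interpretation unit_sphere: finite_measure "sphere_surface 1 :: 'v::euclidean_space measure"
  by (rule finite_measure_sphere_surface) simp

lemma AE_sphere_surface:
  assumes "\<rho> > 0"
  shows "AE y in (sphere_surface \<rho> :: 'v::euclidean_space measure). y \<in> sphere 0 \<rho>"
  using assms by (intro AE_I [of _ _ "- sphere 0 \<rho>"]) (auto simp: emeasure_sphere_surface_Compl)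

text \<open>The map x = \<rho> z contributes \<rho>^n on the solid cones, and the normalisation
  n/\<rho> in \<open>sphere_surface \<rho>\<close> takes one power back.\<close>

lemma sphere_surface_scale:
  assumes "\<rho> > 0"
  shows "(sphere_surface \<rho> :: 'v::euclidean_space measure) =
    density (distr (sphere_surface 1) borel (\<lambda>y. \<rho> *\<^sub>R y)) (\<lambda>_. ennreal (\<rho> ^ (DIM('v) - 1)))"
proof (rule measure_eqI)
  fix A :: "'v set" assume "A \<in> sets (sphere_surface \<rho>)"
  then have A [measurable]: "A \<in> sets borel" by simp
  define n where "n = DIM('v)"
  have n: "n > 0" by (simp add: n_def)
  have [measurable]: "cball 0 \<rho> - {0 :: 'v} \<in> sets borel" "cball 0 1 - {0 :: 'v} \<in> sets borel" by simp_all
  let ?g = "\<lambda>x::'v. indicator A ((\<rho> / norm x) *\<^sub>R x) * indicator (cball 0 \<rho> - {0}) x :: ennreal"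
  let ?J = "\<integral>\<^sup>+z. indicator A (\<rho> *\<^sub>R (1 / norm z) *\<^sub>R z) * indicator (cball 0 1 - {0}) z \<partial>(lborel :: 'v measure)"
  have "(\<integral>\<^sup>+z. ?g (\<rho> *\<^sub>R z) \<partial>lborel) = ennreal (1 / \<rho> ^ n) * (\<integral>\<^sup>+x. ?g x \<partial>lborel)"
    unfolding n_def by (rule nn_integral_lborel_scaleR [OF _ assms]) measurable
  moreover have "(\<integral>\<^sup>+z. ?g (\<rho> *\<^sub>R z) \<partial>lborel) = ?J"
  proof (rule nn_integral_cong)
    fix z :: 'v
    have "(\<rho> / norm (\<rho> *\<^sub>R z)) *\<^sub>R \<rho> *\<^sub>R z = \<rho> *\<^sub>R (1 / norm z) *\<^sub>R z"
      using assms by simp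
    moreover have "\<rho> *\<^sub>R z \<in> cball 0 \<rho> - {0} \<longleftrightarrow> z \<in> cball 0 1 - {0}"
      using assms by auto
    ultimately show "?g (\<rho> *\<^sub>R z) = indicator A (\<rho> *\<^sub>R (1 / norm z) *\<^sub>R z) * indicator (cball 0 1 - {0}) z"
      by (simp only: indicator_def)
  qed
  ultimately have "ennreal (\<rho> ^ n) * ?J = (ennreal (\<rho> ^ n) * ennreal (1 / \<rho> ^ n)) * (\<integral>\<^sup>+x. ?g x \<partial>lborel)"
    by (simp add: mult.assoc)
  also have "ennreal (\<rho> ^ n) * ennreal (1 / \<rho> ^ n) = 1"
    using assms by (subst ennreal_mult [symmetric]) auto
  finally have J: "(\<integral>\<^sup>+x. ?g x \<partial>lborel) = ennreal (\<rho> ^ n) * ?J" by simp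
  have "n / \<rho> * \<rho> ^ n = \<rho> ^ (n - 1) * n"
    using assms n by (simp add: power_eq_if)
  then have c: "ennreal (n / \<rho>) * ennreal (\<rho> ^ n) = ennreal (\<rho> ^ (n - 1)) * ennreal n"
    using assms by (metis divide_nonneg_pos ennreal_mult of_nat_0_le_iff zero_le_power less_imp_le)
  have "emeasure (sphere_surface \<rho>) A = ennreal (n / \<rho>) * (\<integral>\<^sup>+x. ?g x \<partial>lborel)"
    by (subst emeasure_sphere_surface_nn_integral, simp, subst nn_integral_sphere_surface) (use assms in \<open>auto simp: n_def\<close>)
  also have "\<dots> = ennreal (\<rho> ^ (n - 1)) * (ennreal n * ?J)"
    unfolding J mult.assoc [symmetric] c ..
  also have "ennreal n * ?J = (\<integral>\<^sup>+y. indicator A (\<rho> *\<^sub>R y) \<partial>sphere_surface 1)"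
    by (subst nn_integral_sphere_surface) (auto simp: n_def)
  finally show "emeasure (sphere_surface \<rho>) A = emeasure (density (distr (sphere_surface 1) borel (\<lambda>y. \<rho> *\<^sub>R y)) (\<lambda>_. ennreal (\<rho> ^ (DIM('v) - 1)))) A"
    by (simp add: emeasure_density nn_integral_cmult nn_integral_distr n_def del: nn_integral_indicator)
qed simp

text \<open>Polar coordinates as an identity of measures: in this form they pass from nonnegative
  integrands to Bochner integrals through \<open>integral_distr\<close> and
  \<open>integral_density\<close>.\<close>

lemma lborel_polar:
  "(lborel :: 'v::euclidean_space measure) =
    distr (density (lborel \<Otimes>\<^sub>M sphere_surface 1) (\<lambda>z. ennreal (fst z ^ (DIM('v) - 1)) * indicator {0<..} (fst z)))
      borel (\<lambda>z. fst z *\<^sub>R snd z)" (is "_ = ?M")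
proof (rule measure_eqI)
  fix A :: "'v set" assume "A \<in> sets lborel"
  then have A [measurable]: "A \<in> sets borel" by simp
  have "emeasure lborel A = (\<integral>\<^sup>+x. indicator A x \<partial>lborel)" by simp
  also have "\<dots> = (\<integral>\<^sup>+s. ennreal (s ^ (DIM('v) - 1)) * indicator {0<..} s * (\<integral>\<^sup>+y. indicator A (s *\<^sub>R y) \<partial>(sphere_surface 1 :: 'v measure)) \<partial>lborel)"
    by (rule nn_integral_polar) simp
  also have "\<dots> = (\<integral>\<^sup>+s. (\<integral>\<^sup>+y. ennreal (s ^ (DIM('v) - 1)) * indicator {0<..} s * indicator A (s *\<^sub>R y) \<partial>(sphere_surface 1 :: 'v measure)) \<partial>lborel)"
    by (intro nn_integral_cong nn_integral_cmult [symmetric]) measurable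
  also have "\<dots> = (\<integral>\<^sup>+z. ennreal (fst z ^ (DIM('v) - 1)) * indicator {0<..} (fst z) * indicator A (fst z *\<^sub>R snd z) \<partial>(lborel \<Otimes>\<^sub>M (sphere_surface 1 :: 'v measure)))"
    by (subst unit_sphere.nn_integral_fst [symmetric]) auto
  also have "\<dots> = emeasure ?M A"
    by (simp add: emeasure_distr emeasure_density nn_integral_distr flip: nn_integral_indicator)
       (subst nn_integral_density, auto simp: indicator_def intro!: nn_integral_cong)
  finally show "emeasure lborel A = emeasure ?M A" .
qed simp

text \<open>The measure already lives on the sphere; restricting the integral to
  \<open>sphere 0 \<rho>\<close> as well makes continuity of \<open>F\<close> on the sphere
  sufficient for measurability, whatever \<open>F\<close> is elsewhere.\<close>

definition sphere_integral :: "real \<Rightarrow> ('v::euclidean_space \<Rightarrow> 'w::euclidean_space) \<Rightarrow> 'w" where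
  "sphere_integral \<rho> F = (LINT y:sphere 0 \<rho>|sphere_surface \<rho>. F y)"

lemma integrable_sphere:
  fixes F :: "'v::euclidean_space \<Rightarrow> 'w::euclidean_space"
  assumes "\<rho> > 0" "continuous_on (sphere 0 \<rho>) F"
  shows "integrable (sphere_surface \<rho>) (\<lambda>y. indicator (sphere 0 \<rho>) y *\<^sub>R F y)"
proof -
  interpret finite_measure "sphere_surface \<rho> :: 'v measure"
    using assms by (intro finite_measure_sphere_surface)
  obtain B where B: "B \<ge> 0" "\<And>x. x \<in> sphere 0 \<rho> \<Longrightarrow> norm (F x) \<le> B"
    using continuous_on_compact_bound [OF compact_sphere assms(2)] by auto
  show ?thesis
  proof (rule integrable_const_bound [where B = B])
    have "(\<lambda>y. indicator (sphere 0 \<rho>) y *\<^sub>R F y) \<in> borel_measurable borel"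
      using assms by (intro borel_measurable_continuous_on_indicator) auto
    then show "(\<lambda>y. indicator (sphere 0 \<rho>) y *\<^sub>R F y) \<in> borel_measurable (sphere_surface \<rho>)"
      by simp
  qed (use B in \<open>auto simp: indicator_def\<close>)
qed

lemma sphere_integral_cong:
  "(\<And>y. norm y = \<rho> \<Longrightarrow> F y = G y) \<Longrightarrow> sphere_integral \<rho> F = sphere_integral \<rho> G"
  unfolding sphere_integral_def set_lebesgue_integral_def
  by (intro Bochner_Integration.integral_cong) (auto simp: indicator_def)

lemma sphere_integral_add:
  assumes "\<rho> > 0" "continuous_on (sphere 0 \<rho>) F" "continuous_on (sphere 0 \<rho>) G"
  shows "sphere_integral \<rho> (\<lambda>y. F y + G y) = sphere_integral \<rho> F + sphere_integral \<rho> G"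
  using integrable_sphere [of \<rho> F] integrable_sphere [of \<rho> G] assms
  unfolding sphere_integral_def by (intro set_integral_add) (auto simp: set_integrable_def)

lemma sphere_integral_linear:
  assumes "bounded_linear L" "\<rho> > 0" "continuous_on (sphere 0 \<rho>) F"
  shows "sphere_integral \<rho> (\<lambda>y. L (F y)) = L (sphere_integral \<rho> F)"
  using integral_bounded_linear [OF assms(1) integrable_sphere [OF assms(2,3)]]
  unfolding sphere_integral_def set_lebesgue_integral_def
  by (simp add: linear_simps [OF assms(1)])

lemma sphere_integral_sum:
  assumes "\<rho> > 0" "\<And>i. i \<in> I \<Longrightarrow> continuous_on (sphere 0 \<rho>) (F i)"
  shows "sphere_integral \<rho> (\<lambda>y. \<Sum>i\<in>I. F i y) = (\<Sum>i\<in>I. sphere_integral \<rho> (F i))"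
  unfolding sphere_integral_def set_lebesgue_integral_def scaleR_sum_right
  by (intro Bochner_Integration.integral_sum integrable_sphere assms)

lemma sphere_integral_scale:
  fixes F :: "'v::euclidean_space \<Rightarrow> 'w::euclidean_space"
  assumes "\<rho> > 0" "continuous_on (sphere 0 \<rho>) F"
  shows "sphere_integral \<rho> F = \<rho> ^ (DIM('v) - 1) *\<^sub>R sphere_integral 1 (\<lambda>y. F (\<rho> *\<^sub>R y))"
proof -
  have [measurable]: "(\<lambda>y. indicator (sphere 0 \<rho>) y *\<^sub>R F y) \<in> borel_measurable borel"
    using assms by (intro borel_measurable_continuous_on_indicator) auto
  have "sphere_integral \<rho> F = (\<integral>y. \<rho> ^ (DIM('v) - 1) *\<^sub>R (indicator (sphere 0 \<rho>) (\<rho> *\<^sub>R y) *\<^sub>R F (\<rho> *\<^sub>R y)) \<partial>sphere_surface 1)"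
    unfolding sphere_integral_def set_lebesgue_integral_def
    by (simp only: sphere_surface_scale [OF assms(1)], subst integral_density)
      (use assms(1) in \<open>auto simp: integral_distr simp del: integral_scaleR_right scaleR_scaleR\<close>)
  also have "\<dots> = (\<integral>y. \<rho> ^ (DIM('v) - 1) *\<^sub>R (indicator (sphere 0 1) y *\<^sub>R F (\<rho> *\<^sub>R y)) \<partial>sphere_surface 1)"
    using assms(1) by (intro Bochner_Integration.integral_cong) (auto simp: indicator_def)
  also have "\<dots> = \<rho> ^ (DIM('v) - 1) *\<^sub>R (\<integral>y. indicator (sphere 0 1) y *\<^sub>R F (\<rho> *\<^sub>R y) \<partial>sphere_surface 1)"
    using assms by (intro integral_scaleR_right integrable_sphere continuous_on_compose2 [OF assms(2)])
  finally show ?thesis unfolding sphere_integral_def set_lebesgue_integral_def .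
qed

lemma norm_sphere_integral_le:
  fixes F :: "'v::euclidean_space \<Rightarrow> 'w::euclidean_space"
  assumes "\<rho> > 0" "continuous_on (sphere 0 \<rho>) F" "\<And>y. norm y = \<rho> \<Longrightarrow> norm (F y) \<le> B" "B \<ge> 0"
  shows "norm (sphere_integral \<rho> F) \<le> measure (sphere_surface \<rho> :: 'v measure) UNIV * B"
proof -
  interpret finite_measure "sphere_surface \<rho> :: 'v measure"
    using assms by (intro finite_measure_sphere_surface)
  have "norm (sphere_integral \<rho> F) \<le> (\<integral>y. norm (indicator (sphere 0 \<rho>) y *\<^sub>R F y) \<partial>sphere_surface \<rho>)"
    unfolding sphere_integral_def set_lebesgue_integral_def by (rule integral_norm_bound)
  also have "\<dots> \<le> (\<integral>y. B \<partial>(sphere_surface \<rho> :: 'v measure))"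
    using assms integrable_sphere [OF assms(1,2)]
    by (intro integral_mono integrable_norm integrable_const) (auto simp: indicator_def)
  finally show ?thesis by simp
qed

lemma continuous_on_sphere_integral_unit:
  fixes G :: "real \<Rightarrow> 'v::euclidean_space \<Rightarrow> 'w::euclidean_space"
  assumes "compact K" "continuous_on (K \<times> sphere 0 1) (\<lambda>z. G (fst z) (snd z))"
  shows "continuous_on K (\<lambda>s. sphere_integral 1 (G s))"
  unfolding continuous_on_sequentially
proof (intro allI ballI impI, elim conjE)
  fix u :: "nat \<Rightarrow> real" and s
  assume s: "s \<in> K" and u: "\<forall>n. u n \<in> K" and lim: "u \<longlonglongrightarrow> s"
  obtain B where B: "B \<ge> 0" "\<And>x. x \<in> K \<times> sphere 0 1 \<Longrightarrow> norm (G (fst x) (snd x)) \<le> B"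
    using continuous_on_compact_bound [OF compact_Times [OF assms(1) compact_sphere] assms(2)] by auto
  have cont: "continuous_on (sphere 0 1) (G t)" if "t \<in> K" for t
  proof -
    have "continuous_on (sphere 0 1) (\<lambda>y. G (fst (t, y)) (snd (t, y)))"
      by (rule continuous_on_compose2 [OF assms(2)])
        (use that in \<open>auto intro!: continuous_on_Pair continuous_on_const continuous_on_id\<close>)
    then show ?thesis by simp
  qed
  have meas: "(\<lambda>y. indicator (sphere 0 1) y *\<^sub>R G t y) \<in> borel_measurable (sphere_surface 1)" if "t \<in> K" for t
    using borel_measurable_continuous_on_indicator [OF _ cont [OF that]] by simp
  have "(\<lambda>n. \<integral>y. indicator (sphere 0 1) y *\<^sub>R G (u n) y \<partial>sphere_surface 1) \<longlonglongrightarrow>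
      (\<integral>y. indicator (sphere 0 1) y *\<^sub>R G s y \<partial>sphere_surface 1)"
  proof (rule integral_dominated_convergence)
    show "integrable (sphere_surface 1 :: 'v measure) (\<lambda>y. B)" by simp
    show "AE y in sphere_surface 1. (\<lambda>n. indicator (sphere 0 1) y *\<^sub>R G (u n) y) \<longlonglongrightarrow> indicator (sphere 0 1) y *\<^sub>R G s y"
    proof (rule AE_I2)
      fix y :: 'v
      show "(\<lambda>n. indicator (sphere 0 1) y *\<^sub>R G (u n) y) \<longlonglongrightarrow> indicator (sphere 0 1) y *\<^sub>R G s y"
      proof (cases "y \<in> sphere 0 1")
        case True
        have "(\<lambda>n. (u n, y)) \<longlonglongrightarrow> (s, y)" using lim by (intro tendsto_intros)
        then have "(\<lambda>n. G (fst (u n, y)) (snd (u n, y))) \<longlonglongrightarrow> G (fst (s, y)) (snd (s, y))"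
          by (intro continuous_on_tendsto_compose [OF assms(2), of "\<lambda>n. (u n, y)"])
            (use s u True in auto)
        then show ?thesis by (simp add: True tendsto_intros)
      qed simp
    qed
  qed (use meas s u B in \<open>auto simp: indicator_def\<close>)
  then show "((\<lambda>s. sphere_integral 1 (G s)) \<circ> u) \<longlonglongrightarrow> sphere_integral 1 (G s)"
    unfolding sphere_integral_def set_lebesgue_integral_def o_def .
qed

text \<open>Rescaling to the unit sphere moves the radius into the integrand, so that a single
  finite measure carries all the integrals and dominated convergence applies.\<close>

lemma continuous_on_sphere_integral:
  fixes F :: "'v::euclidean_space \<Rightarrow> 'w::euclidean_space"
  assumes "a > 0" "continuous_on {y. a \<le> norm y \<and> norm y \<le> b} F"
  shows "continuous_on {a..b} (\<lambda>s. sphere_integral s F)"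
proof -
  have "continuous_on {a..b} (\<lambda>s. s ^ (DIM('v) - 1) *\<^sub>R sphere_integral 1 (\<lambda>y. F (s *\<^sub>R y)))"
    using assms(1) by (intro continuous_intros continuous_on_sphere_integral_unit
      continuous_on_compose2 [OF assms(2)]) auto
  moreover have "s ^ (DIM('v) - 1) *\<^sub>R sphere_integral 1 (\<lambda>y. F (s *\<^sub>R y)) = sphere_integral s F" if "s \<in> {a..b}" for s
    using that assms by (intro sphere_integral_scale [symmetric] continuous_on_subset [OF assms(2)]) auto
  ultimately show ?thesis
    using continuous_on_cong [OF refl] by (metis (no_types, lifting))
qed

theorem integral_polar:
  fixes \<phi> :: "'v::euclidean_space \<Rightarrow> 'w::euclidean_space"
  assumes "integrable lborel \<phi>"
  shows "integrable lborel (\<lambda>s. indicator {0<..} s *\<^sub>R sphere_integral s \<phi>)"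
    and "integral\<^sup>L lborel \<phi> = (\<integral>s. indicator {0<..} s *\<^sub>R sphere_integral s \<phi> \<partial>lborel)"
proof -
  have [measurable]: "\<phi> \<in> borel_measurable borel" using assms by auto
  let ?S = "sphere_surface 1 :: 'v measure"
  let ?w = "\<lambda>z::real \<times> 'v. fst z ^ (DIM('v) - 1) * indicator {0<..} (fst z)"
  interpret P: pair_sigma_finite "lborel :: real measure" ?S ..
  have lb: "lborel = distr (density (lborel \<Otimes>\<^sub>M ?S) (\<lambda>z. ennreal (?w z))) borel (\<lambda>z. fst z *\<^sub>R snd z)"
  proof -
    have "ennreal (fst z ^ (DIM('v) - 1)) * indicator {0<..} (fst z) = ennreal (?w z)" for z :: "real \<times> 'v"
      by (auto simp: indicator_def)
    then show ?thesis by (subst lborel_polar) simp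
  qed
  have w0: "?w z \<ge> 0" for z by (auto simp: indicator_def)
  have int: "integrable (lborel \<Otimes>\<^sub>M ?S) (\<lambda>z. ?w z *\<^sub>R \<phi> (fst z *\<^sub>R snd z))"
    using assms unfolding lb by (subst (asm) integrable_distr_eq, simp, simp, subst (asm) integrable_density) (use w0 in auto)
  have eq: "(\<integral>y. ?w (s, y) *\<^sub>R \<phi> (fst (s, y) *\<^sub>R snd (s, y)) \<partial>?S) = indicator {0<..} s *\<^sub>R sphere_integral s \<phi>" for s
  proof (cases "s > 0")
    case True
    have [measurable]: "sphere 0 s \<in> sets (borel :: 'v measure)" by simp
    have "sphere_integral s \<phi> = (\<integral>y. \<phi> y \<partial>sphere_surface s)"
      unfolding sphere_integral_def set_lebesgue_integral_def
      using AE_sphere_surface [OF True, where 'v = 'v] by (intro integral_cong_AE) (auto elim!: eventually_mono)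
    also have "\<dots> = s ^ (DIM('v) - 1) *\<^sub>R (\<integral>y. \<phi> (s *\<^sub>R y) \<partial>?S)"
      using True by (subst sphere_surface_scale) (auto simp: integral_density integral_distr)
    finally show ?thesis using True by simp
  qed simp
  show "integrable lborel (\<lambda>s. indicator {0<..} s *\<^sub>R sphere_integral s \<phi>)"
    using P.integrable_fst' [OF int] unfolding eq .
  have "integral\<^sup>L lborel \<phi> = integral\<^sup>L (lborel \<Otimes>\<^sub>M ?S) (\<lambda>z. ?w z *\<^sub>R \<phi> (fst z *\<^sub>R snd z))"
    unfolding lb by (subst integral_distr, simp, simp, subst integral_density) (use w0 in auto)
  also have "\<dots> = (\<integral>s. indicator {0<..} s *\<^sub>R sphere_integral s \<phi> \<partial>lborel)"
    unfolding P.integral_fst' [OF int, symmetric] eq ..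
  finally show "integral\<^sup>L lborel \<phi> = (\<integral>s. indicator {0<..} s *\<^sub>R sphere_integral s \<phi> \<partial>lborel)" .
qed

lemma integral_shell_polar:
  fixes \<phi> :: "'v::euclidean_space \<Rightarrow> 'w::euclidean_space"
  assumes "0 < a" "continuous_on {y. a \<le> norm y \<and> norm y \<le> b} \<phi>"
  shows "(LINT y:{y. a \<le> norm y \<and> norm y \<le> b}|lborel. \<phi> y) = integral {a..b} (\<lambda>s. sphere_integral s \<phi>)"
proof -
  let ?K = "{y::'v. a \<le> norm y \<and> norm y \<le> b}"
  have K: "compact ?K"
  proof -
    have "?K = cball 0 b - ball 0 a" by auto
    then show ?thesis by (simp add: compact_diff)
  qed
  have int: "integrable lborel (\<lambda>y. indicator ?K y *\<^sub>R \<phi> y)"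
    by (rule borel_integrable_compact [OF K assms(2)])
  have eq: "indicator {0<..} s *\<^sub>R sphere_integral s (\<lambda>y. indicator ?K y *\<^sub>R \<phi> y) = indicator {a..b} s *\<^sub>R sphere_integral s \<phi>" for s
  proof (cases "s \<in> {a..b}")
    case True
    then show ?thesis using assms(1) by (auto intro!: sphere_integral_cong)
  next
    case False
    then have "sphere_integral s (\<lambda>y. indicator ?K y *\<^sub>R \<phi> y) = sphere_integral s (\<lambda>y::'v. 0)"
      by (intro sphere_integral_cong) auto
    then show ?thesis using False by (simp add: sphere_integral_def)
  qed
  have "(LINT y:?K|lborel. \<phi> y) = (LINT s:{a..b}|lborel. sphere_integral s \<phi>)"
    unfolding set_lebesgue_integral_def by (simp add: integral_polar(2) [OF int] eq)
  also have "\<dots> = integral {a..b} (\<lambda>s. sphere_integral s \<phi>)"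
    by (rule set_borel_integral_eq_integral)
      (use integral_polar(1) [OF int] in \<open>simp add: eq set_integrable_def\<close>)
  finally show ?thesis .
qed

section \<open>The divergence theorem by radial test functions\<close>

lemma norm_line_derivative:
  fixes y v :: "'v::real_inner"
  assumes "y \<noteq> 0"
  shows "((\<lambda>t. norm (y + t *\<^sub>R v)) has_real_derivative (y \<bullet> v / norm y)) (at 0)"
proof -
  have "((\<lambda>t. norm (y + t *\<^sub>R v)) has_derivative (\<lambda>h. (h *\<^sub>R v) \<bullet> sgn (y + 0 *\<^sub>R v))) (at 0)"
  proof (rule has_derivative_compose [of "\<lambda>t. y + t *\<^sub>R v" "\<lambda>h. h *\<^sub>R v" 0 UNIV norm])
    show "((\<lambda>t. y + t *\<^sub>R v) has_derivative (\<lambda>h. h *\<^sub>R v)) (at 0)"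
      by (auto intro!: derivative_eq_intros)
    show "(norm has_derivative (\<lambda>h. h \<bullet> sgn (y + 0 *\<^sub>R v))) (at (y + 0 *\<^sub>R v))"
      using assms by (intro has_derivative_norm) auto
  qed
  then show ?thesis
    by (rule has_derivative_imp_has_field_derivative)
      (simp add: sgn_div_norm inner_commute divide_inverse mult_ac)
qed

text \<open>The hypothesis says that \<open>J\<close> is the weak derivative of \<open>I\<close>.
  Componentwise, with a primitive \<open>P\<close> of \<open>J\<close>, the difference L = I - P is
  orthogonal to every continuous \<psi> of mean zero that vanishes outside the interval; \<psi> =
  \<theta> (L - c) is such a function and yields L = c. The primitives \<tau> are described for s >
  0 only, where they are to be composed with the norm.\<close>

lemma du_Bois_Reymond:
  fixes I J :: "real \<Rightarrow> 'w::euclidean_space"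
  assumes ab: "0 < a" "a < b"
    and cont: "continuous_on {a..b} I" "continuous_on {a..b} J"
    and test: "\<And>\<psi> \<tau>. continuous_on UNIV \<psi> \<Longrightarrow> (\<And>s. s \<notin> {a<..<b} \<Longrightarrow> \<psi> s = 0)
      \<Longrightarrow> (\<And>s. s > 0 \<Longrightarrow> (\<tau> has_real_derivative \<psi> s) (at s))
      \<Longrightarrow> (\<And>s. s > 0 \<Longrightarrow> s \<notin> {a<..<b} \<Longrightarrow> \<tau> s = 0)
      \<Longrightarrow> integral {a..b} (\<lambda>s. \<psi> s *\<^sub>R I s + \<tau> s *\<^sub>R J s) = 0"
  shows "I b - I a = integral {a..b} J"
proof (rule euclidean_eqI)
  fix w :: 'w
  define P where "P s = integral {a..s} J \<bullet> w" for s
  define L where "L s = I s \<bullet> w - P s" for s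
  have Pd: "(P has_real_derivative J s \<bullet> w) (at s within {a..b})" if "s \<in> {a..b}" for s
    unfolding P_def has_real_derivative_iff_has_vector_derivative
    by (rule bounded_linear.has_vector_derivative [OF bounded_linear_inner_left])
      (rule integral_has_vector_derivative [OF cont(2) that])
  then have Pc: "continuous_on {a..b} P"
    by (meson DERIV_continuous continuous_on_eq_continuous_within)
  have Lc: "continuous_on {a..b} L"
    unfolding L_def by (intro continuous_intros cont Pc)
  \<comment> \<open>A weight that is positive inside and zero at both endpoints, so that \<psi>
    vanishes at the ends of the interval.\<close>
  define \<theta> where "\<theta> s = (s - a) * (b - s)" for s
  have \<theta>c: "continuous_on T \<theta>" for T unfolding \<theta>_def by (intro continuous_intros)
  have \<theta>0: "\<theta> s \<ge> 0" if "s \<in> {a..b}" for s using that by (simp add: \<theta>_def)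
  have \<theta>i: "integral {a..b} \<theta> \<noteq> 0"
  proof
    assume "integral {a..b} \<theta> = 0"
    then have "\<theta> ((a + b) / 2) = 0"
      using integral_eq_0_iff [OF \<theta>c ab(2) \<theta>0] ab by auto
    then show False using ab by (auto simp: \<theta>_def)
  qed
  \<comment> \<open>The \<theta>-weighted mean of \<open>L\<close>: it gives \<psi> mean zero, hence
    the primitive \<tau> vanishes from \<open>b\<close> on.\<close>
  define c where "c = integral {a..b} (\<lambda>s. \<theta> s * L s) / integral {a..b} \<theta>"
  \<comment> \<open>Clamping to [a, b] extends \<psi> continuously to the whole line; by the zeros
    of \<theta> the extension is zero outside.\<close>
  define cl where "cl s = max a (min b s)" for s
  have cl: "cl s \<in> {a..b}" for s using ab by (auto simp: cl_def)
  define \<psi> where "\<psi> s = \<theta> (cl s) * (L (cl s) - c)" for s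
  have \<psi>_eq: "\<psi> s = \<theta> s * (L s - c)" if "s \<in> {a..b}" for s
    using that by (simp add: \<psi>_def cl_def)
  have \<psi>c: "continuous_on UNIV \<psi>"
    unfolding \<psi>_def using cl
    by (intro continuous_intros continuous_on_compose2 [OF Lc] continuous_on_compose2 [OF \<theta>c [of UNIV]])
      (auto simp: cl_def intro!: continuous_intros)
  have \<psi>0: "\<psi> s = 0" if "s \<notin> {a<..<b}" for s
  proof -
    have "cl s = a \<or> cl s = b" using that ab by (auto simp: cl_def)
    then show ?thesis by (auto simp: \<psi>_def \<theta>_def)
  qed
  have int\<psi>: "integral {a..b} \<psi> = 0"
  proof -
    have "integral {a..b} \<psi> = integral {a..b} (\<lambda>s. \<theta> s * L s - c * \<theta> s)"
      by (rule integral_cong) (simp add: \<psi>_eq algebra_simps)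
    also have "\<dots> = integral {a..b} (\<lambda>s. \<theta> s * L s) - c * integral {a..b} \<theta>"
      by (subst integral_diff) (auto intro!: integrable_continuous_interval continuous_intros Lc \<theta>c)
    finally show ?thesis using \<theta>i by (simp add: c_def)
  qed
  define \<tau> where "\<tau> s = integral {0..s} \<psi>" for s
  have \<tau>d: "(\<tau> has_real_derivative \<psi> s) (at s)" if "s > 0" for s
  proof -
    have "(\<tau> has_real_derivative \<psi> s) (at s within {0..s+1})"
      unfolding \<tau>_def using that
      by (intro integral_has_real_derivative continuous_on_subset [OF \<psi>c]) auto
    then show ?thesis using that by (simp add: at_within_interior [of s "{0..s+1}"])
  qed
  have \<tau>a: "\<tau> s = 0" if "s \<le> a" for s
  proof -
    have "\<tau> s = integral {0..s} (\<lambda>_. 0)"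
      unfolding \<tau>_def using that by (intro integral_cong \<psi>0) auto
    then show ?thesis by simp
  qed
  have \<tau>b: "\<tau> s = 0" if "s \<ge> b" for s
  proof -
    have int: "\<psi> integrable_on {u..v}" for u v
      by (intro integrable_continuous_interval continuous_on_subset [OF \<psi>c]) auto
    have "\<tau> s = integral {0..a} \<psi> + integral {a..s} \<psi>"
      unfolding \<tau>_def using that ab by (intro Henstock_Kurzweil_Integration.integral_combine [symmetric] int) auto
    also have "integral {a..s} \<psi> = integral {a..b} \<psi> + integral {b..s} \<psi>"
      using that ab by (intro Henstock_Kurzweil_Integration.integral_combine [symmetric] int) auto
    also have "integral {b..s} \<psi> = integral {b..s} (\<lambda>_. 0)"
      by (intro integral_cong \<psi>0) auto
    finally show ?thesis using \<tau>a [of a] int\<psi> by (simp add: \<tau>_def)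
  qed
  have \<tau>c: "continuous_on {a..b} \<tau>"
    by (rule DERIV_continuous_on [OF has_field_derivative_at_within [OF \<tau>d]]) (use ab in auto)
  have \<psi>c': "continuous_on {a..b} \<psi>" by (rule continuous_on_subset [OF \<psi>c]) simp
  have "integral {a..b} (\<lambda>s. \<psi> s *\<^sub>R I s + \<tau> s *\<^sub>R J s) = 0"
    using \<tau>a \<tau>b by (intro test \<psi>c \<psi>0 \<tau>d) (auto simp: not_less)
  moreover have "integral {a..b} (\<lambda>s. (\<psi> s *\<^sub>R I s + \<tau> s *\<^sub>R J s) \<bullet> w) = integral {a..b} (\<lambda>s. \<psi> s *\<^sub>R I s + \<tau> s *\<^sub>R J s) \<bullet> w"
  proof -
    have "(\<lambda>s. \<psi> s *\<^sub>R I s + \<tau> s *\<^sub>R J s) integrable_on {a..b}"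
      by (intro integrable_continuous_interval continuous_intros cont \<tau>c \<psi>c')
    from integral_linear [OF this bounded_linear_inner_left [of w]] show ?thesis by (simp add: o_def)
  qed
  ultimately have 1: "integral {a..b} (\<lambda>s. (\<psi> s *\<^sub>R I s + \<tau> s *\<^sub>R J s) \<bullet> w) = 0" by simp
  \<comment> \<open>Integration by parts for \<tau> P; the boundary terms vanish with
    \<tau>.\<close>
  have 2: "integral {a..b} (\<lambda>s. \<psi> s * P s + \<tau> s * (J s \<bullet> w)) = 0"
  proof -
    have "((\<lambda>s. \<psi> s * P s + \<tau> s * (J s \<bullet> w)) has_integral (\<tau> b * P b - \<tau> a * P a)) {a..b}"
    proof (rule fundamental_theorem_of_calculus)
      fix s assume s: "s \<in> {a..b}"
      then have "(\<tau> has_real_derivative \<psi> s) (at s within {a..b})"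
        using ab by (intro has_field_derivative_at_within [OF \<tau>d]) auto
      from DERIV_mult [OF this Pd [OF s]]
      show "((\<lambda>s. \<tau> s * P s) has_vector_derivative \<psi> s * P s + \<tau> s * (J s \<bullet> w)) (at s within {a..b})"
        by (simp add: has_real_derivative_iff_has_vector_derivative mult.commute)
    qed (use ab in auto)
    then show ?thesis using \<tau>a [of a] \<tau>b [of b] by (simp add: integral_unique)
  qed
  have "integral {a..b} (\<lambda>s. \<theta> s * (L s - c)\<^sup>2) =
    integral {a..b} (\<lambda>s. ((\<psi> s *\<^sub>R I s + \<tau> s *\<^sub>R J s) \<bullet> w - (\<psi> s * P s + \<tau> s * (J s \<bullet> w))) - c * \<psi> s)"
  proof (rule integral_cong)
    fix s assume s: "s \<in> {a..b}"
    have "\<theta> s * (L s - c)\<^sup>2 = \<psi> s * (L s - c)" by (simp add: \<psi>_eq [OF s] power2_eq_square)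
    then show "\<theta> s * (L s - c)\<^sup>2 = ((\<psi> s *\<^sub>R I s + \<tau> s *\<^sub>R J s) \<bullet> w - (\<psi> s * P s + \<tau> s * (J s \<bullet> w))) - c * \<psi> s"
      by (simp add: L_def inner_add_left algebra_simps)
  qed
  also have "\<dots> = integral {a..b} (\<lambda>s. (\<psi> s *\<^sub>R I s + \<tau> s *\<^sub>R J s) \<bullet> w - (\<psi> s * P s + \<tau> s * (J s \<bullet> w))) - integral {a..b} (\<lambda>s. c * \<psi> s)"
    by (intro Henstock_Kurzweil_Integration.integral_diff integrable_continuous_interval
      continuous_intros cont \<tau>c \<psi>c' Pc)
  also have "integral {a..b} (\<lambda>s. (\<psi> s *\<^sub>R I s + \<tau> s *\<^sub>R J s) \<bullet> w - (\<psi> s * P s + \<tau> s * (J s \<bullet> w)))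
      = integral {a..b} (\<lambda>s. (\<psi> s *\<^sub>R I s + \<tau> s *\<^sub>R J s) \<bullet> w) - integral {a..b} (\<lambda>s. \<psi> s * P s + \<tau> s * (J s \<bullet> w))"
    by (intro Henstock_Kurzweil_Integration.integral_diff integrable_continuous_interval
      continuous_intros cont \<tau>c \<psi>c' Pc)
  also have "integral {a..b} (\<lambda>s. c * \<psi> s) = c * integral {a..b} \<psi>"
    by (rule integral_mult_right)
  finally have "integral {a..b} (\<lambda>s. \<theta> s * (L s - c)\<^sup>2) = 0"
    unfolding 1 2 int\<psi> by simp
  then have z: "integral {a..b} (\<lambda>s. \<theta> s * (L s - c)\<^sup>2) = 0" .
  have "\<forall>s\<in>{a..b}. \<theta> s * (L s - c)\<^sup>2 = 0"
  proof -
    have "continuous_on {a..b} (\<lambda>s. \<theta> s * (L s - c)\<^sup>2)" by (intro continuous_intros \<theta>c Lc)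
    then show ?thesis
      using integral_eq_0_iff [of a b "\<lambda>s. \<theta> s * (L s - c)\<^sup>2"] z ab \<theta>0 by simp
  qed
  then have Lin: "L s = c" if "s \<in> {a<..<b}" for s
    using that by (auto simp: \<theta>_def)
  \<comment> \<open>At the endpoints \<theta> is zero, so there L = c follows only by
    continuity.\<close>
  have cl': "closure {a<..<b} = {a..b}" using ab by simp
  have "L s = c" if "s \<in> {a..b}" for s
    by (rule continuous_constant_on_closure [of "{a<..<b}"]) (use Lc Lin that in \<open>auto simp: cl'\<close>)
  then have "L b = L a" using ab by simp
  then show "(I b - I a) \<bullet> w = integral {a..b} J \<bullet> w"
    by (simp add: L_def P_def inner_diff_left algebra_simps)
qed

text \<open>The field is multiplied by a radial cutoff \<tau>(|y|) supported in the shell, so that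
  every partial derivative of the product has integral zero. In polar coordinates the sum of these
  integrals is the hypothesis of \<open>du_Bois_Reymond\<close>, with the flux through the sphere of
  radius s as \<open>I\<close> and the spherical integral of the divergence as
  \<open>J\<close>.\<close>

theorem divergence_theorem_shell:
  fixes X D :: "'v::euclidean_space \<Rightarrow> 'v \<Rightarrow> 'w::euclidean_space"
  assumes r: "0 \<le> \<rho>\<^sub>1" "\<rho>\<^sub>1 < a" "a \<le> b" "b < \<rho>\<^sub>2"
    and U: "U = {y. \<rho>\<^sub>1 < norm y \<and> norm y < \<rho>\<^sub>2}"
    and contX: "\<And>v. v \<in> Basis \<Longrightarrow> continuous_on U (X v)"
    and contD: "\<And>v. v \<in> Basis \<Longrightarrow> continuous_on U (D v)"
    and deriv: "\<And>v y. v \<in> Basis \<Longrightarrow> y \<in> U \<Longrightarrow> ((\<lambda>t. X v (y + t *\<^sub>R v)) has_vector_derivative D v y) (at 0)"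
  shows "sphere_integral b (\<lambda>y. \<Sum>v\<in>Basis. (y \<bullet> v / norm y) *\<^sub>R X v y)
      - sphere_integral a (\<lambda>y. \<Sum>v\<in>Basis. (y \<bullet> v / norm y) *\<^sub>R X v y)
    = integral {a..b} (\<lambda>s. sphere_integral s (\<lambda>y. \<Sum>v\<in>Basis. D v y))"
proof (cases "a = b")
  case False
  define N where "N y = (\<Sum>v\<in>Basis. (y \<bullet> v / norm y) *\<^sub>R X v y)" for y
  define dv where "dv y = (\<Sum>v\<in>Basis. D v y)" for y
  have ab: "0 < a" "a < b" using r False by auto
  let ?K = "{y::'v. a \<le> norm y \<and> norm y \<le> b}"
  have KU: "?K \<subseteq> U" using r by (auto simp: U)
  have contN: "continuous_on ?K N"
    unfolding N_def using ab by (intro continuous_intros continuous_on_subset [OF contX KU]) auto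
  have contdv: "continuous_on ?K dv"
    unfolding dv_def by (intro continuous_intros continuous_on_subset [OF contD KU])
  have "sphere_integral b N - sphere_integral a N = integral {a..b} (\<lambda>s. sphere_integral s dv)"
  proof (rule du_Bois_Reymond [OF ab])
    show "continuous_on {a..b} (\<lambda>s. sphere_integral s N)" "continuous_on {a..b} (\<lambda>s. sphere_integral s dv)"
      by (intro continuous_on_sphere_integral ab contN contdv)+
  next
    fix \<psi> \<tau> :: "real \<Rightarrow> real"
    assume \<psi>c: "continuous_on UNIV \<psi>" and \<psi>0: "\<And>s. s \<notin> {a<..<b} \<Longrightarrow> \<psi> s = 0"
      and \<tau>d: "\<And>s. s > 0 \<Longrightarrow> (\<tau> has_real_derivative \<psi> s) (at s)"
      and \<tau>0': "\<And>s. s > 0 \<Longrightarrow> s \<notin> {a<..<b} \<Longrightarrow> \<tau> s = 0"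
    \<comment> \<open>\<tau> is controlled only for positive arguments, but the cutoff is composed
      with the norm, which is 0 at the origin.\<close>
    define \<xi> where "\<xi> s = (if s > 0 then \<tau> s else 0)" for s
    have \<tau>0: "\<xi> s = 0" if "s \<notin> {a<..<b}" for s using \<tau>0' that by (auto simp: \<xi>_def)
    have \<xi>d: "(\<xi> has_real_derivative \<psi> s) (at s)" if "s > 0" for s
      using \<tau>d [OF that] by (rule has_field_derivative_transform_within_open [of _ _ _ "{0<..}"])
        (use that in \<open>auto simp: \<xi>_def\<close>)
    have \<xi>c: "continuous_on {0<..} \<xi>"
      by (rule DERIV_continuous_on [OF has_field_derivative_at_within [OF \<xi>d]]) auto
    \<comment> \<open>An open set on which the cutoff vanishes. Together with \<open>U\<close> it
      covers the space, so continuity and derivatives can be checked on the two parts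
      separately.\<close>
    let ?O = "{y::'v. norm y < a} \<union> {y. b < norm y}"
    have opens: "open U" "open ?O" unfolding U
      by (auto intro!: open_Collect_conj open_Collect_less continuous_intros open_Un)
    have cover: "U \<union> ?O = UNIV" using r by (auto simp: U)
    have O: "norm y \<notin> {a<..<b}" if "y \<in> ?O" for y :: 'v using that by auto
    have glue: "continuous_on UNIV g" if "continuous_on U g" "\<And>y. norm y \<notin> {a<..<b} \<Longrightarrow> g y = 0" for g :: "'v \<Rightarrow> 'w"
    proof -
      have "continuous_on ?O g"
        using that(2) O by (subst continuous_on_cong [OF refl, of _ _ "\<lambda>_. 0"]) auto
      then show ?thesis using continuous_on_open_Un [OF opens that(1)] cover by simp
    qed
    have U0: "y \<noteq> 0" if "y \<in> U" for y using that r by (auto simp: U)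
    define \<phi> where "\<phi> v y = \<xi> (norm y) *\<^sub>R X v y" for v y
    define E where "E v y = (\<psi> (norm y) * (y \<bullet> v / norm y)) *\<^sub>R X v y + \<xi> (norm y) *\<^sub>R D v y" for v y
    have E0: "E v y = 0" if "norm y \<notin> {a<..<b}" for v y using \<psi>0 \<tau>0 that by (simp add: E_def)
    have contE: "continuous_on U (E v)" if "v \<in> Basis" for v
      unfolding E_def using U0 that
      by (intro continuous_intros contX contD continuous_on_compose2 [OF \<psi>c] continuous_on_compose2 [OF \<xi>c]) auto
    have intE: "integral\<^sup>L lborel (E v) = 0" if v: "v \<in> Basis" for v
    proof (rule integral_partial_derivative_zero [where \<phi> = "\<phi> v" and v = v and B = b])
      show "continuous_on UNIV (\<phi> v)"
        using U0 v \<tau>0 unfolding \<phi>_def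
        by (intro glue continuous_intros contX continuous_on_compose2 [OF \<xi>c]) auto
      show "continuous_on UNIV (E v)" by (rule glue [OF contE [OF v] E0])
      show "\<phi> v y = 0" "E v y = 0" if "b \<le> norm y" for y
        using that \<tau>0 E0 by (auto simp: \<phi>_def)
      show "((\<lambda>t. \<phi> v (y + t *\<^sub>R v)) has_vector_derivative E v y) (at 0)" for y
      proof (cases "y \<in> U")
        case True
        then have y0: "y \<noteq> 0" by (rule U0)
        note norm_line_derivative [OF y0, of v]
        moreover have "(\<xi> has_real_derivative \<psi> (norm y)) (at (norm (y + 0 *\<^sub>R v)))"
          using \<xi>d y0 by simp
        ultimately have "((\<lambda>t. \<xi> (norm (y + t *\<^sub>R v))) has_real_derivative \<psi> (norm y) * (y \<bullet> v / norm y)) (at 0)"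
          by (rule DERIV_chain2 [rotated])
        from has_vector_derivative_scaleR [OF this deriv [OF v True]]
        show ?thesis unfolding \<phi>_def E_def by (simp add: add.commute)
      next
        case False
        then have yO: "y \<in> ?O" using cover by blast
        have "((\<lambda>t. y + t *\<^sub>R v) \<longlongrightarrow> y + 0 *\<^sub>R v) (at 0)" by (intro tendsto_intros)
        then have "\<forall>\<^sub>F t in at 0. y + t *\<^sub>R v \<in> ?O"
          using topological_tendstoD [OF _ opens(2), of "\<lambda>t. y + t *\<^sub>R v" y "at 0"] yO by simp
        then have "\<forall>\<^sub>F t in at 0. 0 = \<phi> v (y + t *\<^sub>R v)"
          using O \<tau>0 by (auto elim!: eventually_mono simp: \<phi>_def)
        moreover have "E v y = 0" using E0 O yO by blast
        moreover have "\<phi> v (y + 0 *\<^sub>R v) = 0" using \<tau>0 O [OF yO] by (simp add: \<phi>_def)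
        ultimately show ?thesis
          unfolding has_vector_derivative_def
          by (auto intro: has_derivative_transform_eventually [where f = "\<lambda>_. 0", OF has_derivative_const])
      qed
    qed
    \<comment> \<open>Product rule: differentiating the cutoff produces the normal component,
      differentiating the field its divergence.\<close>
    have sumE: "(\<Sum>v\<in>Basis. E v y) = indicator ?K y *\<^sub>R (\<psi> (norm y) *\<^sub>R N y + \<xi> (norm y) *\<^sub>R dv y)" for y
    proof (cases "y \<in> ?K")
      case True
      then show ?thesis
        by (simp add: E_def N_def dv_def sum.distrib scaleR_sum_right)
    next
      case False
      then have "norm y \<notin> {a<..<b}" by auto
      with False show ?thesis by (simp add: E0)
    qed
    have intgr: "integrable lborel (E v)" if v: "v \<in> Basis" for v
    proof -
      have "integrable lborel (\<lambda>y. indicator (cball 0 b) y *\<^sub>R E v y)"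
        by (intro borel_integrable_compact continuous_on_subset [OF glue [OF contE [OF v] E0]]) auto
      also have "(\<lambda>y. indicator (cball 0 b) y *\<^sub>R E v y) = E v"
        using E0 by (fastforce simp: indicator_def)
      finally show ?thesis .
    qed
    have "0 = (\<integral>y. (\<Sum>v\<in>Basis. E v y) \<partial>lborel)"
      by (simp add: integral_sum intgr intE)
    also have "\<dots> = (LINT y:?K|lborel. \<psi> (norm y) *\<^sub>R N y + \<xi> (norm y) *\<^sub>R dv y)"
      unfolding set_lebesgue_integral_def sumE ..
    also have "\<dots> = integral {a..b} (\<lambda>s. sphere_integral s (\<lambda>y. \<psi> (norm y) *\<^sub>R N y + \<xi> (norm y) *\<^sub>R dv y))"
      using ab by (intro integral_shell_polar continuous_intros contN contdv
        continuous_on_compose2 [OF \<psi>c] continuous_on_compose2 [OF \<xi>c]) auto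
    also have "\<dots> = integral {a..b} (\<lambda>s. \<psi> s *\<^sub>R sphere_integral s N + \<tau> s *\<^sub>R sphere_integral s dv)"
    proof (rule integral_cong)
      fix s assume s: "s \<in> {a..b}"
      then have cs: "continuous_on (sphere 0 s) N" "continuous_on (sphere 0 s) dv"
        by (auto intro: continuous_on_subset [OF contN] continuous_on_subset [OF contdv])
      have "sphere_integral s (\<lambda>y. \<psi> (norm y) *\<^sub>R N y + \<xi> (norm y) *\<^sub>R dv y)
          = sphere_integral s (\<lambda>y. \<psi> s *\<^sub>R N y + \<tau> s *\<^sub>R dv y)"
        using s ab by (intro sphere_integral_cong) (auto simp: \<xi>_def)
      also have "\<dots> = sphere_integral s (\<lambda>y. \<psi> s *\<^sub>R N y) + sphere_integral s (\<lambda>y. \<tau> s *\<^sub>R dv y)"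
        using s ab cs by (intro sphere_integral_add continuous_intros) auto
      also have "\<dots> = \<psi> s *\<^sub>R sphere_integral s N + \<tau> s *\<^sub>R sphere_integral s dv"
        using s ab cs by (simp add: sphere_integral_linear [OF bounded_linear_scaleR_right])
      finally show "sphere_integral s (\<lambda>y. \<psi> (norm y) *\<^sub>R N y + \<xi> (norm y) *\<^sub>R dv y)
        = \<psi> s *\<^sub>R sphere_integral s N + \<tau> s *\<^sub>R sphere_integral s dv" .
    qed
    finally show "integral {a..b} (\<lambda>s. \<psi> s *\<^sub>R sphere_integral s N + \<tau> s *\<^sub>R sphere_integral s dv) = 0" by simp
  qed
  then show ?thesis unfolding N_def [abs_def] dv_def [abs_def] .
qed simp

section \<open>The Cauchy kernel on a slice\<close>

text \<open>The norm is not submultiplicative; estimates of products take their constant from this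
  boundedness, which in finite dimension follows from bilinearity.\<close>

lemma bounded_bilinear_clifford:
  "bounded_bilinear ((*) :: 'g::{finite,linorder} clifford \<Rightarrow> _ \<Rightarrow> _)"
  unfolding bilinear_conv_bounded_bilinear [symmetric] bilinear_def
  by (auto intro!: linearI simp: algebra_simps)

section \<open>Commutation relations and paravectors on a slice\<close>

lemma generator_square [simp]: "generator g * generator g = (- 1 :: 'g::{finite,linorder} clifford)"
proof -
  have "(2::real) *\<^sub>R (generator g * generator g) = generator g * generator g + generator g * generator g"
    by (simp add: scaleR_2)
  also have "\<dots> = - 2" using generator_anticommute [of g g] by simp
  also have "\<dots> = (2::real) *\<^sub>R (- 1 :: 'g clifford)" by (simp add: scaleR_conv_of_real)
  finally show ?thesis using scaleR_cancel_left [of 2 "generator g * generator g" "- 1"] by (simp del: scaleR_minus_right)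
qed

lemma generator_mult_commute: "g \<noteq> h \<Longrightarrow> generator h * generator g = - (generator g * generator h)"
  using generator_anticommute [of g h] by (simp add: eq_neg_iff_add_eq_0 add.commute)

text \<open>The conjugate of a basis vector. It arises because moving an imaginary unit past
  \<open>e_vec i\<close> changes the sign unless \<open>e_vec i\<close> is 1.\<close>

definition e_conj :: "'i::{finite,linorder} \<Rightarrow> ('i, 'j::{finite,linorder}) cl" where
  "e_conj i = (if i = idx0 then 1 else - e_vec i)"

lemma Abs_gen_Inl_neq_Inr:
  "(i::'i::{finite,linorder}) \<noteq> idx0 \<Longrightarrow> Abs_gen (Inl i) \<noteq> (Abs_gen (Inr j) :: ('i, 'j::{finite,linorder}) gen)"
  by (subst Abs_gen_inject) auto

lemma Abs_gen_Inl_inject: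
  "(i::'i::{finite,linorder}) \<noteq> idx0 \<Longrightarrow> i' \<noteq> idx0 \<Longrightarrow>
    Abs_gen (Inl i) = (Abs_gen (Inl i') :: ('i, 'j::{finite,linorder}) gen) \<longleftrightarrow> i = i'"
  by (subst Abs_gen_inject) auto

lemma Abs_gen_Inr_inject:
  "Abs_gen (Inr j) = (Abs_gen (Inr j') :: ('i::{finite,linorder}, 'j::{finite,linorder}) gen) \<longleftrightarrow> j = j'"
  by (subst Abs_gen_inject) auto

lemma e_im_e_vec: "e_im j * e_vec i = e_conj i * (e_im j :: ('i::{finite,linorder}, 'j::{finite,linorder}) cl)"
  using generator_mult_commute [OF Abs_gen_Inl_neq_Inr, of i j]
  by (simp add: e_im_def e_vec_def e_conj_def)

lemma im_vec_e_vec: "im_vec \<omega> * e_vec i = e_conj i * (im_vec \<omega> :: ('i::{finite,linorder}, 'j::{finite,linorder}) cl)"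
  by (simp add: im_vec_def sum_distrib_left sum_distrib_right e_im_e_vec)

lemma im_vec_e_conj: "im_vec \<omega> * e_conj i = e_vec i * (im_vec \<omega> :: ('i::{finite,linorder}, 'j::{finite,linorder}) cl)"
  using im_vec_e_vec [of \<omega> i] by (auto simp: e_conj_def e_vec_def split: if_splits)

lemma im_vec_add: "im_vec (u + v) = im_vec u + im_vec v"
  by (simp add: im_vec_def scaleR_left_distrib sum.distrib)

lemma im_vec_scaleR: "im_vec (r *\<^sub>R v) = r *\<^sub>R im_vec v"
  by (simp add: im_vec_def scaleR_sum_right)

lemma scaleR_sum_mult:
  fixes x y :: "_ \<Rightarrow> 'w::real_algebra"
  shows "(\<Sum>i\<in>I. a i *\<^sub>R x i) * (\<Sum>j\<in>J. b j *\<^sub>R y j) = (\<Sum>i\<in>I. \<Sum>j\<in>J. (a i * b j) *\<^sub>R (x i * y j))"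
  by (simp add: sum_product mult.commute)

lemma symmetric_sum_eq:
  fixes F :: "'k::finite \<Rightarrow> 'k \<Rightarrow> 'w::real_vector"
  assumes diag: "\<And>i. F i i = D i" and off: "\<And>i j. i \<noteq> j \<Longrightarrow> F i j + F j i = 0"
  shows "(\<Sum>i\<in>UNIV. \<Sum>j\<in>UNIV. F i j) = (\<Sum>i\<in>UNIV. D i)"
proof -
  let ?S = "\<Sum>i\<in>UNIV. \<Sum>j\<in>UNIV. F i j"
  have "?S + ?S = (\<Sum>i\<in>UNIV. \<Sum>j\<in>UNIV. F i j) + (\<Sum>i\<in>UNIV. \<Sum>j\<in>UNIV. F j i)"
    using sum.swap [of F UNIV UNIV] by simp
  also have "\<dots> = (\<Sum>i\<in>UNIV. \<Sum>j\<in>UNIV. F i j + F j i)" by (simp add: sum.distrib)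
  also have "\<dots> = (\<Sum>i\<in>UNIV. \<Sum>j\<in>UNIV. if i = j then D i + D i else 0)"
    by (intro sum.cong refl) (auto simp: diag off)
  also have "\<dots> = (\<Sum>i\<in>UNIV. D i) + (\<Sum>i\<in>UNIV. D i)" by (simp add: sum.distrib)
  finally have "2 *\<^sub>R ?S = 2 *\<^sub>R (\<Sum>i\<in>UNIV. D i)" unfolding scaleR_2 .
  then show ?thesis by simp
qed

lemma im_vec_square:
  "im_vec \<omega> * im_vec \<omega> = - ((norm \<omega>)\<^sup>2 *\<^sub>R (1 :: ('i::{finite,linorder}, 'j::{finite,linorder}) cl))"
proof -
  have "im_vec \<omega> * im_vec \<omega> = (\<Sum>i\<in>UNIV. \<Sum>j\<in>UNIV. (\<omega> $ i * \<omega> $ j) *\<^sub>R (e_im i * e_im j :: ('i, 'j) cl))"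
    unfolding im_vec_def by (rule scaleR_sum_mult)
  also have "\<dots> = (\<Sum>i\<in>UNIV. - ((\<omega> $ i)\<^sup>2 *\<^sub>R 1))"
  proof (rule symmetric_sum_eq)
    show "(\<omega> $ i * \<omega> $ i) *\<^sub>R (e_im i * e_im i :: ('i, 'j) cl) = - ((\<omega> $ i)\<^sup>2 *\<^sub>R 1)" for i
      by (simp add: e_im_def power2_eq_square)
    show "(\<omega> $ i * \<omega> $ j) *\<^sub>R (e_im i * e_im j :: ('i, 'j) cl) + (\<omega> $ j * \<omega> $ i) *\<^sub>R (e_im j * e_im i) = 0" if "i \<noteq> j" for i j
      using generator_anticommute [of "Abs_gen (Inr i) :: ('i, 'j) gen" "Abs_gen (Inr j)"] that
      by (simp add: e_im_def Abs_gen_Inr_inject mult.commute flip: scaleR_add_right)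
  qed
  also have "\<dots> = - ((\<Sum>i\<in>UNIV. (\<omega> $ i)\<^sup>2) *\<^sub>R 1)" by (simp add: sum_negf scaleR_left.sum)
  also have "(\<Sum>i\<in>UNIV. (\<omega> $ i)\<^sup>2) = (norm \<omega>)\<^sup>2"
    by (simp add: norm_vec_def L2_set_def sum_nonneg)
  finally show ?thesis .
qed

lemma im_vec_unit_square:
  "\<omega> \<in> sphere 0 1 \<Longrightarrow> im_vec \<omega> * im_vec \<omega> = (- 1 :: ('i::{finite,linorder}, 'j::{finite,linorder}) cl)"
  by (simp add: im_vec_square)

definition slice_para :: "real ^ 'j::{finite,linorder} \<Rightarrow> 'i::{finite,linorder} slice \<Rightarrow> ('i, 'j) cl" where
  "slice_para \<eta> y = paravector (slice_point \<eta> y)"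

definition slice_conj :: "real ^ 'j::{finite,linorder} \<Rightarrow> 'i::{finite,linorder} slice \<Rightarrow> ('i, 'j) cl" where
  "slice_conj \<eta> y = conj_paravector (slice_point \<eta> y)"

lemma slice_para_eq: "slice_para \<eta> y = (\<Sum>i\<in>UNIV. (fst y $ i) *\<^sub>R e_vec i) + snd y *\<^sub>R im_vec \<eta>"
  by (simp add: slice_para_def paravector_def slice_point_def im_vec_scaleR)

lemma slice_conj_eq:
  fixes y :: "'i::{finite,linorder} slice" and \<eta> :: "real ^ 'j::{finite,linorder}"
  shows "slice_conj \<eta> y = (\<Sum>i\<in>UNIV. (fst y $ i) *\<^sub>R e_conj i) - snd y *\<^sub>R im_vec \<eta>"
proof -
  have "(\<Sum>i\<in>UNIV. (fst y $ i) *\<^sub>R e_conj i :: ('i, 'j) cl)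
    = (fst y $ idx0) *\<^sub>R 1 + (\<Sum>i\<in>UNIV - {idx0}. (fst y $ i) *\<^sub>R e_conj i)"
    by (subst sum.remove [of _ idx0]) (auto simp: e_conj_def)
  also have "(\<Sum>i\<in>UNIV - {idx0}. (fst y $ i) *\<^sub>R (e_conj i :: ('i, 'j) cl)) = - (\<Sum>i\<in>UNIV - {idx0}. (fst y $ i) *\<^sub>R e_vec i)"
    unfolding sum_negf [symmetric] by (intro sum.cong) (auto simp: e_conj_def)
  finally show ?thesis
    by (simp add: slice_conj_def conj_paravector_def slice_point_def im_vec_scaleR)
qed

lemma linear_slice_para: "linear (slice_para \<eta>)"
  by (intro linearI) (auto simp: slice_para_eq algebra_simps sum.distrib scaleR_sum_right)

lemma linear_slice_conj: "linear (slice_conj \<eta>)"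
  by (intro linearI) (auto simp: slice_conj_eq algebra_simps sum.distrib scaleR_sum_right)

lemma e_vec_e_conj_sum:
  fixes u :: "real ^ 'i::{finite,linorder}"
  shows "(\<Sum>i\<in>UNIV. (u $ i) *\<^sub>R e_conj i) * (\<Sum>i\<in>UNIV. (u $ i) *\<^sub>R e_vec i) = (norm u)\<^sup>2 *\<^sub>R (1 :: ('i, 'j::{finite,linorder}) cl)"
    and "(\<Sum>i\<in>UNIV. (u $ i) *\<^sub>R e_vec i) * (\<Sum>i\<in>UNIV. (u $ i) *\<^sub>R e_conj i) = (norm u)\<^sup>2 *\<^sub>R (1 :: ('i, 'j) cl)"
proof -
  have n: "(\<Sum>i\<in>UNIV. (u $ i)\<^sup>2 *\<^sub>R (1 :: ('i, 'j) cl)) = (norm u)\<^sup>2 *\<^sub>R 1"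
    unfolding scaleR_left.sum [symmetric] by (simp add: norm_vec_def L2_set_def sum_nonneg)
  have ac: "e_vec i * e_vec j + e_vec j * e_vec i = (0 :: ('i, 'j) cl)" if "i \<noteq> j" "i \<noteq> idx0" "j \<noteq> idx0" for i j :: 'i
    using generator_anticommute [of "Abs_gen (Inl i) :: ('i, 'j) gen" "Abs_gen (Inl j)"] that
    by (simp add: e_vec_def Abs_gen_Inl_inject)
  have c1: "e_conj i * e_vec i = (1 :: ('i, 'j) cl)" "e_vec i * e_conj i = (1 :: ('i, 'j) cl)" for i
    by (auto simp: e_conj_def e_vec_def)
  have c2: "e_conj i * e_vec j + e_conj j * e_vec i = (0 :: ('i, 'j) cl)" if "i \<noteq> j" for i j
    using ac [OF that] that by (auto simp: e_conj_def e_vec_def neg_eq_iff_add_eq_0 eq_neg_iff_add_eq_0 add.commute)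
  have c3: "e_vec i * e_conj j + e_vec j * e_conj i = (0 :: ('i, 'j) cl)" if "i \<noteq> j" for i j
    using ac [OF that] that by (auto simp: e_conj_def e_vec_def neg_eq_iff_add_eq_0 eq_neg_iff_add_eq_0 add.commute)
  have "(\<Sum>i\<in>UNIV. (u $ i) *\<^sub>R e_conj i) * (\<Sum>i\<in>UNIV. (u $ i) *\<^sub>R e_vec i)
      = (\<Sum>i\<in>UNIV. \<Sum>j\<in>UNIV. (u $ i * u $ j) *\<^sub>R (e_conj i * e_vec j :: ('i, 'j) cl))"
    by (rule scaleR_sum_mult)
  also have "\<dots> = (\<Sum>i\<in>UNIV. (u $ i)\<^sup>2 *\<^sub>R 1)"
    by (rule symmetric_sum_eq) (use c1 c2 in \<open>auto simp: power2_eq_square mult.commute simp flip: scaleR_add_right\<close>)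
  finally show "(\<Sum>i\<in>UNIV. (u $ i) *\<^sub>R e_conj i) * (\<Sum>i\<in>UNIV. (u $ i) *\<^sub>R e_vec i) = (norm u)\<^sup>2 *\<^sub>R (1 :: ('i, 'j) cl)"
    unfolding n .
  have "(\<Sum>i\<in>UNIV. (u $ i) *\<^sub>R e_vec i) * (\<Sum>i\<in>UNIV. (u $ i) *\<^sub>R e_conj i)
      = (\<Sum>i\<in>UNIV. \<Sum>j\<in>UNIV. (u $ i * u $ j) *\<^sub>R (e_vec i * e_conj j :: ('i, 'j) cl))"
    by (rule scaleR_sum_mult)
  also have "\<dots> = (\<Sum>i\<in>UNIV. (u $ i)\<^sup>2 *\<^sub>R 1)"
    by (rule symmetric_sum_eq) (use c1 c3 in \<open>auto simp: power2_eq_square mult.commute simp flip: scaleR_add_right\<close>)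
  finally show "(\<Sum>i\<in>UNIV. (u $ i) *\<^sub>R e_vec i) * (\<Sum>i\<in>UNIV. (u $ i) *\<^sub>R e_conj i) = (norm u)\<^sup>2 *\<^sub>R (1 :: ('i, 'j) cl)"
    unfolding n .
qed

lemma im_vec_sum_e_vec:
  "im_vec \<omega> * (\<Sum>i\<in>UNIV. c i *\<^sub>R e_vec i) = (\<Sum>i\<in>UNIV. c i *\<^sub>R e_conj i) * (im_vec \<omega> :: ('i::{finite,linorder}, 'j::{finite,linorder}) cl)"
  "im_vec \<omega> * (\<Sum>i\<in>UNIV. c i *\<^sub>R e_conj i) = (\<Sum>i\<in>UNIV. c i *\<^sub>R e_vec i) * (im_vec \<omega> :: ('i, 'j) cl)"
  by (simp_all add: sum_distrib_left sum_distrib_right im_vec_e_vec im_vec_e_conj)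

text \<open>The mixed terms cancel, since \<open>im_vec\<close> conjugates a real combination of the
  \<open>e_vec i\<close> when it passes it; what remains is |u|^2 + r^2, because
  \<open>im_vec \<eta>\<close> has square -1.\<close>

lemma slice_conj_mult_para:
  assumes "\<eta> \<in> sphere 0 1"
  shows "slice_conj \<eta> y * slice_para \<eta> y = (norm y)\<^sup>2 *\<^sub>R (1 :: ('i::{finite,linorder}, 'j::{finite,linorder}) cl)"
    and "slice_para \<eta> y * slice_conj \<eta> y = (norm y)\<^sup>2 *\<^sub>R (1 :: ('i::{finite,linorder}, 'j::{finite,linorder}) cl)"
proof -
  have n: "(norm y)\<^sup>2 = (norm (fst y))\<^sup>2 + (snd y)\<^sup>2"
    by (simp add: norm_prod_def)
  show "slice_conj \<eta> y * slice_para \<eta> y = (norm y)\<^sup>2 *\<^sub>R (1 :: ('i, 'j) cl)"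
    unfolding n slice_conj_eq slice_para_eq
    by (simp add: ring_distribs im_vec_sum_e_vec e_vec_e_conj_sum im_vec_unit_square [OF assms] power2_eq_square scaleR_add_left algebra_simps)
  show "slice_para \<eta> y * slice_conj \<eta> y = (norm y)\<^sup>2 *\<^sub>R (1 :: ('i, 'j) cl)"
    unfolding n slice_conj_eq slice_para_eq
    by (simp add: ring_distribs im_vec_sum_e_vec e_vec_e_conj_sum im_vec_unit_square [OF assms] power2_eq_square scaleR_add_left algebra_simps)
qed

lemma Basis_slice: "(Basis :: 'i::finite slice set) = (\<lambda>i. (axis i 1, 0)) ` UNIV \<union> {(0, 1)}"
  by (auto simp: Basis_prod_def Basis_vec_def)

lemma sum_Basis_slice:
  fixes g :: "'i::finite slice \<Rightarrow> 'w::comm_monoid_add"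
  shows "(\<Sum>v\<in>Basis. g v) = (\<Sum>i\<in>UNIV. g (axis i 1, 0)) + g (0, 1)"
proof -
  have "inj (\<lambda>i::'i. (axis i 1, 0) :: 'i slice)" by (auto simp: inj_def axis_eq_axis)
  then have "(\<Sum>v\<in>range (\<lambda>i::'i. (axis i 1, 0) :: 'i slice). g v) = (\<Sum>i\<in>UNIV. g (axis i 1, 0))"
    by (simp add: sum.reindex)
  then show ?thesis
    unfolding Basis_slice by (subst sum.union_disjoint) auto
qed

lemma slice_para_axis [simp]:
  "slice_para \<eta> (axis i 1, 0) = e_vec i" "slice_para \<eta> (0, 1) = im_vec \<eta>"
  by (auto simp: slice_para_eq axis_def if_distrib [of "\<lambda>c. c *\<^sub>R _"] cong: if_cong)

lemma slice_conj_axis [simp]: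
  "slice_conj \<eta> (axis i 1, 0) = e_conj i" "slice_conj \<eta> (0, 1) = - im_vec \<eta>"
  by (auto simp: slice_conj_eq axis_def if_distrib [of "\<lambda>c. c *\<^sub>R _"] cong: if_cong)

text \<open>Brings the operator into the shape of a divergence, a sum over an orthonormal basis, to
  which \<open>divergence_theorem_shell\<close> and the Leibniz rule apply.\<close>

lemma slice_dirac_eq: "slice_dirac \<eta> g y = (\<Sum>v\<in>Basis. slice_para \<eta> v * directional_deriv v g y)"
  by (simp add: slice_dirac_def sum_Basis_slice)

lemma norm_slice_point: "\<eta> \<in> sphere 0 1 \<Longrightarrow> norm (slice_point \<eta> y) = norm y"
  by (simp add: slice_point_def norm_prod_def)

interpretation clifford_mult: bounded_bilinear "(*) :: 'g::{finite,linorder} clifford \<Rightarrow> 'g clifford \<Rightarrow> 'g clifford"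
  by (rule bounded_bilinear_clifford)

lemma slice_para_scaleR: "slice_para \<eta> (r *\<^sub>R y) = r *\<^sub>R slice_para \<eta> y"
  by (rule linear_scale [OF linear_slice_para])

lemma slice_conj_scaleR: "slice_conj \<eta> (r *\<^sub>R y) = r *\<^sub>R slice_conj \<eta> y"
  by (rule linear_scale [OF linear_slice_conj])

lemma slice_conj_add: "slice_conj \<eta> (x + y) = slice_conj \<eta> x + slice_conj \<eta> y"
  by (rule linear_add [OF linear_slice_conj])

lemma continuous_on_slice_para [continuous_intros]:
  "continuous_on S f \<Longrightarrow> continuous_on S (\<lambda>x. slice_para \<eta> (f x))"
  by (rule bounded_linear.continuous_on [OF linear_slice_para [unfolded linear_conv_bounded_linear]])

lemma continuous_on_slice_conj [continuous_intros]:
  "continuous_on S f \<Longrightarrow> continuous_on S (\<lambda>x. slice_conj \<eta> (f x))"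
  by (rule bounded_linear.continuous_on [OF linear_slice_conj [unfolded linear_conv_bounded_linear]])

lemma continuous_on_clifford_mult [continuous_intros]:
  fixes f g :: "_ \<Rightarrow> 'g::{finite,linorder} clifford"
  shows "continuous_on S f \<Longrightarrow> continuous_on S g \<Longrightarrow> continuous_on S (\<lambda>x. f x * g x)"
  by (rule clifford_mult.continuous_on)

section \<open>Functions with continuous partial derivatives\<close>

lemma has_vector_derivative_line_shift:
  fixes z v :: "'v::real_normed_vector"
  assumes "((\<lambda>t. g (z + s *\<^sub>R v + t *\<^sub>R v)) has_vector_derivative D) (at 0)"
  shows "((\<lambda>t. g (z + t *\<^sub>R v)) has_vector_derivative D) (at s)"
proof -
  have "((\<lambda>t. t - s) has_vector_derivative 1) (at s)"
    by (auto intro!: derivative_eq_intros)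
  moreover have "z + s *\<^sub>R v + (t - s) *\<^sub>R v = z + t *\<^sub>R v" for t
    by (simp add: scaleR_left_diff_distrib)
  ultimately show ?thesis
    using assms vector_diff_chain_at [of "\<lambda>t. t - s" 1 s "\<lambda>t. g (z + s *\<^sub>R v + t *\<^sub>R v)" D]
    by (simp add: o_def add.assoc)
qed

lemma continuous_partials_on_has_vector_derivative:
  assumes "continuous_partials_on U g" "v \<in> Basis" "x \<in> U"
  shows "((\<lambda>t. g (x + t *\<^sub>R v)) has_vector_derivative directional_deriv v g x) (at 0)"
  using assms unfolding continuous_partials_on_def directional_deriv_def
  by (simp add: vector_derivative_works)

lemma directional_deriv_eqI:
  "((\<lambda>t. g (x + t *\<^sub>R v)) has_vector_derivative D) (at 0) \<Longrightarrow> directional_deriv v g x = D"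
  unfolding directional_deriv_def by (rule vector_derivative_at)

lemma continuous_partials_onI:
  assumes "\<And>v x. v \<in> Basis \<Longrightarrow> x \<in> U \<Longrightarrow> ((\<lambda>t. g (x + t *\<^sub>R v)) has_vector_derivative D v x) (at 0)"
    and "\<And>v. v \<in> Basis \<Longrightarrow> continuous_on U (D v)"
  shows "continuous_partials_on U g"
  unfolding continuous_partials_on_def
proof (intro ballI conjI)
  fix v :: 'a assume v: "v \<in> Basis"
  then show "(\<lambda>t. g (x + t *\<^sub>R v)) differentiable at 0" if "x \<in> U" for x
    using assms(1) [OF v that] by (auto intro: differentiableI_vector)
  have "directional_deriv v g x = D v x" if "x \<in> U" for x
    using assms(1) [OF v that] by (rule directional_deriv_eqI)
  then show "continuous_on U (directional_deriv v g)"
    using assms(2) [OF v] by (simp cong: continuous_on_cong)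
qed

text \<open>Monogenicity provides derivatives along the coordinate axes only, so continuity is not
  automatic. Near \<open>x\<close> the partial derivatives are bounded, and changing one coordinate
  after the other changes \<open>g\<close> by at most a multiple of the coordinate
  differences.\<close>

lemma continuous_partials_on_imp_continuous_on:
  fixes g :: "'v::euclidean_space \<Rightarrow> 'w::real_normed_vector"
  assumes "open U" "continuous_partials_on U g"
  shows "continuous_on U g"
proof -
  have "isCont g x" if x: "x \<in> U" for x
  proof -
    obtain e where e: "e > 0" "cball x e \<subseteq> U"
      using assms(1) x by (meson open_contains_cball)
    have "\<exists>M\<ge>0. \<forall>y\<in>cball x e. norm (directional_deriv v g y) \<le> M" if "v \<in> Basis" for v
    proof -
      have "continuous_on (cball x e) (directional_deriv v g)"
        using assms(2) that e unfolding continuous_partials_on_def by (blast intro: continuous_on_subset)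
      from continuous_on_compact_bound [OF compact_cball this] show ?thesis by metis
    qed
    then obtain M where M: "\<And>v. v \<in> Basis \<Longrightarrow> M v \<ge> 0 \<and> (\<forall>y\<in>cball x e. norm (directional_deriv v g y) \<le> M v)"
      by metis
    define N where "N = (\<Sum>v\<in>Basis. M v)"
    have N: "M v \<le> N" if "v \<in> Basis" for v
      unfolding N_def using M that by (intro member_le_sum) auto
    have N0: "N \<ge> 0" unfolding N_def using M by (intro sum_nonneg) auto
    have est: "norm (g y - g x) \<le> N * (\<Sum>v\<in>Basis. \<bar>(y - x) \<bullet> v\<bar>)" if y: "y \<in> cball x e" for y
    proof -
      \<comment> \<open>Corners of a path from \<open>x\<close> to \<open>y\<close> parallel to the
        axes. By Pythagoras |p B - x| \<le> |y - x|, so the corners stay in the ball, and by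
        convexity so do the edges.\<close>
      define p where "p B = x + (\<Sum>v\<in>B. ((y - x) \<bullet> v) *\<^sub>R v)" for B
      have p: "p B \<in> cball x e" if B: "B \<subseteq> Basis" for B
      proof -
        have fin: "finite B" using B finite_Basis finite_subset by blast
        have "(norm (\<Sum>v\<in>B. ((y - x) \<bullet> v) *\<^sub>R v))\<^sup>2 = (\<Sum>v\<in>B. ((y - x) \<bullet> v)\<^sup>2)"
        proof -
          have "(norm (\<Sum>v\<in>B. ((y - x) \<bullet> v) *\<^sub>R v))\<^sup>2 = (\<Sum>v\<in>B. (norm (((y - x) \<bullet> v) *\<^sub>R v))\<^sup>2)"
            using B fin by (intro norm_sum_Pythagorean)
              (auto simp: pairwise_def orthogonal_def inner_Basis subset_iff)
          also have "\<dots> = (\<Sum>v\<in>B. ((y - x) \<bullet> v)\<^sup>2)"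
            using B by (intro sum.cong) (auto simp: power_mult_distrib norm_Basis)
          finally show ?thesis .
        qed
        also have "\<dots> \<le> (\<Sum>v\<in>Basis. ((y - x) \<bullet> v)\<^sup>2)"
          using B by (intro sum_mono2) auto
        also have "\<dots> = (norm (y - x))\<^sup>2"
          by (subst power2_norm_eq_inner, subst euclidean_inner) (simp add: power2_eq_square)
        finally have "norm (\<Sum>v\<in>B. ((y - x) \<bullet> v) *\<^sub>R v) \<le> norm (y - x)"
          by (rule power2_le_imp_le) simp
        then show ?thesis using y by (simp add: p_def dist_norm norm_minus_commute)
      qed
      have "norm (g (p B) - g x) \<le> N * (\<Sum>v\<in>B. \<bar>(y - x) \<bullet> v\<bar>)" if "B \<subseteq> Basis" for B
        using finite_subset [OF that finite_Basis] that
      proof (induction B rule: finite_induct)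
        case empty
        then show ?case by (simp add: p_def)
      next
        case (insert v B)
        define t where "t = (y - x) \<bullet> v"
        have v: "v \<in> Basis" using insert by auto
        have pv: "p (insert v B) = p B + t *\<^sub>R v"
          using insert by (simp add: p_def t_def)
        have seg: "p B + s *\<^sub>R v \<in> cball x e" if s: "s \<in> closed_segment 0 t" for s
        proof -
          obtain u where u: "0 \<le> u" "u \<le> 1" "s = u * t" using s by (auto simp: closed_segment_def)
          have "p B + s *\<^sub>R v = (1 - u) *\<^sub>R p B + u *\<^sub>R p (insert v B)"
            by (simp add: pv u algebra_simps)
          then show ?thesis
            using convexD_alt [OF convex_cball p p, of B "insert v B" u] insert.prems u by auto
        qed
        have "norm (g (p B + t *\<^sub>R v) - g (p B + 0 *\<^sub>R v)) \<le> N * norm (t - 0)"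
        proof (rule differentiable_bound [of "closed_segment 0 t" "\<lambda>s. g (p B + s *\<^sub>R v)"
              "\<lambda>s h. h *\<^sub>R directional_deriv v g (p B + s *\<^sub>R v)"])
          fix s assume s: "s \<in> closed_segment 0 t"
          have "((\<lambda>s. g (p B + s *\<^sub>R v)) has_vector_derivative directional_deriv v g (p B + s *\<^sub>R v)) (at s)"
          proof (rule has_vector_derivative_line_shift)
            have "p B + s *\<^sub>R v \<in> U" using seg [OF s] e by blast
            then show "((\<lambda>t. g (p B + s *\<^sub>R v + t *\<^sub>R v)) has_vector_derivative directional_deriv v g (p B + s *\<^sub>R v)) (at 0)"
              by (rule continuous_partials_on_has_vector_derivative [OF assms(2) v])
          qed
          then show "((\<lambda>s. g (p B + s *\<^sub>R v)) has_derivative (\<lambda>h. h *\<^sub>R directional_deriv v g (p B + s *\<^sub>R v)))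
              (at s within closed_segment 0 t)"
            unfolding has_vector_derivative_def by (rule has_derivative_at_withinI)
          have "norm (directional_deriv v g (p B + s *\<^sub>R v)) \<le> N"
            using M [OF v] seg [OF s] N [OF v] by force
          then show "onorm (\<lambda>h. h *\<^sub>R directional_deriv v g (p B + s *\<^sub>R v)) \<le> N"
            by (intro onorm_le) (auto simp: mult.commute [of N] intro!: mult_left_mono)
        qed auto
        then have "norm (g (p (insert v B)) - g (p B)) \<le> N * \<bar>t\<bar>"
          by (simp add: pv)
        moreover have "norm (g (p B) - g x) \<le> N * (\<Sum>v\<in>B. \<bar>(y - x) \<bullet> v\<bar>)"
          using insert by simp
        ultimately have "norm (g (p (insert v B)) - g x) \<le> N * \<bar>t\<bar> + N * (\<Sum>v\<in>B. \<bar>(y - x) \<bullet> v\<bar>)"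
          using norm_triangle_ineq [of "g (p (insert v B)) - g (p B)" "g (p B) - g x"] by simp
        then show ?case using insert by (simp add: t_def distrib_left)
      qed
      from this [of Basis] show ?thesis by (simp add: p_def euclidean_representation)
    qed
    have "((\<lambda>y. N * (\<Sum>v\<in>Basis. \<bar>(y - x) \<bullet> v\<bar>)) \<longlongrightarrow> N * (\<Sum>v\<in>Basis. \<bar>(x - x) \<bullet> v\<bar>)) (at x)"
      by (intro tendsto_intros)
    then have lim: "((\<lambda>y. N * (\<Sum>v\<in>Basis. \<bar>(y - x) \<bullet> v\<bar>)) \<longlongrightarrow> 0) (at x)" by simp
    have "\<forall>\<^sub>F y in at x. y \<in> cball x e"
      using e eventually_at_in_open' [of "ball x e" x] by (auto elim!: eventually_mono)
    then have "((\<lambda>y. g y - g x) \<longlongrightarrow> 0) (at x)"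
      using est by (intro Lim_null_comparison [OF _ lim]) (auto elim!: eventually_mono)
    then show ?thesis by (simp add: isCont_def LIM_zero_iff)
  qed
  then show ?thesis by (simp add: continuous_at_imp_continuous_on)
qed

definition slice_monogenic ::
  "(real, 'j::{finite,linorder}) vec \<Rightarrow> 'i::{finite,linorder} slice set \<Rightarrow> ('i slice \<Rightarrow> ('i, 'j) cl) \<Rightarrow> bool" where
  "slice_monogenic \<eta> U g \<longleftrightarrow> open U \<and> continuous_partials_on U g \<and> (\<forall>y\<in>U. slice_dirac \<eta> g y = 0)"

lemma slice_monogenic_continuous_on: "slice_monogenic \<eta> U g \<Longrightarrow> continuous_on U g"
  unfolding slice_monogenic_def using continuous_partials_on_imp_continuous_on by blast

section \<open>The Cauchy kernel and its regularisation\<close>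

definition slice_kernel :: "real ^ 'j::{finite,linorder} \<Rightarrow> 'i::{finite,linorder} slice \<Rightarrow> ('i, 'j) cl" where
  "slice_kernel \<eta> z = (1 / sphere_area TYPE('i)) *\<^sub>R ((1 / norm z ^ (CARD('i) + 1)) *\<^sub>R slice_conj \<eta> z)"

lemma cauchy_kernel_slice_point:
  "\<eta> \<in> sphere 0 1 \<Longrightarrow> cauchy_kernel (slice_point \<eta> z) = slice_kernel \<eta> z"
  unfolding cauchy_kernel_def slice_kernel_def by (simp add: norm_slice_point slice_conj_def)

lemma sphere_area_pos: "sphere_area TYPE('i::finite) > 0"
  unfolding sphere_area_def by (intro divide_pos_pos mult_pos_pos zero_less_power Gamma_real_pos) auto

text \<open>\<open>|z|\<^sup>2\<close> is replaced by \<open>|z|\<^sup>2 + \<epsilon>\<^sup>2\<close> in the denominator of the Cauchy kernel; the Dirac operator,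
  acting from the right, maps the result to an approximate identity.\<close>

definition mollified_kernel :: "real \<Rightarrow> real ^ 'j::{finite,linorder} \<Rightarrow> 'i::{finite,linorder} slice \<Rightarrow> ('i, 'j) cl" where
  "mollified_kernel \<epsilon> \<eta> z = (1 / sphere_area TYPE('i)) *\<^sub>R
     (((norm z)\<^sup>2 + \<epsilon>\<^sup>2) powr (- real (CARD('i) + 1) / 2) *\<^sub>R slice_conj \<eta> z)"

text \<open>With n = p + 2 this is \<epsilon>^(-n) times a fixed function of z/\<epsilon>; the
  factor n / \<open>sphere_area\<close> makes its integral 1.\<close>

definition approx_delta :: "real \<Rightarrow> 'i::finite slice \<Rightarrow> real" where
  "approx_delta \<epsilon> z = real (CARD('i) + 1) * \<epsilon>\<^sup>2 / sphere_area TYPE('i) *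
     ((norm z)\<^sup>2 + \<epsilon>\<^sup>2) powr (- real (CARD('i) + 1) / 2 - 1)"

definition mollified_deriv :: "real \<Rightarrow> real ^ 'j::{finite,linorder} \<Rightarrow> 'i slice \<Rightarrow> 'i::{finite,linorder} slice \<Rightarrow> ('i, 'j) cl" where
  "mollified_deriv \<epsilon> \<eta> v z = (1 / sphere_area TYPE('i)) *\<^sub>R
     (((norm z)\<^sup>2 + \<epsilon>\<^sup>2) powr (- real (CARD('i) + 1) / 2) *\<^sub>R slice_conj \<eta> v
      + ((- real (CARD('i) + 1) / 2) * ((norm z)\<^sup>2 + \<epsilon>\<^sup>2) powr (- real (CARD('i) + 1) / 2 - 1) * (2 * (z \<bullet> v))) *\<^sub>R slice_conj \<eta> z)"

lemma mollified_kernel_deriv: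
  fixes z v :: "'i::{finite,linorder} slice" and \<eta> :: "real ^ 'j::{finite,linorder}"
  assumes "\<epsilon> > 0"
  shows "((\<lambda>t. mollified_kernel \<epsilon> \<eta> (z + t *\<^sub>R v)) has_vector_derivative mollified_deriv \<epsilon> \<eta> v z) (at 0)"
proof -
  let ?a = "- real (CARD('i) + 1) / 2"
  have pos: "(norm z)\<^sup>2 + \<epsilon>\<^sup>2 > 0" using assms by (simp add: add_nonneg_pos)
  have "((\<lambda>t. (z + t *\<^sub>R v) \<bullet> (z + t *\<^sub>R v) + \<epsilon>\<^sup>2) has_real_derivative 2 * (z \<bullet> v)) (at 0)"
    by (auto simp: inner_simps inner_commute intro!: derivative_eq_intros)
  then have "((\<lambda>t. (norm (z + t *\<^sub>R v))\<^sup>2 + \<epsilon>\<^sup>2) has_real_derivative 2 * (z \<bullet> v)) (at 0)"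
    by (simp add: power2_norm_eq_inner)
  from DERIV_chain2 [OF has_real_derivative_powr this, of ?a]
  have 1: "((\<lambda>t. ((norm (z + t *\<^sub>R v))\<^sup>2 + \<epsilon>\<^sup>2) powr ?a) has_real_derivative
      ?a * ((norm z)\<^sup>2 + \<epsilon>\<^sup>2) powr (?a - 1) * (2 * (z \<bullet> v))) (at 0)"
    using pos by simp
  have eq: "slice_conj \<eta> (z + t *\<^sub>R v) = slice_conj \<eta> z + t *\<^sub>R slice_conj \<eta> v" for t
    by (simp add: slice_conj_add slice_conj_scaleR)
  have 2: "((\<lambda>t. slice_conj \<eta> (z + t *\<^sub>R v)) has_vector_derivative slice_conj \<eta> v) (at 0)"
    unfolding eq by (auto intro!: derivative_eq_intros)
  have "((\<lambda>t. ((norm (z + t *\<^sub>R v))\<^sup>2 + \<epsilon>\<^sup>2) powr ?a *\<^sub>R slice_conj \<eta> (z + t *\<^sub>R v)) has_vector_derivative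
      ((norm (z + 0 *\<^sub>R v))\<^sup>2 + \<epsilon>\<^sup>2) powr ?a *\<^sub>R slice_conj \<eta> v +
      (?a * ((norm z)\<^sup>2 + \<epsilon>\<^sup>2) powr (?a - 1) * (2 * (z \<bullet> v))) *\<^sub>R slice_conj \<eta> (z + 0 *\<^sub>R v)) (at 0)"
    by (rule has_vector_derivative_scaleR [OF 1 2])
  from bounded_linear.has_vector_derivative [OF bounded_linear_scaleR_right [of "1 / sphere_area TYPE('i)"] this]
  show ?thesis unfolding mollified_kernel_def mollified_deriv_def by simp
qed

text \<open>With N = |z|^2 + \<epsilon>^2 the two terms of the derivative contribute n N^(-n/2) and
  -n N^(-n/2-1) |z|^2, up to the sphere area. For \<epsilon> = 0 they would cancel off the pole; now
  n \<epsilon>^2 N^(-n/2-1) is left.\<close>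

lemma mollified_deriv_sum:
  fixes z :: "'i::{finite,linorder} slice" and \<eta> :: "real ^ 'j::{finite,linorder}"
  assumes "\<epsilon> > 0" "\<eta> \<in> sphere 0 1"
  shows "(\<Sum>v\<in>Basis. mollified_deriv \<epsilon> \<eta> v z * slice_para \<eta> v) = approx_delta \<epsilon> z *\<^sub>R 1"
proof -
  define n where "n = real (CARD('i) + 1)"
  define s where "s = sphere_area TYPE('i)"
  define N where "N = (norm z)\<^sup>2 + \<epsilon>\<^sup>2"
  have N: "N > 0" using assms by (simp add: N_def add_nonneg_pos)
  have z: "(\<Sum>v\<in>Basis. (z \<bullet> v) *\<^sub>R (slice_conj \<eta> z * slice_para \<eta> v)) = (norm z)\<^sup>2 *\<^sub>R 1"
  proof -
    have "(\<Sum>v\<in>Basis. (z \<bullet> v) *\<^sub>R (slice_conj \<eta> z * slice_para \<eta> v)) =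
        slice_conj \<eta> z * slice_para \<eta> (\<Sum>v\<in>Basis. (z \<bullet> v) *\<^sub>R v)"
      by (simp add: linear_sum [OF linear_slice_para] slice_para_scaleR sum_distrib_left)
    then show ?thesis by (simp add: euclidean_representation slice_conj_mult_para [OF assms(2)])
  qed
  have n: "(\<Sum>v\<in>Basis. slice_conj \<eta> v * slice_para \<eta> v) = n *\<^sub>R (1 :: ('i, 'j) cl)"
  proof -
    have "(\<Sum>v\<in>Basis. slice_conj \<eta> v * slice_para \<eta> v) = (\<Sum>v\<in>(Basis :: 'i slice set). (1 :: ('i, 'j) cl))"
      by (intro sum.cong) (simp_all add: slice_conj_mult_para [OF assms(2)])
    also have "\<dots> = real DIM('i slice) *\<^sub>R 1" by (simp add: scaleR_conv_of_real)
    finally show ?thesis by (simp add: n_def)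
  qed
  have "(\<Sum>v\<in>Basis. mollified_deriv \<epsilon> \<eta> v z * slice_para \<eta> v)
    = (1 / s) *\<^sub>R (N powr (- n / 2) *\<^sub>R (\<Sum>v\<in>Basis. slice_conj \<eta> v * slice_para \<eta> v)
      + (- n * N powr (- n / 2 - 1)) *\<^sub>R (\<Sum>v\<in>Basis. (z \<bullet> v) *\<^sub>R (slice_conj \<eta> z * slice_para \<eta> v)))"
    unfolding mollified_deriv_def n_def [symmetric] s_def [symmetric] N_def [symmetric]
    by (simp add: scaleR_sum_right algebra_simps sum.distrib sum_subtractf sum_negf)
  also have "\<dots> = ((1 / s) * (N powr (- n / 2) * n - n * N powr (- n / 2 - 1) * (norm z)\<^sup>2)) *\<^sub>R 1"
    unfolding z n by (simp add: algebra_simps)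
  also have "N powr (- n / 2) = N powr (- n / 2 - 1) * N"
    using N by (simp add: powr_diff)
  also have "(1 / s) * (N powr (- n / 2 - 1) * N * n - n * N powr (- n / 2 - 1) * (norm z)\<^sup>2) = approx_delta \<epsilon> z"
    unfolding approx_delta_def n_def [symmetric] s_def [symmetric] N_def [symmetric]
    by (simp add: N_def algebra_simps)
  finally show ?thesis .
qed

lemma approx_delta_nonneg: "approx_delta \<epsilon> z \<ge> 0"
  unfolding approx_delta_def using sphere_area_pos [where 'i = 'a] by simp

lemma continuous_on_approx_delta:
  assumes "\<epsilon> > 0"
  shows "continuous_on S (approx_delta \<epsilon>)"
proof -
  have "(norm z)\<^sup>2 + \<epsilon>\<^sup>2 \<noteq> 0" for z :: "'a slice"
    using assms by (metis add_nonneg_pos less_irrefl zero_le_power2 zero_less_power)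
  then show ?thesis
    unfolding approx_delta_def by (intro continuous_intros) auto
qed

lemma nn_integral_approx_delta:
  "(\<integral>\<^sup>+z. ennreal (approx_delta 1 z) \<partial>(lborel :: 'i::finite slice measure)) = 1"
proof -
  define m where "m = CARD('i)"
  define n where "n = real (m + 1)"
  define s where "s = sphere_area TYPE('i)"
  have s: "s > 0" unfolding s_def by (rule sphere_area_pos)
  have m: "m > 0" by (simp add: m_def)
  have dim: "DIM('i slice) - 1 = m" by (simp add: m_def)
  let ?f = "\<lambda>r::real. n * r ^ m * (r\<^sup>2 + 1) powr (- n / 2 - 1)"
  have [measurable]: "(approx_delta 1 :: 'i slice \<Rightarrow> real) \<in> borel_measurable borel"
    by (intro borel_measurable_continuous_onI continuous_on_approx_delta) simp
  have "(\<integral>\<^sup>+z. ennreal (approx_delta 1 z) \<partial>(lborel :: 'i slice measure)) =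
    (\<integral>\<^sup>+r. ennreal (r ^ m) * indicator {0<..} r * (\<integral>\<^sup>+y. ennreal (approx_delta 1 (r *\<^sub>R y)) \<partial>(sphere_surface 1 :: 'i slice measure)) \<partial>lborel)"
    unfolding dim [symmetric] by (rule nn_integral_polar) measurable
  also have "\<dots> = (\<integral>\<^sup>+r. ennreal (?f r) * indicator {0..} r \<partial>lborel)"
  proof (rule nn_integral_cong)
    fix r :: real
    have "AE y in (sphere_surface 1 :: 'i slice measure). y \<in> sphere 0 1"
      by (rule AE_sphere_surface) simp
    then have "(\<integral>\<^sup>+y. ennreal (approx_delta 1 (r *\<^sub>R y)) \<partial>(sphere_surface 1 :: 'i slice measure))
      = (\<integral>\<^sup>+y. ennreal (n / s * (r\<^sup>2 + 1) powr (- n / 2 - 1)) \<partial>(sphere_surface 1 :: 'i slice measure))"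
      by (intro nn_integral_cong_AE)
        (auto elim!: eventually_mono simp: approx_delta_def n_def s_def m_def power_mult_distrib)
    also have "\<dots> = ennreal (n / s * (r\<^sup>2 + 1) powr (- n / 2 - 1)) * ennreal s"
      using emeasure_sphere_surface_total [of 1, where 'i = 'i] by (simp add: s_def)
    also have "\<dots> = ennreal (n / s * (r\<^sup>2 + 1) powr (- n / 2 - 1) * s)"
      using s by (intro ennreal_mult [symmetric]) (auto simp: n_def)
    also have "n / s * (r\<^sup>2 + 1) powr (- n / 2 - 1) * s = n * (r\<^sup>2 + 1) powr (- n / 2 - 1)"
      using s by simp
    finally have I: "(\<integral>\<^sup>+y. ennreal (approx_delta 1 (r *\<^sub>R y)) \<partial>(sphere_surface 1 :: 'i slice measure))
      = ennreal (n * (r\<^sup>2 + 1) powr (- n / 2 - 1))" .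
    show "ennreal (r ^ m) * indicator {0<..} r * (\<integral>\<^sup>+y. ennreal (approx_delta 1 (r *\<^sub>R y)) \<partial>(sphere_surface 1 :: 'i slice measure)) = ennreal (?f r) * indicator {0..} r"
    proof (cases "r > 0")
      case True
      have "ennreal (r ^ m) * ennreal (n * (r\<^sup>2 + 1) powr (- n / 2 - 1)) = ennreal (?f r)"
        using True by (subst ennreal_mult [symmetric]) (auto simp: n_def mult_ac)
      then show ?thesis using True by (simp add: I)
    qed (use m in \<open>auto simp: indicator_def zero_power\<close>)
  qed
  \<comment> \<open>The antiderivative r^n (r^2 + 1)^(-n/2) with n = m + 1 tends to 1 from its value
    0 at the origin. The sphere area has already cancelled against the mass of the unit
    sphere.\<close>
  also have "\<dots> = ennreal (1 - 0 ^ (m + 1) * (0\<^sup>2 + 1) powr (- n / 2))"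
  proof (rule nn_integral_FTC_atLeast)
    fix r :: real assume "0 \<le> r"
    have pos: "r\<^sup>2 + 1 > 0" by (rule add_nonneg_pos) simp_all
    have "((\<lambda>r. (r\<^sup>2 + 1) powr (- n / 2)) has_real_derivative - n / 2 * (r\<^sup>2 + 1) powr (- n / 2 - 1) * (2 * r)) (at r)"
      by (rule DERIV_chain2 [OF has_real_derivative_powr]) (use pos in \<open>auto intro!: derivative_eq_intros\<close>)
    from DERIV_mult [OF DERIV_pow [of "m + 1" r] this]
    have "((\<lambda>r. r ^ (m + 1) * (r\<^sup>2 + 1) powr (- n / 2)) has_real_derivative
       n * r ^ m * (r\<^sup>2 + 1) powr (- n / 2) + - n / 2 * (r\<^sup>2 + 1) powr (- n / 2 - 1) * (2 * r) * r ^ (m + 1)) (at r)"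
      by (simp add: n_def mult_ac)
    also have "(r\<^sup>2 + 1) powr (- n / 2) = (r\<^sup>2 + 1) powr (- n / 2 - 1) * (r\<^sup>2 + 1)"
      using pos by (simp add: powr_diff)
    also have "n * r ^ m * ((r\<^sup>2 + 1) powr (- n / 2 - 1) * (r\<^sup>2 + 1)) + - n / 2 * (r\<^sup>2 + 1) powr (- n / 2 - 1) * (2 * r) * r ^ (m + 1)
       = ?f r"
      by (simp add: algebra_simps power2_eq_square)
    finally show "((\<lambda>r. r ^ (m + 1) * (r\<^sup>2 + 1) powr (- n / 2)) has_real_derivative ?f r) (at r)" .
  next
    have "filterlim (\<lambda>r::real. 1 + r\<^sup>2) at_top at_top"
      by (intro filterlim_tendsto_add_at_top [OF tendsto_const] filterlim_pow_at_top filterlim_ident) simp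
    then have "filterlim (\<lambda>r::real. r\<^sup>2 + 1) at_top at_top" by (simp add: add.commute)
    then have "((\<lambda>r::real. inverse (r\<^sup>2 + 1)) \<longlongrightarrow> 0) at_top" by (rule tendsto_inverse_0_at_top)
    then have "((\<lambda>r::real. (1 - inverse (r\<^sup>2 + 1)) powr (n / 2)) \<longlongrightarrow> (1 - 0) powr (n / 2)) at_top"
      by (intro tendsto_intros) auto
    then have "((\<lambda>r::real. (1 - inverse (r\<^sup>2 + 1)) powr (n / 2)) \<longlongrightarrow> 1) at_top" by simp
    moreover have "\<forall>\<^sub>F r::real in at_top. (1 - inverse (r\<^sup>2 + 1)) powr (n / 2) = r ^ (m + 1) * (r\<^sup>2 + 1) powr (- n / 2)"
      using eventually_gt_at_top [of 0]
    proof eventually_elim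
      case (elim r)
      have pos: "r\<^sup>2 + 1 > 0" by (rule add_nonneg_pos) simp_all
      have "1 - inverse (r\<^sup>2 + 1) = r\<^sup>2 / (r\<^sup>2 + 1)" using pos by (simp add: field_simps)
      also have "\<dots> powr (n / 2) = (r\<^sup>2) powr (n / 2) * (r\<^sup>2 + 1) powr (- n / 2)"
        using pos elim by (simp add: powr_divide powr_minus_divide)
      also have "(r\<^sup>2) powr (n / 2) = r powr n"
        using elim by (simp add: powr_powr flip: powr_numeral)
      also have "\<dots> = r ^ (m + 1)" using elim unfolding n_def by (rule powr_realpow)
      finally show ?case .
    qed
    ultimately show "((\<lambda>r::real. r ^ (m + 1) * (r\<^sup>2 + 1) powr (- n / 2)) \<longlongrightarrow> 1) at_top"
      by (rule Lim_transform_eventually)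
  qed (auto simp: n_def)
  finally show ?thesis by simp
qed

lemma approx_delta_rescale:
  fixes z :: "'i::finite slice"
  assumes "\<epsilon> > 0"
  shows "\<epsilon> ^ DIM('i slice) * approx_delta \<epsilon> (\<epsilon> *\<^sub>R z) = approx_delta 1 z"
proof -
  define k where "k = CARD('i) + 1"
  have "(norm (\<epsilon> *\<^sub>R z))\<^sup>2 + \<epsilon>\<^sup>2 = \<epsilon>\<^sup>2 * ((norm z)\<^sup>2 + 1\<^sup>2)"
    by (simp add: power_mult_distrib algebra_simps)
  then have "((norm (\<epsilon> *\<^sub>R z))\<^sup>2 + \<epsilon>\<^sup>2) powr (- real k / 2 - 1) =
      (\<epsilon>\<^sup>2) powr (- real k / 2 - 1) * ((norm z)\<^sup>2 + 1\<^sup>2) powr (- real k / 2 - 1)"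
    using assms by (simp add: powr_mult)
  also have "(\<epsilon>\<^sup>2) powr (- real k / 2 - 1) = inverse (\<epsilon> ^ (k + 2))"
  proof -
    have "(\<epsilon>\<^sup>2) powr (- real k / 2 - 1) = (\<epsilon> powr 2) powr (- real k / 2 - 1)" using assms by simp
    also have "\<dots> = \<epsilon> powr (- real (k + 2))" by (simp add: powr_powr algebra_simps)
    also have "\<dots> = inverse (\<epsilon> powr real (k + 2))" by (rule powr_minus)
    also have "\<dots> = inverse (\<epsilon> ^ (k + 2))" using assms by (simp only: powr_realpow)
    finally show ?thesis .
  qed
  finally have X: "((norm (\<epsilon> *\<^sub>R z))\<^sup>2 + \<epsilon>\<^sup>2) powr (- real k / 2 - 1) =
      inverse (\<epsilon> ^ (k + 2)) * ((norm z)\<^sup>2 + 1\<^sup>2) powr (- real k / 2 - 1)" .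
  have "\<epsilon> ^ k * \<epsilon>\<^sup>2 * inverse (\<epsilon> ^ (k + 2)) = 1"
    unfolding power_add [symmetric] by (rule right_inverse) (use assms in auto)
  moreover have "\<epsilon> ^ k * (real k * \<epsilon>\<^sup>2 / s * (inverse (\<epsilon> ^ (k + 2)) * Y))
      = (\<epsilon> ^ k * \<epsilon>\<^sup>2 * inverse (\<epsilon> ^ (k + 2))) * (real k / s * Y)" for s Y
    by (simp only: divide_inverse mult_ac)
  ultimately have "\<epsilon> ^ k * (real k * \<epsilon>\<^sup>2 / s * (inverse (\<epsilon> ^ (k + 2)) * Y)) = real k * 1\<^sup>2 / s * Y" for s Y
    by simp
  then show ?thesis
    unfolding approx_delta_def k_def [symmetric] X by (simp add: k_def)
qed

text \<open>After y = c + \<epsilon> z the parameter sits in \<open>H\<close> alone, and dominated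
  convergence against the fixed density \<open>approx_delta 1\<close> asks for continuity of
  \<open>H\<close> only at \<open>c\<close>. So \<open>H\<close> may be a function cut off sharply
  at spheres.\<close>

lemma approx_delta_tendsto:
  fixes H :: "'i::finite slice \<Rightarrow> 'w::euclidean_space"
  assumes [measurable]: "H \<in> borel_measurable borel"
    and bound: "\<And>y. norm (H y) \<le> M" and cont: "isCont H c"
  shows "(\<lambda>k. \<integral>y. approx_delta (1 / real (Suc k)) (y - c) *\<^sub>R H y \<partial>lborel) \<longlonglongrightarrow> H c"
proof -
  have [measurable]: "approx_delta \<epsilon> \<in> borel_measurable (borel :: 'i slice measure)" if "\<epsilon> > 0" for \<epsilon>
    by (intro borel_measurable_continuous_onI continuous_on_approx_delta that)
  have m1 [measurable]: "approx_delta 1 \<in> borel_measurable (borel :: 'i slice measure)"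
    by (intro borel_measurable_continuous_onI continuous_on_approx_delta) simp
  have "AE z in lborel. 0 \<le> approx_delta 1 (z :: 'i slice)"
    by (rule AE_I2) (rule approx_delta_nonneg)
  then have int: "integrable lborel (approx_delta 1 :: 'i slice \<Rightarrow> real)"
    and one: "integral\<^sup>L lborel (approx_delta 1 :: 'i slice \<Rightarrow> real) = 1"
    using nn_integral_eq_integrable [of "approx_delta 1 :: 'i slice \<Rightarrow> real" lborel 1]
      nn_integral_approx_delta [where 'i = 'i] by simp_all
  have eq: "(\<integral>y. approx_delta \<epsilon> (y - c) *\<^sub>R H y \<partial>lborel) = (\<integral>z. approx_delta 1 z *\<^sub>R H (c + \<epsilon> *\<^sub>R z) \<partial>lborel)"
    if e: "\<epsilon> > 0" for \<epsilon>
  proof -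
    have [measurable]: "(\<lambda>y. approx_delta \<epsilon> (y - c)) \<in> borel_measurable (borel :: 'i slice measure)"
      by (rule borel_measurable_continuous_onI, rule continuous_on_compose2 [OF continuous_on_approx_delta [OF e, of UNIV]])
        (auto intro!: continuous_intros)
    have "(\<integral>y. approx_delta \<epsilon> (y - c) *\<^sub>R H y \<partial>lborel) =
      (\<integral>y. approx_delta \<epsilon> (y - c) *\<^sub>R H y \<partial>(density (distr lborel borel (\<lambda>z. c + \<epsilon> *\<^sub>R z)) (\<lambda>_. ennreal (\<epsilon> ^ DIM('i slice)))))"
      using e by (subst lborel_affine [of \<epsilon> c]) auto
    also have "\<dots> = (\<integral>y. \<epsilon> ^ DIM('i slice) *\<^sub>R (approx_delta \<epsilon> (y - c) *\<^sub>R H y) \<partial>distr lborel borel (\<lambda>z. c + \<epsilon> *\<^sub>R z))"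
      using e by (intro integral_density) auto
    also have "\<dots> = (\<integral>z. \<epsilon> ^ DIM('i slice) *\<^sub>R (approx_delta \<epsilon> ((c + \<epsilon> *\<^sub>R z) - c) *\<^sub>R H (c + \<epsilon> *\<^sub>R z)) \<partial>lborel)"
      by (rule integral_distr) measurable
    also have "\<dots> = (\<integral>z. approx_delta 1 z *\<^sub>R H (c + \<epsilon> *\<^sub>R z) \<partial>lborel)"
      using e by (intro Bochner_Integration.integral_cong) (simp_all add: approx_delta_rescale del: DIM_prod)
    finally show ?thesis .
  qed
  have "(\<lambda>k. \<integral>z. approx_delta 1 z *\<^sub>R H (c + (1 / real (Suc k)) *\<^sub>R z) \<partial>lborel) \<longlonglongrightarrow> (\<integral>z. approx_delta 1 z *\<^sub>R H c \<partial>(lborel :: 'i slice measure))"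
  proof (rule integral_dominated_convergence)
    show "integrable lborel (\<lambda>z :: 'i slice. approx_delta 1 z * M)" using int by simp
    show "(\<lambda>z. approx_delta 1 z *\<^sub>R H (c + (1 / real (Suc k)) *\<^sub>R z)) \<in> borel_measurable lborel" for k
      by measurable
    show "AE z in lborel. (\<lambda>k. approx_delta 1 z *\<^sub>R H (c + (1 / real (Suc k)) *\<^sub>R z)) \<longlonglongrightarrow> approx_delta 1 z *\<^sub>R H c"
    proof (intro AE_I2 tendsto_intros isCont_tendsto_compose [OF cont])
      fix z :: "'i slice"
      have "(\<lambda>k. c + (1 / real (Suc k)) *\<^sub>R z) \<longlonglongrightarrow> c + 0 *\<^sub>R z"
        using LIMSEQ_Suc [OF lim_1_over_n] by (intro tendsto_intros) auto
      then show "(\<lambda>k. c + (1 / real (Suc k)) *\<^sub>R z) \<longlonglongrightarrow> c" by simp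
    qed
    show "AE z in lborel. norm (approx_delta 1 z *\<^sub>R H (c + (1 / real (Suc k)) *\<^sub>R z)) \<le> approx_delta 1 z * M" for k
    proof (rule AE_I2)
      fix z :: "'i slice"
      show "norm (approx_delta 1 z *\<^sub>R H (c + (1 / real (Suc k)) *\<^sub>R z)) \<le> approx_delta 1 z * M"
        unfolding norm_scaleR using bound [of "c + (1 / real (Suc k)) *\<^sub>R z"] approx_delta_nonneg [of 1 z]
        by (simp only: abs_of_nonneg mult_left_mono)
    qed
  qed measurable
  also have "(\<integral>z. approx_delta 1 z *\<^sub>R H c \<partial>(lborel :: 'i slice measure)) = H c"
    using integral_scaleR_left [OF int, of "H c"] one by simp
  finally show ?thesis by (simp only: eq [OF divide_pos_pos] of_nat_0_less_iff zero_less_Suc zero_less_one)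
qed

section \<open>Stokes' theorem and the Borel-Pompeiu formula\<close>

lemma sphere_integral_tendsto:
  fixes F :: "nat \<Rightarrow> 'v::euclidean_space \<Rightarrow> 'w::euclidean_space"
  assumes "\<rho> > 0" "\<And>k. continuous_on (sphere 0 \<rho>) (F k)" "continuous_on (sphere 0 \<rho>) G"
    and "\<And>y. norm y = \<rho> \<Longrightarrow> (\<lambda>k. F k y) \<longlonglongrightarrow> G y"
    and "\<And>k y. norm y = \<rho> \<Longrightarrow> norm (F k y) \<le> B"
  shows "(\<lambda>k. sphere_integral \<rho> (F k)) \<longlonglongrightarrow> sphere_integral \<rho> G"
  unfolding sphere_integral_def set_lebesgue_integral_def
proof (rule integral_dominated_convergence)
  interpret finite_measure "sphere_surface \<rho> :: 'v measure"
    using assms by (intro finite_measure_sphere_surface)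
  show "integrable (sphere_surface \<rho> :: 'v measure) (\<lambda>y. \<bar>B\<bar>)" by simp
  show "AE y in sphere_surface \<rho>. (\<lambda>k. indicator (sphere 0 \<rho>) y *\<^sub>R F k y) \<longlonglongrightarrow> indicator (sphere 0 \<rho>) y *\<^sub>R G y"
    using assms(4) by (intro AE_I2) (auto simp: indicator_def)
  show "AE y in sphere_surface \<rho>. norm (indicator (sphere 0 \<rho>) y *\<^sub>R F k y) \<le> \<bar>B\<bar>" for k
  proof (rule AE_I2)
    fix y :: 'v
    show "norm (indicator (sphere 0 \<rho>) y *\<^sub>R F k y) \<le> \<bar>B\<bar>"
      using assms(5) [of y k] by (cases "norm y = \<rho>") auto
  qed
qed (intro borel_measurable_integrable integrable_sphere assms)+

text \<open>The middle factor is the exterior unit normal y/\<rho>; its place between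
  \<open>g\<close> and \<open>h\<close> matters, as the algebra is not commutative.\<close>

definition boundary_integral ::
  "real ^ 'j::{finite,linorder} \<Rightarrow> real \<Rightarrow> ('i slice \<Rightarrow> ('i, 'j) cl) \<Rightarrow> ('i::{finite,linorder} slice \<Rightarrow> ('i, 'j) cl) \<Rightarrow> ('i, 'j) cl" where
  "boundary_integral \<eta> \<rho> g h = sphere_integral \<rho> (\<lambda>y. g y * slice_para \<eta> ((1 / \<rho>) *\<^sub>R y) * h y)"

lemma continuous_on_mollified_kernel:
  assumes "\<epsilon> > 0"
  shows "continuous_on S (\<lambda>y. mollified_kernel \<epsilon> \<eta> (y - c))"
proof -
  have "(norm z)\<^sup>2 + \<epsilon>\<^sup>2 \<noteq> 0" for z :: "'a slice"
    using assms by (metis add_nonneg_pos less_irrefl zero_le_power2 zero_less_power)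
  then show ?thesis
    unfolding mollified_kernel_def by (intro continuous_intros) auto
qed

lemma continuous_on_mollified_deriv:
  assumes "\<epsilon> > 0"
  shows "continuous_on S (\<lambda>y. mollified_deriv \<epsilon> \<eta> v (y - c))"
proof -
  have "(norm z)\<^sup>2 + \<epsilon>\<^sup>2 \<noteq> 0" for z :: "'a slice"
    using assms by (metis add_nonneg_pos less_irrefl zero_le_power2 zero_less_power)
  then show ?thesis
    unfolding mollified_deriv_def by (intro continuous_intros) auto
qed

text \<open>The component of the field in direction \<open>v\<close> is g v h, with \<open>v\<close>
  read as a Clifford element between the factors. Its divergence is (g D) h + g (D h), where D acts
  on g from the right: the second term vanishes and the first is the approximate identity times
  \<open>h\<close>. The point \<open>c\<close> is arbitrary, as the regularised kernel is smooth at
  its pole.\<close>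

lemma stokes_mollified:
  fixes h :: "'i::{finite,linorder} slice \<Rightarrow> ('i, 'j::{finite,linorder}) cl"
  assumes \<eta>: "\<eta> \<in> sphere 0 1" and e: "\<epsilon> > 0"
    and r: "0 \<le> \<rho>\<^sub>1" "\<rho>\<^sub>1 < a" "a \<le> b" "b < \<rho>\<^sub>2"
    and mono: "slice_monogenic \<eta> {y. \<rho>\<^sub>1 < norm y \<and> norm y < \<rho>\<^sub>2} h"
  shows "boundary_integral \<eta> b (\<lambda>y. mollified_kernel \<epsilon> \<eta> (y - c)) h
       - boundary_integral \<eta> a (\<lambda>y. mollified_kernel \<epsilon> \<eta> (y - c)) h
    = (LINT y:{y. a \<le> norm y \<and> norm y \<le> b}|lborel. approx_delta \<epsilon> (y - c) *\<^sub>R h y)"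
proof -
  define U where "U = {y::'i slice. \<rho>\<^sub>1 < norm y \<and> norm y < \<rho>\<^sub>2}"
  have mono: "slice_monogenic \<eta> U h" using mono by (simp add: U_def)
  then have hc: "continuous_on U h" by (rule slice_monogenic_continuous_on)
  have hp: "continuous_partials_on U h" and hD: "\<And>y. y \<in> U \<Longrightarrow> slice_dirac \<eta> h y = 0"
    using mono by (auto simp: slice_monogenic_def)
  let ?g = "\<lambda>y. mollified_kernel \<epsilon> \<eta> (y - c)"
  define X where "X v y = ?g y * (slice_para \<eta> v * h y)" for v y
  define D where "D v y = ?g y * (slice_para \<eta> v * directional_deriv v h y) +
      mollified_deriv \<epsilon> \<eta> v (y - c) * (slice_para \<eta> v * h y)" for v y
  have main: "sphere_integral b (\<lambda>y. \<Sum>v\<in>Basis. (y \<bullet> v / norm y) *\<^sub>R X v y)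
      - sphere_integral a (\<lambda>y. \<Sum>v\<in>Basis. (y \<bullet> v / norm y) *\<^sub>R X v y)
    = integral {a..b} (\<lambda>s. sphere_integral s (\<lambda>y. \<Sum>v\<in>Basis. D v y))"
  proof (rule divergence_theorem_shell [OF r U_def])
    fix v :: "'i slice" assume v: "v \<in> Basis"
    show "continuous_on U (X v)"
      unfolding X_def by (intro continuous_intros continuous_on_mollified_kernel e hc)
    have "continuous_on U (directional_deriv v h)"
      using hp v by (simp add: continuous_partials_on_def)
    then show "continuous_on U (D v)"
      unfolding D_def by (intro continuous_intros continuous_on_mollified_kernel continuous_on_mollified_deriv e hc)
    fix y assume y: "y \<in> U"
    have 1: "((\<lambda>t. ?g (y + t *\<^sub>R v)) has_vector_derivative mollified_deriv \<epsilon> \<eta> v (y - c)) (at 0)"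
      using mollified_kernel_deriv [OF e, of \<eta> "y - c" v] by (simp add: algebra_simps)
    have 2: "((\<lambda>t. slice_para \<eta> v * h (y + t *\<^sub>R v)) has_vector_derivative slice_para \<eta> v * directional_deriv v h y) (at 0)"
      by (rule bounded_linear.has_vector_derivative [OF clifford_mult.bounded_linear_right
        continuous_partials_on_has_vector_derivative [OF hp v y]])
    show "((\<lambda>t. X v (y + t *\<^sub>R v)) has_vector_derivative D v y) (at 0)"
      using clifford_mult.has_vector_derivative [OF 1 2] by (simp add: X_def D_def)
  qed
  have N: "(\<Sum>v\<in>Basis. (y \<bullet> v / norm y) *\<^sub>R X v y) = ?g y * slice_para \<eta> ((1 / norm y) *\<^sub>R y) * h y" for y
  proof -
    have "(1 / norm y) *\<^sub>R y = (\<Sum>v\<in>Basis. (y \<bullet> v / norm y) *\<^sub>R v)"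
      by (subst (2) euclidean_representation [symmetric, of y]) (simp add: scaleR_sum_right)
    then have "slice_para \<eta> ((1 / norm y) *\<^sub>R y) = (\<Sum>v\<in>Basis. (y \<bullet> v / norm y) *\<^sub>R slice_para \<eta> v)"
      by (simp only: linear_sum [OF linear_slice_para] slice_para_scaleR)
    then show ?thesis
      by (simp add: X_def sum_distrib_left sum_distrib_right mult.assoc)
  qed
  have S: "(\<Sum>v\<in>Basis. D v y) = approx_delta \<epsilon> (y - c) *\<^sub>R h y" if y: "y \<in> U" for y
  proof -
    have "(\<Sum>v\<in>Basis. D v y) = ?g y * slice_dirac \<eta> h y +
        (\<Sum>v\<in>Basis. mollified_deriv \<epsilon> \<eta> v (y - c) * slice_para \<eta> v) * h y"
      by (simp add: D_def slice_dirac_eq sum.distrib sum_distrib_left sum_distrib_right mult.assoc)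
    then show ?thesis using hD [OF y] by (simp add: mollified_deriv_sum [OF e \<eta>])
  qed
  let ?K = "{y::'i slice. a \<le> norm y \<and> norm y \<le> b}"
  have KU: "?K \<subseteq> U" using r by (auto simp: U_def)
  have B: "sphere_integral s (\<lambda>y. \<Sum>v\<in>Basis. (y \<bullet> v / norm y) *\<^sub>R X v y) = boundary_integral \<eta> s ?g h" for s
    unfolding boundary_integral_def N by (intro sphere_integral_cong) simp
  have "integral {a..b} (\<lambda>s. sphere_integral s (\<lambda>y. \<Sum>v\<in>Basis. D v y))
      = integral {a..b} (\<lambda>s. sphere_integral s (\<lambda>y. approx_delta \<epsilon> (y - c) *\<^sub>R h y))"
    by (intro integral_cong sphere_integral_cong S) (use KU in auto)
  also have "\<dots> = (LINT y:?K|lborel. approx_delta \<epsilon> (y - c) *\<^sub>R h y)"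
    using r by (intro integral_shell_polar [symmetric] continuous_intros continuous_on_subset [OF hc KU]
      continuous_on_compose2 [OF continuous_on_approx_delta [OF e, of UNIV]]) auto
  finally show ?thesis using main unfolding B by simp
qed

lemma continuous_on_slice_kernel: "0 \<notin> S \<Longrightarrow> continuous_on S (slice_kernel \<eta>)"
  unfolding slice_kernel_def by (intro continuous_intros) auto

text \<open>Provides a majorant that does not depend on \<epsilon> and is bounded on spheres
  avoiding the pole.\<close>

lemma norm_mollified_kernel_le:
  fixes z :: "'i::{finite,linorder} slice" and \<eta> :: "real ^ 'j::{finite,linorder}"
  shows "norm (mollified_kernel \<epsilon> \<eta> z) \<le> norm (slice_kernel \<eta> z)"
proof (cases "z = 0")
  case False
  let ?n = "real (CARD('i) + 1)"
  have "((norm z)\<^sup>2 + \<epsilon>\<^sup>2) powr (- ?n / 2) \<le> ((norm z)\<^sup>2) powr (- ?n / 2)"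
    using False by (intro powr_mono2') auto
  also have "((norm z)\<^sup>2) powr (- ?n / 2) = (norm z powr 2) powr (- ?n / 2)"
    using False by (subst powr_numeral) auto
  also have "\<dots> = 1 / norm z ^ (CARD('i) + 1)"
    unfolding powr_powr using False by (simp add: powr_minus_divide powr_realpow [symmetric] del: of_nat_Suc power_Suc)
  finally show ?thesis
    using sphere_area_pos [where 'i = 'i] unfolding mollified_kernel_def slice_kernel_def norm_scaleR
    by (intro mult_left_mono mult_right_mono) auto
qed (simp add: mollified_kernel_def linear_0 [OF linear_slice_conj])

lemma mollified_kernel_tendsto:
  fixes z :: "'i::{finite,linorder} slice" and \<eta> :: "real ^ 'j::{finite,linorder}"
  assumes "z \<noteq> 0"
  shows "(\<lambda>k. mollified_kernel (1 / real (Suc k)) \<eta> z) \<longlonglongrightarrow> slice_kernel \<eta> z"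
proof -
  let ?n = "real (CARD('i) + 1)"
  have "(\<lambda>k. ((norm z)\<^sup>2 + (1 / real (Suc k))\<^sup>2) powr (- ?n / 2)) \<longlonglongrightarrow> ((norm z)\<^sup>2 + 0\<^sup>2) powr (- ?n / 2)"
    using assms LIMSEQ_Suc [OF lim_1_over_n] by (intro tendsto_intros) auto
  also have "((norm z)\<^sup>2 + 0\<^sup>2) powr (- ?n / 2) = (norm z powr 2) powr (- ?n / 2)"
    using assms by (subst powr_numeral) auto
  also have "\<dots> = 1 / norm z ^ (CARD('i) + 1)"
    unfolding powr_powr using assms by (simp add: powr_minus_divide powr_realpow [symmetric] del: of_nat_Suc power_Suc)
  finally show ?thesis
    unfolding mollified_kernel_def slice_kernel_def by (intro tendsto_intros)
qed

text \<open>The limit \<epsilon> \<rightarrow> 0 of \<open>stokes_mollified\<close>. As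
  \<open>c\<close> lies on neither sphere, the boundary terms converge by domination, and
  \<open>h\<close> cut off to the closed shell is continuous at \<open>c\<close>. A pole outside the
  closed shell is included: then the two boundary integrals agree, which is what comparisons between
  radii rest on.\<close>

theorem borel_pompeiu_shell:
  fixes h :: "'i::{finite,linorder} slice \<Rightarrow> ('i, 'j::{finite,linorder}) cl"
  assumes \<eta>: "\<eta> \<in> sphere 0 1"
    and r: "0 \<le> \<rho>\<^sub>1" "\<rho>\<^sub>1 < a" "a \<le> b" "b < \<rho>\<^sub>2"
    and mono: "slice_monogenic \<eta> {y. \<rho>\<^sub>1 < norm y \<and> norm y < \<rho>\<^sub>2} h"
    and c: "norm c \<noteq> a" "norm c \<noteq> b"
  shows "boundary_integral \<eta> b (\<lambda>y. slice_kernel \<eta> (y - c)) h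
       - boundary_integral \<eta> a (\<lambda>y. slice_kernel \<eta> (y - c)) h
    = (if a < norm c \<and> norm c < b then h c else 0)"
proof -
  define U where "U = {y::'i slice. \<rho>\<^sub>1 < norm y \<and> norm y < \<rho>\<^sub>2}"
  let ?K = "{y::'i slice. a \<le> norm y \<and> norm y \<le> b}"
  have KU: "?K \<subseteq> U" using r by (auto simp: U_def)
  have hc: "continuous_on U h" using slice_monogenic_continuous_on [OF mono] by (simp add: U_def)
  let ?e = "\<lambda>k. 1 / real (Suc k)"
  have e: "?e k > 0" for k by simp
  have lim: "(\<lambda>k. boundary_integral \<eta> s (\<lambda>y. mollified_kernel (?e k) \<eta> (y - c)) h)
      \<longlonglongrightarrow> boundary_integral \<eta> s (\<lambda>y. slice_kernel \<eta> (y - c)) h" if s: "a \<le> s" "s \<le> b" "norm c \<noteq> s" for s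
  proof -
    have s0: "s > 0" using s r by auto
    have hs: "continuous_on (sphere 0 s) h"
      by (rule continuous_on_subset [OF hc]) (use s r in \<open>auto simp: U_def\<close>)
    let ?P = "\<lambda>y. slice_para \<eta> ((1 / s) *\<^sub>R y) * h y"
    have Pc: "continuous_on (sphere 0 s) ?P"
      by (intro continuous_intros hs)
    have kc: "continuous_on (sphere 0 s) (\<lambda>y. slice_kernel \<eta> (y - c))"
      by (rule continuous_on_compose2 [OF continuous_on_slice_kernel [of "- {0}"]])
        (use s in \<open>auto intro!: continuous_intros\<close>)
    obtain C where C: "\<And>x y :: ('i, 'j) cl. norm (x * y) \<le> norm x * norm y * C" and C0: "C > 0"
      using clifford_mult.pos_bounded by blast
    have "continuous_on (sphere 0 s) (\<lambda>y. norm (slice_kernel \<eta> (y - c)) * norm (?P y) * C)"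
      by (intro continuous_intros kc Pc)
    from continuous_on_compact_bound [OF compact_sphere this]
    obtain B where B: "\<And>y. y \<in> sphere 0 s \<Longrightarrow> norm (norm (slice_kernel \<eta> (y - c)) * norm (?P y) * C) \<le> B"
      by blast
    show ?thesis
      unfolding boundary_integral_def mult.assoc
    proof (rule sphere_integral_tendsto [OF s0])
      show "continuous_on (sphere 0 s) (\<lambda>y. mollified_kernel (?e k) \<eta> (y - c) * ?P y)" for k
        by (intro continuous_on_clifford_mult continuous_on_mollified_kernel Pc divide_pos_pos) simp_all
      show "continuous_on (sphere 0 s) (\<lambda>y. slice_kernel \<eta> (y - c) * ?P y)"
        by (intro continuous_on_clifford_mult kc Pc)
      show "(\<lambda>k. mollified_kernel (?e k) \<eta> (y - c) * ?P y) \<longlonglongrightarrow> slice_kernel \<eta> (y - c) * ?P y" if "norm y = s" for y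
        by (intro clifford_mult.tendsto tendsto_const mollified_kernel_tendsto) (use that s in auto)
      show "norm (mollified_kernel (?e k) \<eta> (y - c) * ?P y) \<le> B" if "norm y = s" for k y
      proof -
        have "norm (mollified_kernel (?e k) \<eta> (y - c) * ?P y) \<le> norm (mollified_kernel (?e k) \<eta> (y - c)) * norm (?P y) * C"
          by (rule C)
        also have "\<dots> \<le> norm (slice_kernel \<eta> (y - c)) * norm (?P y) * C"
          using C0 by (intro mult_right_mono norm_mollified_kernel_le) auto
        also have "\<dots> \<le> B" using B [of y] that by simp
        finally show ?thesis .
      qed
    qed
  qed
  define H where "H y = indicator ?K y *\<^sub>R h y" for y
  have Kcompact: "compact ?K"
  proof -
    have "?K = cball 0 b - ball 0 a" by auto
    then show ?thesis by (simp add: compact_diff)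
  qed
  have hK: "continuous_on ?K h" by (rule continuous_on_subset [OF hc KU])
  obtain M where M: "M \<ge> 0" "\<And>y. y \<in> ?K \<Longrightarrow> norm (h y) \<le> M"
    using continuous_on_compact_bound [OF Kcompact hK] by metis
  have HM: "norm (H y) \<le> M" for y using M by (auto simp: H_def indicator_def)
  have Hm: "H \<in> borel_measurable borel"
    unfolding H_def by (intro borel_measurable_continuous_on_indicator borel_compact Kcompact hK)
  have Hcont: "isCont H c"
  proof (cases "a < norm c \<and> norm c < b")
    case True
    let ?O = "{y::'i slice. a < norm y \<and> norm y < b}"
    have "open ?O" by (auto intro!: open_Collect_conj open_Collect_less continuous_intros)
    moreover have "continuous_on ?O H"
    proof -
      have "continuous_on ?O h" by (rule continuous_on_subset [OF hK]) auto
      then show ?thesis by (rule continuous_on_eq) (simp add: H_def)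
    qed
    ultimately show ?thesis using True by (intro continuous_on_interior) (auto simp: interior_open)
  next
    case False
    let ?O = "{y::'i slice. norm y < a} \<union> {y. b < norm y}"
    have "open ?O" by (auto intro!: open_Un open_Collect_less continuous_intros)
    moreover have "continuous_on ?O H"
      by (rule continuous_on_eq [OF continuous_on_const [of _ 0]]) (auto simp: H_def)
    moreover have "c \<in> ?O" using False c by auto
    ultimately show ?thesis by (intro continuous_on_interior) (auto simp: interior_open)
  qed
  have "(\<lambda>k. \<integral>y. approx_delta (?e k) (y - c) *\<^sub>R H y \<partial>lborel) \<longlonglongrightarrow> H c"
    by (rule approx_delta_tendsto [OF Hm HM Hcont])
  moreover have "(\<integral>y. approx_delta (?e k) (y - c) *\<^sub>R H y \<partial>lborel) =
      boundary_integral \<eta> b (\<lambda>y. mollified_kernel (?e k) \<eta> (y - c)) h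
      - boundary_integral \<eta> a (\<lambda>y. mollified_kernel (?e k) \<eta> (y - c)) h" for k
    unfolding stokes_mollified [OF \<eta> e r mono] set_lebesgue_integral_def
    by (intro Bochner_Integration.integral_cong) (simp_all add: H_def)
  moreover have "(\<lambda>k. boundary_integral \<eta> b (\<lambda>y. mollified_kernel (?e k) \<eta> (y - c)) h
      - boundary_integral \<eta> a (\<lambda>y. mollified_kernel (?e k) \<eta> (y - c)) h)
    \<longlonglongrightarrow> boundary_integral \<eta> b (\<lambda>y. slice_kernel \<eta> (y - c)) h - boundary_integral \<eta> a (\<lambda>y. slice_kernel \<eta> (y - c)) h"
    using r c by (intro tendsto_diff lim) auto
  ultimately have "boundary_integral \<eta> b (\<lambda>y. slice_kernel \<eta> (y - c)) h - boundary_integral \<eta> a (\<lambda>y. slice_kernel \<eta> (y - c)) h = H c"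
    using LIMSEQ_unique by simp
  also have "H c = (if a < norm c \<and> norm c < b then h c else 0)"
    using c by (auto simp: H_def indicator_def)
  finally show ?thesis .
qed

section \<open>Iterated derivatives of the Cauchy kernel\<close>

text \<open>
  The coordinates of \<open>E\<close> are expressions of this form. As they are closed under directional derivatives,
  smoothness of \<open>E\<close> and the symmetry of its higher derivatives need no general theory.
\<close>

datatype 'v rexpr =
    Const real | Inner 'v | InvNorm | Add "'v rexpr" "'v rexpr" | Mul "'v rexpr" "'v rexpr"

primrec reval :: "'v::real_inner rexpr \<Rightarrow> 'v \<Rightarrow> real" where
  "reval (Const c) x = c"
| "reval (Inner w) x = x \<bullet> w"
| "reval InvNorm x = inverse (norm x)"
| "reval (Add e f) x = reval e x + reval f x"
| "reval (Mul e f) x = reval e x * reval f x"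

primrec rdiff :: "'v::real_inner \<Rightarrow> 'v rexpr \<Rightarrow> 'v rexpr" where
  "rdiff v (Const c) = Const 0"
| "rdiff v (Inner w) = Const (v \<bullet> w)"
| "rdiff v InvNorm = Mul (Const (- 1)) (Mul (Inner v) (Mul InvNorm (Mul InvNorm InvNorm)))"
| "rdiff v (Add e f) = Add (rdiff v e) (rdiff v f)"
| "rdiff v (Mul e f) = Add (Mul (rdiff v e) f) (Mul e (rdiff v f))"

lemma reval_derivative:
  "x \<noteq> 0 \<Longrightarrow> ((\<lambda>t. reval e (x + t *\<^sub>R v)) has_real_derivative reval (rdiff v e) x) (at 0)"
proof (induction e)
  case InvNorm
  have "((\<lambda>t. inverse (norm (x + t *\<^sub>R v))) has_real_derivative
      - (x \<bullet> v / norm x * inverse (norm (x + 0 *\<^sub>R v) ^ Suc (Suc 0)))) (at 0)"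
    using InvNorm by (intro DERIV_inverse_fun norm_line_derivative) auto
  then show ?case using InvNorm by (simp add: divide_inverse mult_ac)
next
  case (Mul e f)
  show ?case
    using DERIV_mult [OF Mul.IH(1) [OF Mul.prems] Mul.IH(2) [OF Mul.prems]] by (simp add: mult.commute)
qed (auto intro!: derivative_eq_intros simp: inner_add_left)

text \<open>The two expressions differ syntactically, so symmetry is a statement about values; as a
  purely algebraic identity it holds at the origin too.\<close>

lemma rdiff_commute: "reval (rdiff u (rdiff v e)) x = reval (rdiff v (rdiff u e)) x"
  by (induction e) (auto simp: inner_commute algebra_simps)

lemma rdiff_add: "reval (rdiff (u + v) e) x = reval (rdiff u e) x + reval (rdiff v e) x"
  by (induction e) (auto simp: inner_simps algebra_simps)

lemma rdiff_scaleR: "reval (rdiff (c *\<^sub>R v) e) x = c * reval (rdiff v e) x"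
  by (induction e) (auto simp: inner_simps algebra_simps)

lemma continuous_on_reval: "0 \<notin> S \<Longrightarrow> continuous_on S (reval e)"
  by (induction e) (auto intro!: continuous_intros)

text \<open>Representation off the origin suffices because a line through
  \<open>x \<noteq> 0\<close> avoids the origin for small parameters; equalities between derivatives
  therefore carry the hypothesis \<open>x \<noteq> 0\<close>.\<close>

definition smooth_off0 :: "('v::euclidean_space \<Rightarrow> 'w::euclidean_space) \<Rightarrow> bool" where
  "smooth_off0 g \<longleftrightarrow> (\<exists>e. \<forall>x. x \<noteq> 0 \<longrightarrow> g x = (\<Sum>b\<in>Basis. reval (e b) x *\<^sub>R b))"

lemma line_avoids_0:
  fixes x v :: "'v::real_normed_vector"
  assumes "x \<noteq> 0"
  shows "\<forall>\<^sub>F t in at 0. x + t *\<^sub>R v \<noteq> 0"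
proof -
  have "((\<lambda>t. x + t *\<^sub>R v) \<longlongrightarrow> x + 0 *\<^sub>R v) (at 0)" by (intro tendsto_intros)
  then show ?thesis using assms by (intro tendsto_imp_eventually_ne) auto
qed

lemma has_vector_derivative_cong_off0:
  fixes g g' :: "'v::real_normed_vector \<Rightarrow> 'w::real_normed_vector"
  assumes "x \<noteq> 0" "\<And>x. x \<noteq> 0 \<Longrightarrow> g x = g' x"
    and "((\<lambda>t. g (x + t *\<^sub>R v)) has_vector_derivative D) (at 0)"
  shows "((\<lambda>t. g' (x + t *\<^sub>R v)) has_vector_derivative D) (at 0)"
  using assms(3) unfolding has_vector_derivative_def
  by (rule has_derivative_transform_eventually)
    (use line_avoids_0 [OF assms(1), of v] assms in \<open>auto elim!: eventually_mono\<close>)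

lemma smooth_off0_expr:
  fixes e :: "'w::euclidean_space \<Rightarrow> 'v::euclidean_space rexpr"
  assumes g: "\<And>x. x \<noteq> 0 \<Longrightarrow> g x = (\<Sum>b\<in>Basis. reval (e b) x *\<^sub>R b)" and x: "x \<noteq> 0"
  shows "((\<lambda>t. g (x + t *\<^sub>R v)) has_vector_derivative (\<Sum>b\<in>Basis. reval (rdiff v (e b)) x *\<^sub>R b)) (at 0)"
    and "directional_deriv v g x = (\<Sum>b\<in>Basis. reval (rdiff v (e b)) x *\<^sub>R b)"
proof -
  have "((\<lambda>t. \<Sum>b\<in>Basis. reval (e b) (x + t *\<^sub>R v) *\<^sub>R b) has_vector_derivative
      (\<Sum>b\<in>Basis. reval (rdiff v (e b)) x *\<^sub>R b)) (at 0)"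
  proof (rule has_vector_derivative_sum)
    fix b :: 'w
    show "((\<lambda>t. reval (e b) (x + t *\<^sub>R v) *\<^sub>R b) has_vector_derivative reval (rdiff v (e b)) x *\<^sub>R b) (at 0)"
      using has_vector_derivative_scaleR [OF reval_derivative [OF x] has_vector_derivative_const, of "e b" v b]
      by simp
  qed
  then show *: "((\<lambda>t. g (x + t *\<^sub>R v)) has_vector_derivative (\<Sum>b\<in>Basis. reval (rdiff v (e b)) x *\<^sub>R b)) (at 0)"
    by (rule has_vector_derivative_cong_off0 [OF x, rotated]) (simp add: g)
  show "directional_deriv v g x = (\<Sum>b\<in>Basis. reval (rdiff v (e b)) x *\<^sub>R b)"
    by (rule directional_deriv_eqI [OF *])
qed

lemma smooth_off0_has_vector_derivative:
  "smooth_off0 g \<Longrightarrow> x \<noteq> 0 \<Longrightarrow> ((\<lambda>t. g (x + t *\<^sub>R v)) has_vector_derivative directional_deriv v g x) (at 0)"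
proof -
  assume g: "smooth_off0 g" and x: "x \<noteq> 0"
  obtain e where e: "\<And>x. x \<noteq> 0 \<Longrightarrow> g x = (\<Sum>b\<in>Basis. reval (e b) x *\<^sub>R b)"
    using g unfolding smooth_off0_def by blast
  have "directional_deriv v g x = (\<Sum>b\<in>Basis. reval (rdiff v (e b)) x *\<^sub>R b)"
    by (rule smooth_off0_expr(2) [OF e x])
  moreover have "((\<lambda>t. g (x + t *\<^sub>R v)) has_vector_derivative (\<Sum>b\<in>Basis. reval (rdiff v (e b)) x *\<^sub>R b)) (at 0)"
    by (rule smooth_off0_expr(1) [OF e x])
  ultimately show ?thesis by simp
qed

lemma smooth_off0_directional_deriv:
  assumes "smooth_off0 g"
  shows "smooth_off0 (directional_deriv v g)"
proof -
  obtain e where e: "\<And>x. x \<noteq> 0 \<Longrightarrow> g x = (\<Sum>b\<in>Basis. reval (e b) x *\<^sub>R b)"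
    using assms unfolding smooth_off0_def by blast
  show ?thesis
    unfolding smooth_off0_def
    by (intro exI [of _ "\<lambda>b. rdiff v (e b)"] allI impI smooth_off0_expr(2) [OF e])
qed

lemma directional_deriv_cong_off0:
  assumes "smooth_off0 g" "\<And>x. x \<noteq> 0 \<Longrightarrow> g x = g' x" "x \<noteq> 0"
  shows "directional_deriv v g x = directional_deriv v g' x"
  by (rule directional_deriv_eqI [symmetric])
    (rule has_vector_derivative_cong_off0 [OF assms(3,2) smooth_off0_has_vector_derivative [OF assms(1,3)]])

lemma directional_deriv_commute:
  assumes "smooth_off0 g" "x \<noteq> 0"
  shows "directional_deriv u (directional_deriv v g) x = directional_deriv v (directional_deriv u g) x"
proof -
  obtain e where e: "\<And>x. x \<noteq> 0 \<Longrightarrow> g x = (\<Sum>b\<in>Basis. reval (e b) x *\<^sub>R b)"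
    using assms unfolding smooth_off0_def by blast
  note d = smooth_off0_expr(2) [OF e]
  show ?thesis
    using smooth_off0_expr(2) [OF d assms(2)] by (simp add: rdiff_commute)
qed

lemma directional_deriv_add:
  assumes "smooth_off0 g" "x \<noteq> 0"
  shows "directional_deriv (u + v) g x = directional_deriv u g x + directional_deriv v g x"
proof -
  obtain e where e: "\<And>x. x \<noteq> 0 \<Longrightarrow> g x = (\<Sum>b\<in>Basis. reval (e b) x *\<^sub>R b)"
    using assms unfolding smooth_off0_def by blast
  show ?thesis
    using smooth_off0_expr(2) [OF e assms(2)] by (simp add: rdiff_add scaleR_add_left sum.distrib)
qed

lemma directional_deriv_scaleR:
  assumes "smooth_off0 g" "x \<noteq> 0"
  shows "directional_deriv (c *\<^sub>R v) g x = c *\<^sub>R directional_deriv v g x"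
proof -
  obtain e where e: "\<And>x. x \<noteq> 0 \<Longrightarrow> g x = (\<Sum>b\<in>Basis. reval (e b) x *\<^sub>R b)"
    using assms unfolding smooth_off0_def by blast
  show ?thesis
    using smooth_off0_expr(2) [OF e assms(2)] by (simp add: rdiff_scaleR scaleR_sum_right)
qed

lemma directional_deriv_sum:
  assumes "smooth_off0 g" "x \<noteq> 0" "finite I"
  shows "directional_deriv (\<Sum>i\<in>I. c i *\<^sub>R v i) g x = (\<Sum>i\<in>I. c i *\<^sub>R directional_deriv (v i) g x)"
  using assms(3)
proof (induction I rule: finite_induct)
  case empty
  then show ?case using directional_deriv_scaleR [OF assms(1,2), of 0 0] by simp
qed (simp add: directional_deriv_add [OF assms(1,2)] directional_deriv_scaleR [OF assms(1,2)])

lemma continuous_on_smooth_off0: 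
  assumes "smooth_off0 g" "0 \<notin> S"
  shows "continuous_on S g"
proof -
  obtain e where e: "\<And>x. x \<noteq> 0 \<Longrightarrow> g x = (\<Sum>b\<in>Basis. reval (e b) x *\<^sub>R b)"
    using assms unfolding smooth_off0_def by blast
  have "continuous_on S (\<lambda>x. \<Sum>b\<in>Basis. reval (e b) x *\<^sub>R b)"
    by (intro continuous_intros continuous_on_reval assms)
  then show ?thesis
  proof (rule continuous_on_eq)
    fix x assume "x \<in> S"
    then have "x \<noteq> 0" using assms(2) by blast
    then show "(\<Sum>b\<in>Basis. reval (e b) x *\<^sub>R b) = g x" by (rule e [symmetric])
  qed
qed

lemma reval_foldr_Add: "reval (foldr Add es (Const 0)) x = (\<Sum>e\<leftarrow>es. reval e x)"
  by (induction es) auto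

lemma smooth_off0_sum_scaleR:
  fixes w :: "'k \<Rightarrow> 'w::euclidean_space" and r :: "'k \<Rightarrow> 'v::euclidean_space rexpr"
  assumes "finite I" and "\<And>x. x \<noteq> 0 \<Longrightarrow> g x = (\<Sum>i\<in>I. reval (r i) x *\<^sub>R w i)"
  shows "smooth_off0 g"
proof -
  obtain xs where xs: "set xs = I" "distinct xs" using assms(1) finite_distinct_list by blast
  define e where "e b = foldr Add (map (\<lambda>i. Mul (r i) (Const (w i \<bullet> b))) xs) (Const 0)" for b
  have "g x = (\<Sum>b\<in>Basis. reval (e b) x *\<^sub>R b)" if "x \<noteq> 0" for x
  proof -
    have "reval (e b) x = g x \<bullet> b" for b
      using xs assms(2) [OF that]
      by (simp add: e_def reval_foldr_Add o_def inner_sum_left sum_list_distinct_conv_sum_set)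
    then show ?thesis by (simp add: euclidean_representation)
  qed
  then show ?thesis unfolding smooth_off0_def by blast
qed

lemma smooth_off0_linear:
  fixes L :: "'w::euclidean_space \<Rightarrow> 'u::euclidean_space"
  assumes "smooth_off0 g" "linear L"
  shows "smooth_off0 (\<lambda>x. L (g x))"
proof -
  obtain e where e: "\<And>x. x \<noteq> 0 \<Longrightarrow> g x = (\<Sum>b\<in>Basis. reval (e b) x *\<^sub>R b)"
    using assms unfolding smooth_off0_def by blast
  show ?thesis
    by (rule smooth_off0_sum_scaleR [of Basis _ e L])
      (simp_all add: e linear_sum [OF assms(2)] linear_scale [OF assms(2)])
qed

lemma smooth_off0_sum:
  fixes g :: "'k \<Rightarrow> 'v::euclidean_space \<Rightarrow> 'w::euclidean_space"
  assumes "finite I" "\<And>i. i \<in> I \<Longrightarrow> smooth_off0 (g i)"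
  shows "smooth_off0 (\<lambda>x. \<Sum>i\<in>I. g i x)"
proof -
  have "\<exists>e. \<forall>x. x \<noteq> 0 \<longrightarrow> g i x = (\<Sum>b\<in>Basis. reval (e b) x *\<^sub>R b)" if "i \<in> I" for i
    using assms(2) [OF that] unfolding smooth_off0_def .
  then obtain e where e: "\<And>i x. i \<in> I \<Longrightarrow> x \<noteq> 0 \<Longrightarrow> g i x = (\<Sum>b\<in>Basis. reval (e i b) x *\<^sub>R b)"
    by metis
  show ?thesis
  proof (rule smooth_off0_sum_scaleR [of "I \<times> Basis" _ "\<lambda>z. e (fst z) (snd z)" snd])
    fix x :: 'v assume "x \<noteq> 0"
    then have "(\<Sum>i\<in>I. g i x) = (\<Sum>i\<in>I. \<Sum>b\<in>Basis. reval (e i b) x *\<^sub>R b)"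
      by (intro sum.cong refl e)
    then show "(\<Sum>i\<in>I. g i x) = (\<Sum>z\<in>I \<times> Basis. reval (e (fst z) (snd z)) x *\<^sub>R snd z)"
      by (simp add: sum.cartesian_product split_def)
  qed (use assms in simp)
qed

lemma directional_deriv_linear:
  assumes "smooth_off0 g" "linear L" "x \<noteq> 0"
  shows "directional_deriv v (\<lambda>x. L (g x)) x = L (directional_deriv v g x)"
  by (rule directional_deriv_eqI)
    (rule bounded_linear.has_vector_derivative [OF assms(2) [unfolded linear_conv_bounded_linear]
      smooth_off0_has_vector_derivative [OF assms(1,3)]])

lemma directional_deriv_fun_sum:
  assumes "finite I" "\<And>i. i \<in> I \<Longrightarrow> smooth_off0 (g i)" "x \<noteq> 0"
  shows "directional_deriv v (\<lambda>x. \<Sum>i\<in>I. g i x) x = (\<Sum>i\<in>I. directional_deriv v (g i) x)"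
  by (rule directional_deriv_eqI)
    (intro has_vector_derivative_sum smooth_off0_has_vector_derivative assms)

section \<open>Iterated directional derivatives\<close>

definition iter_deriv :: "'v::euclidean_space list \<Rightarrow> ('v \<Rightarrow> 'w::euclidean_space) \<Rightarrow> 'v \<Rightarrow> 'w" where
  "iter_deriv vs g = foldr directional_deriv vs g"

lemma iter_deriv_simps [simp]:
  "iter_deriv [] g = g"
  "iter_deriv (v # vs) g = directional_deriv v (iter_deriv vs g)"
  by (simp_all add: iter_deriv_def)

lemma iter_deriv_append: "iter_deriv (vs @ ws) g = iter_deriv vs (iter_deriv ws g)"
  by (simp add: iter_deriv_def)

lemma smooth_off0_iter_deriv: "smooth_off0 g \<Longrightarrow> smooth_off0 (iter_deriv vs g)"
  by (induction vs) (auto intro: smooth_off0_directional_deriv)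

lemma iter_deriv_cong_off0:
  assumes "smooth_off0 g" "\<And>x. x \<noteq> 0 \<Longrightarrow> g x = g' x"
  shows "x \<noteq> 0 \<Longrightarrow> iter_deriv vs g x = iter_deriv vs g' x"
proof (induction vs arbitrary: x)
  case (Cons v vs)
  then show ?case
    using directional_deriv_cong_off0 [OF smooth_off0_iter_deriv [OF assms(1)], of vs] by simp
qed (use assms in simp)

lemma iter_deriv_swap:
  assumes "smooth_off0 g"
  shows "x \<noteq> 0 \<Longrightarrow> directional_deriv v (iter_deriv vs g) x = iter_deriv vs (directional_deriv v g) x"
proof (induction vs arbitrary: x)
  case (Cons w vs)
  have "directional_deriv v (iter_deriv (w # vs) g) x = directional_deriv w (directional_deriv v (iter_deriv vs g)) x"
    using directional_deriv_commute [OF smooth_off0_iter_deriv [OF assms]] Cons.prems by simp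
  also have "\<dots> = directional_deriv w (iter_deriv vs (directional_deriv v g)) x"
    by (rule directional_deriv_cong_off0 [OF smooth_off0_directional_deriv [OF smooth_off0_iter_deriv [OF assms]]])
      (use Cons in auto)
  finally show ?case by simp
qed simp

lemma iter_deriv_permute:
  assumes "smooth_off0 g"
  shows "mset vs = mset ws \<Longrightarrow> x \<noteq> 0 \<Longrightarrow> iter_deriv vs g x = iter_deriv ws g x"
proof (induction vs arbitrary: ws x)
  case (Cons v vs)
  have "v \<in> set ws" using Cons.prems(1) by (metis list.set_intros(1) set_mset_mset)
  then obtain as bs where ws: "ws = as @ v # bs" by (meson split_list)
  have eq: "mset vs = mset (as @ bs)" using Cons.prems(1) by (simp add: ws)
  have "iter_deriv ws g x = iter_deriv as (directional_deriv v (iter_deriv bs g)) x"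
    by (simp add: ws iter_deriv_append)
  also have "\<dots> = directional_deriv v (iter_deriv (as @ bs) g) x"
    using iter_deriv_swap [OF smooth_off0_iter_deriv [OF assms] Cons.prems(2)] by (simp add: iter_deriv_append)
  also have "\<dots> = directional_deriv v (iter_deriv vs g) x"
    by (rule directional_deriv_cong_off0 [OF smooth_off0_iter_deriv [OF assms] _ Cons.prems(2)])
      (use Cons.IH [OF eq] in simp)
  finally show ?case by simp
qed simp

lemma iter_deriv_linear:
  assumes "smooth_off0 g" "linear L"
  shows "x \<noteq> 0 \<Longrightarrow> iter_deriv vs (\<lambda>x. L (g x)) x = L (iter_deriv vs g x)"
proof (induction vs arbitrary: x)
  case (Cons v vs)
  have "directional_deriv v (iter_deriv vs (\<lambda>x. L (g x))) x = directional_deriv v (\<lambda>x. L (iter_deriv vs g x)) x"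
    by (rule directional_deriv_cong_off0 [OF smooth_off0_iter_deriv [OF smooth_off0_linear [OF assms]]])
      (use Cons in auto)
  also have "\<dots> = L (directional_deriv v (iter_deriv vs g) x)"
    by (rule directional_deriv_linear [OF smooth_off0_iter_deriv [OF assms(1)] assms(2) Cons.prems])
  finally show ?case by simp
qed simp

lemma iter_deriv_fun_sum:
  assumes "finite I" "\<And>i. i \<in> I \<Longrightarrow> smooth_off0 (g i)"
  shows "x \<noteq> 0 \<Longrightarrow> iter_deriv vs (\<lambda>x. \<Sum>i\<in>I. g i x) x = (\<Sum>i\<in>I. iter_deriv vs (g i) x)"
proof (induction vs arbitrary: x)
  case (Cons v vs)
  have "directional_deriv v (iter_deriv vs (\<lambda>x. \<Sum>i\<in>I. g i x)) x = directional_deriv v (\<lambda>x. \<Sum>i\<in>I. iter_deriv vs (g i) x) x"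
    by (rule directional_deriv_cong_off0 [OF smooth_off0_iter_deriv [OF smooth_off0_sum [OF assms]]])
      (use Cons in auto)
  also have "\<dots> = (\<Sum>i\<in>I. directional_deriv v (iter_deriv vs (g i)) x)"
    by (rule directional_deriv_fun_sum [OF assms(1) smooth_off0_iter_deriv [OF assms(2)] Cons.prems])
  finally show ?case by simp
qed simp

lemma iter_deriv_replicate_scaleR:
  assumes "smooth_off0 g"
  shows "x \<noteq> 0 \<Longrightarrow> iter_deriv (replicate k (c *\<^sub>R v)) g x = c ^ k *\<^sub>R iter_deriv (replicate k v) g x"
proof (induction k arbitrary: x)
  case (Suc k)
  have "directional_deriv (c *\<^sub>R v) (iter_deriv (replicate k (c *\<^sub>R v)) g) x
      = directional_deriv (c *\<^sub>R v) (\<lambda>x. c ^ k *\<^sub>R iter_deriv (replicate k v) g x) x"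
    by (rule directional_deriv_cong_off0 [OF smooth_off0_iter_deriv [OF assms]]) (use Suc in auto)
  also have "\<dots> = c ^ k *\<^sub>R directional_deriv (c *\<^sub>R v) (iter_deriv (replicate k v) g) x"
    by (rule directional_deriv_linear [OF smooth_off0_iter_deriv [OF assms] _ Suc.prems])
      (rule bounded_linear.linear [OF bounded_linear_scaleR_right])
  also have "\<dots> = c ^ Suc k *\<^sub>R directional_deriv v (iter_deriv (replicate k v) g) x"
    using directional_deriv_scaleR [OF smooth_off0_iter_deriv [OF assms] Suc.prems] by simp
  finally show ?case by simp
qed simp

text \<open>
  If one directional derivative of \<open>E\<close> is a combination of the others with constant coefficients,
  so is every power of it; \<open>act\<close> is multiplication from the left or from the right.
\<close>

lemma iter_deriv_replicate_expand:
  fixes E :: "'v::euclidean_space \<Rightarrow> 'w::euclidean_space" and ax :: "'k::finite \<Rightarrow> 'v"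
  assumes E: "smooth_off0 E" and lin: "\<And>l. linear (act l :: 'w \<Rightarrow> 'w)"
    and dv: "\<And>x. x \<noteq> 0 \<Longrightarrow> directional_deriv v E x = (\<Sum>l\<in>UNIV. act l (directional_deriv (ax l) E x))"
  shows "x \<noteq> 0 \<Longrightarrow> iter_deriv (replicate k v) E x =
    (\<Sum>ls | length ls = k. foldr act ls (iter_deriv (map ax ls) E x))"
proof (induction k arbitrary: x)
  case (Suc k)
  have fin: "finite {ls :: 'k list. length ls = k}"
    by (rule finite_subset [OF _ finite_lists_length_eq [of "UNIV :: 'k set" k]]) auto
  have linf: "linear (foldr act ls)" for ls
  proof (induction ls)
    case Nil
    show ?case by (simp add: linear_iff)
  next
    case (Cons l ls)
    from linear_compose [OF Cons lin] show ?case by (simp add: o_def)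
  qed
  note sm = smooth_off0_iter_deriv [OF E]
  have "iter_deriv (replicate (Suc k) v) E x = directional_deriv v (iter_deriv (replicate k v) E) x" by simp
  also have "\<dots> = directional_deriv v (\<lambda>x. \<Sum>ls | length ls = k. foldr act ls (iter_deriv (map ax ls) E x)) x"
    by (rule directional_deriv_cong_off0 [OF sm]) (use Suc in auto)
  also have "\<dots> = (\<Sum>ls | length ls = k. directional_deriv v (\<lambda>x. foldr act ls (iter_deriv (map ax ls) E x)) x)"
    by (rule directional_deriv_fun_sum [OF fin smooth_off0_linear [OF sm linf] Suc.prems])
  also have "\<dots> = (\<Sum>ls | length ls = k. \<Sum>l\<in>UNIV. foldr act (ls @ [l]) (iter_deriv (map ax (ls @ [l])) E x))"
  proof (rule sum.cong [OF refl])
    fix ls :: "'k list"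
    have sml: "smooth_off0 (\<lambda>x. act l (directional_deriv (ax l) E x))" for l
      by (rule smooth_off0_linear [OF smooth_off0_directional_deriv [OF E] lin])
    have "directional_deriv v (\<lambda>x. foldr act ls (iter_deriv (map ax ls) E x)) x
        = foldr act ls (directional_deriv v (iter_deriv (map ax ls) E) x)"
      by (rule directional_deriv_linear [OF sm linf Suc.prems])
    \<comment> \<open>\<open>dv\<close> describes the derivative of \<open>E\<close> itself, so the
      new derivative is moved to the innermost place; its letter is therefore appended at the end of
      the word.\<close>
    also have "directional_deriv v (iter_deriv (map ax ls) E) x = iter_deriv (map ax ls) (directional_deriv v E) x"
      by (rule iter_deriv_swap [OF E Suc.prems])
    also have "\<dots> = iter_deriv (map ax ls) (\<lambda>x. \<Sum>l\<in>UNIV. act l (directional_deriv (ax l) E x)) x"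
      by (rule iter_deriv_cong_off0 [OF smooth_off0_directional_deriv [OF E] dv Suc.prems])
    also have "\<dots> = (\<Sum>l\<in>UNIV. iter_deriv (map ax ls) (\<lambda>x. act l (directional_deriv (ax l) E x)) x)"
      by (rule iter_deriv_fun_sum [OF finite sml Suc.prems])
    also have "\<dots> = (\<Sum>l\<in>UNIV. act l (iter_deriv (map ax ls) (directional_deriv (ax l) E) x))"
      by (intro sum.cong refl iter_deriv_linear [OF smooth_off0_directional_deriv [OF E] lin Suc.prems])
    finally show "directional_deriv v (\<lambda>x. foldr act ls (iter_deriv (map ax ls) E x)) x =
        (\<Sum>l\<in>UNIV. foldr act (ls @ [l]) (iter_deriv (map ax (ls @ [l])) E x))"
      by (simp add: linear_sum [OF linf] iter_deriv_append)
  qed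
  also have "\<dots> = (\<Sum>(ls, l)\<in>{ls. length ls = k} \<times> UNIV. foldr act (ls @ [l]) (iter_deriv (map ax (ls @ [l])) E x))"
    by (rule sum.cartesian_product)
  also have "\<dots> = (\<Sum>ls | length ls = Suc k. foldr act ls (iter_deriv (map ax ls) E x))"
  proof (rule sum.reindex_bij_witness [of _ "\<lambda>ls. (butlast ls, last ls)" "\<lambda>(ls, l). ls @ [l]"])
    fix ls :: "'k list" assume "ls \<in> {ls. length ls = Suc k}"
    then have "ls \<noteq> []" by auto
    then show "(case (butlast ls, last ls) of (ls, l) \<Rightarrow> ls @ [l]) = ls" by simp
  qed auto
  finally show ?case .
qed simp

section \<open>Monogenicity of the Cauchy kernel from both sides\<close>

lemma slice_para_Basis_sum: "slice_para \<eta> z = (\<Sum>v\<in>Basis. (z \<bullet> v) *\<^sub>R slice_para \<eta> v)"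
  by (subst euclidean_representation [symmetric, of z])
    (simp only: linear_sum [OF linear_slice_para] slice_para_scaleR)

lemma slice_conj_Basis_sum: "slice_conj \<eta> z = (\<Sum>v\<in>Basis. (z \<bullet> v) *\<^sub>R slice_conj \<eta> v)"
  by (subst euclidean_representation [symmetric, of z])
    (simp only: linear_sum [OF linear_slice_conj] slice_conj_scaleR)

lemma smooth_off0_slice_kernel: "smooth_off0 (slice_kernel \<eta> :: 'i::{finite,linorder} slice \<Rightarrow> ('i, 'j::{finite,linorder}) cl)"
proof (rule smooth_off0_sum_scaleR [of Basis _
    "\<lambda>v. Mul (Const (1 / sphere_area TYPE('i))) (Mul (foldr Mul (replicate (CARD('i) + 1) InvNorm) (Const 1)) (Inner v))"
    "slice_conj \<eta>"])
  fix x :: "'i slice" assume "x \<noteq> 0"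
  have "reval (foldr Mul (replicate k InvNorm) (Const 1)) x = inverse (norm x) ^ k" for k
    by (induction k) auto
  then show "slice_kernel \<eta> x = (\<Sum>v\<in>Basis. reval (Mul (Const (1 / sphere_area TYPE('i)))
      (Mul (foldr Mul (replicate (CARD('i) + 1) InvNorm) (Const 1)) (Inner v))) x *\<^sub>R slice_conj \<eta> v)"
    unfolding slice_kernel_def
    by (subst slice_conj_Basis_sum)
      (simp add: scaleR_sum_right divide_inverse power_inverse mult.assoc)
qed simp

lemma slice_kernel_directional_deriv:
  fixes z v :: "'i::{finite,linorder} slice" and \<eta> :: "real ^ 'j::{finite,linorder}"
  assumes "z \<noteq> 0"
  shows "directional_deriv v (slice_kernel \<eta>) z = (1 / sphere_area TYPE('i)) *\<^sub>R
     (inverse (norm z) ^ (CARD('i) + 1) *\<^sub>R slice_conj \<eta> v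
      - (real (CARD('i) + 1) * inverse (norm z) ^ (CARD('i) + 3) * (z \<bullet> v)) *\<^sub>R slice_conj \<eta> z)"
proof (rule directional_deriv_eqI)
  let ?n = "CARD('i) + 1"
  have "((\<lambda>t. inverse (norm (z + t *\<^sub>R v))) has_real_derivative
      - (z \<bullet> v / norm z * inverse (norm (z + 0 *\<^sub>R v) ^ Suc (Suc 0)))) (at 0)"
    using assms by (intro DERIV_inverse_fun norm_line_derivative) auto
  from DERIV_power [OF this, of ?n]
  have 1: "((\<lambda>t. inverse (norm (z + t *\<^sub>R v)) ^ ?n) has_real_derivative
      - (real ?n * inverse (norm z) ^ (CARD('i) + 3) * (z \<bullet> v))) (at 0)"
    by (simp add: divide_inverse power_inverse mult_ac numeral_3_eq_3)
  have eq: "slice_conj \<eta> (z + t *\<^sub>R v) = slice_conj \<eta> z + t *\<^sub>R slice_conj \<eta> v" for t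
    by (simp add: slice_conj_add slice_conj_scaleR)
  have 2: "((\<lambda>t. slice_conj \<eta> (z + t *\<^sub>R v)) has_vector_derivative slice_conj \<eta> v) (at 0)"
    unfolding eq by (auto intro!: derivative_eq_intros)
  from has_vector_derivative_scaleR [OF 1 2]
  have 3: "((\<lambda>t. inverse (norm (z + t *\<^sub>R v)) ^ ?n *\<^sub>R slice_conj \<eta> (z + t *\<^sub>R v)) has_vector_derivative
      inverse (norm z) ^ ?n *\<^sub>R slice_conj \<eta> v
      - (real ?n * inverse (norm z) ^ (CARD('i) + 3) * (z \<bullet> v)) *\<^sub>R slice_conj \<eta> z) (at 0)"
    by (simp del: power_Suc of_nat_Suc)
  have 4: "slice_kernel \<eta> w = (1 / sphere_area TYPE('i)) *\<^sub>R (inverse (norm w) ^ ?n *\<^sub>R slice_conj \<eta> w)" for w :: "'i slice"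
    unfolding slice_kernel_def by (simp only: power_one_over inverse_eq_divide)
  show "((\<lambda>t. slice_kernel \<eta> (z + t *\<^sub>R v)) has_vector_derivative (1 / sphere_area TYPE('i)) *\<^sub>R
     (inverse (norm z) ^ ?n *\<^sub>R slice_conj \<eta> v
      - (real ?n * inverse (norm z) ^ (CARD('i) + 3) * (z \<bullet> v)) *\<^sub>R slice_conj \<eta> z)) (at 0)"
    unfolding 4 by (rule bounded_linear.has_vector_derivative [OF bounded_linear_scaleR_right 3])
qed

lemma sum_Basis_conj_para:
  assumes "\<eta> \<in> sphere 0 1"
  shows "(\<Sum>v\<in>Basis. slice_conj \<eta> v * slice_para \<eta> v) = real (CARD('i) + 1) *\<^sub>R (1 :: ('i::{finite,linorder}, 'j::{finite,linorder}) cl)"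
    and "(\<Sum>v\<in>Basis. slice_para \<eta> v * slice_conj \<eta> v) = real (CARD('i) + 1) *\<^sub>R (1 :: ('i::{finite,linorder}, 'j::{finite,linorder}) cl)"
proof -
  have 1: "(\<Sum>v\<in>(Basis :: 'i slice set). (1 :: ('i, 'j) cl)) = real (CARD('i) + 1) *\<^sub>R 1"
    by (simp add: scaleR_conv_of_real)
  have "(\<Sum>v\<in>Basis. slice_conj \<eta> v * slice_para \<eta> v) = (\<Sum>v\<in>(Basis :: 'i slice set). (1 :: ('i, 'j) cl))"
    by (intro sum.cong) (simp_all add: slice_conj_mult_para [OF assms])
  then show "(\<Sum>v\<in>Basis. slice_conj \<eta> v * slice_para \<eta> v) = real (CARD('i) + 1) *\<^sub>R (1 :: ('i, 'j) cl)"
    unfolding 1 .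
  have "(\<Sum>v\<in>Basis. slice_para \<eta> v * slice_conj \<eta> v) = (\<Sum>v\<in>(Basis :: 'i slice set). (1 :: ('i, 'j) cl))"
    by (intro sum.cong) (simp_all add: slice_conj_mult_para [OF assms])
  then show "(\<Sum>v\<in>Basis. slice_para \<eta> v * slice_conj \<eta> v) = real (CARD('i) + 1) *\<^sub>R (1 :: ('i, 'j) cl)"
    unfolding 1 .
qed

text \<open>Differentiating the conjugate and the power of the norm yields n |z|^(-n) and -n
  |z|^(-n-2) |z|^2, which cancel. Both orders of multiplication work because the conjugate inverts
  \<open>z\<close> up to |z|^2 from either side.\<close>

lemma slice_kernel_dirac:
  fixes z :: "'i::{finite,linorder} slice" and \<eta> :: "real ^ 'j::{finite,linorder}"
  assumes "z \<noteq> 0" "\<eta> \<in> sphere 0 1"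
  shows "(\<Sum>v\<in>Basis. slice_para \<eta> v * directional_deriv v (slice_kernel \<eta>) z) = 0"
    and "(\<Sum>v\<in>Basis. directional_deriv v (slice_kernel \<eta>) z * slice_para \<eta> v) = 0"
proof -
  define a where "a = inverse (norm z) ^ (CARD('i) + 1)"
  define b where "b = real (CARD('i) + 1) * inverse (norm z) ^ (CARD('i) + 3)"
  have ab: "real (CARD('i) + 1) * a - b * (norm z)\<^sup>2 = 0"
  proof -
    have "inverse (norm z) ^ 2 * (norm z)\<^sup>2 = 1"
      using assms(1) by (simp flip: power_mult_distrib)
    moreover have "CARD('i) + 3 = (CARD('i) + 1) + 2" by simp
    ultimately have e: "inverse (norm z) ^ (CARD('i) + 3) * (norm z)\<^sup>2 = inverse (norm z) ^ (CARD('i) + 1)"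
      by (simp only: power_add mult.assoc mult_1_right)
    show ?thesis unfolding a_def b_def mult.assoc e by simp
  qed
  note d = slice_kernel_directional_deriv [OF assms(1), of _ \<eta>, folded a_def b_def]
  have "(\<Sum>v\<in>Basis. slice_para \<eta> v * directional_deriv v (slice_kernel \<eta>) z)
    = (1 / sphere_area TYPE('i)) *\<^sub>R (a *\<^sub>R (\<Sum>v\<in>Basis. slice_para \<eta> v * slice_conj \<eta> v)
       - b *\<^sub>R ((\<Sum>v\<in>Basis. (z \<bullet> v) *\<^sub>R slice_para \<eta> v) * slice_conj \<eta> z))"
    unfolding d by (simp add: scaleR_sum_right sum_distrib_right algebra_simps sum.distrib sum_subtractf)
  also have "\<dots> = (1 / sphere_area TYPE('i)) *\<^sub>R ((real (CARD('i) + 1) * a - b * (norm z)\<^sup>2) *\<^sub>R 1)"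
    unfolding sum_Basis_conj_para [OF assms(2)]
    unfolding slice_para_Basis_sum [symmetric] slice_conj_mult_para [OF assms(2)]
    by (simp only: scaleR_scaleR scaleR_left_diff_distrib mult.commute [of a])
  finally show "(\<Sum>v\<in>Basis. slice_para \<eta> v * directional_deriv v (slice_kernel \<eta>) z) = 0"
    unfolding ab by simp
  have "(\<Sum>v\<in>Basis. directional_deriv v (slice_kernel \<eta>) z * slice_para \<eta> v)
    = (1 / sphere_area TYPE('i)) *\<^sub>R (a *\<^sub>R (\<Sum>v\<in>Basis. slice_conj \<eta> v * slice_para \<eta> v)
       - b *\<^sub>R (slice_conj \<eta> z * (\<Sum>v\<in>Basis. (z \<bullet> v) *\<^sub>R slice_para \<eta> v)))"
    unfolding d by (simp add: scaleR_sum_right sum_distrib_left algebra_simps sum.distrib sum_subtractf)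
  also have "\<dots> = (1 / sphere_area TYPE('i)) *\<^sub>R ((real (CARD('i) + 1) * a - b * (norm z)\<^sup>2) *\<^sub>R 1)"
    unfolding sum_Basis_conj_para [OF assms(2)]
    unfolding slice_para_Basis_sum [symmetric] slice_conj_mult_para [OF assms(2)]
    by (simp only: scaleR_scaleR scaleR_left_diff_distrib mult.commute [of a])
  finally show "(\<Sum>v\<in>Basis. directional_deriv v (slice_kernel \<eta>) z * slice_para \<eta> v) = 0"
    unfolding ab by simp
qed

lemma slice_point_decomp: "(v :: 'i::finite slice) = (\<Sum>i\<in>UNIV. (fst v $ i) *\<^sub>R (axis i 1, 0)) + snd v *\<^sub>R (0, 1)"
proof -
  have "(\<Sum>i\<in>UNIV. (fst v $ i) *\<^sub>R ((axis i 1, 0) :: 'i slice)) = (fst v, 0)"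
    by (simp add: prod_eq_iff fst_sum snd_sum vec_eq_iff axis_def if_distrib [of "\<lambda>c. _ * c"] cong: if_cong)
  then show ?thesis by (simp add: prod_eq_iff)
qed

text \<open>Multiplying D E = 0 by \<open>im_vec \<eta>\<close>, whose square is -1, solves it for
  the derivative in r: this is the sum of \<eta> e_l times the derivatives in x_l. In direction
  \<open>v\<close> the coefficient of the latter is then the Fueter variable z_l evaluated at
  \<open>v\<close>.\<close>

lemma slice_kernel_directional_deriv_left:
  fixes z v :: "'i::{finite,linorder} slice" and \<eta> :: "real ^ 'j::{finite,linorder}"
  assumes "z \<noteq> 0" "\<eta> \<in> sphere 0 1"
  shows "directional_deriv v (slice_kernel \<eta>) z =
    (\<Sum>l\<in>UNIV. ((fst v $ l) *\<^sub>R 1 + snd v *\<^sub>R (im_vec \<eta> * e_vec l)) * directional_deriv (axis l 1, 0) (slice_kernel \<eta>) z)"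
proof -
  let ?D = "\<lambda>v. directional_deriv v (slice_kernel \<eta>) z :: ('i, 'j) cl"
  have "im_vec \<eta> * ((\<Sum>l\<in>UNIV. e_vec l * ?D (axis l 1, 0)) + im_vec \<eta> * ?D (0, 1)) = 0"
    using slice_kernel_dirac(1) [OF assms] by (simp add: sum_Basis_slice)
  then have r: "?D (0, 1) = (\<Sum>l\<in>UNIV. im_vec \<eta> * e_vec l * ?D (axis l 1, 0))"
    using im_vec_unit_square [OF assms(2), where 'i = 'i]
    by (simp add: distrib_left sum_distrib_left mult.assoc [symmetric])
  note sm = smooth_off0_slice_kernel [of \<eta>, where 'i = 'i]
  have "?D v = (\<Sum>l\<in>UNIV. (fst v $ l) *\<^sub>R ?D (axis l 1, 0)) + snd v *\<^sub>R ?D (0, 1)"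
    by (subst slice_point_decomp)
      (simp only: directional_deriv_add [OF sm assms(1)] directional_deriv_sum [OF sm assms(1) finite]
        directional_deriv_scaleR [OF sm assms(1)])
  then show ?thesis
    unfolding r by (simp add: scaleR_sum_right distrib_right sum.distrib)
qed

text \<open>The mirror image, from E D = 0 multiplied by \<open>im_vec \<eta>\<close> on the right:
  the coefficients become the variables z_l^R and stand behind the derivatives.\<close>

lemma slice_kernel_directional_deriv_right:
  fixes z v :: "'i::{finite,linorder} slice" and \<eta> :: "real ^ 'j::{finite,linorder}"
  assumes "z \<noteq> 0" "\<eta> \<in> sphere 0 1"
  shows "directional_deriv v (slice_kernel \<eta>) z =
    (\<Sum>l\<in>UNIV. directional_deriv (axis l 1, 0) (slice_kernel \<eta>) z * ((fst v $ l) *\<^sub>R 1 + snd v *\<^sub>R (e_vec l * im_vec \<eta>)))"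
proof -
  let ?D = "\<lambda>v. directional_deriv v (slice_kernel \<eta>) z :: ('i, 'j) cl"
  have "((\<Sum>l\<in>UNIV. ?D (axis l 1, 0) * e_vec l) + ?D (0, 1) * im_vec \<eta>) * im_vec \<eta> = 0"
    using slice_kernel_dirac(2) [OF assms] by (simp add: sum_Basis_slice)
  then have r: "?D (0, 1) = (\<Sum>l\<in>UNIV. ?D (axis l 1, 0) * (e_vec l * im_vec \<eta>))"
    using im_vec_unit_square [OF assms(2), where 'i = 'i]
    by (simp add: distrib_right sum_distrib_right mult.assoc)
  note sm = smooth_off0_slice_kernel [of \<eta>, where 'i = 'i]
  have "?D v = (\<Sum>l\<in>UNIV. (fst v $ l) *\<^sub>R ?D (axis l 1, 0)) + snd v *\<^sub>R ?D (0, 1)"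
    by (subst slice_point_decomp)
      (simp only: directional_deriv_add [OF sm assms(1)] directional_deriv_sum [OF sm assms(1) finite]
        directional_deriv_scaleR [OF sm assms(1)])
  then show ?thesis
    unfolding r by (simp add: scaleR_sum_right distrib_left sum.distrib)
qed

section \<open>Words, multi-indices and Fueter polynomials\<close>

definition slice_multi_deriv ::
  "('i::{finite,linorder} \<Rightarrow> nat) \<Rightarrow> ('i slice \<Rightarrow> 'w::euclidean_space) \<Rightarrow> 'i slice \<Rightarrow> 'w" where
  "slice_multi_deriv \<kappa> g = foldr (\<lambda>i. directional_deriv (axis i 1, 0) ^^ \<kappa> i) (sorted_list_of_set UNIV) g"

lemma foldr_directional_deriv:
  "foldr (\<lambda>i. directional_deriv (ax i) ^^ \<kappa> i) xs g = iter_deriv (map ax (concat (map (\<lambda>i. replicate (\<kappa> i) i) xs))) g"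
proof (induction xs)
  case (Cons i xs)
  have "(directional_deriv v ^^ k) h = iter_deriv (replicate k v) h" for v k h
    by (induction k) auto
  with Cons show ?case by (simp add: iter_deriv_append)
qed simp

text \<open>By the symmetry of mixed derivatives, a word of coordinate directions matters only
  through the number of occurrences of each letter.\<close>

lemma iter_deriv_eq_slice_multi_deriv:
  assumes g: "smooth_off0 g" and x: "x \<noteq> 0" and ls: "\<And>l. count_list ls l = \<kappa> l"
  shows "iter_deriv (map (\<lambda>i. (axis i 1, 0)) ls) g x = slice_multi_deriv \<kappa> g x"
proof -
  have "count (mset (concat (map (\<lambda>i. replicate (\<kappa> i) i) xs))) l = (if l \<in> set xs then \<kappa> l else 0)"
    if "distinct xs" for xs :: "'a list" and l
    using that by (induction xs) auto
  then have "mset ls = mset (concat (map (\<lambda>i. replicate (\<kappa> i) i) (sorted_list_of_set UNIV)))"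
    using ls by (intro multiset_eqI) (simp add: count_mset)
  then have "mset (map (\<lambda>i. (axis i 1, 0 :: real)) ls) =
      mset (map (\<lambda>i. (axis i 1, 0)) (concat (map (\<lambda>i. replicate (\<kappa> i) i) (sorted_list_of_set UNIV))))"
    by (simp only: mset_map)
  from iter_deriv_permute [OF g this x] show ?thesis
    unfolding slice_multi_deriv_def foldr_directional_deriv .
qed

lemma finite_multi_indices: "finite {\<kappa> :: 'i::finite \<Rightarrow> nat. sum \<kappa> UNIV = k}"
proof (rule finite_subset)
  show "{\<kappa> :: 'i \<Rightarrow> nat. sum \<kappa> UNIV = k} \<subseteq> PiE UNIV (\<lambda>_. {..k})"
  proof
    fix \<kappa> :: "'i \<Rightarrow> nat" assume "\<kappa> \<in> {\<kappa>. sum \<kappa> UNIV = k}"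
    then have "\<kappa> i \<le> k" for i using member_le_sum [of i UNIV \<kappa>] by auto
    then show "\<kappa> \<in> PiE UNIV (\<lambda>_. {..k})" by (auto simp: PiE_def extensional_def)
  qed
  show "finite (PiE (UNIV :: 'i set) (\<lambda>_. {..k}))" by (intro finite_PiE) auto
qed

text \<open>The expansion of a k-fold derivative runs over words, the Laurent series over
  multi-indices; the words with letter counts \<kappa> are exactly those summed in
  \<open>fueter_slice\<close>.\<close>

lemma sum_lists_by_count:
  fixes h :: "'i::finite list \<Rightarrow> 'w::comm_monoid_add"
  shows "(\<Sum>ls | length ls = k. h ls) = (\<Sum>\<kappa> | sum \<kappa> UNIV = k. \<Sum>ls | \<forall>l. count_list ls l = \<kappa> l. h ls)"
proof -
  have fin: "finite {ls :: 'i list. length ls = k}"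
    by (rule finite_subset [OF _ finite_lists_length_eq [of "UNIV :: 'i set" k]]) auto
  have len: "sum (count_list ls) UNIV = length ls" for ls :: "'i list"
    by (rule sum_count_set) auto
  have "(\<Sum>ls | length ls = k. h ls) =
    (\<Sum>\<kappa> | sum \<kappa> UNIV = k. \<Sum>ls\<in>{ls \<in> {ls. length ls = k}. count_list ls = \<kappa>}. h ls)"
    by (rule sum.group [symmetric]) (use fin len finite_multi_indices in auto)
  also have "\<dots> = (\<Sum>\<kappa> | sum \<kappa> UNIV = k. \<Sum>ls | \<forall>l. count_list ls l = \<kappa> l. h ls)"
  proof (rule sum.cong [OF refl])
    fix \<kappa> :: "'i \<Rightarrow> nat" assume "\<kappa> \<in> {\<kappa>. sum \<kappa> UNIV = k}"
    then have "{ls \<in> {ls. length ls = k}. count_list ls = \<kappa>} = {ls. \<forall>l. count_list ls l = \<kappa> l}"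
      using len by (auto simp: fun_eq_iff) (metis ext len)
    then show "(\<Sum>ls\<in>{ls \<in> {ls. length ls = k}. count_list ls = \<kappa>}. h ls) = (\<Sum>ls | \<forall>l. count_list ls l = \<kappa> l. h ls)"
      by simp
  qed
  finally show ?thesis .
qed

lemma foldr_mult_left: "foldr (\<lambda>l w. z l * w) ls w = prod_list (map z ls) * (w :: 'w::monoid_mult)"
  by (induction ls) (auto simp: mult.assoc)

text \<open>The factor of the last letter is attached first, so the letters come out reversed. The
  set of words with given letter counts is closed under reversal, which later undoes this.\<close>

lemma foldr_mult_right: "foldr (\<lambda>l w. w * z l) ls w = (w :: 'w::monoid_mult) * prod_list (map z (rev ls))"
  by (induction ls arbitrary: w) (auto simp: mult.assoc)

lemma iter_deriv_slice_kernel_left: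
  fixes y v :: "'i::{finite,linorder} slice" and \<eta> :: "real ^ 'j::{finite,linorder}"
  assumes "y \<noteq> 0" "\<eta> \<in> sphere 0 1"
  shows "iter_deriv (replicate k v) (slice_kernel \<eta>) y =
    fact k *\<^sub>R (\<Sum>\<kappa> | sum \<kappa> UNIV = k. fueter_slice \<eta> \<kappa> v * slice_multi_deriv \<kappa> (slice_kernel \<eta>) y)"
proof -
  let ?z = "\<lambda>l. (fst v $ l) *\<^sub>R 1 + snd v *\<^sub>R (im_vec \<eta> * e_vec l) :: ('i, 'j) cl"
  let ?E = "slice_kernel \<eta> :: 'i slice \<Rightarrow> ('i, 'j) cl"
  note sm = smooth_off0_slice_kernel [of \<eta>, where 'i = 'i]
  have "iter_deriv (replicate k v) ?E y =
     (\<Sum>ls | length ls = k. foldr (\<lambda>l w. ?z l * w) ls (iter_deriv (map (\<lambda>l. (axis l 1, 0)) ls) ?E y))"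
    by (rule iter_deriv_replicate_expand [OF sm _ _ assms(1)])
      (auto intro!: linearI slice_kernel_directional_deriv_left [OF _ assms(2)] simp: distrib_left)
  also have "\<dots> = (\<Sum>\<kappa> | sum \<kappa> UNIV = k. \<Sum>ls | \<forall>l. count_list ls l = \<kappa> l.
      prod_list (map ?z ls) * iter_deriv (map (\<lambda>l. (axis l 1, 0)) ls) ?E y)"
    unfolding foldr_mult_left by (rule sum_lists_by_count)
  also have "\<dots> = (\<Sum>\<kappa> | sum \<kappa> UNIV = k. fact k *\<^sub>R (fueter_slice \<eta> \<kappa> v * slice_multi_deriv \<kappa> ?E y))"
  proof (rule sum.cong [OF refl])
    fix \<kappa> :: "'i \<Rightarrow> nat" assume \<kappa>: "\<kappa> \<in> {\<kappa>. sum \<kappa> UNIV = k}"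
    have "(\<Sum>ls | \<forall>l. count_list ls l = \<kappa> l. prod_list (map ?z ls) * iter_deriv (map (\<lambda>l. (axis l 1, 0)) ls) ?E y)
      = (\<Sum>ls | \<forall>l. count_list ls l = \<kappa> l. prod_list (map ?z ls) * slice_multi_deriv \<kappa> ?E y)"
      by (intro sum.cong refl arg_cong2 [where f = "(*)"] iter_deriv_eq_slice_multi_deriv [OF sm assms(1)]) simp
    also have "\<dots> = (\<Sum>ls | \<forall>l. count_list ls l = \<kappa> l. prod_list (map ?z ls)) * slice_multi_deriv \<kappa> ?E y"
      by (simp only: sum_distrib_right)
    also have "(\<Sum>ls | \<forall>l. count_list ls l = \<kappa> l. prod_list (map ?z ls)) = fact k *\<^sub>R fueter_slice \<eta> \<kappa> v"
      using \<kappa> by (simp add: fueter_slice_def)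
    finally show "(\<Sum>ls | \<forall>l. count_list ls l = \<kappa> l. prod_list (map ?z ls) * iter_deriv (map (\<lambda>l. (axis l 1, 0)) ls) ?E y)
      = fact k *\<^sub>R (fueter_slice \<eta> \<kappa> v * slice_multi_deriv \<kappa> ?E y)" by simp
  qed
  finally show ?thesis by (simp add: scaleR_sum_right)
qed

lemma iter_deriv_slice_kernel_right:
  fixes y v :: "'i::{finite,linorder} slice" and \<eta> :: "real ^ 'j::{finite,linorder}"
  assumes "y \<noteq> 0" "\<eta> \<in> sphere 0 1"
  shows "iter_deriv (replicate k v) (slice_kernel \<eta>) y =
    fact k *\<^sub>R (\<Sum>\<kappa> | sum \<kappa> UNIV = k. slice_multi_deriv \<kappa> (slice_kernel \<eta>) y * fueter_slice_right \<eta> \<kappa> v)"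
proof -
  let ?z = "\<lambda>l. (fst v $ l) *\<^sub>R 1 + snd v *\<^sub>R (e_vec l * im_vec \<eta>) :: ('i, 'j) cl"
  let ?E = "slice_kernel \<eta> :: 'i slice \<Rightarrow> ('i, 'j) cl"
  note sm = smooth_off0_slice_kernel [of \<eta>, where 'i = 'i]
  have "iter_deriv (replicate k v) ?E y =
     (\<Sum>ls | length ls = k. foldr (\<lambda>l w. w * ?z l) ls (iter_deriv (map (\<lambda>l. (axis l 1, 0)) ls) ?E y))"
    by (rule iter_deriv_replicate_expand [OF sm _ _ assms(1)])
      (auto intro!: linearI slice_kernel_directional_deriv_right [OF _ assms(2)] simp: distrib_right)
  also have "\<dots> = (\<Sum>\<kappa> | sum \<kappa> UNIV = k. \<Sum>ls | \<forall>l. count_list ls l = \<kappa> l.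
      iter_deriv (map (\<lambda>l. (axis l 1, 0)) ls) ?E y * prod_list (map ?z (rev ls)))"
    unfolding foldr_mult_right by (rule sum_lists_by_count)
  also have "\<dots> = (\<Sum>\<kappa> | sum \<kappa> UNIV = k. fact k *\<^sub>R (slice_multi_deriv \<kappa> ?E y * fueter_slice_right \<eta> \<kappa> v))"
  proof (rule sum.cong [OF refl])
    fix \<kappa> :: "'i \<Rightarrow> nat" assume \<kappa>: "\<kappa> \<in> {\<kappa>. sum \<kappa> UNIV = k}"
    have "(\<Sum>ls | \<forall>l. count_list ls l = \<kappa> l. iter_deriv (map (\<lambda>l. (axis l 1, 0)) ls) ?E y * prod_list (map ?z (rev ls)))
      = (\<Sum>ls | \<forall>l. count_list ls l = \<kappa> l. slice_multi_deriv \<kappa> ?E y * prod_list (map ?z (rev ls)))"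
      by (intro sum.cong refl arg_cong2 [where f = "(*)"] iter_deriv_eq_slice_multi_deriv [OF sm assms(1)]) simp
    also have "\<dots> = slice_multi_deriv \<kappa> ?E y * (\<Sum>ls | \<forall>l. count_list ls l = \<kappa> l. prod_list (map ?z (rev ls)))"
      by (simp only: sum_distrib_left)
    also have "(\<Sum>ls | \<forall>l. count_list ls l = \<kappa> l. prod_list (map ?z (rev ls))) =
        (\<Sum>ls | \<forall>l. count_list ls l = \<kappa> l. prod_list (map ?z ls))"
      by (rule sum.reindex_bij_witness [of _ rev rev]) (auto simp: count_list_rev)
    also have "\<dots> = fact k *\<^sub>R fueter_slice_right \<eta> \<kappa> v"
      using \<kappa> by (simp add: fueter_slice_right_def)
    finally show "(\<Sum>ls | \<forall>l. count_list ls l = \<kappa> l. iter_deriv (map (\<lambda>l. (axis l 1, 0)) ls) ?E y * prod_list (map ?z (rev ls)))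
      = fact k *\<^sub>R (slice_multi_deriv \<kappa> ?E y * fueter_slice_right \<eta> \<kappa> v)" by simp
  qed
  finally show ?thesis by (simp add: scaleR_sum_right)
qed

lemma directional_deriv_slice_point:
  "directional_deriv (axis i 1, 0) g (slice_point \<eta> y) = directional_deriv (axis i 1, 0) (\<lambda>y. g (slice_point \<eta> y)) y"
  unfolding directional_deriv_def by (simp add: slice_point_def)

text \<open>Derivatives in x_0, ..., x_p stay inside every slice, so they commute with the
  restriction to it.\<close>

lemma multi_deriv_slice_point:
  fixes g :: "('i::{finite,linorder}, 'j::{finite,linorder}) point \<Rightarrow> 'w::euclidean_space"
  shows "multi_deriv \<kappa> g (slice_point \<eta> y) = slice_multi_deriv \<kappa> (\<lambda>y. g (slice_point \<eta> y)) y"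
proof -
  have 1: "(\<lambda>y. (directional_deriv (axis i 1, 0) ^^ k) g (slice_point \<eta> y)) = (directional_deriv (axis i 1, 0) ^^ k) (\<lambda>y. g (slice_point \<eta> y))"
    for i :: 'i and k and g :: "('i, 'j) point \<Rightarrow> 'w"
    by (induction k) (auto simp: directional_deriv_slice_point)
  have "(\<lambda>y. foldr (\<lambda>i. directional_deriv (axis i 1, 0) ^^ \<kappa> i) xs g (slice_point \<eta> y)) =
      foldr (\<lambda>i. directional_deriv (axis i 1, 0) ^^ \<kappa> i) xs (\<lambda>y. g (slice_point \<eta> y))" for xs
    by (induction xs) (auto simp: 1)
  from fun_cong [OF this] show ?thesis
    unfolding multi_deriv_def slice_multi_deriv_def .
qed

lemma kernel_deriv_slice_eq:
  assumes "\<eta> \<in> sphere 0 1"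
  shows "kernel_deriv_slice \<eta> \<kappa> y = (- 1) ^ sum \<kappa> UNIV *\<^sub>R slice_multi_deriv \<kappa> (slice_kernel \<eta>) y"
  unfolding kernel_deriv_slice_def multi_deriv_slice_point cauchy_kernel_slice_point [OF assms] ..

text \<open>The component of degree \<open>k\<close> in \<open>x\<close> of \<open>E(y - x)\<close>.\<close>

definition kernel_term ::
  "real ^ 'j::{finite,linorder} \<Rightarrow> nat \<Rightarrow> 'i slice \<Rightarrow> 'i slice \<Rightarrow> ('i::{finite,linorder}, 'j) cl" where
  "kernel_term \<eta> k x y = (1 / fact k) *\<^sub>R iter_deriv (replicate k (- x)) (slice_kernel \<eta>) y"

text \<open>The sign (-1)^k from the direction -x is the one built into Q. With the polynomial in
  front, integrating over \<open>y\<close> leaves P on the left of the coefficient a, as the regular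
  part of the series requires.\<close>

lemma kernel_term_left:
  fixes x y :: "'i::{finite,linorder} slice" and \<eta> :: "real ^ 'j::{finite,linorder}"
  assumes "y \<noteq> 0" "\<eta> \<in> sphere 0 1"
  shows "kernel_term \<eta> k x y = (\<Sum>\<kappa> | sum \<kappa> UNIV = k. fueter_slice \<eta> \<kappa> x * kernel_deriv_slice \<eta> \<kappa> y)"
proof -
  have "iter_deriv (replicate k (- x)) (slice_kernel \<eta>) y = (- 1) ^ k *\<^sub>R iter_deriv (replicate k x) (slice_kernel \<eta>) y"
    using iter_deriv_replicate_scaleR [OF smooth_off0_slice_kernel [of \<eta>] assms(1), of k "- 1" x] by simp
  then show ?thesis
    by (auto simp: kernel_term_def iter_deriv_slice_kernel_left [OF assms] kernel_deriv_slice_eq [OF assms(2)]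
      scaleR_sum_right intro!: sum.cong)
qed

text \<open>The form for the principal part: there the integration variable takes the place of
  \<open>x\<close>, and Q, which depends on the other variable, has to come out on the left of the
  coefficient b.\<close>

lemma kernel_term_right:
  fixes x y :: "'i::{finite,linorder} slice" and \<eta> :: "real ^ 'j::{finite,linorder}"
  assumes "y \<noteq> 0" "\<eta> \<in> sphere 0 1"
  shows "kernel_term \<eta> k x y = (\<Sum>\<kappa> | sum \<kappa> UNIV = k. kernel_deriv_slice \<eta> \<kappa> y * fueter_slice_right \<eta> \<kappa> x)"
proof -
  have "iter_deriv (replicate k (- x)) (slice_kernel \<eta>) y = (- 1) ^ k *\<^sub>R iter_deriv (replicate k x) (slice_kernel \<eta>) y"
    using iter_deriv_replicate_scaleR [OF smooth_off0_slice_kernel [of \<eta>] assms(1), of k "- 1" x] by simp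
  then show ?thesis
    by (auto simp: kernel_term_def iter_deriv_slice_kernel_right [OF assms] kernel_deriv_slice_eq [OF assms(2)]
      scaleR_sum_right intro!: sum.cong)
qed

lemma kernel_term_scaleR:
  fixes x y :: "'i::{finite,linorder} slice" and \<eta> :: "real ^ 'j::{finite,linorder}"
  assumes "y \<noteq> 0"
  shows "kernel_term \<eta> k (s *\<^sub>R x) y = s ^ k *\<^sub>R kernel_term \<eta> k x y"
  using iter_deriv_replicate_scaleR [OF smooth_off0_slice_kernel [of \<eta>] assms, of k s "- x"]
  by (simp add: kernel_term_def)

lemma continuous_on_kernel_term: "0 \<notin> S \<Longrightarrow> continuous_on S (kernel_term \<eta> k x)"
  unfolding kernel_term_def
  by (intro continuous_intros continuous_on_smooth_off0 smooth_off0_iter_deriv smooth_off0_slice_kernel)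

section \<open>Power series expansion of the Cauchy kernel\<close>

lemma diffs_funpow:
  fixes c :: "nat \<Rightarrow> real"
  shows "(diffs ^^ k) c j = (fact (j + k) / fact j) * c (j + k)"
proof (induction k arbitrary: j)
  case (Suc k)
  have "(diffs ^^ Suc k) c j = real (Suc j) * ((diffs ^^ k) c (Suc j))"
    by (simp add: diffs_def)
  also have "\<dots> = (fact (j + Suc k) / fact j) * c (j + Suc k)"
    unfolding Suc.IH by (simp add: field_simps del: of_nat_Suc)
  finally show ?case .
qed simp

text \<open>Termwise differentiation, k times. The derivatives enter as a chain \<open>F\<close>
  because the iterated directional derivatives of the kernel form such a chain along a line.\<close>

lemma powser_coeffs_from_derivs:
  fixes F :: "nat \<Rightarrow> real \<Rightarrow> real" and c :: "nat \<Rightarrow> real"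
  assumes r: "r > 0"
    and d: "\<And>k s. \<bar>s\<bar> < r \<Longrightarrow> (F k has_real_derivative F (Suc k) s) (at s)"
    and s0: "\<And>s. \<bar>s\<bar> < r \<Longrightarrow> (\<lambda>j. c j * s ^ j) sums F 0 s"
  shows "F k 0 = fact k * c k"
proof -
  have "(\<lambda>j. (diffs ^^ k) c j * s ^ j) sums F k s" if "\<bar>s\<bar> < r" for s
    using that
  proof (induction k arbitrary: s)
    case 0
    then show ?case using s0 by simp
  next
    case (Suc k)
    let ?C = "(diffs ^^ k) c"
    obtain K where K: "\<bar>s\<bar> < K" "K < r" using dense [OF Suc.prems] by blast
    have summ: "summable (\<lambda>j. ?C j * t ^ j)" if "\<bar>t\<bar> < r" for t
      using Suc.IH [OF that] by (rule sums_summable)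
    have 1: "((\<lambda>x. \<Sum>j. ?C j * x ^ j) has_real_derivative (\<Sum>j. diffs ?C j * s ^ j)) (at s)"
      by (rule termdiffs_strong [of _ K]) (use summ [of K] K in auto)
    have "((\<lambda>x. \<Sum>j. ?C j * x ^ j) has_real_derivative F (Suc k) s) (at s)"
    proof (rule has_field_derivative_transform_within_open [OF d [OF Suc.prems], of "{- r<..<r}"])
      show "F k x = (\<Sum>j. ?C j * x ^ j)" if "x \<in> {- r<..<r}" for x
        using Suc.IH [of x] that by (simp add: sums_iff abs_less_iff)
    qed (use Suc.prems in auto)
    with 1 have "F (Suc k) s = (\<Sum>j. diffs ?C j * s ^ j)" using DERIV_unique by blast
    moreover have "summable (\<lambda>j. diffs ?C j * s ^ j)"
      by (rule termdiff_converges [of s r]) (use Suc.prems summ in auto)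
    ultimately show ?case by (simp add: summable_sums)
  qed
  from this [of 0] have "(\<lambda>j. (diffs ^^ k) c j * 0 ^ j) sums F k 0" using r by simp
  then have "F k 0 = (diffs ^^ k) c 0"
    using powser_sums_zero [of "(diffs ^^ k) c"] sums_unique2 by blast
  then show ?thesis by (simp add: diffs_funpow)
qed

text \<open>
  Gegenbauer expansion: \<open>|y - s x|\<^sup>2 = |y|\<^sup>2 |1 - s \<zeta>|\<^sup>2\<close> for a complex number \<open>\<zeta>\<close> of modulus \<open>|x| / |y|\<close>,
  and \<open>|1 - s \<zeta>|\<^sup>-\<^sup>n\<close> is the square of the modulus of a binomial series.
\<close>

lemma inverse_norm_powser:
  "\<exists>\<gamma> :: nat \<Rightarrow> real. (\<forall>k. \<gamma> k \<ge> 0) \<and> (\<forall>q. 0 \<le> q \<longrightarrow> q < 1 \<longrightarrow> summable (\<lambda>k. \<gamma> k * q ^ k)) \<and>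
    (\<forall>x y :: 'v::euclidean_space. y \<noteq> 0 \<longrightarrow>
      (\<exists>c. (\<forall>s. \<bar>s\<bar> * norm x < norm y \<longrightarrow> (\<lambda>k. c k * s ^ k) sums (1 / norm (y - s *\<^sub>R x) ^ n))
        \<and> (\<forall>k. \<bar>c k\<bar> \<le> \<gamma> k * (norm x / norm y) ^ k / norm y ^ n)))"
proof -
  \<comment> \<open>The power -n of a modulus splits into a complex power and its conjugate, which
    halves the exponent.\<close>
  define a where "a = - complex_of_real (real n / 2)"
  define d where "d k = (a gchoose k)" for k
  \<comment> \<open>Coefficients of the square of the series with coefficients |d k|. Apart from
    explicit powers of the norms they bound the expansion coefficients for all \<open>x\<close> and
    \<open>y\<close> at once.\<close>
  define \<gamma> where "\<gamma> k = (\<Sum>i\<le>k. norm (d i) * norm (d (k - i)))" for k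
  have binom: "(\<lambda>k. d k * w ^ k) sums (1 + w) powr a" if "norm w < 1" for w
    using gen_binomial_complex [OF that, of a] by (simp add: d_def)
  have abs: "summable (\<lambda>k. norm (d k * w ^ k))" if w: "norm w < 1" for w
  proof -
    obtain K where K: "norm w < K" "K < 1" using dense [OF w] by blast
    have "K \<ge> 0" using K(1) norm_ge_zero [of w] by linarith
    then have "norm (complex_of_real K) = K" by simp
    then show ?thesis
      using powser_insidea [OF sums_summable [OF binom [of "complex_of_real K"]], of w] K by simp
  qed
  show ?thesis
  proof (rule exI [of _ \<gamma>], intro conjI allI impI)
    show "\<gamma> k \<ge> 0" for k unfolding \<gamma>_def by (intro sum_nonneg) auto
  next
    fix q :: real assume q: "0 \<le> q" "q < 1"
    have s: "summable (\<lambda>k. norm (d k) * q ^ k)"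
      using abs [of "complex_of_real q"] q by (simp add: norm_mult norm_power)
    then have "summable (\<lambda>k. \<Sum>i\<le>k. (norm (d i) * q ^ i) * (norm (d (k - i)) * q ^ (k - i)))"
      using q by (intro summable_Cauchy_product) (auto simp: abs_mult)
    moreover have "(\<Sum>i\<le>k. (norm (d i) * q ^ i) * (norm (d (k - i)) * q ^ (k - i))) = \<gamma> k * q ^ k" for k
      unfolding \<gamma>_def sum_distrib_right
    proof (rule sum.cong [OF refl])
      fix i assume "i \<in> {..k}"
      then have "q ^ i * q ^ (k - i) = q ^ k" by (simp flip: power_add)
      then show "norm (d i) * q ^ i * (norm (d (k - i)) * q ^ (k - i)) = norm (d i) * norm (d (k - i)) * q ^ k"
        by (metis (no_types, opaque_lifting) mult.assoc mult.left_commute)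
    qed
    ultimately show "summable (\<lambda>k. \<gamma> k * q ^ k)" by simp
  next
    fix x y :: 'v assume y: "y \<noteq> 0"
    define q where "q = norm x / norm y"
    define u where "u = x \<bullet> y / (norm y)\<^sup>2"
    have uq: "u\<^sup>2 \<le> q\<^sup>2"
    proof -
      have "\<bar>x \<bullet> y\<bar> \<le> norm x * norm y" by (rule Cauchy_Schwarz_ineq2)
      then have "\<bar>u\<bar> \<le> q" using y by (simp add: u_def q_def abs_mult power2_eq_square field_simps)
      then show ?thesis by (meson abs_le_square_iff abs_of_nonneg order_trans abs_ge_self abs_le_square_iff power2_abs)
    qed
    \<comment> \<open>The real part makes |1 - s \<zeta>|^2 match the inner product, the imaginary
      part fixes the modulus \<open>q\<close>; the root is real by Cauchy-Schwarz.\<close>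
    define \<zeta> where "\<zeta> = Complex u (sqrt (q\<^sup>2 - u\<^sup>2))"
    have q0: "q \<ge> 0" by (simp add: q_def)
    have n\<zeta>: "norm \<zeta> = q" using uq q0 by (simp add: \<zeta>_def cmod_def)
    define t where "t k = (\<Sum>i\<le>k. d i * (- \<zeta>) ^ i * cnj (d (k - i) * (- \<zeta>) ^ (k - i)))" for k
    define c where "c k = Re (t k) / norm y ^ n" for k
    have "\<bar>c k\<bar> \<le> \<gamma> k * (norm x / norm y) ^ k / norm y ^ n" for k
    proof -
      have "\<bar>Re (t k)\<bar> \<le> norm (t k)" by (rule abs_Re_le_cmod)
      also have "\<dots> \<le> (\<Sum>i\<le>k. norm (d i * (- \<zeta>) ^ i * cnj (d (k - i) * (- \<zeta>) ^ (k - i))))"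
        unfolding t_def by (rule norm_sum)
      also have "\<dots> = \<gamma> k * q ^ k"
        unfolding \<gamma>_def sum_distrib_right
      proof (rule sum.cong [OF refl])
        fix i assume "i \<in> {..k}"
        then have "q ^ i * q ^ (k - i) = q ^ k" by (simp flip: power_add)
        moreover have "norm (d i * (- \<zeta>) ^ i * cnj (d (k - i) * (- \<zeta>) ^ (k - i))) =
            norm (d i) * norm (d (k - i)) * (q ^ i * q ^ (k - i))"
          by (simp add: norm_mult norm_power n\<zeta> mult_ac del: complex_cnj_mult)
        ultimately show "norm (d i * (- \<zeta>) ^ i * cnj (d (k - i) * (- \<zeta>) ^ (k - i))) = norm (d i) * norm (d (k - i)) * q ^ k"
          by simp
      qed
      finally show ?thesis
        by (simp add: c_def q_def divide_right_mono)
    qed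
    moreover have "(\<lambda>k. c k * s ^ k) sums (1 / norm (y - s *\<^sub>R x) ^ n)" if s: "\<bar>s\<bar> * norm x < norm y" for s
    proof -
      define w where "w = - complex_of_real s * \<zeta>"
      have "norm w = \<bar>s\<bar> * q" by (simp add: w_def norm_mult n\<zeta>)
      then have w: "norm w < 1" using s y by (simp add: q_def)
      have w1: "norm (1 + w) > 0"
      proof -
        have "norm (1 + w) \<ge> 1 - norm w" using norm_triangle_ineq2 [of 1 "- w"] by simp
        with w show ?thesis by linarith
      qed
      have sq: "(norm (y - s *\<^sub>R x))\<^sup>2 = (norm y)\<^sup>2 * (norm (1 + w))\<^sup>2"
      proof -
        have "(norm (1 + w))\<^sup>2 = (1 - s * u)\<^sup>2 + s\<^sup>2 * (q\<^sup>2 - u\<^sup>2)"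
          using uq unfolding cmod_power2 by (simp add: w_def \<zeta>_def power_mult_distrib)
        also have "\<dots> = 1 - 2 * s * u + s\<^sup>2 * q\<^sup>2" by (simp add: power2_eq_square algebra_simps)
        finally have W: "(norm (1 + w))\<^sup>2 = 1 - 2 * s * u + s\<^sup>2 * q\<^sup>2" .
        have "(norm y)\<^sup>2 * (norm (1 + w))\<^sup>2 = (norm y)\<^sup>2 - 2 * s * ((norm y)\<^sup>2 * u) + s\<^sup>2 * ((norm y)\<^sup>2 * q\<^sup>2)"
          unfolding W by (simp add: algebra_simps)
        also have "(norm y)\<^sup>2 * u = x \<bullet> y" using y by (simp add: u_def)
        also have "(norm y)\<^sup>2 * q\<^sup>2 = (norm x)\<^sup>2" using y by (simp add: q_def power_divide)
        finally have "(norm y)\<^sup>2 * (norm (1 + w))\<^sup>2 = (norm y)\<^sup>2 - 2 * s * (x \<bullet> y) + s\<^sup>2 * (norm x)\<^sup>2" .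
        also have "\<dots> = (norm (y - s *\<^sub>R x))\<^sup>2"
          unfolding power2_norm_eq_inner by (simp add: inner_simps inner_commute power2_eq_square algebra_simps)
        finally show ?thesis ..
      qed
      then have nn: "norm (y - s *\<^sub>R x) = norm y * norm (1 + w)"
        by (metis norm_ge_zero power2_eq_imp_eq power_mult_distrib zero_le_mult_iff)
      let ?S = "(1 + w) powr a"
      have S: "(\<lambda>k. d k * w ^ k) sums ?S" by (rule binom [OF w])
      then have cS: "(\<lambda>k. cnj (d k * w ^ k)) sums cnj ?S" by (simp only: sums_cnj)
      have "(\<lambda>k. \<Sum>i\<le>k. d i * w ^ i * cnj (d (k - i) * w ^ (k - i))) sums ((\<Sum>k. d k * w ^ k) * (\<Sum>k. cnj (d k * w ^ k)))"
        by (rule Cauchy_product_sums) (use abs [OF w] in \<open>simp_all only: complex_mod_cnj\<close>)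
      then have "(\<lambda>k. \<Sum>i\<le>k. d i * w ^ i * cnj (d (k - i) * w ^ (k - i))) sums (?S * cnj ?S)"
        using S cS by (simp only: sums_iff)
      moreover have "(\<Sum>i\<le>k. d i * w ^ i * cnj (d (k - i) * w ^ (k - i))) = complex_of_real (s ^ k) * t k" for k
        unfolding t_def sum_distrib_left
      proof (rule sum.cong [OF refl])
        fix i assume "i \<in> {..k}"
        then have "complex_of_real (s ^ k) = complex_of_real (s ^ i) * complex_of_real (s ^ (k - i))"
          by (simp flip: power_add of_real_mult)
        moreover have "w ^ j = complex_of_real (s ^ j) * (- \<zeta>) ^ j" for j
          by (simp only: w_def of_real_power minus_mult_left [symmetric] mult_minus_right [symmetric] power_mult_distrib)
        ultimately show "d i * w ^ i * cnj (d (k - i) * w ^ (k - i)) =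
            complex_of_real (s ^ k) * (d i * (- \<zeta>) ^ i * cnj (d (k - i) * (- \<zeta>) ^ (k - i)))"
          by (simp add: mult_ac)
      qed
      ultimately have "(\<lambda>k. complex_of_real (s ^ k) * t k) sums (?S * cnj ?S)" by simp
      from sums_Re [OF this] have "(\<lambda>k. s ^ k * Re (t k)) sums Re (?S * cnj ?S)" by simp
      also have "Re (?S * cnj ?S) = 1 / norm (1 + w) ^ n"
      proof -
        have "norm ?S = norm (1 + w) powr (- real n / 2)"
          using norm_powr_real_powr' [of a "1 + w"] by (simp add: a_def)
        then have "(norm ?S)\<^sup>2 = norm (1 + w) powr (- real n)"
          using w1 by (simp add: power2_eq_square flip: powr_add)
        also have "\<dots> = 1 / norm (1 + w) ^ n"
          using w1 by (simp add: powr_minus_divide powr_realpow)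
        finally show ?thesis by (simp add: complex_mult_cnj cmod_power2)
      qed
      finally have "(\<lambda>k. s ^ k * Re (t k) / norm y ^ n) sums (1 / norm (1 + w) ^ n / norm y ^ n)"
        by (rule sums_divide)
      then show ?thesis by (simp add: c_def nn power_mult_distrib mult.commute)
    qed
    ultimately show "\<exists>c. (\<forall>s. \<bar>s\<bar> * norm x < norm y \<longrightarrow> (\<lambda>k. c k * s ^ k) sums (1 / norm (y - s *\<^sub>R x) ^ n))
      \<and> (\<forall>k. \<bar>c k\<bar> \<le> \<gamma> k * (norm x / norm y) ^ k / norm y ^ n)"
      by blast
  qed
qed

text \<open>Multiplying the Gegenbauer series by the conjugate of y - s x gives a power series in s
  for E(y - s x). Its coefficients are the kernel terms, both being determined by the derivatives at
  s = 0, and they inherit a bound through |x|/|y| and a power of |y|.\<close>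

lemma slice_kernel_powser:
  fixes \<eta> :: "real ^ 'j::{finite,linorder}"
  shows "\<exists>\<Gamma> :: nat \<Rightarrow> real. (\<forall>k. \<Gamma> k \<ge> 0) \<and> (\<forall>q. 0 \<le> q \<longrightarrow> q < 1 \<longrightarrow> summable (\<lambda>k. \<Gamma> k * q ^ k)) \<and>
    (\<forall>(x :: 'i::{finite,linorder} slice) y k. y \<noteq> 0 \<longrightarrow>
      norm (kernel_term \<eta> k x y) \<le> \<Gamma> k * (norm x / norm y) ^ k / norm y ^ CARD('i)) \<and>
    (\<forall>(x :: 'i slice) y. norm x < norm y \<longrightarrow> (\<lambda>k. kernel_term \<eta> k x y) sums slice_kernel \<eta> (y - x))"
proof -
  define n where "n = CARD('i) + 1"
  define \<sigma> where "\<sigma> = sphere_area TYPE('i)"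
  have \<sigma>: "\<sigma> > 0" unfolding \<sigma>_def by (rule sphere_area_pos)
  obtain \<gamma> :: "nat \<Rightarrow> real" where \<gamma>0: "\<And>k. \<gamma> k \<ge> 0"
    and \<gamma>s: "\<And>q. 0 \<le> q \<Longrightarrow> q < 1 \<Longrightarrow> summable (\<lambda>k. \<gamma> k * q ^ k)"
    and \<gamma>: "\<And>x y :: 'i slice. y \<noteq> 0 \<Longrightarrow> \<exists>c. (\<forall>s. \<bar>s\<bar> * norm x < norm y \<longrightarrow> (\<lambda>k. c k * s ^ k) sums (1 / norm (y - s *\<^sub>R x) ^ n))
      \<and> (\<forall>k. \<bar>c k\<bar> \<le> \<gamma> k * (norm x / norm y) ^ k / norm y ^ n)"
    using inverse_norm_powser [where 'v = "'i slice" and n = n] by blast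
  obtain K where K: "K > 0" "\<And>z. norm (slice_conj \<eta> z :: ('i, 'j) cl) \<le> norm z * K"
    using bounded_linear.pos_bounded [OF linear_slice_conj [unfolded linear_conv_bounded_linear]] by blast
  \<comment> \<open>The conjugate of y - s x has a constant and a linear part in s. The linear part
    shifts the index, whence the preceding coefficient, which is 0 for k = 0.\<close>
  define \<Gamma> where "\<Gamma> k = K / \<sigma> * (\<gamma> k + (case k of 0 \<Rightarrow> 0 | Suc j \<Rightarrow> \<gamma> j))" for k
  have main: "norm (kernel_term \<eta> k x y) \<le> \<Gamma> k * (norm x / norm y) ^ k / norm y ^ CARD('i)"
      "norm x < norm y \<Longrightarrow> (\<lambda>k. kernel_term \<eta> k x y) sums slice_kernel \<eta> (y - x)"
    if y: "y \<noteq> 0" for x y :: "'i slice" and k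
  proof -
    obtain c where c: "\<And>s. \<bar>s\<bar> * norm x < norm y \<Longrightarrow> (\<lambda>k. c k * s ^ k) sums (1 / norm (y - s *\<^sub>R x) ^ n)"
      and cb: "\<And>k. \<bar>c k\<bar> \<le> \<gamma> k * (norm x / norm y) ^ k / norm y ^ n"
      using \<gamma> [OF y, of x] by blast
    define c' where "c' k = (case k of 0 \<Rightarrow> 0 | Suc j \<Rightarrow> c j)" for k
    define C where "C k = (1 / \<sigma>) *\<^sub>R (c k *\<^sub>R slice_conj \<eta> y - c' k *\<^sub>R slice_conj \<eta> x)" for k
    have sums: "(\<lambda>k. s ^ k *\<^sub>R C k) sums slice_kernel \<eta> (y - s *\<^sub>R x)" if s: "\<bar>s\<bar> * norm x < norm y" for s
    proof -
      let ?A = "1 / norm (y - s *\<^sub>R x) ^ n"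
      have 1: "(\<lambda>k. (c k * s ^ k) *\<^sub>R slice_conj \<eta> y) sums (?A *\<^sub>R slice_conj \<eta> y)"
        by (rule sums_scaleR_left [OF c [OF s]])
      have "(\<lambda>k. (c k * s ^ k * s) *\<^sub>R slice_conj \<eta> x) sums ((?A * s) *\<^sub>R slice_conj \<eta> x)"
        by (rule sums_scaleR_left [OF sums_mult2 [OF c [OF s]]])
      then have "(\<lambda>k. (c' (Suc k) * s ^ Suc k) *\<^sub>R slice_conj \<eta> x) sums ((?A * s) *\<^sub>R slice_conj \<eta> x)"
        by (simp add: c'_def mult_ac)
      then have 2: "(\<lambda>k. (c' k * s ^ k) *\<^sub>R slice_conj \<eta> x) sums ((?A * s) *\<^sub>R slice_conj \<eta> x)"
        by (subst (asm) sums_Suc_iff) (simp add: c'_def)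
      have "(\<lambda>k. (1 / \<sigma>) *\<^sub>R ((c k * s ^ k) *\<^sub>R slice_conj \<eta> y - (c' k * s ^ k) *\<^sub>R slice_conj \<eta> x))
          sums ((1 / \<sigma>) *\<^sub>R (?A *\<^sub>R slice_conj \<eta> y - (?A * s) *\<^sub>R slice_conj \<eta> x))"
        by (intro sums_scaleR_right sums_diff 1 2)
      moreover have "(1 / \<sigma>) *\<^sub>R (?A *\<^sub>R slice_conj \<eta> y - (?A * s) *\<^sub>R slice_conj \<eta> x) = slice_kernel \<eta> (y - s *\<^sub>R x)"
        unfolding slice_kernel_def \<sigma>_def [symmetric] n_def [symmetric]
        by (simp add: linear_diff [OF linear_slice_conj] slice_conj_scaleR scaleR_diff_right)
      moreover have "(1 / \<sigma>) *\<^sub>R ((c k * s ^ k) *\<^sub>R slice_conj \<eta> y - (c' k * s ^ k) *\<^sub>R slice_conj \<eta> x) = s ^ k *\<^sub>R C k" for k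
        by (simp add: C_def scaleR_diff_right mult_ac)
      ultimately show ?thesis by simp
    qed
    let ?E = "slice_kernel \<eta> :: 'i slice \<Rightarrow> ('i, 'j) cl"
    note sm = smooth_off0_slice_kernel [of \<eta>, where 'i = 'i]
    have kC: "kernel_term \<eta> k x y = C k" for k
    proof (rule euclidean_eqI)
      fix b :: "('i, 'j) cl"
      \<comment> \<open>A radius within |y|/|x| that makes sense for x = 0 as well.\<close>
      define r where "r = norm y / (norm x + 1)"
      have x1: "norm x + 1 > 0" by (simp add: add_nonneg_pos)
      have r: "r > 0" using y x1 by (simp add: r_def)
      have sr: "\<bar>s\<bar> * norm x < norm y" if "\<bar>s\<bar> < r" for s
      proof -
        have "\<bar>s\<bar> * norm x \<le> \<bar>s\<bar> * (norm x + 1)" by (simp add: mult_left_mono)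
        also have "\<dots> < norm y" using that x1 by (simp add: r_def field_simps)
        finally show ?thesis .
      qed
      define F where "F k s = iter_deriv (replicate k (- x)) ?E (y + s *\<^sub>R (- x)) \<bullet> b" for k s
      have "F k 0 = fact k * (C k \<bullet> b)"
      proof (rule powser_coeffs_from_derivs [OF r])
        fix k :: nat and s :: real assume s: "\<bar>s\<bar> < r"
        have "norm (s *\<^sub>R x) < norm y" using sr [OF s] by simp
        then have ne: "y + s *\<^sub>R (- x) \<noteq> 0" by auto
        have "((\<lambda>t. iter_deriv (replicate k (- x)) ?E (y + t *\<^sub>R (- x))) has_vector_derivative
            directional_deriv (- x) (iter_deriv (replicate k (- x)) ?E) (y + s *\<^sub>R (- x))) (at s)"
          by (rule has_vector_derivative_line_shift [OF smooth_off0_has_vector_derivative [OF smooth_off0_iter_deriv [OF sm] ne]])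
        from bounded_linear.has_vector_derivative [OF bounded_linear_inner_left this]
        show "(F k has_real_derivative F (Suc k) s) (at s)"
          unfolding F_def has_real_derivative_iff_has_vector_derivative by simp
      next
        fix s :: real assume s: "\<bar>s\<bar> < r"
        from bounded_linear.sums [OF bounded_linear_inner_left sums [OF sr [OF s]], of b]
        show "(\<lambda>k. C k \<bullet> b * s ^ k) sums F 0 s"
          by (simp add: F_def mult.commute)
      qed
      then show "kernel_term \<eta> k x y \<bullet> b = C k \<bullet> b"
        by (simp add: kernel_term_def F_def)
    qed
    show "(\<lambda>k. kernel_term \<eta> k x y) sums slice_kernel \<eta> (y - x)" if "norm x < norm y"
      using sums [of 1] that by (simp add: kC)
    define q where "q = norm x / norm y"
    have q: "q \<ge> 0" by (simp add: q_def)
    have e1: "\<bar>c k\<bar> * norm y \<le> \<gamma> k * q ^ k / norm y ^ CARD('i)"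
    proof -
      have "\<bar>c k\<bar> * norm y \<le> \<gamma> k * q ^ k / norm y ^ n * norm y"
        using cb [of k] by (intro mult_right_mono) (simp_all add: q_def)
      also have "\<dots> = \<gamma> k * q ^ k / norm y ^ CARD('i)" using y by (simp add: n_def)
      finally show ?thesis .
    qed
    have e2: "\<bar>c' k\<bar> * norm x \<le> (case k of 0 \<Rightarrow> 0 | Suc j \<Rightarrow> \<gamma> j) * q ^ k / norm y ^ CARD('i)"
    proof (cases k)
      case (Suc j)
      have "\<bar>c j\<bar> * norm x \<le> \<gamma> j * q ^ j / norm y ^ n * norm x"
        using cb [of j] by (intro mult_right_mono) (simp_all add: q_def)
      also have "\<gamma> j * q ^ j / norm y ^ n * norm x = \<gamma> j * q ^ Suc j / norm y ^ CARD('i)"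
      proof -
        have nx: "norm x = q * norm y" using y by (simp add: q_def)
        show ?thesis unfolding nx using y by (simp add: n_def)
      qed
      finally show ?thesis by (simp add: c'_def Suc)
    qed (simp add: c'_def)
    have "norm (kernel_term \<eta> k x y) \<le> (1 / \<sigma>) * (\<bar>c k\<bar> * (norm y * K) + \<bar>c' k\<bar> * (norm x * K))"
    proof -
      have "norm (c k *\<^sub>R slice_conj \<eta> y - c' k *\<^sub>R slice_conj \<eta> x :: ('i, 'j) cl) \<le> \<bar>c k\<bar> * (norm y * K) + \<bar>c' k\<bar> * (norm x * K)"
        by (rule order_trans [OF norm_triangle_ineq4]) (auto intro!: add_mono mult_left_mono K)
      then show ?thesis
        unfolding kC C_def norm_scaleR using \<sigma> by (simp add: divide_right_mono)
    qed
    also have "\<dots> = K / \<sigma> * (\<bar>c k\<bar> * norm y + \<bar>c' k\<bar> * norm x)"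
      by (simp add: algebra_simps)
    also have "\<dots> \<le> K / \<sigma> * (\<gamma> k * q ^ k / norm y ^ CARD('i) + (case k of 0 \<Rightarrow> 0 | Suc j \<Rightarrow> \<gamma> j) * q ^ k / norm y ^ CARD('i))"
      using K \<sigma> by (intro mult_left_mono add_mono e1 e2) auto
    also have "\<dots> = \<Gamma> k * q ^ k / norm y ^ CARD('i)"
      by (simp add: \<Gamma>_def distrib_right distrib_left add_divide_distrib)
    finally show "norm (kernel_term \<eta> k x y) \<le> \<Gamma> k * (norm x / norm y) ^ k / norm y ^ CARD('i)"
      unfolding q_def .
  qed
  show ?thesis
  proof (rule exI [of _ \<Gamma>], intro conjI allI impI)
    show "\<Gamma> k \<ge> 0" for k
      unfolding \<Gamma>_def using K \<sigma> \<gamma>0 by (auto intro!: mult_nonneg_nonneg add_nonneg_nonneg split: nat.split)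
  next
    fix q :: real assume q: "0 \<le> q" "q < 1"
    have "summable (\<lambda>k. \<gamma> k * q ^ k * q)" using \<gamma>s [OF q] by (rule summable_mult2)
    then have "summable (\<lambda>k. (case Suc k of 0 \<Rightarrow> 0 | Suc j \<Rightarrow> \<gamma> j) * q ^ Suc k)" by (simp add: mult_ac)
    then have "summable (\<lambda>k. (case k of 0 \<Rightarrow> 0 | Suc j \<Rightarrow> \<gamma> j) * q ^ k)"
      using summable_Suc_iff [of "\<lambda>k. (case k of 0 \<Rightarrow> 0 | Suc j \<Rightarrow> \<gamma> j) * q ^ k"] by blast
    then have "summable (\<lambda>k. K / \<sigma> * (\<gamma> k * q ^ k + (case k of 0 \<Rightarrow> 0 | Suc j \<Rightarrow> \<gamma> j) * q ^ k))"
      by (intro summable_mult summable_add \<gamma>s q)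
    then show "summable (\<lambda>k. \<Gamma> k * q ^ k)"
      by (simp add: \<Gamma>_def distrib_right mult.assoc)
  next
    show "norm (kernel_term \<eta> k x y) \<le> \<Gamma> k * (norm x / norm y) ^ k / norm y ^ CARD('i)" if "y \<noteq> 0" for x y :: "'i slice" and k
      by (rule main(1) [OF that])
    show "(\<lambda>k. kernel_term \<eta> k x y) sums slice_kernel \<eta> (y - x)" if "norm x < norm y" for x y :: "'i slice"
      using that by (intro main(2)) auto
  qed
qed

section \<open>Boundary integrals of series\<close>

lemma bounded_linear_clifford_mult_left: "bounded_linear (\<lambda>x. c * (x :: 'g::{finite,linorder} clifford))"
  by (rule clifford_mult.bounded_linear_right)

lemma continuous_on_boundary_density:
  assumes "continuous_on (sphere 0 \<rho>) g" "continuous_on (sphere 0 \<rho>) h"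
  shows "continuous_on (sphere 0 \<rho>) (\<lambda>y. g y * slice_para \<eta> ((1 / \<rho>) *\<^sub>R y) * h y)"
  by (intro continuous_intros assms)

lemma boundary_integral_cong:
  "(\<And>y. norm y = \<rho> \<Longrightarrow> g y = g' y) \<Longrightarrow> (\<And>y. norm y = \<rho> \<Longrightarrow> h y = h' y) \<Longrightarrow>
    boundary_integral \<eta> \<rho> g h = boundary_integral \<eta> \<rho> g' h'"
  unfolding boundary_integral_def by (intro sphere_integral_cong) simp

lemma boundary_integral_sum:
  assumes "\<rho> > 0" "\<And>i. i \<in> I \<Longrightarrow> continuous_on (sphere 0 \<rho>) (g i)" "continuous_on (sphere 0 \<rho>) h"
  shows "boundary_integral \<eta> \<rho> (\<lambda>y. \<Sum>i\<in>I. g i y) h = (\<Sum>i\<in>I. boundary_integral \<eta> \<rho> (g i) h)"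
  unfolding boundary_integral_def sum_distrib_right
  by (intro sphere_integral_sum continuous_on_boundary_density assms)

lemma boundary_integral_mult_left:
  assumes "\<rho> > 0" "continuous_on (sphere 0 \<rho>) g" "continuous_on (sphere 0 \<rho>) h"
  shows "boundary_integral \<eta> \<rho> (\<lambda>y. c * g y) h = c * boundary_integral \<eta> \<rho> g h"
  unfolding boundary_integral_def mult.assoc
  by (rule sphere_integral_linear [OF bounded_linear_clifford_mult_left assms(1)])
    (use continuous_on_boundary_density [OF assms(2,3)] in \<open>simp add: mult.assoc\<close>)

lemma boundary_integral_scaleR:
  assumes "\<rho> > 0" "continuous_on (sphere 0 \<rho>) g" "continuous_on (sphere 0 \<rho>) h"
  shows "boundary_integral \<eta> \<rho> (\<lambda>y. c *\<^sub>R g y) h = c *\<^sub>R boundary_integral \<eta> \<rho> g h"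
  using boundary_integral_mult_left [OF assms, of \<eta> "c *\<^sub>R 1"] by simp

lemma boundary_integral_diff:
  assumes "\<rho> > 0" "continuous_on (sphere 0 \<rho>) g" "continuous_on (sphere 0 \<rho>) g'" "continuous_on (sphere 0 \<rho>) h"
  shows "boundary_integral \<eta> \<rho> (\<lambda>y. g y - g' y) h = boundary_integral \<eta> \<rho> g h - boundary_integral \<eta> \<rho> g' h"
proof -
  have "boundary_integral \<eta> \<rho> (\<lambda>y. g y - g' y) h = boundary_integral \<eta> \<rho> (\<lambda>y. g y + (- 1) * g' y) h"
    by simp
  also have "\<dots> = boundary_integral \<eta> \<rho> g h + boundary_integral \<eta> \<rho> (\<lambda>y. (- 1) * g' y) h"
    unfolding boundary_integral_def distrib_right
    by (intro sphere_integral_add continuous_on_boundary_density continuous_intros assms)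
  finally show ?thesis by (simp add: boundary_integral_mult_left [OF assms(1,3,4), of \<eta> "- 1", simplified])
qed

text \<open>The order of the quantifiers is the point: the constant depends on \<open>h\<close> and
  \<rho> but not on \<open>g\<close>, so a uniform bound on kernel terms carries over to their
  boundary integrals.\<close>

lemma boundary_integral_bound:
  fixes h :: "'i::{finite,linorder} slice \<Rightarrow> ('i, 'j::{finite,linorder}) cl"
  assumes "\<rho> > 0" "continuous_on (sphere 0 \<rho>) h"
  shows "\<exists>M\<ge>0. \<forall>g \<beta>. continuous_on (sphere 0 \<rho>) g \<longrightarrow> \<beta> \<ge> 0 \<longrightarrow> (\<forall>y. norm y = \<rho> \<longrightarrow> norm (g y) \<le> \<beta>)
    \<longrightarrow> norm (boundary_integral \<eta> \<rho> g h) \<le> M * \<beta>"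
proof -
  let ?P = "\<lambda>y. slice_para \<eta> ((1 / \<rho>) *\<^sub>R y) * h y"
  obtain C where C: "\<And>x y :: ('i, 'j) cl. norm (x * y) \<le> norm x * norm y * C" and C0: "C > 0"
    using clifford_mult.pos_bounded by blast
  have Pc: "continuous_on (sphere 0 \<rho>) ?P" by (intro continuous_intros assms)
  obtain B where B: "B \<ge> 0" "\<And>y. y \<in> sphere 0 \<rho> \<Longrightarrow> norm (?P y) \<le> B"
    using continuous_on_compact_bound [OF compact_sphere Pc] by blast
  define m where "m = measure (sphere_surface \<rho> :: 'i slice measure) UNIV"
  have "norm (boundary_integral \<eta> \<rho> g h) \<le> m * (B * C) * \<beta>"
    if g: "continuous_on (sphere 0 \<rho>) g" "\<beta> \<ge> 0" "\<And>y. norm y = \<rho> \<Longrightarrow> norm (g y) \<le> \<beta>" for g \<beta>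
  proof -
    have "norm (boundary_integral \<eta> \<rho> g h) \<le> m * (\<beta> * B * C)"
      unfolding boundary_integral_def m_def
    proof (rule norm_sphere_integral_le [OF assms(1) continuous_on_boundary_density [OF g(1) assms(2)]])
      fix y :: "'i slice" assume y: "norm y = \<rho>"
      have "norm (g y * ?P y) \<le> norm (g y) * norm (?P y) * C" by (rule C)
      also have "\<dots> \<le> \<beta> * B * C"
        using g(3) [OF y] B(2) [of y] B(1) y C0 g(2) by (intro mult_mono mult_nonneg_nonneg) auto
      finally show "norm (g y * slice_para \<eta> ((1 / \<rho>) *\<^sub>R y) * h y) \<le> \<beta> * B * C" by (simp add: mult.assoc)
    qed (use g B C0 in auto)
    then show ?thesis by (simp add: mult_ac)
  qed
  moreover have "m * (B * C) \<ge> 0" using B C0 by (simp add: m_def)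
  ultimately show ?thesis by blast
qed

text \<open>On the sphere the remainders of the series are bounded by the tails of \<beta>, and
  \<open>boundary_integral_bound\<close> passes this on to the integrals.\<close>

lemma boundary_integral_sums:
  fixes T :: "nat \<Rightarrow> 'i::{finite,linorder} slice \<Rightarrow> ('i, 'j::{finite,linorder}) cl"
  assumes "\<rho> > 0" "continuous_on (sphere 0 \<rho>) h" "\<And>k. continuous_on (sphere 0 \<rho>) (T k)" "continuous_on (sphere 0 \<rho>) G"
    and sums: "\<And>y. norm y = \<rho> \<Longrightarrow> (\<lambda>k. T k y) sums G y"
    and \<beta>: "\<And>k y. norm y = \<rho> \<Longrightarrow> norm (T k y) \<le> \<beta> k" "\<And>k. \<beta> k \<ge> 0" "summable \<beta>"
  shows "(\<lambda>k. boundary_integral \<eta> \<rho> (T k) h) sums boundary_integral \<eta> \<rho> G h"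
proof -
  obtain M where M: "\<And>g b. continuous_on (sphere 0 \<rho>) g \<Longrightarrow> b \<ge> 0 \<Longrightarrow> (\<And>y. norm y = \<rho> \<Longrightarrow> norm (g y) \<le> b)
    \<Longrightarrow> norm (boundary_integral \<eta> \<rho> g h) \<le> M * b"
    using boundary_integral_bound [OF assms(1,2), of \<eta>] by blast
  let ?s = "\<lambda>N. \<Sum>k<N. boundary_integral \<eta> \<rho> (T k) h"
  let ?t = "\<lambda>N. suminf \<beta> - (\<Sum>k<N. \<beta> k)"
  have t: "?t N = (\<Sum>k. \<beta> (k + N))" for N
    using suminf_minus_initial_segment [OF \<beta>(3), of N] by simp
  have "norm (boundary_integral \<eta> \<rho> G h - ?s N) \<le> M * ?t N" for N
  proof -
    have "boundary_integral \<eta> \<rho> G h - ?s N = boundary_integral \<eta> \<rho> (\<lambda>y. G y - (\<Sum>k<N. T k y)) h"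
      using assms(1-4) by (subst boundary_integral_diff) (auto simp: boundary_integral_sum intro!: continuous_intros)
    also have "norm \<dots> \<le> M * ?t N"
    proof (rule M)
      show "continuous_on (sphere 0 \<rho>) (\<lambda>y. G y - (\<Sum>k<N. T k y))"
        by (intro continuous_intros assms)
      have s: "summable (\<lambda>k. \<beta> (k + N))" by (rule summable_ignore_initial_segment [OF \<beta>(3)])
      show "?t N \<ge> 0" unfolding t by (rule suminf_nonneg [OF s \<beta>(2)])
      fix y :: "'i slice" assume y: "norm y = \<rho>"
      have "G y - (\<Sum>k<N. T k y) = (\<Sum>k. T (k + N) y)"
        using suminf_minus_initial_segment [OF sums_summable [OF sums [OF y]], of N] sums_unique [OF sums [OF y]] by simp
      also have "norm \<dots> \<le> (\<Sum>k. \<beta> (k + N))"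
        by (rule norm_suminf_le [OF \<beta>(1) [OF y] s])
      finally show "norm (G y - (\<Sum>k<N. T k y)) \<le> ?t N" unfolding t .
    qed
    finally show ?thesis .
  qed
  then have le: "\<forall>N. norm (boundary_integral \<eta> \<rho> G h - ?s N) \<le> M * ?t N" by blast
  have "(\<lambda>N. M * ?t N) \<longlonglongrightarrow> M * (suminf \<beta> - suminf \<beta>)"
    by (intro tendsto_intros summable_LIMSEQ \<beta>(3))
  then have lim: "(\<lambda>N. M * ?t N) \<longlonglongrightarrow> 0" by simp
  have "(\<lambda>N. boundary_integral \<eta> \<rho> G h - ?s N) \<longlonglongrightarrow> 0"
    by (rule Lim_null_comparison [OF always_eventually [OF le] lim])
  then have "(\<lambda>N. boundary_integral \<eta> \<rho> G h - (boundary_integral \<eta> \<rho> G h - ?s N)) \<longlonglongrightarrow> boundary_integral \<eta> \<rho> G h - 0"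
    by (intro tendsto_intros)
  then show ?thesis by (simp add: sums_def)
qed

text \<open>Comparison of coefficients when the sum is known on one side of 0 only, as for a
  positive scaling parameter. The constant term is the limit from the right, and division by s
  lowers the index.\<close>

lemma powser_zero_right:
  fixes a :: "nat \<Rightarrow> 'w::euclidean_space"
  assumes "\<delta> > 0" "\<And>s. 0 < s \<Longrightarrow> s < \<delta> \<Longrightarrow> (\<lambda>k. s ^ k *\<^sub>R a k) sums 0"
  shows "a k = 0"
proof -
  have first: "c 0 = 0" if c: "\<And>s. 0 < s \<Longrightarrow> s < \<delta> \<Longrightarrow> (\<lambda>k. c k * s ^ k) sums 0" for c :: "nat \<Rightarrow> real"
  proof -
    let ?f = "\<lambda>x. \<Sum>k. c k * x ^ k"
    have "summable (\<lambda>k. c k * (\<delta> / 2) ^ k)" using c [of "\<delta> / 2"] assms(1) by (auto simp: sums_iff)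
    then have "(\<lambda>k. c k * x ^ k) sums ?f x" if "norm x < \<delta> / 2" for x
      using powser_inside [of c "\<delta> / 2" x] that assms(1) by (simp add: summable_sums)
    then have "(?f \<longlongrightarrow> c 0) (at 0)"
      using assms(1) by (intro powser_limit_0 [of "\<delta> / 2"]) auto
    then have "(?f \<longlongrightarrow> c 0) (at_right 0)" by (rule tendsto_within_subset) simp
    moreover have "\<forall>\<^sub>F x in at_right 0. ?f x = 0"
      using c assms(1) by (intro eventually_at_rightI [of 0 \<delta>]) (auto simp: sums_iff)
    then have "(?f \<longlongrightarrow> 0) (at_right 0)" by (rule tendsto_eventually)
    ultimately show ?thesis using tendsto_unique trivial_limit_at_right_real by blast
  qed
  have "c k = 0" if "\<And>s. 0 < s \<Longrightarrow> s < \<delta> \<Longrightarrow> (\<lambda>k. c k * s ^ k) sums 0" for c :: "nat \<Rightarrow> real"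
    using that
  proof (induction k arbitrary: c)
    case (Suc k)
    have c0: "c 0 = 0" by (rule first) (rule Suc.prems)
    have "(\<lambda>k. c (Suc k) * s ^ k) sums 0" if s: "0 < s" "s < \<delta>" for s
    proof -
      have "(\<lambda>k. c (Suc k) * s ^ Suc k) sums 0"
        using Suc.prems [OF s] by (subst sums_Suc_iff) (simp add: c0)
      from sums_mult [OF this, of "inverse s"] show ?thesis
        using s by (simp add: field_simps)
    qed
    from Suc.IH [of "\<lambda>k. c (Suc k)", OF this] show ?case .
  qed (rule first)
  moreover have "(\<lambda>k. (a k \<bullet> b) * s ^ k) sums 0" if "0 < s" "s < \<delta>" for s b
    using bounded_linear.sums [OF bounded_linear_inner_left assms(2) [OF that], of b]
    by (simp add: mult.commute)
  ultimately have "a k \<bullet> b = 0" for b by metis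
  then show ?thesis by (simp add: euclidean_eq_iff [of "a k"])
qed

section \<open>The identity theorem on a slice\<close>

lemma open_shell: "open {y :: 'v::real_normed_vector. a < norm y \<and> norm y < b}"
  by (intro open_Collect_conj open_Collect_less continuous_intros)

lemma slice_monogenic_subset:
  assumes "slice_monogenic \<eta> U h" "open V" "V \<subseteq> U"
  shows "slice_monogenic \<eta> V h"
  using assms unfolding slice_monogenic_def continuous_partials_on_def
  by (auto intro: continuous_on_subset)

lemma slice_monogenic_translation:
  assumes "slice_monogenic \<eta> U h"
  shows "slice_monogenic \<eta> ((+) c -` U) (\<lambda>y. h (c + y))"
proof -
  have U: "open U" "continuous_partials_on U h" "\<And>y. y \<in> U \<Longrightarrow> slice_dirac \<eta> h y = 0"
    using assms by (auto simp: slice_monogenic_def)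
  have d: "directional_deriv v (\<lambda>y. h (c + y)) y = directional_deriv v h (c + y)" for v y
    unfolding directional_deriv_def by (simp add: add.assoc)
  have "continuous_partials_on ((+) c -` U) (\<lambda>y. h (c + y))"
  proof (rule continuous_partials_onI [where D = "\<lambda>v y. directional_deriv v h (c + y)"])
    show "((\<lambda>t. h (c + (x + t *\<^sub>R v))) has_vector_derivative directional_deriv v h (c + x)) (at 0)"
      if "v \<in> Basis" "x \<in> (+) c -` U" for v x
      using continuous_partials_on_has_vector_derivative [OF U(2) that(1), of "c + x"] that by (simp add: add.assoc)
    show "continuous_on ((+) c -` U) (\<lambda>y. directional_deriv v h (c + y))" if "v \<in> Basis" for v
    proof (rule continuous_on_compose2 [of U "directional_deriv v h"])
      show "continuous_on U (directional_deriv v h)"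
        using U(2) that by (simp add: continuous_partials_on_def)
    qed (auto intro!: continuous_intros)
  qed
  moreover have "open ((+) c -` U)"
    by (intro open_vimage U continuous_intros)
  ultimately show ?thesis
    unfolding slice_monogenic_def using U(3) by (auto simp: slice_dirac_def d)
qed

lemma slice_monogenic_diff:
  assumes "slice_monogenic \<eta> U g" "slice_monogenic \<eta> U h"
  shows "slice_monogenic \<eta> U (\<lambda>y. g y - h y)"
proof -
  have U: "open U" "continuous_partials_on U g" "continuous_partials_on U h"
    "\<And>y. y \<in> U \<Longrightarrow> slice_dirac \<eta> g y = 0" "\<And>y. y \<in> U \<Longrightarrow> slice_dirac \<eta> h y = 0"
    using assms by (auto simp: slice_monogenic_def)
  have d: "((\<lambda>t. g (x + t *\<^sub>R v) - h (x + t *\<^sub>R v)) has_vector_derivative directional_deriv v g x - directional_deriv v h x) (at 0)"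
    if "v \<in> Basis" "x \<in> U" for v x
    by (intro has_vector_derivative_diff continuous_partials_on_has_vector_derivative [OF _ that] U)
  have "continuous_partials_on U (\<lambda>y. g y - h y)"
  proof (rule continuous_partials_onI [OF d])
    show "continuous_on U (\<lambda>x. directional_deriv v g x - directional_deriv v h x)" if "v \<in> Basis" for v
      using U(2,3) that unfolding continuous_partials_on_def by (intro continuous_intros) auto
  qed
  moreover have "slice_dirac \<eta> (\<lambda>y. g y - h y) y = slice_dirac \<eta> g y - slice_dirac \<eta> h y" if "y \<in> U" for y
  proof -
    have "slice_dirac \<eta> (\<lambda>y. g y - h y) y = (\<Sum>v\<in>Basis. slice_para \<eta> v * (directional_deriv v g y - directional_deriv v h y))"
      unfolding slice_dirac_eq by (intro sum.cong refl arg_cong2 [where f = "(*)"] directional_deriv_eqI d that)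
    then show ?thesis by (simp add: slice_dirac_eq right_diff_distrib sum_subtractf)
  qed
  ultimately show ?thesis using U unfolding slice_monogenic_def by simp
qed

lemma slice_kernel_minus: "slice_kernel \<eta> (- z) = - slice_kernel \<eta> z"
  using slice_conj_scaleR [of \<eta> "- 1" z] by (simp add: slice_kernel_def)

lemma slice_kernel_scaleR:
  fixes z :: "'i::{finite,linorder} slice" and \<eta> :: "real ^ 'j::{finite,linorder}"
  assumes "s > 0"
  shows "slice_kernel \<eta> (s *\<^sub>R z) = (1 / s ^ CARD('i)) *\<^sub>R slice_kernel \<eta> z"
proof -
  have "1 / (s * norm z) ^ (CARD('i) + 1) * s = 1 / s ^ CARD('i) * (1 / norm z ^ (CARD('i) + 1))"
    using assms by (simp add: power_mult_distrib)
  then show ?thesis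
    using assms by (simp add: slice_kernel_def slice_conj_scaleR mult_ac del: power_Suc)
qed

text \<open>An upper bound \<tau> takes the place of the ratio of the norms, so that one majorant
  serves a whole sphere or shell.\<close>

lemma kernel_term_dominated:
  fixes \<eta> :: "real ^ 'j::{finite,linorder}"
  shows "\<exists>\<Gamma> :: nat \<Rightarrow> real. (\<forall>k. \<Gamma> k \<ge> 0) \<and> (\<forall>q. 0 \<le> q \<longrightarrow> q < 1 \<longrightarrow> summable (\<lambda>k. \<Gamma> k * q ^ k)) \<and>
    (\<forall>(x :: 'i::{finite,linorder} slice) y k \<tau>. norm x / norm y \<le> \<tau> \<longrightarrow> y \<noteq> 0 \<longrightarrow>
      norm (kernel_term \<eta> k x y) \<le> \<Gamma> k * \<tau> ^ k / norm y ^ CARD('i)) \<and>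
    (\<forall>(x :: 'i slice) y. norm x < norm y \<longrightarrow> (\<lambda>k. kernel_term \<eta> k x y) sums slice_kernel \<eta> (y - x))"
proof -
  obtain \<Gamma> :: "nat \<Rightarrow> real" where \<Gamma>: "\<And>k. \<Gamma> k \<ge> 0" "\<And>q. 0 \<le> q \<Longrightarrow> q < 1 \<Longrightarrow> summable (\<lambda>k. \<Gamma> k * q ^ k)"
    "\<And>(x :: 'i slice) y k. y \<noteq> 0 \<Longrightarrow> norm (kernel_term \<eta> k x y) \<le> \<Gamma> k * (norm x / norm y) ^ k / norm y ^ CARD('i)"
    "\<And>(x :: 'i slice) y. norm x < norm y \<Longrightarrow> (\<lambda>k. kernel_term \<eta> k x y) sums slice_kernel \<eta> (y - x)"
    using slice_kernel_powser [of \<eta>, where 'i = 'i] by blast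
  have "norm (kernel_term \<eta> k x y) \<le> \<Gamma> k * \<tau> ^ k / norm y ^ CARD('i)"
    if "norm x / norm y \<le> \<tau>" "y \<noteq> 0" for x y :: "'i slice" and k \<tau>
  proof -
    have "\<Gamma> k * (norm x / norm y) ^ k / norm y ^ CARD('i) \<le> \<Gamma> k * \<tau> ^ k / norm y ^ CARD('i)"
      using that \<Gamma>(1) [of k] by (intro divide_right_mono mult_left_mono power_mono) auto
    with \<Gamma>(3) [OF that(2), of k x] show ?thesis by linarith
  qed
  with \<Gamma> show ?thesis by (intro exI [of _ \<Gamma>]) auto
qed

text \<open>The majorant has the form \<Gamma> k q^k up to a constant, with q = |x|/R for a pole
  inside the sphere. For a pole outside, the integration variable is the smaller one, the arguments
  of the kernel term are exchanged and q = R/|x|.\<close>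

lemma boundary_integral_kernel_sums:
  fixes h :: "'i::{finite,linorder} slice \<Rightarrow> ('i, 'j::{finite,linorder}) cl"
  assumes R: "R > 0" and h: "continuous_on (sphere 0 R) h"
  shows "norm x < R \<Longrightarrow> (\<lambda>k. boundary_integral \<eta> R (kernel_term \<eta> k x) h) sums
      boundary_integral \<eta> R (\<lambda>y. slice_kernel \<eta> (y - x)) h"
    and "(\<And>k. continuous_on (sphere 0 R) (\<lambda>y. kernel_term \<eta> k y x)) \<Longrightarrow> R < norm x \<Longrightarrow>
      (\<lambda>k. boundary_integral \<eta> R (\<lambda>y. kernel_term \<eta> k y x) h) sums
      boundary_integral \<eta> R (\<lambda>y. slice_kernel \<eta> (x - y)) h"
proof -
  obtain \<Gamma> :: "nat \<Rightarrow> real" where \<Gamma>: "\<And>k. \<Gamma> k \<ge> 0" "\<And>q. 0 \<le> q \<Longrightarrow> q < 1 \<Longrightarrow> summable (\<lambda>k. \<Gamma> k * q ^ k)"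
    "\<And>(x :: 'i slice) y k \<tau>. norm x / norm y \<le> \<tau> \<Longrightarrow> y \<noteq> 0 \<Longrightarrow> norm (kernel_term \<eta> k x y) \<le> \<Gamma> k * \<tau> ^ k / norm y ^ CARD('i)"
    "\<And>(x :: 'i slice) y. norm x < norm y \<Longrightarrow> (\<lambda>k. kernel_term \<eta> k x y) sums slice_kernel \<eta> (y - x)"
    using kernel_term_dominated [of \<eta>, where 'i = 'i] by blast
  show "(\<lambda>k. boundary_integral \<eta> R (kernel_term \<eta> k x) h) sums boundary_integral \<eta> R (\<lambda>y. slice_kernel \<eta> (y - x)) h"
    if x: "norm x < R"
  proof (rule boundary_integral_sums [OF R h, where \<beta> = "\<lambda>k. \<Gamma> k * (norm x / R) ^ k / R ^ CARD('i)"])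
    show "continuous_on (sphere 0 R) (kernel_term \<eta> k x)" for k
      using R by (intro continuous_on_kernel_term) auto
    show "continuous_on (sphere 0 R) (\<lambda>y. slice_kernel \<eta> (y - x))"
      by (rule continuous_on_compose2 [OF continuous_on_slice_kernel [of "- {0}"]])
        (use x in \<open>auto intro!: continuous_intros\<close>)
    show "summable (\<lambda>k. \<Gamma> k * (norm x / R) ^ k / R ^ CARD('i))"
      using x R by (intro summable_divide \<Gamma>(2)) auto
    show "norm (kernel_term \<eta> k x y) \<le> \<Gamma> k * (norm x / R) ^ k / R ^ CARD('i)" if "norm y = R" for k y
      using \<Gamma>(3) [of x y "norm x / R" k] that R by auto
    show "(\<lambda>k. kernel_term \<eta> k x y) sums slice_kernel \<eta> (y - x)" if "norm y = R" for y
      using that x by (intro \<Gamma>(4)) simp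
    show "\<Gamma> k * (norm x / R) ^ k / R ^ CARD('i) \<ge> 0" for k
      using R \<Gamma>(1) [of k] by simp
  qed
  show "(\<lambda>k. boundary_integral \<eta> R (\<lambda>y. kernel_term \<eta> k y x) h) sums
      boundary_integral \<eta> R (\<lambda>y. slice_kernel \<eta> (x - y)) h"
    if c: "\<And>k. continuous_on (sphere 0 R) (\<lambda>y. kernel_term \<eta> k y x)" and x: "R < norm x"
  proof (rule boundary_integral_sums [OF R h c, where \<beta> = "\<lambda>k. \<Gamma> k * (R / norm x) ^ k / norm x ^ CARD('i)"])
    show "continuous_on (sphere 0 R) (\<lambda>y. slice_kernel \<eta> (x - y))"
      by (rule continuous_on_compose2 [OF continuous_on_slice_kernel [of "- {0}"]])
        (use x in \<open>auto intro!: continuous_intros\<close>)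
    show "summable (\<lambda>k. \<Gamma> k * (R / norm x) ^ k / norm x ^ CARD('i))"
      using x R by (intro summable_divide \<Gamma>(2)) (auto simp: divide_less_eq)
    show "norm (kernel_term \<eta> k y x) \<le> \<Gamma> k * (R / norm x) ^ k / norm x ^ CARD('i)" if "norm y = R" for k y
    proof -
      have "x \<noteq> 0" using x R by auto
      then show ?thesis using \<Gamma>(3) [of y x "R / norm x" k] that by simp
    qed
    show "(\<lambda>k. kernel_term \<eta> k y x) sums slice_kernel \<eta> (x - y)" if "norm y = R" for y
      using that x by (intro \<Gamma>(4)) simp
    show "\<Gamma> k * (R / norm x) ^ k / norm x ^ CARD('i) \<ge> 0" for k
      using R \<Gamma>(1) [of k] by simp
  qed
qed

text \<open>After translation to the centre, Cauchy's formula on shells makes s \<mapsto> g (s w) a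
  power series on 0 < s \<le> 1. It vanishes for small s, so all its coefficients do, and g w = 0
  follows without loss of radius.\<close>

lemma slice_monogenic_ball_unique:
  fixes h :: "'i::{finite,linorder} slice \<Rightarrow> ('i, 'j::{finite,linorder}) cl"
  assumes \<eta>: "\<eta> \<in> sphere 0 1" and mono: "slice_monogenic \<eta> (ball c r) h"
    and "\<delta> > 0" "\<And>z. z \<in> ball c \<delta> \<Longrightarrow> h z = 0" and x: "x \<in> ball c r"
  shows "h x = 0"
proof -
  define g where "g y = h (c + y)" for y
  have vim: "(+) c -` ball c r = ball 0 r"
  proof (rule set_eqI)
    show "y \<in> (+) c -` ball c r \<longleftrightarrow> y \<in> ball 0 r" for y by (simp add: dist_norm)
  qed
  have gm: "slice_monogenic \<eta> (ball 0 r) g"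
    using slice_monogenic_translation [OF mono, of c] unfolding g_def vim .
  have g0: "g z = 0" if "norm z < \<delta>" for z using assms(4) [of "c + z"] that by (simp add: g_def dist_norm)
  have "g w = 0" if w: "norm w < r" for w
  proof (cases "w = 0")
    case True
    then show ?thesis using g0 \<open>\<delta> > 0\<close> by simp
  next
    case False
    obtain b where b: "norm w < b" "b < r" using dense [OF w] by blast
    have b0: "b > 0" using b(1) norm_ge_zero [of w] by linarith
    have gm': "slice_monogenic \<eta> {y. 0 < norm y \<and> norm y < r} g"
      by (rule slice_monogenic_subset [OF gm open_shell]) auto
    have gc: "continuous_on (sphere 0 b) g"
      by (rule continuous_on_subset [OF slice_monogenic_continuous_on [OF gm]]) (use b in auto)
    have rep: "g z = boundary_integral \<eta> b (\<lambda>y. slice_kernel \<eta> (y - z)) g" if z: "0 < norm z" "norm z < b" for z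
    proof -
      obtain a where a: "0 < a" "a < min (norm z) \<delta>"
        using dense [of 0 "min (norm z) \<delta>"] z \<open>\<delta> > 0\<close> by auto
      have "boundary_integral \<eta> b (\<lambda>y. slice_kernel \<eta> (y - z)) g - boundary_integral \<eta> a (\<lambda>y. slice_kernel \<eta> (y - z)) g
          = (if a < norm z \<and> norm z < b then g z else 0)"
        by (rule borel_pompeiu_shell [OF \<eta> order_refl _ _ _ gm']) (use a b z in auto)
      \<comment> \<open>The inner radius is below \<delta>, so the inner boundary integral vanishes
        and only the outer sphere is left in the formula.\<close>
      moreover have "boundary_integral \<eta> a (\<lambda>y. slice_kernel \<eta> (y - z)) g = 0"
      proof -
        have "boundary_integral \<eta> a (\<lambda>y. slice_kernel \<eta> (y - z)) g = boundary_integral \<eta> a (\<lambda>y. slice_kernel \<eta> (y - z)) (\<lambda>_. 0)"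
          by (rule boundary_integral_cong) (use a g0 in auto)
        also have "\<dots> = 0" by (simp add: boundary_integral_def sphere_integral_def)
        finally show ?thesis .
      qed
      ultimately show ?thesis using a z by simp
    qed
    let ?A = "\<lambda>k. boundary_integral \<eta> b (kernel_term \<eta> k w) g"
    have sums: "(\<lambda>k. s ^ k *\<^sub>R ?A k) sums g (s *\<^sub>R w)" if s: "0 < s" "s \<le> 1" for s
    proof -
      have sw: "0 < norm (s *\<^sub>R w)" "norm (s *\<^sub>R w) < b"
      proof -
        have "s * norm w \<le> norm w" using mult_right_mono [OF s(2) norm_ge_zero [of w]] by simp
        then show "norm (s *\<^sub>R w) < b" using s b by simp
        show "0 < norm (s *\<^sub>R w)" using s False by simp
      qed
      have "boundary_integral \<eta> b (kernel_term \<eta> k (s *\<^sub>R w)) g = s ^ k *\<^sub>R ?A k" for k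
      proof -
        have "boundary_integral \<eta> b (kernel_term \<eta> k (s *\<^sub>R w)) g = boundary_integral \<eta> b (\<lambda>y. s ^ k *\<^sub>R kernel_term \<eta> k w y) g"
        proof (rule boundary_integral_cong)
          fix y :: "'i slice" assume "norm y = b"
          then have "y \<noteq> 0" using b0 by auto
          then show "kernel_term \<eta> k (s *\<^sub>R w) y = s ^ k *\<^sub>R kernel_term \<eta> k w y" by (rule kernel_term_scaleR)
        qed simp
        also have "\<dots> = s ^ k *\<^sub>R ?A k"
          by (rule boundary_integral_scaleR [OF b0 continuous_on_kernel_term gc]) (use b0 in auto)
        finally show ?thesis .
      qed
      then show ?thesis
        using boundary_integral_kernel_sums(1) [OF b0 gc sw(2), of \<eta>] rep [OF sw] by simp
    qed
    have "?A k = 0" for k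
    proof (rule powser_zero_right [of "min 1 (\<delta> / norm w)"])
      show "0 < min 1 (\<delta> / norm w)" using False \<open>\<delta> > 0\<close> by simp
      fix s assume s: "0 < s" "s < min 1 (\<delta> / norm w)"
      then have "norm (s *\<^sub>R w) < \<delta>" using False by (simp add: less_divide_eq)
      then show "(\<lambda>k. s ^ k *\<^sub>R ?A k) sums 0" using sums [of s] s g0 by simp
    qed
    then have "(\<lambda>k. 0) sums g w" using sums [of 1] by simp
    then show ?thesis using sums_unique2 [OF sums_zero] by metis
  qed
  from this [of "x - c"] show ?thesis using x by (simp add: g_def dist_norm norm_minus_commute)
qed

text \<open>The set of points near which \<open>h\<close> vanishes is open by construction. It is
  also closed in \<open>U\<close>: by \<open>slice_monogenic_ball_unique\<close>, vanishing near
  \<open>w\<close> spreads over any ball about \<open>w\<close> inside \<open>U\<close>, and such a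
  ball reaches the points close to \<open>w\<close>.\<close>

lemma slice_monogenic_connected_unique:
  fixes h :: "'i::{finite,linorder} slice \<Rightarrow> ('i, 'j::{finite,linorder}) cl"
  assumes \<eta>: "\<eta> \<in> sphere 0 1" and mono: "slice_monogenic \<eta> U h" and conn: "connected U"
    and "y0 \<in> U" "\<delta> > 0" "\<And>z. z \<in> ball y0 \<delta> \<Longrightarrow> h z = 0" and "x \<in> U"
  shows "h x = 0"
proof -
  have U: "open U" using mono by (simp add: slice_monogenic_def)
  define Z where "Z = {y\<in>U. \<exists>\<delta>>0. \<forall>z\<in>ball y \<delta>. h z = 0}"
  have "open Z"
    unfolding open_contains_ball
  proof
    fix y assume "y \<in> Z"
    then obtain d where d: "y \<in> U" "d > 0" "\<And>z. z \<in> ball y d \<Longrightarrow> h z = 0" by (auto simp: Z_def)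
    obtain e where e: "e > 0" "ball y e \<subseteq> U" using U d(1) by (meson open_contains_ball)
    have "w \<in> Z" if w: "w \<in> ball y (min d e)" for w
    proof -
      have "ball w (d - dist y w) \<subseteq> ball y d"
      proof
        fix z assume "z \<in> ball w (d - dist y w)"
        then show "z \<in> ball y d" using dist_triangle [of y z w] by simp
      qed
      then have "\<forall>z\<in>ball w (d - dist y w). h z = 0" using d(3) by blast
      then show ?thesis using w e unfolding Z_def by (auto intro!: exI [of _ "d - dist y w"])
    qed
    then show "\<exists>e>0. ball y e \<subseteq> Z" using d(2) e(1) by (intro exI [of _ "min d e"]) auto
  qed
  moreover have "open (U - Z)"
    unfolding open_contains_ball
  proof
    fix y assume y: "y \<in> U - Z"
    obtain e where e: "e > 0" "ball y e \<subseteq> U" using U y by (meson DiffD1 open_contains_ball)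
    \<comment> \<open>Half the radius: the ball of radius e/2 about \<open>w\<close> lies in
      \<open>U\<close> and still contains \<open>y\<close>.\<close>
    have "w \<notin> Z" if w: "w \<in> ball y (e / 2)" for w
    proof
      assume "w \<in> Z"
      then obtain d where d: "d > 0" "\<And>z. z \<in> ball w d \<Longrightarrow> h z = 0" by (auto simp: Z_def)
      have sub: "ball w (e / 2) \<subseteq> U"
      proof -
        have "ball w (e / 2) \<subseteq> ball y e"
        proof
          fix z assume "z \<in> ball w (e / 2)"
          then show "z \<in> ball y e" using w dist_triangle [of y z w] by simp
        qed
        then show ?thesis using e by blast
      qed
      have z0: "h z = 0" if "z \<in> ball w (e / 2)" for z
        by (rule slice_monogenic_ball_unique [OF \<eta> slice_monogenic_subset [OF mono open_ball sub] d that])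
      have "h z = 0" if "z \<in> ball y (e / 2 - dist y w)" for z
        using that dist_triangle [of w z y] by (intro z0) (simp add: dist_commute)
      moreover have "e / 2 - dist y w > 0" using w by simp
      ultimately have "y \<in> Z" using y unfolding Z_def by blast
      with y show False by blast
    qed
    moreover have "ball y (e / 2) \<subseteq> U" using e subset_ball [of "e / 2" e y] by auto
    ultimately show "\<exists>e>0. ball y e \<subseteq> U - Z" using e(1) by (intro exI [of _ "e / 2"]) auto
  qed
  moreover have "Z \<inter> U \<noteq> {}" using assms(4-6) unfolding Z_def by blast
  moreover have "U \<subseteq> Z \<union> (U - Z)" "Z \<inter> (U - Z) \<inter> U = {}" by auto
  ultimately have "(U - Z) \<inter> U = {}" using connectedD [OF conn, of Z "U - Z"] by blast
  then have "x \<in> Z" using assms(7) by blast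
  then show ?thesis by (force simp: Z_def)
qed

section \<open>The representation formula\<close>

text \<open>Serves functions that are set to zero on one side of a hyperplane: at its points the new
  function is dominated by the old one, whose derivative is zero there.\<close>

lemma tendsto_le_null_deriv:
  fixes f g :: "real \<Rightarrow> 'w::real_normed_vector"
  assumes "(f has_vector_derivative 0) (at 0)" "f 0 = 0" "g 0 = 0" "\<And>t. norm (g t) \<le> norm (f t)"
  shows "(g has_vector_derivative 0) (at 0)"
proof -
  have f: "((\<lambda>h. norm (f h) / norm h) \<longlongrightarrow> 0) (at 0)"
    using assms(1,2) by (simp add: has_vector_derivative_def has_derivative_at)
  have "((\<lambda>h. norm (g h) / norm h) \<longlongrightarrow> 0) (at 0)"
    by (rule Lim_null_comparison [OF _ f]) (auto intro!: always_eventually divide_right_mono assms(4))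
  then show ?thesis
    using assms(3) by (simp add: has_vector_derivative_def has_derivative_at)
qed

lemma line_in_open:
  fixes y v :: "'v::real_normed_vector"
  assumes "open U" "y \<in> U"
  shows "\<forall>\<^sub>F t in at 0. y + t *\<^sub>R v \<in> U"
proof -
  have "((\<lambda>t. y + t *\<^sub>R v) \<longlongrightarrow> y + 0 *\<^sub>R v) (at 0)" by (intro tendsto_intros)
  then show ?thesis using topological_tendstoD [OF _ assms(1), of "\<lambda>t. y + t *\<^sub>R v" y "at 0"] assms(2) by simp
qed

lemma has_vector_derivative_cong_line:
  fixes g g' :: "'v::real_normed_vector \<Rightarrow> 'w::real_normed_vector"
  assumes "open U" "y \<in> U" "\<And>z. z \<in> U \<Longrightarrow> g z = g' z"
    and "((\<lambda>t. g (y + t *\<^sub>R v)) has_vector_derivative D) (at 0)"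
  shows "((\<lambda>t. g' (y + t *\<^sub>R v)) has_vector_derivative D) (at 0)"
  using assms(4) unfolding has_vector_derivative_def
  by (rule has_derivative_transform_eventually)
    (use line_in_open [OF assms(1,2), of v] assms in \<open>auto elim!: eventually_mono\<close>)

text \<open>
  A monogenic function that vanishes on the hyperplane \<open>r = 0\<close> has all its partial derivatives
  vanish there, so it stays monogenic when it is replaced by zero on one side of the hyperplane.
\<close>

lemma slice_monogenic_half:
  fixes h :: "'i::{finite,linorder} slice \<Rightarrow> ('i, 'j::{finite,linorder}) cl"
  assumes \<eta>: "\<eta> \<in> sphere 0 1" and mono: "slice_monogenic \<eta> U h"
    and zero: "\<And>y. y \<in> U \<Longrightarrow> snd y = 0 \<Longrightarrow> h y = 0" and c: "c \<noteq> 0"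
  shows "slice_monogenic \<eta> U (\<lambda>y. if c * snd y \<le> 0 then 0 else h y)"
proof -
  have U: "open U" "continuous_partials_on U h" "\<And>y. y \<in> U \<Longrightarrow> slice_dirac \<eta> h y = 0"
    using mono by (auto simp: slice_monogenic_def)
  note hd = continuous_partials_on_has_vector_derivative [OF U(2)]
  define g where "g y = (if c * snd y \<le> 0 then 0 else h y)" for y
  define D where "D v y = (if c * snd y \<le> 0 then 0 else directional_deriv v h y)" for v y
  have ax: "directional_deriv (axis i 1, 0) h y = 0" if y: "y \<in> U" "snd y = 0" for i y
  proof (rule directional_deriv_eqI)
    have ev: "\<forall>\<^sub>F t in at 0. 0 = h (y + t *\<^sub>R (axis i 1, 0))"
    proof (rule eventually_mono [OF line_in_open [OF U(1) y(1), of "(axis i 1, 0)"]])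
      fix t assume *: "y + t *\<^sub>R (axis i 1, 0) \<in> U"
      have "snd (y + t *\<^sub>R (axis i 1, 0)) = 0" using y by simp
      from zero [OF * this] show "0 = h (y + t *\<^sub>R (axis i 1, 0))" by (rule sym)
    qed
    show "((\<lambda>t. h (y + t *\<^sub>R (axis i 1, 0))) has_vector_derivative 0) (at 0)"
      unfolding has_vector_derivative_def
      by (rule has_derivative_transform_eventually [where f = "\<lambda>_. 0"]) (use ev zero [OF y] in \<open>auto simp flip: zero_prod_def\<close>)
  qed
  \<comment> \<open>The tangential derivatives being zero, only the term with
    \<open>im_vec \<eta>\<close> is left of the Dirac equation, and \<open>im_vec \<eta>\<close> is
    invertible.\<close>
  have rd: "directional_deriv (0, 1) h y = 0" if y: "y \<in> U" "snd y = 0" for y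
  proof -
    have "im_vec \<eta> * directional_deriv (0, 1) h y = 0"
      using U(3) [OF y(1)] ax [OF y] by (simp add: slice_dirac_def)
    then have "im_vec \<eta> * im_vec \<eta> * directional_deriv (0, 1) h y = 0"
      by (simp add: mult.assoc)
    then show ?thesis by (simp add: im_vec_unit_square [OF \<eta>])
  qed
  have d0: "directional_deriv v h y = 0" if v: "v \<in> Basis" and y: "y \<in> U" "snd y = 0" for v y
  proof -
    consider i where "v = (axis i 1, 0)" | "v = (0, 1)" using v by (auto simp: Basis_slice)
    then show ?thesis using ax [OF y] rd [OF y] by cases (simp_all only:)
  qed
  have gd: "((\<lambda>t. g (y + t *\<^sub>R v)) has_vector_derivative D v y) (at 0)" if v: "v \<in> Basis" and y: "y \<in> U" for v y
  proof -
    consider "c * snd y > 0" | "c * snd y < 0" | "snd y = 0" using c by fastforce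
    then show ?thesis
    proof cases
      case 1
      have o: "open {y :: 'i slice. c * snd y > 0}" by (intro open_Collect_less continuous_intros)
      have "((\<lambda>t. g (y + t *\<^sub>R v)) has_vector_derivative directional_deriv v h y) (at 0)"
        by (rule has_vector_derivative_cong_line [OF o _ _ hd [OF v y]]) (use 1 in \<open>auto simp: g_def\<close>)
      then show ?thesis using 1 by (simp add: D_def)
    next
      case 2
      have o: "open {y :: 'i slice. c * snd y < 0}" by (intro open_Collect_less continuous_intros)
      have "((\<lambda>t. g (y + t *\<^sub>R v)) has_vector_derivative 0) (at 0)"
        by (rule has_vector_derivative_cong_line [OF o, where g = "\<lambda>_. 0"]) (use 2 in \<open>auto simp: g_def\<close>)
      then show ?thesis using 2 by (simp add: D_def)
    next
      case 3
      have "((\<lambda>t. g (y + t *\<^sub>R v)) has_vector_derivative 0) (at 0)"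
        by (rule tendsto_le_null_deriv [where f = "\<lambda>t. h (y + t *\<^sub>R v)"])
          (use hd [OF v y] d0 [OF v y 3] zero [OF y 3] 3 in \<open>auto simp: g_def\<close>)
      then show ?thesis using 3 by (simp add: D_def)
    qed
  qed
  have "continuous_partials_on U g"
  proof (rule continuous_partials_onI [OF gd])
    fix v :: "'i slice" assume v: "v \<in> Basis"
    have dc: "continuous_on U (directional_deriv v h)" using U(2) v by (simp add: continuous_partials_on_def)
    show "continuous_on U (D v)"
      unfolding D_def
    proof (rule continuous_on_cases_le)
      show "continuous_on {t \<in> U. 0 \<le> c * snd t} (directional_deriv v h)"
        by (rule continuous_on_subset [OF dc]) auto
      show "0 = directional_deriv v h t" if "t \<in> U" "c * snd t = 0" for t
        using d0 [OF v that(1)] that(2) c by simp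
    qed (auto intro!: continuous_intros)
  qed
  moreover have "slice_dirac \<eta> g y = 0" if y: "y \<in> U" for y
  proof -
    have "slice_dirac \<eta> g y = (\<Sum>v\<in>Basis. slice_para \<eta> v * D v y)"
      unfolding slice_dirac_eq by (intro sum.cong refl arg_cong2 [where f = "(*)"] directional_deriv_eqI gd y)
    also have "\<dots> = (if c * snd y \<le> 0 then 0 else slice_dirac \<eta> h y)"
      by (simp add: D_def slice_dirac_eq)
    finally show ?thesis using U(3) [OF y] by simp
  qed
  ultimately show ?thesis using U(1) unfolding slice_monogenic_def g_def [abs_def] by simp
qed

text \<open>Setting the function to zero on the half opposite to \<open>y\<close> keeps it monogenic
  by \<open>slice_monogenic_half\<close>. It then vanishes on a nonempty open subset of the shell,
  which is connected because its dimension p + 2 is at least 2, and hence it vanishes at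
  \<open>y\<close>.\<close>

lemma slice_monogenic_shell_unique:
  fixes h :: "'i::{finite,linorder} slice \<Rightarrow> ('i, 'j::{finite,linorder}) cl"
  assumes \<eta>: "\<eta> \<in> sphere 0 1" and r: "0 \<le> \<rho>\<^sub>1" "\<rho>\<^sub>1 < \<rho>\<^sub>2"
    and U: "U = {y. \<rho>\<^sub>1 < norm y \<and> norm y < \<rho>\<^sub>2}" and mono: "slice_monogenic \<eta> U h"
    and zero: "\<And>y. y \<in> U \<Longrightarrow> snd y = 0 \<Longrightarrow> h y = 0" and y: "y \<in> U"
  shows "h y = 0"
proof (cases "snd y = 0")
  case False
  define c where "c = sgn (snd y)"
  have c: "c \<noteq> 0" "c * snd y > 0" using False by (auto simp: c_def sgn_if)
  define s where "s = (\<rho>\<^sub>1 + \<rho>\<^sub>2) / 2"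
  \<comment> \<open>A point of the half opposite to \<open>y\<close>, on the sphere midway between
    the two radii.\<close>
  define z where "z = ((0, - c * s) :: 'i slice)"
  have s: "s > 0" "\<rho>\<^sub>1 < s" "s < \<rho>\<^sub>2" using r by (auto simp: s_def)
  have "norm z = s" using s False by (simp add: z_def norm_prod_def c_def abs_mult abs_sgn_eq)
  then have zU: "z \<in> U" using s by (simp add: U)
  have conn: "connected U"
  proof -
    have "connected {y :: 'i slice. \<rho>\<^sub>1 < norm (y - 0) \<and> norm (y - 0) < \<rho>\<^sub>2}"
      by (rule connected_annulus) (simp add: Suc_le_eq)
    then show ?thesis by (simp add: U)
  qed
  have "open {y :: 'i slice. c * snd y < 0}" by (intro open_Collect_less continuous_intros)
  moreover have "z \<in> {y. c * snd y < 0}" using s False by (simp add: z_def c_def sgn_if)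
  ultimately obtain \<delta> where \<delta>: "\<delta> > 0" "ball z \<delta> \<subseteq> {y. c * snd y < 0}"
    by (meson open_contains_ball)
  have "(if c * snd y \<le> 0 then 0 else h y) = 0"
    by (rule slice_monogenic_connected_unique [OF \<eta> slice_monogenic_half [OF \<eta> mono zero c(1)] conn zU \<delta>(1) _ y])
      (use \<delta>(2) in \<open>auto dest!: subsetD\<close>)
  then show ?thesis using c(2) by simp
qed (use zero y in simp)

section \<open>Transfer between slices\<close>

definition slice_reflect :: "'i::finite slice \<Rightarrow> 'i slice" where
  "slice_reflect y = (fst y, - snd y)"

text \<open>The right-hand side of the representation formula.\<close>

definition slice_transfer ::
  "(real, 'j::{finite,linorder}) vec \<Rightarrow> (real, 'j) vec \<Rightarrow> ('i::{finite,linorder} slice \<Rightarrow> ('i, 'j) cl) \<Rightarrow> 'i slice \<Rightarrow> ('i, 'j) cl" where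
  "slice_transfer \<omega> \<eta> g y = (1 / 2) *\<^sub>R ((1 - im_vec \<omega> * im_vec \<eta>) * g y + (1 + im_vec \<omega> * im_vec \<eta>) * g (slice_reflect y))"

lemma norm_slice_reflect [simp]: "norm (slice_reflect y) = norm y"
  by (simp add: slice_reflect_def norm_prod_def)

text \<open>The factor \<open>1 - 2 * snd v\<close> is 1 along x_0, ..., x_p and -1 along r.\<close>

lemma slice_reflect_line:
  "v \<in> Basis \<Longrightarrow> slice_reflect (y + t *\<^sub>R v) = slice_reflect y + ((1 - 2 * snd v) * t) *\<^sub>R v"
  by (auto simp: slice_reflect_def Basis_slice prod_eq_iff)

text \<open>Each of the two imaginary factors conjugates \<open>e_vec i\<close>, and the two
  conjugations cancel. So the factors in \<open>slice_transfer\<close> pass through the part of the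
  Dirac operator in x_0, ..., x_p.\<close>

lemma e_vec_im_vec_im_vec:
  "e_vec i * (im_vec \<omega> * im_vec \<eta>) = (im_vec \<omega> * im_vec \<eta>) * (e_vec i :: ('i::{finite,linorder}, 'j::{finite,linorder}) cl)"
proof -
  have "e_vec i * (im_vec \<omega> * im_vec \<eta>) = im_vec \<omega> * (e_conj i * (im_vec \<eta> :: ('i, 'j) cl))"
    by (simp only: im_vec_e_conj mult.assoc [symmetric])
  also have "\<dots> = im_vec \<omega> * (im_vec \<eta> * e_vec i)" by (simp only: im_vec_e_vec)
  finally show ?thesis by (simp only: mult.assoc)
qed

text \<open>With \<open>p\<close> the product of \<omega> and \<eta> as Clifford elements, \<omega>
  (1 - p) = (1 - p) \<eta> and \<omega> (1 + p) = - (1 + p) \<eta>, while reflection reverses the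
  derivative in r. So the operator for \<omega>, applied to the transfer, reduces to the operator
  for \<eta>, applied to \<open>g\<close> at \<open>y\<close> and at its reflection.\<close>

lemma slice_monogenic_transfer:
  fixes g :: "'i::{finite,linorder} slice \<Rightarrow> ('i, 'j::{finite,linorder}) cl"
  assumes \<eta>: "\<eta> \<in> sphere 0 1" and \<omega>: "\<omega> \<in> sphere 0 1" and mono: "slice_monogenic \<eta> U g"
    and sym_U: "\<And>y. y \<in> U \<Longrightarrow> slice_reflect y \<in> U"
  shows "slice_monogenic \<omega> U (slice_transfer \<omega> \<eta> g)"
proof -
  have U: "open U" "continuous_partials_on U g" "\<And>y. y \<in> U \<Longrightarrow> slice_dirac \<eta> g y = 0"
    using mono by (auto simp: slice_monogenic_def)
  note hd = continuous_partials_on_has_vector_derivative [OF U(2)]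
  define p where "p = im_vec \<omega> * (im_vec \<eta> :: ('i, 'j) cl)"
  define D where "D v y = (1 / 2) *\<^sub>R ((1 - p) * directional_deriv v g y
      + (1 + p) * ((1 - 2 * snd v) *\<^sub>R directional_deriv v g (slice_reflect y)))" for v y
  have gd: "((\<lambda>t. slice_transfer \<omega> \<eta> g (y + t *\<^sub>R v)) has_vector_derivative D v y) (at 0)" if v: "v \<in> Basis" and y: "y \<in> U" for v y
  proof -
    have "((\<lambda>t. (1 - 2 * snd v) * t) has_vector_derivative (1 - 2 * snd v)) (at 0)"
      by (auto intro!: derivative_eq_intros simp flip: has_real_derivative_iff_has_vector_derivative)
    moreover have "((\<lambda>t. g (slice_reflect y + t *\<^sub>R v)) has_vector_derivative directional_deriv v g (slice_reflect y)) (at ((1 - 2 * snd v) * 0))"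
      using hd [OF v sym_U [OF y]] by simp
    ultimately have "((\<lambda>t. g (slice_reflect (y + t *\<^sub>R v))) has_vector_derivative (1 - 2 * snd v) *\<^sub>R directional_deriv v g (slice_reflect y)) (at 0)"
      using vector_diff_chain_at [of "\<lambda>t. (1 - 2 * snd v) * t" "1 - 2 * snd v" 0 "\<lambda>t. g (slice_reflect y + t *\<^sub>R v)"]
      unfolding slice_reflect_line [OF v] o_def by simp
    then show ?thesis
      unfolding slice_transfer_def D_def p_def [symmetric]
      by (intro bounded_linear.has_vector_derivative [OF bounded_linear_scaleR_right] has_vector_derivative_add
        bounded_linear.has_vector_derivative [OF bounded_linear_clifford_mult_left] hd v y)
  qed
  have "continuous_partials_on U (slice_transfer \<omega> \<eta> g)"
  proof (rule continuous_partials_onI [OF gd])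
    fix v :: "'i slice" assume v: "v \<in> Basis"
    have dc: "continuous_on U (directional_deriv v g)" using U(2) v by (simp add: continuous_partials_on_def)
    have "continuous_on U (\<lambda>y. directional_deriv v g (slice_reflect y))"
    proof (rule continuous_on_compose2 [OF dc])
      show "continuous_on U slice_reflect" unfolding slice_reflect_def by (intro continuous_intros)
    qed (use sym_U in auto)
    then show "continuous_on U (D v)"
      unfolding D_def by (intro continuous_intros dc)
  qed
  moreover have "slice_dirac \<omega> (slice_transfer \<omega> \<eta> g) y = 0" if y: "y \<in> U" for y
  proof -
    define A where "A = directional_deriv (0, 1) g y"
    define B where "B = directional_deriv (0, 1) g (slice_reflect y)"
    have e: "(\<Sum>i\<in>UNIV. e_vec i * directional_deriv (axis i 1, 0) g z) = - (im_vec \<eta> * directional_deriv (0, 1) g z)" if "z \<in> U" for z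
      using U(3) [OF that] by (simp add: slice_dirac_def eq_neg_iff_add_eq_0)
    have pe: "e_vec i * p = p * e_vec i" for i unfolding p_def by (rule e_vec_im_vec_im_vec)
    have p\<eta>: "p * im_vec \<eta> = - im_vec \<omega>"
      by (simp add: p_def mult.assoc im_vec_unit_square [OF \<eta>])
    have \<omega>p: "im_vec \<omega> * p = - im_vec \<eta>"
      by (simp add: p_def mult.assoc [symmetric] im_vec_unit_square [OF \<omega>])
    have "slice_dirac \<omega> (slice_transfer \<omega> \<eta> g) y = (\<Sum>v\<in>Basis. slice_para \<omega> v * D v y)"
      unfolding slice_dirac_eq by (intro sum.cong refl arg_cong2 [where f = "(*)"] directional_deriv_eqI gd y)
    also have "\<dots> = (\<Sum>i\<in>UNIV. e_vec i * ((1 / 2) *\<^sub>R ((1 - p) * directional_deriv (axis i 1, 0) g y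
        + (1 + p) * directional_deriv (axis i 1, 0) g (slice_reflect y)))) + im_vec \<omega> * ((1 / 2) *\<^sub>R ((1 - p) * A - (1 + p) * B))"
      by (simp add: sum_Basis_slice D_def A_def B_def)
    also have "(\<Sum>i\<in>UNIV. e_vec i * ((1 / 2) *\<^sub>R ((1 - p) * directional_deriv (axis i 1, 0) g y
        + (1 + p) * directional_deriv (axis i 1, 0) g (slice_reflect y))))
      = (1 / 2) *\<^sub>R ((1 - p) * (\<Sum>i\<in>UNIV. e_vec i * directional_deriv (axis i 1, 0) g y)
        + (1 + p) * (\<Sum>i\<in>UNIV. e_vec i * directional_deriv (axis i 1, 0) g (slice_reflect y)))"
    proof -
      have "e_vec i * ((1 / 2) *\<^sub>R ((1 - p) * a + (1 + p) * b)) = (1 / 2) *\<^sub>R ((1 - p) * (e_vec i * a)) + (1 / 2) *\<^sub>R ((1 + p) * (e_vec i * b))" for i a b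
        by (simp add: distrib_left distrib_right left_diff_distrib right_diff_distrib mult.assoc [symmetric] pe scaleR_add_right scaleR_diff_right)
      then show ?thesis
        by (simp only: scaleR_sum_right sum_distrib_left sum.distrib scaleR_add_right)
    qed
    also have "\<dots> = (1 / 2) *\<^sub>R (- ((1 - p) * im_vec \<eta> * A) - (1 + p) * im_vec \<eta> * B)"
      unfolding e [OF y] e [OF sym_U [OF y]] A_def B_def by (simp add: mult.assoc)
    also have "\<dots> + im_vec \<omega> * ((1 / 2) *\<^sub>R ((1 - p) * A - (1 + p) * B)) = 0"
      by (simp add: left_diff_distrib right_diff_distrib distrib_left distrib_right mult.assoc [symmetric] p\<eta> \<omega>p
        scaleR_diff_right scaleR_add_right)
    finally show ?thesis .
  qed
  ultimately show ?thesis using U(1) unfolding slice_monogenic_def by simp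
qed

lemma slice_transfer_r0: "slice_transfer \<omega> \<eta> g (u, 0) = g (u, 0)"
proof -
  have "slice_transfer \<omega> \<eta> g (u, 0) = (1 / 2) *\<^sub>R (g (u, 0) + g (u, 0))"
    by (simp add: slice_transfer_def slice_reflect_def left_diff_distrib distrib_right)
  then show ?thesis by (simp flip: scaleR_2)
qed

text \<open>A function of the form A + \<eta> B with A even and B odd in r is turned into A +
  \<omega> B. This is how explicit functions are recognised as transfers of their restriction to one
  slice.\<close>

lemma slice_transfer_stem:
  assumes \<eta>: "\<eta> \<in> sphere 0 1" and "g y = A + im_vec \<eta> * B" "g (slice_reflect y) = A - im_vec \<eta> * B"
  shows "slice_transfer \<omega> \<eta> g y = A + im_vec \<omega> * B"
proof -
  have "im_vec \<omega> * im_vec \<eta> * (im_vec \<eta> * B) = - (im_vec \<omega> * B)"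
  proof -
    have "im_vec \<omega> * im_vec \<eta> * (im_vec \<eta> * B) = im_vec \<omega> * ((im_vec \<eta> * im_vec \<eta>) * B)"
      by (simp only: mult.assoc)
    then show ?thesis by (simp add: im_vec_unit_square [OF \<eta>])
  qed
  then have "(1 - im_vec \<omega> * im_vec \<eta>) * (A + im_vec \<eta> * B) + (1 + im_vec \<omega> * im_vec \<eta>) * (A - im_vec \<eta> * B) = 2 *\<^sub>R (A + im_vec \<omega> * B)"
    by (simp add: distrib_left distrib_right left_diff_distrib right_diff_distrib scaleR_2)
  then show ?thesis by (simp add: slice_transfer_def assms(2,3))
qed

lemma slice_transfer_sum: "slice_transfer \<omega> \<eta> (\<lambda>y. \<Sum>i\<in>I. G i y) y = (\<Sum>i\<in>I. slice_transfer \<omega> \<eta> (G i) y)"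
  by (simp add: slice_transfer_def sum_distrib_left sum.distrib scaleR_add_right scaleR_sum_right)

lemma slice_transfer_mult_right: "slice_transfer \<omega> \<eta> g y * a = slice_transfer \<omega> \<eta> (\<lambda>y. g y * a) y"
  by (simp add: slice_transfer_def distrib_right mult.assoc)

lemma slice_transfer_scaleR: "slice_transfer \<omega> \<eta> (\<lambda>y. c *\<^sub>R g y) y = c *\<^sub>R slice_transfer \<omega> \<eta> g y"
  by (simp add: slice_transfer_def scaleR_add_right)

text \<open>The point is that \<open>A\<close> and \<open>B\<close> do not depend on \<omega>. This
  survives the induction because moving \<omega> to the left past a letter only conjugates
  \<open>e_vec\<close>. The second product, with -r, records the parity in r.\<close>

lemma fueter_product_stem:
  fixes ls :: "'i::{finite,linorder} list"
  shows "\<exists>A B :: ('i, 'j::{finite,linorder}) cl. \<forall>\<omega>\<in>sphere 0 1.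
    prod_list (map (\<lambda>l. (u $ l) *\<^sub>R 1 + r *\<^sub>R (im_vec \<omega> * e_vec l)) ls) = A + im_vec \<omega> * B \<and>
    prod_list (map (\<lambda>l. (u $ l) *\<^sub>R 1 + (- r) *\<^sub>R (im_vec \<omega> * e_vec l)) ls) = A - im_vec \<omega> * B"
proof (induction ls)
  case Nil
  show ?case by (intro exI [of _ 1] exI [of _ 0]) simp
next
  case (Cons l ls)
  then obtain A B :: "('i, 'j) cl" where AB: "\<And>\<omega>. \<omega> \<in> sphere 0 1 \<Longrightarrow>
    prod_list (map (\<lambda>l. (u $ l) *\<^sub>R 1 + r *\<^sub>R (im_vec \<omega> * e_vec l)) ls) = A + im_vec \<omega> * B \<and>
    prod_list (map (\<lambda>l. (u $ l) *\<^sub>R 1 + (- r) *\<^sub>R (im_vec \<omega> * e_vec l)) ls) = A - im_vec \<omega> * B"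
    by blast
  define A' where "A' = (u $ l) *\<^sub>R A - r *\<^sub>R (e_conj l * B)"
  define B' where "B' = (u $ l) *\<^sub>R B + r *\<^sub>R (e_vec l * A)"
  have "((u $ l) *\<^sub>R 1 + r *\<^sub>R (im_vec \<omega> * e_vec l)) * (A + im_vec \<omega> * B) = A' + im_vec \<omega> * B'"
    "((u $ l) *\<^sub>R 1 + (- r) *\<^sub>R (im_vec \<omega> * e_vec l)) * (A - im_vec \<omega> * B) = A' - im_vec \<omega> * B'"
    if \<omega>: "\<omega> \<in> sphere 0 1" for \<omega> :: "(real, 'j) vec"
  proof -
    have "e_vec l * (im_vec \<omega> * B) = im_vec \<omega> * (e_conj l * B)"
      by (simp only: im_vec_e_conj mult.assoc [symmetric])
    have e: "im_vec \<omega> * e_vec l * (im_vec \<omega> * B) = - (e_conj l * B)"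
    proof -
      have "im_vec \<omega> * e_vec l * (im_vec \<omega> * B) = im_vec \<omega> * (im_vec \<omega> * (e_conj l * B))"
        unfolding mult.assoc \<open>e_vec l * (im_vec \<omega> * B) = im_vec \<omega> * (e_conj l * B)\<close> ..
      also have "\<dots> = (im_vec \<omega> * im_vec \<omega>) * (e_conj l * B)" by (simp only: mult.assoc)
      finally show ?thesis by (simp add: im_vec_unit_square [OF \<omega>])
    qed
    show "((u $ l) *\<^sub>R 1 + r *\<^sub>R (im_vec \<omega> * e_vec l)) * (A + im_vec \<omega> * B) = A' + im_vec \<omega> * B'"
      "((u $ l) *\<^sub>R 1 + (- r) *\<^sub>R (im_vec \<omega> * e_vec l)) * (A - im_vec \<omega> * B) = A' - im_vec \<omega> * B'"
      by (simp_all add: A'_def B'_def distrib_left distrib_right left_diff_distrib right_diff_distrib e)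
        (simp_all add: mult.assoc)
  qed
  with AB show ?case by (intro exI [of _ A'] exI [of _ B']) simp
qed

lemma fueter_slice_transfer:
  fixes \<kappa> :: "'i::{finite,linorder} \<Rightarrow> nat" and \<omega> \<eta> :: "real ^ 'j::{finite,linorder}"
  assumes "\<omega> \<in> sphere 0 1" "\<eta> \<in> sphere 0 1"
  shows "fueter_slice \<omega> \<kappa> y = slice_transfer \<omega> \<eta> (fueter_slice \<eta> \<kappa>) y"
proof -
  have "prod_list (map (\<lambda>l. (fst y $ l) *\<^sub>R 1 + snd y *\<^sub>R (im_vec \<omega> * e_vec l)) ls) =
      slice_transfer \<omega> \<eta> (\<lambda>y. prod_list (map (\<lambda>l. (fst y $ l) *\<^sub>R 1 + snd y *\<^sub>R (im_vec \<eta> * e_vec l)) ls)) y" for ls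
  proof -
    obtain A B :: "('i, 'j) cl" where AB: "\<forall>\<omega>\<in>sphere 0 1.
      prod_list (map (\<lambda>l. (fst y $ l) *\<^sub>R 1 + snd y *\<^sub>R (im_vec \<omega> * e_vec l)) ls) = A + im_vec \<omega> * B \<and>
      prod_list (map (\<lambda>l. (fst y $ l) *\<^sub>R 1 + (- snd y) *\<^sub>R (im_vec \<omega> * e_vec l)) ls) = A - im_vec \<omega> * B"
      using fueter_product_stem [of "fst y" "snd y" ls] by blast
    have "slice_transfer \<omega> \<eta> (\<lambda>y. prod_list (map (\<lambda>l. (fst y $ l) *\<^sub>R 1 + snd y *\<^sub>R (im_vec \<eta> * e_vec l)) ls)) y = A + im_vec \<omega> * B"
      by (rule slice_transfer_stem [OF assms(2)]) (use AB assms in \<open>auto simp: slice_reflect_def\<close>)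
    then show ?thesis using AB assms by simp
  qed
  then show ?thesis
    unfolding fueter_slice_def slice_transfer_scaleR slice_transfer_sum by simp
qed

lemma im_vec_minus: "im_vec (- v) = - im_vec v"
  using im_vec_scaleR [of "- 1" v] by simp

lemma slice_kernel_reflect: "slice_kernel \<eta> (slice_reflect z) = slice_kernel (- \<eta>) z"
  unfolding slice_kernel_def slice_conj_eq norm_slice_reflect im_vec_minus by (simp add: slice_reflect_def)

lemma slice_multi_deriv_reflect:
  fixes g :: "'i::{finite,linorder} slice \<Rightarrow> 'w::euclidean_space"
  shows "slice_multi_deriv \<kappa> (\<lambda>z. g (slice_reflect z)) y = slice_multi_deriv \<kappa> g (slice_reflect y)"
proof -
  have 1: "directional_deriv (axis i 1, 0) (\<lambda>z. g (slice_reflect z)) = (\<lambda>z. directional_deriv (axis i 1, 0) g (slice_reflect z))" for i and g :: "'i slice \<Rightarrow> 'w"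
    unfolding directional_deriv_def by (simp add: slice_reflect_def)
  have "iter_deriv (map (\<lambda>i. (axis i 1, 0)) ls) (\<lambda>z. g (slice_reflect z)) = (\<lambda>z. iter_deriv (map (\<lambda>i. (axis i 1, 0)) ls) g (slice_reflect z))" for ls
    by (induction ls) (simp_all add: 1)
  then show ?thesis
    unfolding slice_multi_deriv_def foldr_directional_deriv by simp
qed

text \<open>The kernel itself has the form A + \<omega> B, and derivatives in x_0, ..., x_p commute
  both with reflection in r and with left multiplication by constants.\<close>

lemma kernel_deriv_slice_transfer:
  fixes \<kappa> :: "'i::{finite,linorder} \<Rightarrow> nat" and \<omega> \<eta> :: "real ^ 'j::{finite,linorder}"
  assumes "\<omega> \<in> sphere 0 1" "\<eta> \<in> sphere 0 1" "y \<noteq> 0"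
  shows "kernel_deriv_slice \<omega> \<kappa> y = slice_transfer \<omega> \<eta> (kernel_deriv_slice \<eta> \<kappa>) y"
proof -
  define p where "p = im_vec \<omega> * (im_vec \<eta> :: ('i, 'j) cl)"
  let ?E = "\<lambda>\<eta>. slice_kernel \<eta> :: 'i slice \<Rightarrow> ('i, 'j) cl"
  have E: "?E \<omega> z = slice_transfer \<omega> \<eta> (?E \<eta>) z" for z
  proof -
    define k where "k = (1 / sphere_area TYPE('i)) * (1 / norm z ^ (CARD('i) + 1))"
    have K: "?E \<theta> w = k *\<^sub>R (\<Sum>i\<in>UNIV. (fst w $ i) *\<^sub>R e_conj i) + im_vec \<theta> * (- (k * snd w) *\<^sub>R 1)" if "norm w = norm z" for \<theta> w
      by (simp add: slice_kernel_def slice_conj_eq that k_def scaleR_diff_right)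
    have "slice_transfer \<omega> \<eta> (?E \<eta>) z = k *\<^sub>R (\<Sum>i\<in>UNIV. (fst z $ i) *\<^sub>R e_conj i) + im_vec \<omega> * (- (k * snd z) *\<^sub>R 1)"
      by (rule slice_transfer_stem [OF assms(2)]) (simp_all only: K norm_slice_reflect, simp_all add: slice_reflect_def)
    then show ?thesis using K [of z \<omega>] by simp
  qed
  define L1 where "L1 x = (1 / 2) *\<^sub>R ((1 - p) * x)" for x
  define L2 where "L2 x = (1 / 2) *\<^sub>R ((1 + p) * x)" for x
  have L: "linear L1" "linear L2"
    unfolding L1_def L2_def by (auto intro!: linearI simp: distrib_left scaleR_add_right)
  \<comment> \<open>The reflected kernel is written as the kernel of -\<eta>, for which smoothness
    off the origin is known; the two summands are indexed by a Boolean to fit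
    \<open>iter_deriv_fun_sum\<close>.\<close>
  have E': "?E \<omega> z = (\<Sum>b\<in>UNIV. (if b then L1 (?E \<eta> z) else L2 (?E (- \<eta>) z)))" for z
    by (simp add: E slice_transfer_def L1_def L2_def p_def UNIV_bool slice_kernel_reflect scaleR_add_right add.commute)
  note sm = smooth_off0_slice_kernel
  define vs where "vs = map (\<lambda>i. (axis i 1, 0) :: 'i slice) (concat (map (\<lambda>i. replicate (\<kappa> i) i) (sorted_list_of_set UNIV)))"
  have smd: "slice_multi_deriv \<kappa> G = iter_deriv vs G" for G :: "'i slice \<Rightarrow> ('i, 'j) cl"
    unfolding slice_multi_deriv_def foldr_directional_deriv vs_def ..
  have sm2: "smooth_off0 (\<lambda>z. if b then L1 (?E \<eta> z) else L2 (?E (- \<eta>) z))" for b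
    using smooth_off0_linear [OF sm L(1), of \<eta>] smooth_off0_linear [OF sm L(2), of "- \<eta>"] by (cases b) auto
  have "iter_deriv vs (?E \<omega>) y = (\<Sum>b\<in>UNIV. iter_deriv vs (\<lambda>z. if b then L1 (?E \<eta> z) else L2 (?E (- \<eta>) z)) y)"
    unfolding E' by (rule iter_deriv_fun_sum [OF finite sm2 assms(3)])
  also have "\<dots> = L1 (iter_deriv vs (?E \<eta>) y) + L2 (iter_deriv vs (?E (- \<eta>)) y)"
    using iter_deriv_linear [OF sm L(1) assms(3), of vs \<eta>] iter_deriv_linear [OF sm L(2) assms(3), of vs "- \<eta>"]
    by (simp add: UNIV_bool add.commute)
  also have "iter_deriv vs (?E (- \<eta>)) y = iter_deriv vs (?E \<eta>) (slice_reflect y)"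
    using slice_multi_deriv_reflect [of \<kappa> "?E \<eta>" y] unfolding smd slice_kernel_reflect .
  finally have "slice_multi_deriv \<kappa> (?E \<omega>) y = slice_transfer \<omega> \<eta> (slice_multi_deriv \<kappa> (?E \<eta>)) y"
    unfolding smd by (simp add: slice_transfer_def L1_def L2_def p_def scaleR_add_right)
  then show ?thesis
    unfolding kernel_deriv_slice_eq [OF assms(1)] kernel_deriv_slice_eq [OF assms(2)] slice_transfer_scaleR by simp
qed

text \<open>The constant is uniform in \<omega>, so a bound on the slice of \<eta> yields one on all
  slices simultaneously.\<close>

lemma slice_transfer_bound:
  "\<exists>C\<ge>0. \<forall>(\<omega> :: (real, 'j::{finite,linorder}) vec) (\<eta> :: (real, 'j) vec) (g :: 'i::{finite,linorder} slice \<Rightarrow> ('i, 'j) cl) y.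
    \<omega> \<in> sphere 0 1 \<longrightarrow> \<eta> \<in> sphere 0 1 \<longrightarrow> norm (slice_transfer \<omega> \<eta> g y) \<le> C * (norm (g y) + norm (g (slice_reflect y)))"
proof -
  obtain K where K: "K > 0" "\<And>x y :: ('i, 'j) cl. norm (x * y) \<le> norm x * norm y * K"
    using clifford_mult.pos_bounded by blast
  have "linear (im_vec :: (real, 'j) vec \<Rightarrow> ('i, 'j) cl)"
    by (intro linearI) (simp_all add: im_vec_add im_vec_scaleR)
  then obtain N where N: "N > 0" "\<And>v. norm (im_vec v :: ('i, 'j) cl) \<le> norm v * N"
    unfolding linear_conv_bounded_linear using bounded_linear.pos_bounded by blast
  define q where "q = norm (1 :: ('i, 'j) cl) + N * N * K"
  have "norm (slice_transfer \<omega> \<eta> g y) \<le> (q * K) * (norm (g y) + norm (g (slice_reflect y)))"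
    if o: "\<omega> \<in> sphere 0 1" "\<eta> \<in> sphere 0 1" for \<omega> \<eta> :: "(real, 'j) vec" and g :: "'i slice \<Rightarrow> ('i, 'j) cl" and y
  proof -
    let ?p = "im_vec \<omega> * im_vec \<eta> :: ('i, 'j) cl"
    have "norm ?p \<le> norm (im_vec \<omega> :: ('i, 'j) cl) * norm (im_vec \<eta> :: ('i, 'j) cl) * K" by (rule K)
    also have "\<dots> \<le> N * N * K" using N(2) [of \<omega>] N(2) [of \<eta>] N(1) K(1) o by (intro mult_mono) auto
    finally have p: "norm (1 - ?p) \<le> q" "norm (1 + ?p) \<le> q"
      unfolding q_def using norm_triangle_ineq4 [of 1 ?p] norm_triangle_ineq [of 1 ?p] by linarith+
    have t: "norm (a * x) \<le> q * K * norm x" if "norm a \<le> q" for a x :: "('i, 'j) cl"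
    proof -
      have "norm (a * x) \<le> norm a * norm x * K" by (rule K)
      also have "\<dots> \<le> q * norm x * K" using that K(1) by (intro mult_right_mono) auto
      finally show ?thesis by (simp add: mult_ac)
    qed
    have "norm (slice_transfer \<omega> \<eta> g y) \<le> (1 / 2) * (norm ((1 - ?p) * g y) + norm ((1 + ?p) * g (slice_reflect y)))"
      unfolding slice_transfer_def norm_scaleR using norm_triangle_ineq by (simp add: mult_left_mono)
    also have "\<dots> \<le> norm ((1 - ?p) * g y) + norm ((1 + ?p) * g (slice_reflect y))" by simp
    also have "\<dots> \<le> q * K * norm (g y) + q * K * norm (g (slice_reflect y))"
      by (intro add_mono t p)
    finally show ?thesis by (simp add: distrib_left)
  qed
  moreover have "q * K \<ge> 0" using K N by (simp add: q_def)
  ultimately show ?thesis by blast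
qed

section \<open>The Laurent expansion\<close>

text \<open>
  Both sequences of coefficients are read off a power series in a scaling parameter whose sum is a
  boundary integral of the Cauchy kernel with its pole outside the shell.
\<close>

lemma boundary_integral_kernel_term_radius:
  fixes g :: "'i::{finite,linorder} slice \<Rightarrow> ('i, 'j::{finite,linorder}) cl"
  assumes \<eta>: "\<eta> \<in> sphere 0 1"
    and r: "0 \<le> \<rho>\<^sub>1" "\<rho>\<^sub>1 < R" "R \<le> R'" "R' < \<rho>\<^sub>2"
    and mono: "slice_monogenic \<eta> {y. \<rho>\<^sub>1 < norm y \<and> norm y < \<rho>\<^sub>2} g"
  shows "boundary_integral \<eta> R (kernel_term \<eta> k x) g = boundary_integral \<eta> R' (kernel_term \<eta> k x) g"
    and "x \<noteq> 0 \<Longrightarrow> (\<And>k s. 0 < s \<Longrightarrow> continuous_on (sphere 0 s) (\<lambda>y. kernel_term \<eta> k y x)) \<Longrightarrow>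
      boundary_integral \<eta> R (\<lambda>y. kernel_term \<eta> k y x) g = boundary_integral \<eta> R' (\<lambda>y. kernel_term \<eta> k y x) g"
proof -
  have gc: "continuous_on (sphere 0 s) g" if "\<rho>\<^sub>1 < s" "s < \<rho>\<^sub>2" for s
    by (rule continuous_on_subset [OF slice_monogenic_continuous_on [OF mono]]) (use that in auto)
  have R0: "R > 0" "R' > 0" using r by auto
  have gR: "continuous_on (sphere 0 R) g" "continuous_on (sphere 0 R') g" using r by (auto intro: gc)
  show "boundary_integral \<eta> R (kernel_term \<eta> k x) g = boundary_integral \<eta> R' (kernel_term \<eta> k x) g"
  proof -
    let ?A = "\<lambda>s k. boundary_integral \<eta> s (kernel_term \<eta> k x) g"
    have scale: "boundary_integral \<eta> s (kernel_term \<eta> k (t *\<^sub>R x)) g = t ^ k *\<^sub>R ?A s k"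
      if s: "s > 0" "continuous_on (sphere 0 s) g" for s t k
    proof -
      have "boundary_integral \<eta> s (kernel_term \<eta> k (t *\<^sub>R x)) g = boundary_integral \<eta> s (\<lambda>y. t ^ k *\<^sub>R kernel_term \<eta> k x y) g"
      proof (rule boundary_integral_cong)
        fix y :: "'i slice" assume "norm y = s"
        then have "y \<noteq> 0" using s by auto
        then show "kernel_term \<eta> k (t *\<^sub>R x) y = t ^ k *\<^sub>R kernel_term \<eta> k x y" by (rule kernel_term_scaleR)
      qed simp
      also have "\<dots> = t ^ k *\<^sub>R ?A s k"
        by (rule boundary_integral_scaleR [OF s(1) continuous_on_kernel_term s(2)]) (use s in auto)
      finally show ?thesis .
    qed
    \<comment> \<open>For small t the point t x lies inside the smaller sphere, so the two boundary
      integrals of the kernel agree. The summand 1 in the radius below covers x = 0.\<close>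
    have "?A R k - ?A R' k = 0"
    proof (rule powser_zero_right [where \<delta> = "R / (norm x + 1)"])
      have x1: "norm x + 1 > 0" by (simp add: add_nonneg_pos)
      then show "R / (norm x + 1) > 0" using R0 by simp
      fix t assume t: "0 < t" "t < R / (norm x + 1)"
      have "t * norm x \<le> t * (norm x + 1)" using t by simp
      also have "\<dots> < R" using t x1 by (simp add: pos_less_divide_eq)
      finally have tx: "norm (t *\<^sub>R x) < R" using t by simp
      have "boundary_integral \<eta> R' (\<lambda>y. slice_kernel \<eta> (y - t *\<^sub>R x)) g - boundary_integral \<eta> R (\<lambda>y. slice_kernel \<eta> (y - t *\<^sub>R x)) g
          = (if R < norm (t *\<^sub>R x) \<and> norm (t *\<^sub>R x) < R' then g (t *\<^sub>R x) else 0)"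
        by (rule borel_pompeiu_shell [OF \<eta> r mono]) (use tx r in auto)
      then have eq: "boundary_integral \<eta> R' (\<lambda>y. slice_kernel \<eta> (y - t *\<^sub>R x)) g = boundary_integral \<eta> R (\<lambda>y. slice_kernel \<eta> (y - t *\<^sub>R x)) g"
        using tx by simp
      have "(\<lambda>k. t ^ k *\<^sub>R ?A R k - t ^ k *\<^sub>R ?A R' k) sums (boundary_integral \<eta> R (\<lambda>y. slice_kernel \<eta> (y - t *\<^sub>R x)) g
          - boundary_integral \<eta> R' (\<lambda>y. slice_kernel \<eta> (y - t *\<^sub>R x)) g)"
        unfolding scale [OF R0(1) gR(1), symmetric] scale [OF R0(2) gR(2), symmetric]
        by (intro sums_diff boundary_integral_kernel_sums(1) R0 gR) (use tx r in auto)
      then show "(\<lambda>k. t ^ k *\<^sub>R (?A R k - ?A R' k)) sums 0"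
        unfolding eq by (simp add: scaleR_diff_right)
    qed
    then show ?thesis by simp
  qed
  show "boundary_integral \<eta> R (\<lambda>y. kernel_term \<eta> k y x) g = boundary_integral \<eta> R' (\<lambda>y. kernel_term \<eta> k y x) g"
    if x: "x \<noteq> 0" and c: "\<And>k s. 0 < s \<Longrightarrow> continuous_on (sphere 0 s) (\<lambda>y. kernel_term \<eta> k y x)"
  proof -
    let ?B = "\<lambda>s k. boundary_integral \<eta> s (\<lambda>y. kernel_term \<eta> k y x) g"
    \<comment> \<open>E(x - t y) is rewritten with the pole x/t, which lies outside the sphere as t
      s < |x|. The kernel is odd and homogeneous of degree -(p + 1), which gives the factor
      -t^(-(p+1)).\<close>
    have sums: "(\<lambda>k. t ^ k *\<^sub>R ?B s k) sums ((- (1 / t ^ CARD('i))) *\<^sub>R boundary_integral \<eta> s (\<lambda>y. slice_kernel \<eta> (y - (1 / t) *\<^sub>R x)) g)"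
      if s: "s > 0" "continuous_on (sphere 0 s) g" and t: "t > 0" "t * s < norm x" for s t
    proof -
      let ?x = "(1 / t) *\<^sub>R x"
      obtain \<Gamma> :: "nat \<Rightarrow> real" where \<Gamma>: "\<And>k. \<Gamma> k \<ge> 0" "\<And>q. 0 \<le> q \<Longrightarrow> q < 1 \<Longrightarrow> summable (\<lambda>k. \<Gamma> k * q ^ k)"
        "\<And>(x :: 'i slice) y k \<tau>. norm x / norm y \<le> \<tau> \<Longrightarrow> y \<noteq> 0 \<Longrightarrow> norm (kernel_term \<eta> k x y) \<le> \<Gamma> k * \<tau> ^ k / norm y ^ CARD('i)"
        "\<And>(x :: 'i slice) y. norm x < norm y \<Longrightarrow> (\<lambda>k. kernel_term \<eta> k x y) sums slice_kernel \<eta> (y - x)"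
        using kernel_term_dominated [of \<eta>, where 'i = 'i] by blast
      have kt: "kernel_term \<eta> k (t *\<^sub>R y) x = t ^ k *\<^sub>R kernel_term \<eta> k y x" for k y
        by (rule kernel_term_scaleR [OF x])
      have ker: "slice_kernel \<eta> (x - t *\<^sub>R y) = (- (1 / t ^ CARD('i))) *\<^sub>R slice_kernel \<eta> (y - ?x)" for y
      proof -
        have "x - t *\<^sub>R y = t *\<^sub>R (- (y - ?x))" using t by (simp add: scaleR_diff_right)
        then show ?thesis using slice_kernel_scaleR [OF t(1), of \<eta> "- (y - ?x)"] slice_kernel_minus [of \<eta> "y - ?x"] by simp
      qed
      have kc: "continuous_on (sphere 0 s) (\<lambda>y. slice_kernel \<eta> (y - ?x))"
      proof (rule continuous_on_compose2 [OF continuous_on_slice_kernel [of "- {0}"]])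
        have "norm ?x > s" using t by (simp add: pos_less_divide_eq mult.commute)
        then show "(\<lambda>y. y - ?x) ` sphere 0 s \<subseteq> - {0}" by auto
      qed (auto intro!: continuous_intros)
      have "(\<lambda>k. boundary_integral \<eta> s (\<lambda>y. t ^ k *\<^sub>R kernel_term \<eta> k y x) g) sums
          boundary_integral \<eta> s (\<lambda>y. (- (1 / t ^ CARD('i))) *\<^sub>R slice_kernel \<eta> (y - ?x)) g"
      proof (rule boundary_integral_sums [OF s, where \<beta> = "\<lambda>k. \<Gamma> k * (t * s / norm x) ^ k / norm x ^ CARD('i)"])
        show "continuous_on (sphere 0 s) (\<lambda>y. t ^ k *\<^sub>R kernel_term \<eta> k y x)" for k
          by (intro continuous_intros c s)
        show "continuous_on (sphere 0 s) (\<lambda>y. (- (1 / t ^ CARD('i))) *\<^sub>R slice_kernel \<eta> (y - ?x))"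
          by (intro continuous_intros kc)
        show "summable (\<lambda>k. \<Gamma> k * (t * s / norm x) ^ k / norm x ^ CARD('i))"
          using x s t by (intro summable_divide \<Gamma>(2)) (auto simp: divide_less_eq)
        show "\<Gamma> k * (t * s / norm x) ^ k / norm x ^ CARD('i) \<ge> 0" for k
          using \<Gamma>(1) [of k] s t by simp
        show "norm (t ^ k *\<^sub>R kernel_term \<eta> k y x) \<le> \<Gamma> k * (t * s / norm x) ^ k / norm x ^ CARD('i)" if "norm y = s" for k y
          unfolding kt [symmetric] using \<Gamma>(3) [of "t *\<^sub>R y" x "t * s / norm x" k] that x t by simp
        show "(\<lambda>k. t ^ k *\<^sub>R kernel_term \<eta> k y x) sums ((- (1 / t ^ CARD('i))) *\<^sub>R slice_kernel \<eta> (y - ?x))" if "norm y = s" for y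
          unfolding kt [symmetric] ker [symmetric] using that t by (intro \<Gamma>(4)) simp
      qed
      then show ?thesis
        by (simp only: boundary_integral_scaleR [OF s(1) c [OF s(1)] s(2)] boundary_integral_scaleR [OF s(1) kc s(2)])
    qed
    \<comment> \<open>For small t the pole x/t lies beyond the larger sphere, so both radii give the
      same sum of the power series in t.\<close>
    have "?B R k - ?B R' k = 0"
    proof (rule powser_zero_right [where \<delta> = "norm x / R'"])
      show "norm x / R' > 0" using R0 x by simp
      fix t assume t: "0 < t" "t < norm x / R'"
      have tR': "t * R' < norm x" using t R0 by (simp add: pos_less_divide_eq)
      have tR: "t * R < norm x" using mult_left_mono [OF r(3), of t] t tR' by linarith
      let ?x = "(1 / t) *\<^sub>R x"
      have nx: "norm ?x > R'" using tR' t by (simp add: pos_less_divide_eq mult.commute)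
      have "boundary_integral \<eta> R' (\<lambda>y. slice_kernel \<eta> (y - ?x)) g - boundary_integral \<eta> R (\<lambda>y. slice_kernel \<eta> (y - ?x)) g
          = (if R < norm ?x \<and> norm ?x < R' then g ?x else 0)"
        by (rule borel_pompeiu_shell [OF \<eta> r mono]) (use nx r in linarith)+
      then have eq: "boundary_integral \<eta> R' (\<lambda>y. slice_kernel \<eta> (y - ?x)) g = boundary_integral \<eta> R (\<lambda>y. slice_kernel \<eta> (y - ?x)) g"
        using nx by simp
      have "(\<lambda>k. t ^ k *\<^sub>R ?B R k - t ^ k *\<^sub>R ?B R' k) sums
          ((- (1 / t ^ CARD('i))) *\<^sub>R boundary_integral \<eta> R (\<lambda>y. slice_kernel \<eta> (y - ?x)) g
            - (- (1 / t ^ CARD('i))) *\<^sub>R boundary_integral \<eta> R' (\<lambda>y. slice_kernel \<eta> (y - ?x)) g)"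
        by (intro sums_diff sums R0 gR t tR tR')
      then show "(\<lambda>k. t ^ k *\<^sub>R (?B R k - ?B R' k)) sums 0"
        unfolding eq by (simp add: scaleR_diff_right)
    qed
    then show ?thesis by simp
  qed
qed

lemma continuous_on_fueter_slice_right:
  fixes \<eta> :: "real ^ 'j::{finite,linorder}" and \<kappa> :: "'i::{finite,linorder} \<Rightarrow> nat"
  shows "continuous_on S (fueter_slice_right \<eta> \<kappa>)"
proof -
  have "continuous_on S (\<lambda>y. prod_list (map (\<lambda>l. (fst y $ l) *\<^sub>R 1 + snd y *\<^sub>R (e_vec l * im_vec \<eta>) :: ('i, 'j) cl) ls))" for ls
    by (induction ls) (auto intro!: continuous_intros)
  then show ?thesis unfolding fueter_slice_right_def by (intro continuous_intros)
qed

lemma continuous_on_kernel_deriv_slice: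
  assumes "\<eta> \<in> sphere 0 1" "0 \<notin> S"
  shows "continuous_on S (kernel_deriv_slice \<eta> \<kappa>)"
proof -
  have "continuous_on S (\<lambda>y. (- 1) ^ sum \<kappa> UNIV *\<^sub>R slice_multi_deriv \<kappa> (slice_kernel \<eta>) y)"
    unfolding slice_multi_deriv_def foldr_directional_deriv
    by (intro continuous_intros continuous_on_smooth_off0 smooth_off0_iter_deriv smooth_off0_slice_kernel assms)
  then show ?thesis by (simp add: kernel_deriv_slice_eq [OF assms(1), abs_def])
qed

text \<open>By \<open>kernel_term_right\<close> a kernel term is a polynomial in its first argument,
  with constants on the left.\<close>

lemma continuous_on_kernel_term_left:
  assumes "\<eta> \<in> sphere 0 1" "x \<noteq> 0"
  shows "continuous_on S (\<lambda>y. kernel_term \<eta> k y x)"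
  unfolding kernel_term_right [OF assms(2,1)]
  by (intro continuous_intros continuous_on_fueter_slice_right)

text \<open>Borel-Pompeiu between radii a < |x| < b: the kernel series converges on the outer sphere
  through the ratio |x|/b and on the inner one through a/|x|. Since every single term is independent
  of the radius of integration, both a and b may afterwards be replaced by \<rho>.\<close>

theorem slice_laurent:
  fixes g :: "'i::{finite,linorder} slice \<Rightarrow> ('i, 'j::{finite,linorder}) cl"
  assumes \<eta>: "\<eta> \<in> sphere 0 1"
    and r: "0 \<le> \<rho>\<^sub>1" "\<rho>\<^sub>1 < \<rho>" "\<rho> < \<rho>\<^sub>2"
    and mono: "slice_monogenic \<eta> {y. \<rho>\<^sub>1 < norm y \<and> norm y < \<rho>\<^sub>2} g"
    and A_def: "A = (\<lambda>k x. boundary_integral \<eta> \<rho> (kernel_term \<eta> k x) g)"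
    and B_def: "B = (\<lambda>k x. boundary_integral \<eta> \<rho> (\<lambda>y. kernel_term \<eta> k y x) g)"
  shows "\<rho>\<^sub>1 < norm x \<Longrightarrow> norm x < \<rho>\<^sub>2 \<Longrightarrow> summable (\<lambda>k. A k x) \<and> summable (\<lambda>k. B k x) \<and> g x = (\<Sum>k. A k x) + (\<Sum>k. B k x)"
    and "\<rho>\<^sub>1 < m \<Longrightarrow> m \<le> M \<Longrightarrow> M < \<rho>\<^sub>2 \<Longrightarrow> \<exists>\<beta>. summable \<beta> \<and> (\<forall>k x. m \<le> norm x \<longrightarrow> norm x \<le> M \<longrightarrow> norm (A k x) \<le> \<beta> k \<and> norm (B k x) \<le> \<beta> k)"
proof -
  have gc: "continuous_on (sphere 0 s) g" if "\<rho>\<^sub>1 < s" "s < \<rho>\<^sub>2" for s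
    by (rule continuous_on_subset [OF slice_monogenic_continuous_on [OF mono]]) (use that in auto)
  have A: "A k x = boundary_integral \<eta> R (kernel_term \<eta> k x) g" if R: "\<rho>\<^sub>1 < R" "R < \<rho>\<^sub>2" for R k x
  proof (cases "\<rho> \<le> R")
    case True
    show ?thesis unfolding A_def by (rule boundary_integral_kernel_term_radius(1) [OF \<eta> r(1,2) True R(2) mono])
  next
    case False
    then have "R \<le> \<rho>" by simp
    from boundary_integral_kernel_term_radius(1) [OF \<eta> r(1) R(1) this r(3) mono] show ?thesis by (simp add: A_def)
  qed
  have B: "B k x = boundary_integral \<eta> R (\<lambda>y. kernel_term \<eta> k y x) g" if R: "\<rho>\<^sub>1 < R" "R < \<rho>\<^sub>2" and x: "x \<noteq> 0" for R k x
  proof (cases "\<rho> \<le> R")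
    case True
    show ?thesis unfolding B_def
      by (rule boundary_integral_kernel_term_radius(2) [OF \<eta> r(1,2) True R(2) mono x continuous_on_kernel_term_left [OF \<eta> x]])
  next
    case False
    then have "R \<le> \<rho>" by simp
    from boundary_integral_kernel_term_radius(2) [OF \<eta> r(1) R(1) this r(3) mono x continuous_on_kernel_term_left [OF \<eta> x]]
    show ?thesis by (simp add: B_def)
  qed
  show "summable (\<lambda>k. A k x) \<and> summable (\<lambda>k. B k x) \<and> g x = (\<Sum>k. A k x) + (\<Sum>k. B k x)" if x: "\<rho>\<^sub>1 < norm x" "norm x < \<rho>\<^sub>2"
  proof -
    obtain a where a: "\<rho>\<^sub>1 < a" "a < norm x" using dense [OF x(1)] by blast
    obtain b where b: "norm x < b" "b < \<rho>\<^sub>2" using dense [OF x(2)] by blast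
    have x0: "x \<noteq> 0" using x r by auto
    have "(\<lambda>k. boundary_integral \<eta> b (kernel_term \<eta> k x) g) sums boundary_integral \<eta> b (\<lambda>y. slice_kernel \<eta> (y - x)) g"
      by (rule boundary_integral_kernel_sums(1)) (use a b r in \<open>auto intro: gc\<close>)
    then have sA: "(\<lambda>k. A k x) sums boundary_integral \<eta> b (\<lambda>y. slice_kernel \<eta> (y - x)) g"
      using A [of b] a b by simp
    have "(\<lambda>k. boundary_integral \<eta> a (\<lambda>y. kernel_term \<eta> k y x) g) sums boundary_integral \<eta> a (\<lambda>y. slice_kernel \<eta> (x - y)) g"
      by (rule boundary_integral_kernel_sums(2) [OF _ _ continuous_on_kernel_term_left [OF \<eta> x0]])
        (use a b r in \<open>auto intro: gc\<close>)
    then have sB: "(\<lambda>k. B k x) sums boundary_integral \<eta> a (\<lambda>y. slice_kernel \<eta> (x - y)) g"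
      using B [of a] a b x0 by simp
    \<comment> \<open>The kernel is odd, so the minus sign of the inner integral is absorbed by
      expanding E(x - y) instead of E(y - x).\<close>
    have "boundary_integral \<eta> a (\<lambda>y. slice_kernel \<eta> (x - y)) g = boundary_integral \<eta> a (\<lambda>y. (- 1) *\<^sub>R slice_kernel \<eta> (y - x)) g"
      
    proof (rule boundary_integral_cong)
      fix y
      show "slice_kernel \<eta> (x - y) = (- 1) *\<^sub>R slice_kernel \<eta> (y - x)"
        using slice_kernel_minus [of \<eta> "y - x"] by (simp only: minus_diff_eq scaleR_minus1_left)
    qed simp
    also have "\<dots> = (- 1) *\<^sub>R boundary_integral \<eta> a (\<lambda>y. slice_kernel \<eta> (y - x)) g"
    proof (rule boundary_integral_scaleR)
      show "continuous_on (sphere 0 a) (\<lambda>y. slice_kernel \<eta> (y - x))"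
        by (rule continuous_on_compose2 [OF continuous_on_slice_kernel [of "- {0}"]])
          (use a in \<open>auto intro!: continuous_intros\<close>)
    qed (use a b r in \<open>auto intro: gc\<close>)
    finally have neg: "boundary_integral \<eta> a (\<lambda>y. slice_kernel \<eta> (x - y)) g = - boundary_integral \<eta> a (\<lambda>y. slice_kernel \<eta> (y - x)) g"
      by simp
    have "boundary_integral \<eta> b (\<lambda>y. slice_kernel \<eta> (y - x)) g - boundary_integral \<eta> a (\<lambda>y. slice_kernel \<eta> (y - x)) g
        = (if a < norm x \<and> norm x < b then g x else 0)"
      by (rule borel_pompeiu_shell [OF \<eta> r(1) a(1) _ b(2) mono]) (use a b in auto)
    then have "g x = boundary_integral \<eta> b (\<lambda>y. slice_kernel \<eta> (y - x)) g + boundary_integral \<eta> a (\<lambda>y. slice_kernel \<eta> (x - y)) g"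
      using a b neg by simp
    then show ?thesis using sA sB by (simp add: sums_iff)
  qed
  show "\<exists>\<beta>. summable \<beta> \<and> (\<forall>k x. m \<le> norm x \<longrightarrow> norm x \<le> M \<longrightarrow> norm (A k x) \<le> \<beta> k \<and> norm (B k x) \<le> \<beta> k)"
    if m: "\<rho>\<^sub>1 < m" "m \<le> M" "M < \<rho>\<^sub>2"
  proof -
    \<comment> \<open>Spheres strictly off the closed shell m \<le> |x| \<le> M: the ratios a/m and
      M/b are below 1 and serve all these x at once.\<close>
    obtain a where a: "\<rho>\<^sub>1 < a" "a < m" using dense [OF m(1)] by blast
    obtain b where b: "M < b" "b < \<rho>\<^sub>2" using dense [OF m(3)] by blast
    have pos: "a > 0" "m > 0" "M > 0" "b > 0" using a b m r by auto
    have ra: "\<rho>\<^sub>1 < a" "a < \<rho>\<^sub>2" and rb: "\<rho>\<^sub>1 < b" "b < \<rho>\<^sub>2" using a b m by auto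
    have ga: "continuous_on (sphere 0 a) g" by (rule gc) (use a b m in auto)
    have gb: "continuous_on (sphere 0 b) g" by (rule gc) (use a b m in auto)
    obtain \<Gamma> :: "nat \<Rightarrow> real" where \<Gamma>: "\<And>k. \<Gamma> k \<ge> 0" "\<And>q. 0 \<le> q \<Longrightarrow> q < 1 \<Longrightarrow> summable (\<lambda>k. \<Gamma> k * q ^ k)"
      "\<And>(x :: 'i slice) y k \<tau>. norm x / norm y \<le> \<tau> \<Longrightarrow> y \<noteq> 0 \<Longrightarrow> norm (kernel_term \<eta> k x y) \<le> \<Gamma> k * \<tau> ^ k / norm y ^ CARD('i)"
      using kernel_term_dominated [of \<eta>, where 'i = 'i] by blast
    obtain N1 where N1: "N1 \<ge> 0" "\<And>G \<beta>. continuous_on (sphere 0 a) G \<Longrightarrow> \<beta> \<ge> 0 \<Longrightarrow> (\<And>y. norm y = a \<Longrightarrow> norm (G y) \<le> \<beta>)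
      \<Longrightarrow> norm (boundary_integral \<eta> a G g) \<le> N1 * \<beta>"
      using boundary_integral_bound [OF pos(1) ga, of \<eta>] by blast
    obtain N2 where N2: "N2 \<ge> 0" "\<And>G \<beta>. continuous_on (sphere 0 b) G \<Longrightarrow> \<beta> \<ge> 0 \<Longrightarrow> (\<And>y. norm y = b \<Longrightarrow> norm (G y) \<le> \<beta>)
      \<Longrightarrow> norm (boundary_integral \<eta> b G g) \<le> N2 * \<beta>"
      using boundary_integral_bound [OF pos(4) gb, of \<eta>] by blast
    define \<beta>1 where "\<beta>1 k = N1 * (\<Gamma> k * (a / m) ^ k / m ^ CARD('i))" for k
    define \<beta>2 where "\<beta>2 k = N2 * (\<Gamma> k * (M / b) ^ k / b ^ CARD('i))" for k
    have \<beta>0: "\<beta>1 k \<ge> 0" "\<beta>2 k \<ge> 0" for k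
      using N1(1) N2(1) \<Gamma>(1) [of k] pos by (auto simp: \<beta>1_def \<beta>2_def)
    have "summable (\<lambda>k. \<beta>1 k + \<beta>2 k)"
      unfolding \<beta>1_def \<beta>2_def using a b pos by (intro summable_add summable_mult summable_divide \<Gamma>(2)) auto
    moreover have "norm (A k x) \<le> \<beta>1 k + \<beta>2 k \<and> norm (B k x) \<le> \<beta>1 k + \<beta>2 k" if x: "m \<le> norm x" "norm x \<le> M" for k x
    proof -
      have x0: "x \<noteq> 0" using x pos by auto
      have "norm (boundary_integral \<eta> b (kernel_term \<eta> k x) g) \<le> \<beta>2 k"
        unfolding \<beta>2_def
      proof (rule N2(2))
        show "continuous_on (sphere 0 b) (kernel_term \<eta> k x)" using pos by (intro continuous_on_kernel_term) auto
        show "norm (kernel_term \<eta> k x y) \<le> \<Gamma> k * (M / b) ^ k / b ^ CARD('i)" if "norm y = b" for y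
        proof -
          have "y \<noteq> 0" using that pos by auto
          then show ?thesis using \<Gamma>(3) [of x y "M / b" k] that x pos by (simp add: divide_right_mono)
        qed
      qed (use \<Gamma>(1) [of k] pos in simp)
      moreover have "norm (boundary_integral \<eta> a (\<lambda>y. kernel_term \<eta> k y x) g) \<le> \<beta>1 k"
        unfolding \<beta>1_def
      proof (rule N1(2) [OF continuous_on_kernel_term_left [OF \<eta> x0]])
        show "norm (kernel_term \<eta> k y x) \<le> \<Gamma> k * (a / m) ^ k / m ^ CARD('i)" if y: "norm y = a" for y
        proof -
          have "norm (kernel_term \<eta> k y x) \<le> \<Gamma> k * (a / m) ^ k / norm x ^ CARD('i)"
            using x y pos x0 by (intro \<Gamma>(3)) (simp add: frac_le)
          also have "\<dots> \<le> \<Gamma> k * (a / m) ^ k / m ^ CARD('i)"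
            using \<Gamma>(1) [of k] pos x x0 by (intro divide_left_mono power_mono mult_pos_pos zero_less_power) auto
          finally show ?thesis .
        qed
      qed (use \<Gamma>(1) [of k] pos in simp)
      ultimately show ?thesis
        unfolding A [OF rb] B [OF ra x0] using \<beta>0 [of k] by linarith
    qed
    ultimately show ?thesis by blast
  qed
qed

theorem theorem3p34:
  fixes \<rho>\<^sub>1 \<rho> \<rho>\<^sub>2 :: real
    and \<eta> :: "real ^ 'j::{finite,linorder}"
    and f :: "('i::{finite,linorder}, 'j) point \<Rightarrow> ('i, 'j) cl"
    and A S :: "('i, 'j) point set"
    and n :: "'i slice \<Rightarrow> ('i, 'j) cl"
    and a b :: "('i \<Rightarrow> nat) \<Rightarrow> ('i, 'j) cl"
  assumes "0 \<le> \<rho>\<^sub>1" "\<rho>\<^sub>1 < \<rho>" "\<rho> < \<rho>\<^sub>2"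
    and "\<eta> \<in> sphere 0 1"
    and "A = {x. \<rho>\<^sub>1 < norm x \<and> norm x < \<rho>\<^sub>2}"
    and "S = {x. norm x = \<rho>}"
    and "gen_partial_slice_monogenic A f"
    and "n = (\<lambda>y. paravector (slice_point \<eta> ((1 / \<rho>) *\<^sub>R y)))"
    and "a = (\<lambda>\<kappa>. LINT y:slice_point \<eta> -` S|sphere_surface \<rho>.
                kernel_deriv_slice \<eta> \<kappa> y * n y * f (slice_point \<eta> y))"
    and "b = (\<lambda>\<kappa>. LINT y:slice_point \<eta> -` S|sphere_surface \<rho>.
                fueter_slice_right \<eta> \<kappa> y * n y * f (slice_point \<eta> y))"
  shows "(\<forall>x\<in>A. f x = (\<Sum>k. \<Sum>\<kappa> | sum \<kappa> UNIV = k. fueter \<kappa> x * a \<kappa>)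
                    + (\<Sum>k. \<Sum>\<kappa> | sum \<kappa> UNIV = k. kernel_deriv \<kappa> x * b \<kappa>))
       \<and> (\<forall>K. compact K \<and> K \<subseteq> A \<longrightarrow>
            uniformly_convergent_on K (\<lambda>N x. \<Sum>k<N. \<Sum>\<kappa> | sum \<kappa> UNIV = k. fueter \<kappa> x * a \<kappa>) \<and>
            uniformly_convergent_on K (\<lambda>N x. \<Sum>k<N. \<Sum>\<kappa> | sum \<kappa> UNIV = k. kernel_deriv \<kappa> x * b \<kappa>))"
proof -
  note r = assms(1-3) and \<eta> = assms(4)
  define U where "U = {y :: 'i slice. \<rho>\<^sub>1 < norm y \<and> norm y < \<rho>\<^sub>2}"
  define g where "g = f \<circ> slice_point \<eta>"
  have vim: "slice_point \<omega> -` A = U" if "\<omega> \<in> sphere 0 1" for \<omega> :: "(real, 'j) vec"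
    by (rule set_eqI) (simp only: assms(5) U_def vimage_eq mem_Collect_eq norm_slice_point [OF that])
  have mono: "slice_monogenic \<omega> U (f \<circ> slice_point \<omega>)" if "\<omega> \<in> sphere 0 1" for \<omega> :: "(real, 'j) vec"
  proof -
    have "open U" unfolding U_def by (rule open_shell)
    moreover have "continuous_partials_on (slice_point \<omega> -` A) (f \<circ> slice_point \<omega>) \<and>
        (\<forall>y\<in>slice_point \<omega> -` A. slice_dirac \<omega> (f \<circ> slice_point \<omega>) y = 0)"
      using assms(7) that unfolding gen_partial_slice_monogenic_def by blast
    ultimately show ?thesis unfolding vim [OF that] slice_monogenic_def by blast
  qed
  have gm: "slice_monogenic \<eta> {y. \<rho>\<^sub>1 < norm y \<and> norm y < \<rho>\<^sub>2} g"
    using mono [OF \<eta>] by (simp add: g_def U_def)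
  have gc: "continuous_on (sphere 0 \<rho>) g"
    by (rule continuous_on_subset [OF slice_monogenic_continuous_on [OF gm]]) (use r in auto)
  have \<rho>0: "\<rho> > 0" using r by simp
  have vimS: "slice_point \<eta> -` S = sphere 0 \<rho>"
    by (rule set_eqI) (simp only: assms(6) vimage_eq mem_Collect_eq norm_slice_point [OF \<eta>] mem_sphere_0)
  have a_eq: "a \<kappa> = boundary_integral \<eta> \<rho> (kernel_deriv_slice \<eta> \<kappa>) g" for \<kappa>
    unfolding assms(8,9) vimS boundary_integral_def sphere_integral_def slice_para_def g_def o_def ..
  have b_eq: "b \<kappa> = boundary_integral \<eta> \<rho> (fueter_slice_right \<eta> \<kappa>) g" for \<kappa>
    unfolding assms(8,10) vimS boundary_integral_def sphere_integral_def slice_para_def g_def o_def ..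
  define P where "P k y = boundary_integral \<eta> \<rho> (kernel_term \<eta> k y) g" for k y
  define Q where "Q k y = boundary_integral \<eta> \<rho> (\<lambda>w. kernel_term \<eta> k w y) g" for k y
  \<comment> \<open>The polynomial in \<open>y\<close> is constant under the integral and stands on
    the left, so it comes out and leaves the coefficient a.\<close>
  have P_eq: "P k y = (\<Sum>\<kappa> | sum \<kappa> UNIV = k. fueter_slice \<eta> \<kappa> y * a \<kappa>)" for k y
  proof -
    have kc: "continuous_on (sphere 0 \<rho>) (kernel_deriv_slice \<eta> \<kappa>)" for \<kappa>
      using \<rho>0 by (intro continuous_on_kernel_deriv_slice \<eta>) auto
    have "P k y = boundary_integral \<eta> \<rho> (\<lambda>w. \<Sum>\<kappa> | sum \<kappa> UNIV = k. fueter_slice \<eta> \<kappa> y * kernel_deriv_slice \<eta> \<kappa> w) g"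
      unfolding P_def
    proof (rule boundary_integral_cong)
      fix w :: "'i slice" assume "norm w = \<rho>"
      then have "w \<noteq> 0" using \<rho>0 by auto
      then show "kernel_term \<eta> k y w = (\<Sum>\<kappa> | sum \<kappa> UNIV = k. fueter_slice \<eta> \<kappa> y * kernel_deriv_slice \<eta> \<kappa> w)"
        by (rule kernel_term_left [OF _ \<eta>])
    qed simp
    also have "\<dots> = (\<Sum>\<kappa> | sum \<kappa> UNIV = k. boundary_integral \<eta> \<rho> (\<lambda>w. fueter_slice \<eta> \<kappa> y * kernel_deriv_slice \<eta> \<kappa> w) g)"
      by (intro boundary_integral_sum \<rho>0 gc continuous_intros kc)
    finally show ?thesis by (simp only: boundary_integral_mult_left [OF \<rho>0 kc gc] a_eq)
  qed
  have Q_eq: "Q k y = (\<Sum>\<kappa> | sum \<kappa> UNIV = k. kernel_deriv_slice \<eta> \<kappa> y * b \<kappa>)" if y: "y \<noteq> 0" for k y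
  proof -
    note fc = continuous_on_fueter_slice_right
    have "Q k y = (\<Sum>\<kappa> | sum \<kappa> UNIV = k. boundary_integral \<eta> \<rho> (\<lambda>w. kernel_deriv_slice \<eta> \<kappa> y * fueter_slice_right \<eta> \<kappa> w) g)"
      unfolding Q_def kernel_term_right [OF y \<eta>]
      by (intro boundary_integral_sum \<rho>0 gc continuous_intros fc)
    then show ?thesis by (simp only: boundary_integral_mult_left [OF \<rho>0 fc gc] b_eq)
  qed
  have laurent: "summable (\<lambda>k. P k y) \<and> summable (\<lambda>k. Q k y) \<and> g y = (\<Sum>k. P k y) + (\<Sum>k. Q k y)" if "y \<in> U" for y
    using slice_laurent(1) [OF \<eta> r gm refl refl, of y] that unfolding P_def Q_def U_def by blast
  have U0: "y \<noteq> 0" if "y \<in> U" for y using that r by (auto simp: U_def)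
  have reflU: "slice_reflect y \<in> U" if "y \<in> U" for y using that by (simp add: U_def)
  \<comment> \<open>For r = 0 any unit vector may serve as direction, and \<eta> is at hand.\<close>
  have decomp: "\<exists>\<omega> u r. \<omega> \<in> sphere 0 1 \<and> r \<ge> 0 \<and> x = slice_point \<omega> (u, r)" for x :: "('i, 'j) point"
  proof (cases "snd x = 0")
    case True
    then show ?thesis using \<eta> by (intro exI [of _ \<eta>] exI [of _ "fst x"] exI [of _ 0]) (auto simp: slice_point_def prod_eq_iff)
  next
    case False
    then show ?thesis
      by (intro exI [of _ "sgn (snd x)"] exI [of _ "fst x"] exI [of _ "norm (snd x)"])
        (auto simp: slice_point_def prod_eq_iff norm_sgn sgn_div_norm)
  qed
  \<comment> \<open>Term by term both series satisfy the representation formula, so each term is the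
    transfer of its restriction to the slice of \<eta>.\<close>
  have terms: "(\<Sum>\<kappa> | sum \<kappa> UNIV = k. fueter \<kappa> (slice_point \<omega> (u, s)) * a \<kappa>) = slice_transfer \<omega> \<eta> (P k) (u, s)"
      "(u, s) \<in> U \<Longrightarrow> (\<Sum>\<kappa> | sum \<kappa> UNIV = k. kernel_deriv \<kappa> (slice_point \<omega> (u, s)) * b \<kappa>) = slice_transfer \<omega> \<eta> (Q k) (u, s)"
    if \<omega>: "\<omega> \<in> sphere 0 1" "s \<ge> 0" for \<omega> :: "(real, 'j) vec" and u s k
  proof -
    show "(\<Sum>\<kappa> | sum \<kappa> UNIV = k. fueter \<kappa> (slice_point \<omega> (u, s)) * a \<kappa>) = slice_transfer \<omega> \<eta> (P k) (u, s)"
      unfolding P_eq [abs_def] slice_transfer_sum fueter_eq [OF \<omega>]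
      by (simp only: fueter_slice_transfer [OF \<omega>(1) \<eta>] slice_transfer_mult_right)
    assume U: "(u, s) \<in> U"
    have "(\<Sum>\<kappa> | sum \<kappa> UNIV = k. kernel_deriv \<kappa> (slice_point \<omega> (u, s)) * b \<kappa>) =
        (\<Sum>\<kappa> | sum \<kappa> UNIV = k. kernel_deriv_slice \<omega> \<kappa> (u, s) * b \<kappa>)"
      by (simp add: kernel_deriv_def kernel_deriv_slice_def)
    also have "\<dots> = slice_transfer \<omega> \<eta> (\<lambda>y. \<Sum>\<kappa> | sum \<kappa> UNIV = k. kernel_deriv_slice \<eta> \<kappa> y * b \<kappa>) (u, s)"
      unfolding slice_transfer_sum by (simp only: kernel_deriv_slice_transfer [OF \<omega>(1) \<eta> U0 [OF U]] slice_transfer_mult_right)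
    also have "\<dots> = slice_transfer \<omega> \<eta> (Q k) (u, s)"
      unfolding slice_transfer_def using Q_eq [OF U0 [OF U]] Q_eq [OF U0 [OF reflU [OF U]]] by simp
    finally show "(\<Sum>\<kappa> | sum \<kappa> UNIV = k. kernel_deriv \<kappa> (slice_point \<omega> (u, s)) * b \<kappa>) = slice_transfer \<omega> \<eta> (Q k) (u, s)" .
  qed
  have norm_dec: "norm (slice_point \<omega> (u, s)) = norm (u, s)" if "\<omega> \<in> sphere 0 1" for \<omega> :: "(real, 'j) vec" and u :: "(real, 'i) vec" and s
    by (rule norm_slice_point [OF that])
  show ?thesis
  proof (intro conjI ballI allI impI; (elim conjE)?)
    fix x assume "x \<in> A"
    obtain \<omega> u s where x: "\<omega> \<in> sphere 0 1" "s \<ge> 0" "x = slice_point \<omega> (u, s)" using decomp by blast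
    have yU: "(u, s) \<in> U" using vim [OF x(1)] \<open>x \<in> A\<close> x(3) by auto
    \<comment> \<open>On r = 0 the slices of \<omega> and \<eta> coincide, and so do
      \<open>f\<close> and its transfer. The difference is monogenic for \<omega>, hence zero on the
      whole shell.\<close>
    define h where "h y = (f \<circ> slice_point \<omega>) y - slice_transfer \<omega> \<eta> g y" for y
    have "h (u, s) = 0"
    proof (rule slice_monogenic_shell_unique [OF x(1) r(1) _ U_def _ _ yU])
      show "slice_monogenic \<omega> U h"
        unfolding h_def using gm
        by (intro slice_monogenic_diff mono slice_monogenic_transfer [OF \<eta>] x(1) reflU) (simp_all add: U_def)
      show "h y = 0" if "y \<in> U" "snd y = 0" for y
        using that slice_transfer_r0 [of \<omega> \<eta> g "fst y"]
        by (cases y) (simp add: h_def g_def slice_point_def)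
    qed (use r in simp)
    then have "f x = slice_transfer \<omega> \<eta> g (u, s)" by (simp add: h_def x(3))
    also have "\<dots> = (\<Sum>k. slice_transfer \<omega> \<eta> (P k) (u, s)) + (\<Sum>k. slice_transfer \<omega> \<eta> (Q k) (u, s))"
    proof -
      \<comment> \<open>A transfer involves only the values at (u, s) and at its reflection, both in
        the shell, so it commutes with summation.\<close>
      have s: "(\<lambda>k. slice_transfer \<omega> \<eta> (T k) (u, s)) sums
          slice_transfer \<omega> \<eta> (\<lambda>y. \<Sum>k. T k y) (u, s)" if "\<And>y. y \<in> U \<Longrightarrow> summable (\<lambda>k. T k y)" for T :: "nat \<Rightarrow> 'i slice \<Rightarrow> ('i, 'j) cl"
        unfolding slice_transfer_def
        by (intro sums_scaleR_right sums_add bounded_linear.sums [OF bounded_linear_clifford_mult_left]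
          summable_sums that yU reflU)
      have "slice_transfer \<omega> \<eta> g (u, s) = slice_transfer \<omega> \<eta> (\<lambda>y. \<Sum>k. P k y) (u, s) + slice_transfer \<omega> \<eta> (\<lambda>y. \<Sum>k. Q k y) (u, s)"
        using laurent [OF yU] laurent [OF reflU [OF yU]]
        by (simp add: slice_transfer_def distrib_left scaleR_add_right)
      then show ?thesis
        using s [of P] s [of Q] laurent by (simp add: sums_iff)
    qed
    finally show "f x = (\<Sum>k. \<Sum>\<kappa> | sum \<kappa> UNIV = k. fueter \<kappa> x * a \<kappa>) + (\<Sum>k. \<Sum>\<kappa> | sum \<kappa> UNIV = k. kernel_deriv \<kappa> x * b \<kappa>)"
      by (simp only: x(3) terms(1) [OF x(1,2)] terms(2) [OF x(1,2) yU])
  next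
    fix K assume K: "compact K" "K \<subseteq> A"
    obtain C where C: "C \<ge> 0" "\<And>(\<omega> :: (real, 'j) vec) (G :: 'i slice \<Rightarrow> ('i, 'j) cl) y. \<omega> \<in> sphere 0 1 \<Longrightarrow>
        norm (slice_transfer \<omega> \<eta> G y) \<le> C * (norm (G y) + norm (G (slice_reflect y)))"
      using slice_transfer_bound [where 'i = 'i and 'j = 'j] \<eta> by blast
    have "\<exists>\<beta>. summable \<beta> \<and> (\<forall>k. \<forall>x\<in>K. norm (\<Sum>\<kappa> | sum \<kappa> UNIV = k. fueter \<kappa> x * a \<kappa>) \<le> \<beta> k
        \<and> norm (\<Sum>\<kappa> | sum \<kappa> UNIV = k. kernel_deriv \<kappa> x * b \<kappa>) \<le> \<beta> k)"
    proof (cases "K = {}")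
      case True
      then show ?thesis by (intro exI [of _ "\<lambda>_. 0"]) simp
    next
      case False
      \<comment> \<open>The extreme norms on the compact set bound a closed shell within the open
        one, where the estimates on the slice of \<eta> are uniform.\<close>
      have cn: "continuous_on K norm" by (intro continuous_intros)
      obtain x1 where x1: "x1 \<in> K" "\<And>x. x \<in> K \<Longrightarrow> norm x1 \<le> norm x"
        using continuous_attains_inf [OF K(1) False cn] by blast
      obtain x2 where x2: "x2 \<in> K" "\<And>x. x \<in> K \<Longrightarrow> norm x \<le> norm x2"
        using continuous_attains_sup [OF K(1) False cn] by blast
      have b12: "\<rho>\<^sub>1 < norm x1" "norm x1 \<le> norm x2" "norm x2 < \<rho>\<^sub>2"
        using x1 x2 K(2) by (auto simp: assms(5))
      obtain \<beta> where \<beta>: "summable \<beta>" "\<And>k y. norm x1 \<le> norm y \<Longrightarrow> norm y \<le> norm x2 \<Longrightarrow> norm (P k y) \<le> \<beta> k \<and> norm (Q k y) \<le> \<beta> k"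
        using slice_laurent(2) [OF \<eta> r gm refl refl b12] unfolding P_def Q_def by blast
      \<comment> \<open>\<beta> occurs twice: once for the point and once for its reflection, which
        has the same norm.\<close>
      have "norm (\<Sum>\<kappa> | sum \<kappa> UNIV = k. fueter \<kappa> x * a \<kappa>) \<le> C * (\<beta> k + \<beta> k)
          \<and> norm (\<Sum>\<kappa> | sum \<kappa> UNIV = k. kernel_deriv \<kappa> x * b \<kappa>) \<le> C * (\<beta> k + \<beta> k)" if xK: "x \<in> K" for k x
      proof -
        obtain \<omega> u s where x: "\<omega> \<in> sphere 0 1" "s \<ge> 0" "x = slice_point \<omega> (u, s)" using decomp by blast
        have yU: "(u, s) \<in> U" using vim [OF x(1)] xK K(2) x(3) by auto
        have ny: "norm x1 \<le> norm (u, s)" "norm (u, s) \<le> norm x2"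
          using x1(2) [OF xK] x2(2) [OF xK] norm_dec [OF x(1), of u s] x(3) by simp_all
        have bd: "norm (slice_transfer \<omega> \<eta> G (u, s)) \<le> C * (\<beta> k + \<beta> k)"
          if "norm (G (u, s)) \<le> \<beta> k" "norm (G (slice_reflect (u, s))) \<le> \<beta> k" for G :: "'i slice \<Rightarrow> ('i, 'j) cl"
        proof -
          have "C * (norm (G (u, s)) + norm (G (slice_reflect (u, s)))) \<le> C * (\<beta> k + \<beta> k)"
            using that C(1) by (intro mult_left_mono add_mono)
          with C(2) [OF x(1), of G "(u, s)"] show ?thesis by linarith
        qed
        show ?thesis
          unfolding x(3) terms(1) [OF x(1,2)] terms(2) [OF x(1,2) yU]
          using \<beta>(2) [OF ny, of k] \<beta>(2) [of "slice_reflect (u, s)" k] ny bd [of "P k"] bd [of "Q k"] by simp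
      qed
      moreover have "summable (\<lambda>k. C * (\<beta> k + \<beta> k))" by (intro summable_mult summable_add \<beta>(1))
      ultimately show ?thesis by (intro exI [of _ "\<lambda>k. C * (\<beta> k + \<beta> k)"]) blast
    qed
    then obtain \<beta> where \<beta>: "summable \<beta>" "\<And>k x. x \<in> K \<Longrightarrow> norm (\<Sum>\<kappa> | sum \<kappa> UNIV = k. fueter \<kappa> x * a \<kappa>) \<le> \<beta> k"
      "\<And>k x. x \<in> K \<Longrightarrow> norm (\<Sum>\<kappa> | sum \<kappa> UNIV = k. kernel_deriv \<kappa> x * b \<kappa>) \<le> \<beta> k"
      by blast
    show "uniformly_convergent_on K (\<lambda>N x. \<Sum>k<N. \<Sum>\<kappa> | sum \<kappa> UNIV = k. fueter \<kappa> x * a \<kappa>)"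
      by (rule Weierstrass_m_test' [OF \<beta>(2,1)])
    show "uniformly_convergent_on K (\<lambda>N x. \<Sum>k<N. \<Sum>\<kappa> | sum \<kappa> UNIV = k. kernel_deriv \<kappa> x * b \<kappa>)"
      by (rule Weierstrass_m_test' [OF \<beta>(3,1)])
  qed
qed

end
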